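(* Let $\lambda/\mu$ be a skew diagram satisfying the positivity condition $\lambda'_{i+1}-\mu'_i\le n$ for $i=1,\dots,l-1$, where $l=\lambda_1$, and let $a\in\mathbb C$. Let $\mathrm{Tab}(\lambda/\mu)$ be the set of all tableaux $T$ of shape $\lambda/\mu$ with entries in $I$ that satisfy the horizontal rule $(\mathbf H)$, the vertical rule $(\mathbf V)$, and the extra rule $(\mathbf E)$: the corresponding tuple of paths $p=\mathcal T_{\mathrm v}^{-1}(T)$ does not have any odd $\mathrm{II}$-region. Then $$\chi_{\lambda/\mu,a}=\sum_{T\in\mathrm{Tab}(\lambda/\mu)}z_a^T .$$
   Context: Ring and determinant. Fix a positive integer $n$ (rank of type $D_n$). $I=\{1,2,\dots,n,\overline n,\dots,\overline 2,\overline 1\}$. $\mathcal Z$ is the commutative ring over $\mathbb Z$ generated by $z_{i,a}$ ($i\in I$, $a\in\mathbb C$) with relations $z_{i,a}z_{\overline i,a-2n+2i}=z_{i-1,a}z_{\overline{i-1},a-2n+2i}$ ($i=1,\dots,n$), where $z_{0,a}=z_{\overline 0,a}=1$. In the non-commutative ring generated by $\mathcal Z$ and $\mathbb Z[[X]]$ with $Xz_{i,a}=z_{i,a-2}X$, put $E_a(z,X)=(1+z_{1,a}X)\cdots(1+z_{n,a}X)\,(1-z_{\overline n,a}Xz_{n,a}X)^{-1}\,(1+z_{\overline n,a}X)\cdots(1+z_{\overline 1,a}X)=\sum_{i\ge0}e_{i,a}X^i$ with $e_{i,a}\in\mathcal Z$, and $e_{i,a}=0$ for $i<0$. A skew diagram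 $\lambda/\mu$ is a pair of partitions with $\lambda_i\ge\mu_i$ for all $i$, identified with $\{(i,j):\mu_i+1\le j\le\lambda_i\}$ ($i$ = row, $j$ = column); $\lambda',\mu'$ are the conjugates. $\chi_{\lambda/\mu,a}=\det(e_{\lambda'_i-\mu'_j-i+j,\,a-2(\mu'_j-j+1)})_{1\le i,j\le l}$ with $l=\lambda_1$. Tableaux. $I$ is partially ordered by $1\prec\dots\prec n-1\prec n,\overline n\prec\overline{n-1}\prec\dots\prec\overline1$, with $n,\overline n$ incomparable. A tableau $T$ of shape $\lambda/\mu$ fills each box $(i,j)$ with $T(i,j)\in I$; its weight is $z_a^T=\prod_{(i,j)\in\lambda/\mu}z_{T(i,j),a+2(j-i)}$. $(\mathbf H)$: $T(i,j)\preceq T(i,j+1)$ or $(T(i,j),T(i,j+1))=(n,\overline n)$, for horizontally neighbouring boxes. $(\mathbf V)$: $T(i,j)\not\succeq T(i+1,j)$, for vertically neighbouring boxes. $T$ is an HV-tableau if it satisfies $(\mathbf H)$ and $(\mathbf V)$. Paths. For $w=(x,y)\in\mathbb R^2$ put $\mathrm{ht}(w)=x+y$ (height), $\mathrm{hp}(w)=\frac12(x-y)$ (horizontal position). Steps on $\mathbb Z^2$: NE-step $(x,y)\to(x+1,y)$, NW-step $(x,y)\to(x,y+1)$, E-step $(x,y)\to(x+1,y-1)$. A path is a sequence of consecutive NE-, NW-, E-steps from a lattice point of height $-n$ to one of height $n$, where E-steps occur only at height $0$ and their number is even. For an NE- or E-step $s$ of a path starting at $(x,y)$, with $m=x+y$,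 its label $L^1(s)\in I$ is: $n+1+m$ if $m<0$; $n$ if $m=0$ and $s$ is the 2nd, 4th, 6th, ... E-step of the path; $\overline{n-m}$ otherwise. Put $u_i=(\mu'_i+1-i,-n-\mu'_i-1+i)$, $v_i=(\lambda'_i+1-i,n-\lambda'_i-1+i)$ for $1\le i\le l$. Two paths intersect if they share a lattice point. An intersecting pair $(p_i,p_j)$ is specially intersecting if the intersection occurs only at height $0$ and $p_i(0)-p_j(0)$ is odd, where $p_i(0)$ is the horizontal position of the leftmost point of $p_i$ at height $0$; otherwise it is ordinarily intersecting. $P_{\mathrm{HV}}(\lambda/\mu)$ is the set of tuples $p=(p_1,\dots,p_l)$ of paths, $p_i$ from $u_i$ to $v_i$, with no ordinarily intersecting adjacent pair $(p_i,p_{i+1})$. The map $\mathcal T_{\mathrm v}$ sends such $p$ to the tableau whose $j$th column, from top to bottom, lists the labels $L^1$ of the NE- and E-steps of $p_j$ in order; it is a bijection from $P_{\mathrm{HV}}(\lambda/\mu)$ onto the set of HV-tableaux of shape $\lambda/\mu$. Odd $\mathrm{II}$-regions. $S_+=\{0\le\mathrm{ht}\le n\}$, $S_-=\{-n\le\mathrm{ht}\le0\}$. A lower (resp. upper) path is a sequence of consecutive NE/NW-steps from height $-n$ to $0$ (resp. from $0$ to $n$); $\alpha(r)$ denotes the horizontal position at height $r$. Duals: $\alpha^*(r)=\alpha(-r)-1$, $\beta^*(-r)=\beta(r)+1$ ($0\le r\le n$) for a lower path $\alpha$ and an upper path $\beta$. For $p\in P_{\mathrm{HV}}(\lambda/\mu)$,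 removing all E-steps gives $\pi(p)=(\alpha;\beta)=(\alpha_1,\dots,\alpha_l;\beta_1,\dots,\beta_l)$, where $\alpha_i$ is the lower path starting at $u_i$ and $\beta_i$ the upper path ending at $v_i$. A unit $U\subset S_\pm$ is a unit square of the lattice inside $S_\pm$, or the half in $S_\pm$ of a unit square whose horizontal diagonal lies on the boundary of $S_\pm$; its height is the height of its left vertex; its left and right vertices have horizontal positions $a$ and $a'=a+1$. With $\pm r=\mathrm{ht}(U)$, $U$ is a $\mathrm{II}$-unit if for some $0\le i\le l$: $\beta_{i+1}(r)\le a<a'\le\alpha_i^*(r)$ (if $U\subset S_+$), resp. $\beta^*_{i+1}(-r)\le a<a'\le\alpha_i(-r)$ (if $U\subset S_-$), where $\beta_{l+1}=\beta_{l+1}^*=-\infty$, $\alpha_0=\alpha_0^*=+\infty$; it is a boundary $\mathrm{II}$-unit if this holds with $i=0$, or $i=l$, or $r=n$. Two units are adjacent if the left or right vertex of one is also a vertex of the other. A connected component of the $\mathrm{II}$-units is the union of an equivalence class for the equivalence relation on the set of $\mathrm{II}$-units generated by adjacency. A $\mathrm{II}$-region is a connected component containing at least one $\mathrm{II}$-unit of height $0$ and no boundary $\mathrm{II}$-unit. The pair $(\alpha_i,\beta_{i+1})$ ($1\le i\le l-1$) is an even hole if $\alpha_i(0)-\beta_{i+1}(0)$ is positive and even; it intersects $V$ at height $0$ if the height-$0$ endpoint of $\alpha_i$ lies in a unit of $V$ in $S_-$ or that of $\beta_{i+1}$ lies in a unit of $V$ in $S_+$. A $\mathrm{II}$-region $V$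 is odd if the number of even holes $(\alpha_i,\beta_{i+1})$ intersecting $V$ at height $0$ is odd.
   Formalization: Two units count as adjacent only if both lie in S_+ or both lie in S_-; if units of different strips could be adjacent through a vertex at height 0, the identity would fail for λ=(2), μ=∅, where the row (n, n̄) would wrongly be admitted. *)

theory Defs
  imports
    Complex_Main
    "HOL-Library.Poly_Mapping"
    "HOL-Library.FuncSet"
    "HOL-Library.Extended_Real"
    "HOL-Library.Cardinality"
    "HOL-Library.Product_Plus"
    "Jordan_Normal_Form.Determinant"
begin

section \<open>The index set\<close>

text \<open>The element \<open>i\<close> of \<open>I\<close> is \<open>Pos i\<close>, and the barred element is \<open>Bar i\<close>.\<close>

datatype letter = Pos nat | Bar nat

definition letters :: "nat \<Rightarrow> letter set" where
  "letters n = Pos ` {1..n} \<union> Bar ` {1..n}"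

fun letter_le :: "nat \<Rightarrow> letter \<Rightarrow> letter \<Rightarrow> bool" where
  "letter_le n (Pos i) (Pos j) \<longleftrightarrow> i \<le> j"
| "letter_le n (Bar i) (Bar j) \<longleftrightarrow> j \<le> i"
| "letter_le n (Pos i) (Bar j) \<longleftrightarrow> \<not> (i = n \<and> j = n)"
| "letter_le n (Bar i) (Pos j) \<longleftrightarrow> False"


section \<open>The ring of the variables \<open>z\<close>\<close>

text \<open>Polynomials with integer coefficients in variables indexed by a letter and a complex
  number; a monomial is its finitely supported exponent function.\<close>

type_synonym zpoly = "((letter \<times> complex) \<Rightarrow>\<^sub>0 nat) \<Rightarrow>\<^sub>0 int"

definition zvar :: "letter \<Rightarrow> complex \<Rightarrow> zpoly" where
  "zvar x a = Poly_Mapping.single (Poly_Mapping.single (x, a) 1) 1"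

text \<open>The variables whose index lies outside \<open>{1..n}\<close> are put equal to 1.  For index 0 this is
  the convention of the paper; for an index above \<open>n\<close> it removes a variable which is present only
  because the type of letters does not depend on \<open>n\<close>.\<close>

definition zrelators :: "nat \<Rightarrow> zpoly set" where
  "zrelators n =
     {zvar (Pos i) a * zvar (Bar i) (a - 2 * of_nat n + 2 * of_nat i)
        - zvar (Pos (i - 1)) a * zvar (Bar (i - 1)) (a - 2 * of_nat n + 2 * of_nat i)
      | i a. i \<in> {1..n}}
     \<union> {zvar x a - 1 | x a. x \<notin> letters n}"

definition zideal :: "nat \<Rightarrow> zpoly set" where
  "zideal n = Modules.module.span (*) (zrelators n)"

definition zcong :: "nat \<Rightarrow> zpoly \<Rightarrow> zpoly \<Rightarrow> bool" where
  "zcong n p q \<longleftrightarrow> p - q \<in> zideal n"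

lemma zpoly_module: "Modules.module ((*) :: zpoly \<Rightarrow> zpoly \<Rightarrow> zpoly)"
  by unfold_locales (simp_all add: algebra_simps)

lemma zideal_zero: "0 \<in> zideal n"
  and zideal_add: "p \<in> zideal n \<Longrightarrow> q \<in> zideal n \<Longrightarrow> p + q \<in> zideal n"
  and zideal_mult: "q \<in> zideal n \<Longrightarrow> p * q \<in> zideal n"
  and zideal_neg: "p \<in> zideal n \<Longrightarrow> - p \<in> zideal n"
  and zideal_base: "p \<in> zrelators n \<Longrightarrow> p \<in> zideal n"
  unfolding zideal_def
  by (rule Modules.module.span_zero[OF zpoly_module] Modules.module.span_add[OF zpoly_module]
      Modules.module.span_scale[OF zpoly_module] Modules.module.span_neg[OF zpoly_module]
      Modules.module.span_base[OF zpoly_module]; assumption)+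

lemma zcong_equivp: "equivp (zcong n)"
proof (rule equivpI)
  show "reflp (zcong n)"
    by (auto simp: reflp_def zcong_def zideal_zero)
  show "symp (zcong n)"
  proof (rule sympI)
    fix p q assume "zcong n p q"
    then show "zcong n q p"
      using zideal_neg[of "p - q" n] by (simp add: zcong_def)
  qed
  show "transp (zcong n)"
  proof (rule transpI)
    fix p q r assume "zcong n p q" "zcong n q r"
    then show "zcong n p r"
      using zideal_add[of "p - q" n "q - r"] by (simp add: zcong_def)
  qed
qed

text \<open>Substitution of ring elements for the variables.\<close>

definition mon_subst ::
  "(letter \<times> complex \<Rightarrow> 'a::comm_ring_1) \<Rightarrow> ((letter \<times> complex) \<Rightarrow>\<^sub>0 nat) \<Rightarrow> 'a" where
  "mon_subst f m = (\<Prod>v\<in>Poly_Mapping.keys m. f v ^ Poly_Mapping.lookup m v)"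

definition zsubst :: "(letter \<times> complex \<Rightarrow> 'a::comm_ring_1) \<Rightarrow> zpoly \<Rightarrow> 'a" where
  "zsubst f p = (\<Sum>m\<in>Poly_Mapping.keys p. of_int (Poly_Mapping.lookup p m) * mon_subst f m)"

lemma mon_subst_superset:
  assumes "finite A" "Poly_Mapping.keys m \<subseteq> A"
  shows "mon_subst f m = (\<Prod>v\<in>A. f v ^ Poly_Mapping.lookup m v)"
  unfolding mon_subst_def using assms
  by (intro prod.mono_neutral_left) (auto simp: in_keys_iff)

lemma mon_subst_add: "mon_subst f (m + m') = mon_subst f m * mon_subst f m'"
proof -
  let ?A = "Poly_Mapping.keys m \<union> Poly_Mapping.keys m'"
  have "mon_subst f (m + m') = (\<Prod>v\<in>?A. f v ^ Poly_Mapping.lookup (m + m') v)"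
    by (rule mon_subst_superset) (simp_all add: Poly_Mapping.keys_add)
  also have "\<dots> = (\<Prod>v\<in>?A. f v ^ Poly_Mapping.lookup m v) * (\<Prod>v\<in>?A. f v ^ Poly_Mapping.lookup m' v)"
    by (simp add: lookup_add power_add prod.distrib)
  also have "\<dots> = mon_subst f m * mon_subst f m'"
    by (simp add: mon_subst_superset[of ?A m] mon_subst_superset[of ?A m'])
  finally show ?thesis .
qed

lemma zsubst_superset:
  assumes "finite A" "Poly_Mapping.keys p \<subseteq> A"
  shows "zsubst f p = (\<Sum>m\<in>A. of_int (Poly_Mapping.lookup p m) * mon_subst f m)"
  unfolding zsubst_def using assms
  by (intro sum.mono_neutral_left) (auto simp: in_keys_iff)

lemma zsubst_add: "zsubst f (p + q) = zsubst f p + zsubst f q"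
proof -
  let ?A = "Poly_Mapping.keys p \<union> Poly_Mapping.keys q"
  have "zsubst f (p + q) = (\<Sum>m\<in>?A. of_int (Poly_Mapping.lookup (p + q) m) * mon_subst f m)"
    by (rule zsubst_superset) (simp_all add: Poly_Mapping.keys_add)
  also have "\<dots> = (\<Sum>m\<in>?A. of_int (Poly_Mapping.lookup p m) * mon_subst f m)
      + (\<Sum>m\<in>?A. of_int (Poly_Mapping.lookup q m) * mon_subst f m)"
    by (simp add: lookup_add algebra_simps sum.distrib)
  also have "\<dots> = zsubst f p + zsubst f q"
    by (simp add: zsubst_superset[of ?A p] zsubst_superset[of ?A q])
  finally show ?thesis .
qed

lemma zsubst_single [simp]: "zsubst f (Poly_Mapping.single m c) = of_int c * mon_subst f m"
  by (simp add: zsubst_def)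

lemma mon_subst_zero [simp]: "mon_subst f 0 = 1"
  by (simp add: mon_subst_def)

lemma zsubst_zero [simp]: "zsubst f 0 = 0"
  by (simp add: zsubst_def)

lemma zsubst_one [simp]: "zsubst f 1 = 1"
  using zsubst_single[of f 0 1] by (simp del: zsubst_single)

lemma zsubst_zvar [simp]: "zsubst f (zvar x a) = f (x, a)"
  by (simp add: zvar_def mon_subst_def)

lemma zsubst_diff: "zsubst f (p - q) = zsubst f p - zsubst f q"
  using zsubst_add[of f "p - q" q] by simp

lemma zpoly_induct:
  fixes p :: zpoly
  assumes single: "\<And>m c. P (Poly_Mapping.single m c)"
    and add: "\<And>p q. P p \<Longrightarrow> P q \<Longrightarrow> P (p + q)"
  shows "P p"
proof (induction p rule: Poly_Mapping.update_induct)
  case const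
  show ?case using single[of 0 0] by simp
next
  case (update p m c)
  have "Poly_Mapping.update m c p = p + Poly_Mapping.single m c"
    using update(1)
    by (intro poly_mapping_eqI)
       (auto simp: lookup_update lookup_add lookup_single when_def in_keys_iff)
  then show ?case using add[OF update(3) single] by simp
qed

lemma zsubst_mult: "zsubst f (p * q) = zsubst f p * zsubst f q"
proof (induction p rule: zpoly_induct)
  case (1 m c)
  show ?case
    by (induction q rule: zpoly_induct)
       (simp_all add: Poly_Mapping.mult_single mon_subst_add zsubst_add algebra_simps)
next
  case (2 p p')
  then show ?case by (simp add: zsubst_add algebra_simps)
qed

lemma zideal_induct [consumes 1, case_names zero add mult base]:
  assumes "p \<in> zideal n"
    and "Q 0" "\<And>p q. Q p \<Longrightarrow> Q q \<Longrightarrow> Q (p + q)" "\<And>p q. Q q \<Longrightarrow> Q (p * q)"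
    and "\<And>p. p \<in> zrelators n \<Longrightarrow> Q p"
  shows "Q p"
proof -
  have "Modules.module.subspace (*) (Collect Q)"
    unfolding Modules.module.subspace_def[OF zpoly_module] using assms(2-4) by auto
  then have "zideal n \<subseteq> Collect Q"
    unfolding zideal_def using assms(5)
    by (intro Modules.module.span_minimal[OF zpoly_module]) auto
  then show ?thesis using assms(1) by auto
qed

lemma one_notin_zideal: "1 \<notin> zideal n"
proof -
  have "zsubst (\<lambda>_. 1 :: int) p = 0" if "p \<in> zideal n" for p
    using that
    by (induction p rule: zideal_induct)
       (auto simp: zrelators_def zsubst_add zsubst_mult zsubst_diff)
  from this[of 1] show ?thesis by auto
qed

definition zpoly_shift :: "zpoly \<Rightarrow> zpoly" where
  "zpoly_shift = zsubst (\<lambda>(x, a). zvar x (a - 2))"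

lemma zpoly_shift_zideal: "p \<in> zideal n \<Longrightarrow> zpoly_shift p \<in> zideal n"
proof (induction p rule: zideal_induct)
  case (base p)
  then consider
    (r) i a where "i \<in> {1..n}" "p = zvar (Pos i) a * zvar (Bar i) (a - 2 * of_nat n + 2 * of_nat i)
        - zvar (Pos (i - 1)) a * zvar (Bar (i - 1)) (a - 2 * of_nat n + 2 * of_nat i)"
  | (x) x a where "x \<notin> letters n" "p = zvar x a - 1"
    unfolding zrelators_def by blast
  then have "zpoly_shift p \<in> zrelators n"
  proof cases
    case r
    have *: "(a - 2 * of_nat n + 2 * of_nat i) - 2 = (a - 2) - 2 * of_nat n + 2 * of_nat i"
      by simp
    show ?thesis unfolding zrelators_def r zpoly_shift_def zsubst_diff zsubst_mult zsubst_zvar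
      split * using r(1) by blast
  next
    case x
    have "zpoly_shift p = zvar x (a - 2) - 1"
      by (simp add: x zpoly_shift_def zsubst_diff)
    then show ?thesis unfolding zrelators_def using x(1) by blast
  qed
  then show ?case by (rule zideal_base)
qed (auto simp: zideal_zero zpoly_shift_def zsubst_add zsubst_mult intro: zideal_add zideal_mult)

text \<open>The rank \<open>n\<close> is carried by the type argument, \<open>n = CARD('n)\<close>.\<close>

quotient_type 'n zring = zpoly / "zcong CARD('n)"
  by (rule zcong_equivp)

instantiation zring :: (type) comm_ring_1
begin

lift_definition zero_zring :: "'a zring" is 0 .
lift_definition one_zring :: "'a zring" is 1 .

lift_definition plus_zring :: "'a zring \<Rightarrow> 'a zring \<Rightarrow> 'a zring" is "(+)"
proof -
  fix p p' q q' assume "zcong CARD('a) p p'" "zcong CARD('a) q q'"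
  then have "(p - p') + (q - q') \<in> zideal CARD('a)"
    unfolding zcong_def by (rule zideal_add)
  then show "zcong CARD('a) (p + q) (p' + q')"
    by (simp add: zcong_def algebra_simps)
qed

lift_definition uminus_zring :: "'a zring \<Rightarrow> 'a zring" is uminus
proof -
  fix p p' assume "zcong CARD('a) p p'"
  then have "- (p - p') \<in> zideal CARD('a)"
    unfolding zcong_def by (rule zideal_neg)
  then show "zcong CARD('a) (- p) (- p')"
    by (simp add: zcong_def algebra_simps)
qed

lift_definition minus_zring :: "'a zring \<Rightarrow> 'a zring \<Rightarrow> 'a zring" is "(-)"
proof -
  fix p p' q q' assume "zcong CARD('a) p p'" "zcong CARD('a) q q'"
  then have "(p - p') + - (q - q') \<in> zideal CARD('a)"
    unfolding zcong_def by (intro zideal_add zideal_neg)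
  then show "zcong CARD('a) (p - q) (p' - q')"
    by (simp add: zcong_def algebra_simps)
qed

lift_definition times_zring :: "'a zring \<Rightarrow> 'a zring \<Rightarrow> 'a zring" is "(*)"
proof -
  fix p p' q q' assume "zcong CARD('a) p p'" "zcong CARD('a) q q'"
  then have "q * (p - p') + p' * (q - q') \<in> zideal CARD('a)"
    unfolding zcong_def by (intro zideal_add zideal_mult)
  then show "zcong CARD('a) (p * q) (p' * q')"
    by (simp add: zcong_def algebra_simps)
qed

instance
proof
  show "(0 :: 'a zring) \<noteq> 1"
    by transfer (use zideal_neg one_notin_zideal in \<open>fastforce simp: zcong_def\<close>)
qed (transfer; simp add: zcong_def zideal_zero algebra_simps)+

end

lift_definition zgen :: "letter \<Rightarrow> complex \<Rightarrow> 'n zring" is zvar .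

text \<open>The ring automorphism \<open>zgen x a \<mapsto> zgen x (a - 2)\<close>, which is conjugation by \<open>X\<close>.\<close>

lift_definition zshift :: "'n zring \<Rightarrow> 'n zring" is zpoly_shift
  unfolding zcong_def using zpoly_shift_zideal
  by (metis zpoly_shift_def zsubst_diff)

lemma zshift_z [simp]: "zshift (zgen x a) = zgen x (a - 2)"
  by transfer (simp add: zpoly_shift_def zcong_def zideal_zero)

lemma zshift_zero [simp]: "zshift 0 = 0"
  and zshift_one [simp]: "zshift 1 = 1"
  and zshift_add: "zshift (p + q) = zshift p + zshift q"
  and zshift_mult: "zshift (p * q) = zshift p * zshift q"
  by (transfer; simp add: zpoly_shift_def zsubst_add zsubst_mult zcong_def zideal_zero)+

lemma z_outside: "x \<notin> letters CARD('n) \<Longrightarrow> (zgen x a :: 'n zring) = 1"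
proof transfer
  fix x a assume "x \<notin> letters CARD('n)"
  then have "zvar x a - 1 \<in> zrelators CARD('n)"
    unfolding zrelators_def by blast
  then show "zcong CARD('n) (zvar x a) 1"
    unfolding zcong_def by (rule zideal_base)
qed

lemma z_relation:
  assumes "i \<in> {1..CARD('n)}"
  shows "(zgen (Pos i) a * zgen (Bar i) (a - 2 * of_nat CARD('n) + 2 * of_nat i) :: 'n zring)
    = zgen (Pos (i - 1)) a * zgen (Bar (i - 1)) (a - 2 * of_nat CARD('n) + 2 * of_nat i)"
  using assms
proof transfer
  fix i a assume "i \<in> {1..CARD('n)}"
  then have "zvar (Pos i) a * zvar (Bar i) (a - 2 * of_nat CARD('n) + 2 * of_nat i)
      - zvar (Pos (i - 1)) a * zvar (Bar (i - 1)) (a - 2 * of_nat CARD('n) + 2 * of_nat i)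
      \<in> zrelators CARD('n)"
    unfolding zrelators_def by blast
  then show "zcong CARD('n)
      (zvar (Pos i) a * zvar (Bar i) (a - 2 * of_nat CARD('n) + 2 * of_nat i))
      (zvar (Pos (i - 1)) a * zvar (Bar (i - 1)) (a - 2 * of_nat CARD('n) + 2 * of_nat i))"
    unfolding zcong_def by (rule zideal_base)
qed


section \<open>Twisted power series and the determinant\<close>

text \<open>Power series in \<open>X\<close> with coefficients in \<open>'n zring\<close> written on the left of the powers of
  \<open>X\<close>, with \<open>X * zgen x a = zgen x (a - 2) * X\<close>.\<close>

typedef 'n tps = "UNIV :: (nat \<Rightarrow> 'n zring) set"
  morphisms tps_nth Abs_tps ..

setup_lifting type_definition_tps

instantiation tps :: (type) ring_1
begin

lift_definition zero_tps :: "'a tps" is "\<lambda>_. 0" .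
lift_definition one_tps :: "'a tps" is "\<lambda>k. if k = 0 then 1 else 0" .
lift_definition plus_tps :: "'a tps \<Rightarrow> 'a tps \<Rightarrow> 'a tps" is "\<lambda>f g k. f k + g k" .
lift_definition minus_tps :: "'a tps \<Rightarrow> 'a tps \<Rightarrow> 'a tps" is "\<lambda>f g k. f k - g k" .
lift_definition uminus_tps :: "'a tps \<Rightarrow> 'a tps" is "\<lambda>f k. - f k" .
lift_definition times_tps :: "'a tps \<Rightarrow> 'a tps \<Rightarrow> 'a tps" is
  "\<lambda>f g k. \<Sum>i\<le>k. f i * (zshift ^^ i) (g (k - i))" .

lemma zshift_pow_zero: "(zshift ^^ i) 0 = 0"
  and zshift_pow_one: "(zshift ^^ i) 1 = 1"
  and zshift_pow_add: "(zshift ^^ i) (p + q) = (zshift ^^ i) p + (zshift ^^ i) q"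
  and zshift_pow_mult: "(zshift ^^ i) (p * q) = (zshift ^^ i) p * (zshift ^^ i) q"
  by (induction i) (simp_all add: zshift_add zshift_mult)

lemma zshift_pow_sum: "(zshift ^^ i) (sum h A) = (\<Sum>x\<in>A. (zshift ^^ i) (h x))"
  by (induction A rule: infinite_finite_induct) (simp_all add: zshift_pow_zero zshift_pow_add)

instance
proof
  fix f g h :: "'a tps"
  show "f * g * h = f * (g * h)"
  proof (transfer, rule ext)
    fix f g h :: "nat \<Rightarrow> 'a zring" and k
    have "(\<Sum>i\<le>k. (\<Sum>j\<le>i. f j * (zshift ^^ j) (g (i - j))) * (zshift ^^ i) (h (k - i)))
      = (\<Sum>i\<le>k. \<Sum>j\<le>i. f j * (zshift ^^ j) (g (i - j)) * (zshift ^^ (j + (i - j))) (h (k - j - (i - j))))"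
      by (simp add: sum_distrib_right)
    also have "\<dots> = (\<Sum>j\<le>k. \<Sum>i\<le>k - j. f j * (zshift ^^ j) (g i) * (zshift ^^ (j + i)) (h (k - j - i)))"
      unfolding sum.Sigma[OF finite_atMost ballI[OF finite_atMost]] sum.Sigma
      by (rule sum.reindex_bij_witness[of _ "\<lambda>(j, i). (j + i, j)" "\<lambda>(i, j). (j, i - j)"]) auto
    also have "\<dots> = (\<Sum>j\<le>k. f j * (zshift ^^ j) (\<Sum>i\<le>k - j. g i * (zshift ^^ i) (h (k - j - i))))"
      by (simp add: sum_distrib_left zshift_pow_sum zshift_pow_mult funpow_add mult.assoc)
    finally show "(\<Sum>i\<le>k. (\<Sum>j\<le>i. f j * (zshift ^^ j) (g (i - j))) * (zshift ^^ i) (h (k - i)))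
      = (\<Sum>j\<le>k. f j * (zshift ^^ j) (\<Sum>i\<le>k - j. g i * (zshift ^^ i) (h (k - j - i))))" .
  qed
  show "1 * f = f"
    by transfer (rule ext, simp add: sum.delta if_distrib[of "\<lambda>x. x * _"] cong: if_cong)
  show "f * 1 = f"
  proof (transfer, rule ext)
    fix f :: "nat \<Rightarrow> 'a zring" and k
    have "(\<Sum>i\<le>k. f i * (zshift ^^ i) (if k - i = 0 then 1 else 0)) = (\<Sum>i\<le>k. if i = k then f i else 0)"
      by (rule sum.cong) (auto simp: zshift_pow_zero zshift_pow_one)
    then show "(\<Sum>i\<le>k. f i * (zshift ^^ i) (if k - i = 0 then 1 else 0)) = f k"
      by simp
  qed
  show "(f + g) * h = f * h + g * h" "f * (g + h) = f * g + f * h"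
    by (transfer; simp add: fun_eq_iff zshift_pow_add algebra_simps sum.distrib)+
  show "(0 :: 'a tps) \<noteq> 1"
    by transfer (auto simp: fun_eq_iff)
qed (transfer; simp add: fun_eq_iff algebra_simps)+

end

definition tps_const :: "'n zring \<Rightarrow> 'n tps" where
  "tps_const c = Abs_tps (\<lambda>k. if k = 0 then c else 0)"

definition tps_X :: "'n tps" where
  "tps_X = Abs_tps (\<lambda>k. if k = 1 then 1 else 0)"

lemma tps_nth_mult: "tps_nth (f * g) k = (\<Sum>i\<le>k. tps_nth f i * (zshift ^^ i) (tps_nth g (k - i)))"
  by transfer simp

lemma tps_eqI: "(\<And>k. tps_nth f k = tps_nth g k) \<Longrightarrow> f = g"
  by (metis tps_nth_inverse ext)

lemma tps_nth_one: "tps_nth 1 k = (if k = 0 then 1 else 0)"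
  by transfer simp

lemma tps_X_commute: "tps_X * tps_const (zgen x a) = tps_const (zgen x (a - 2) :: 'n zring) * tps_X"
proof (rule tps_eqI)
  fix k
  have "(\<Sum>i\<le>k. (if i = 1 then 1 else 0) * (zshift ^^ i) (if k - i = 0 then zgen x a else 0 :: 'n zring))
      = (\<Sum>i\<le>k. if i = 1 then (if k = 1 then zgen x (a - 2) else 0) else 0)"
    by (rule sum.cong) auto
  moreover have "(\<Sum>i\<le>k. (if i = 0 then zgen x (a - 2) else 0 :: 'n zring) * (zshift ^^ i) (if k - i = 1 then 1 else 0))
      = (\<Sum>i\<le>k. if i = 0 then (if k = 1 then zgen x (a - 2) else 0) else 0)"
    by (rule sum.cong) auto
  ultimately show "tps_nth (tps_X * tps_const (zgen x a)) k = tps_nth (tps_const (zgen x (a - 2) :: 'n zring) * tps_X) k"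
    by (simp add: tps_nth_mult tps_X_def tps_const_def Abs_tps_inverse)
qed

definition tps_inverse :: "'n tps \<Rightarrow> 'n tps" where
  "tps_inverse f = (THE g. f * g = 1 \<and> g * f = 1)"

fun tps_linv_nth :: "'n tps \<Rightarrow> nat \<Rightarrow> 'n zring" where
  "tps_linv_nth f k =
     (if k = 0 then 1 else - (\<Sum>i<k. tps_linv_nth f i * (zshift ^^ i) (tps_nth f (k - i))))"

fun tps_rinv_nth :: "'n tps \<Rightarrow> nat \<Rightarrow> 'n zring" where
  "tps_rinv_nth f k =
     (if k = 0 then 1
      else - (\<Sum>i<k. tps_nth f (k - i) * (zshift ^^ (k - i)) (tps_rinv_nth f i)))"

declare tps_linv_nth.simps [simp del] tps_rinv_nth.simps [simp del]

lemma tps_inverse: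
  assumes "tps_nth f 0 = 1"
  shows "f * tps_inverse f = 1" "tps_inverse f * f = 1"
proof -
  define g where "g = Abs_tps (tps_linv_nth f)"
  define h where "h = Abs_tps (tps_rinv_nth f)"
  have g: "g * f = 1"
  proof (rule tps_eqI)
    fix k
    show "tps_nth (g * f) k = tps_nth 1 k"
      using assms
      by (cases k)
        (simp_all add: tps_nth_mult g_def Abs_tps_inverse tps_nth_one zshift_pow_one
          tps_linv_nth.simps[of f "Suc _"] tps_linv_nth.simps[of f 0] lessThan_Suc_atMost[symmetric])
  qed
  have h: "f * h = 1"
  proof (rule tps_eqI)
    fix k
    have "tps_nth (f * h) k = (\<Sum>i\<le>k. tps_nth f (k - i) * (zshift ^^ (k - i)) (tps_nth h i))"
      unfolding tps_nth_mult by (rule sum.reindex_bij_witness[of _ "\<lambda>i. k - i" "\<lambda>i. k - i"]) auto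
    also have "\<dots> = tps_nth 1 k"
      using assms
      by (cases k)
        (simp_all add: h_def Abs_tps_inverse tps_nth_one
          tps_rinv_nth.simps[of f "Suc _"] tps_rinv_nth.simps[of f 0] lessThan_Suc_atMost[symmetric])
    finally show "tps_nth (f * h) k = tps_nth 1 k" .
  qed
  have "g = h"
    using g h by (metis mult.assoc mult.left_neutral mult.right_neutral)
  then have "\<exists>!g. f * g = 1 \<and> g * f = 1"
    using g h by (metis mult.assoc mult.left_neutral mult.right_neutral)
  then have "f * tps_inverse f = 1 \<and> tps_inverse f * f = 1"
    unfolding tps_inverse_def by (rule theI')
  then show "f * tps_inverse f = 1" "tps_inverse f * f = 1" by auto
qed

definition zX :: "letter \<Rightarrow> complex \<Rightarrow> 'n tps" where
  "zX x a = tps_const (zgen x a) * tps_X"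

definition E_series :: "complex \<Rightarrow> 'n tps" where
  "E_series a =
     prod_list (map (\<lambda>i. 1 + zX (Pos i) a) [1..<CARD('n) + 1])
     * tps_inverse (1 - zX (Bar CARD('n)) a * zX (Pos CARD('n)) a)
     * prod_list (map (\<lambda>i. 1 + zX (Bar i) a) (rev [1..<CARD('n) + 1]))"

definition e_coeff :: "int \<Rightarrow> complex \<Rightarrow> 'n zring" where
  "e_coeff k a = (if k < 0 then 0 else tps_nth (E_series a) (nat k))"

text \<open>Partitions are indexed from 1; the value at 0 plays no role.\<close>

definition is_partition :: "(nat \<Rightarrow> nat) \<Rightarrow> bool" where
  "is_partition lam \<longleftrightarrow> (\<forall>i\<ge>1. lam (i + 1) \<le> lam i) \<and> finite {i. 1 \<le> i \<and> lam i \<noteq> 0}"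

definition conj_partition :: "(nat \<Rightarrow> nat) \<Rightarrow> nat \<Rightarrow> nat" where
  "conj_partition lam j = card {i. 1 \<le> i \<and> j \<le> lam i}"

definition skew_diagram :: "(nat \<Rightarrow> nat) \<Rightarrow> (nat \<Rightarrow> nat) \<Rightarrow> bool" where
  "skew_diagram lam mu \<longleftrightarrow> is_partition lam \<and> is_partition mu \<and> (\<forall>i\<ge>1. mu i \<le> lam i)"

definition boxes :: "(nat \<Rightarrow> nat) \<Rightarrow> (nat \<Rightarrow> nat) \<Rightarrow> (nat \<times> nat) set" where
  "boxes lam mu = {(i, j). 1 \<le> i \<and> mu i + 1 \<le> j \<and> j \<le> lam i}"

text \<open>Matrices are indexed from 0, so the entry in row \<open>i\<close> and column \<open>j\<close> of the paper is at
  \<open>(i - 1, j - 1)\<close>.\<close>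

definition jt_det :: "(nat \<Rightarrow> nat) \<Rightarrow> (nat \<Rightarrow> nat) \<Rightarrow> complex \<Rightarrow> 'n zring" where
  "jt_det lam mu a = det (mat (lam 1) (lam 1) (\<lambda>(i0, j0).
     let i = i0 + 1; j = j0 + 1 in
       e_coeff (int (conj_partition lam i) - int (conj_partition mu j) - int i + int j)
         (a - 2 * (of_nat (conj_partition mu j) - of_nat j + 1))))"


section \<open>Tableaux\<close>

definition tableaux :: "nat \<Rightarrow> (nat \<Rightarrow> nat) \<Rightarrow> (nat \<Rightarrow> nat) \<Rightarrow> (nat \<times> nat \<Rightarrow> letter) set" where
  "tableaux n lam mu = boxes lam mu \<rightarrow>\<^sub>E letters n"

definition H_rule where
  "H_rule n lam mu T \<longleftrightarrow> (\<forall>i j. (i, j) \<in> boxes lam mu \<and> (i, j + 1) \<in> boxes lam mu \<longrightarrow>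
     letter_le n (T (i, j)) (T (i, j + 1)) \<or> (T (i, j), T (i, j + 1)) = (Pos n, Bar n))"

definition V_rule where
  "V_rule n lam mu T \<longleftrightarrow> (\<forall>i j. (i, j) \<in> boxes lam mu \<and> (i + 1, j) \<in> boxes lam mu \<longrightarrow>
     \<not> letter_le n (T (i + 1, j)) (T (i, j)))"

definition weight :: "(nat \<Rightarrow> nat) \<Rightarrow> (nat \<Rightarrow> nat) \<Rightarrow> complex \<Rightarrow> (nat \<times> nat \<Rightarrow> letter) \<Rightarrow> 'n zring" where
  "weight lam mu a T = (\<Prod>(i, j)\<in>boxes lam mu. zgen (T (i, j)) (a + 2 * (of_nat j - of_nat i)))"


section \<open>Paths\<close>

type_synonym point = "int \<times> int"

definition ht :: "point \<Rightarrow> int" where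
  "ht w = fst w + snd w"

definition hp :: "point \<Rightarrow> real" where
  "hp w = (real_of_int (fst w) - real_of_int (snd w)) / 2"

datatype step = NE_step | NW_step | E_step

fun move :: "step \<Rightarrow> point \<Rightarrow> point" where
  "move NE_step (x, y) = (x + 1, y)"
| "move NW_step (x, y) = (x, y + 1)"
| "move E_step (x, y) = (x + 1, y - 1)"

text \<open>A path is given by its starting point and its list of steps.\<close>

type_synonym path = "point \<times> step list"

fun points :: "path \<Rightarrow> point list" where
  "points (w, []) = [w]"
| "points (w, s # ss) = w # points (move s w, ss)"

definition start :: "path \<Rightarrow> point" where
  "start q = fst q"

definition steps :: "path \<Rightarrow> step list" where
  "steps q = snd q"

definition finish :: "path \<Rightarrow> point" where
  "finish q = last (points q)"

definition is_path :: "nat \<Rightarrow> path \<Rightarrow> bool" where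
  "is_path n q \<longleftrightarrow> ht (start q) = - int n \<and> ht (finish q) = int n
     \<and> (\<forall>k < length (steps q). steps q ! k = E_step \<longrightarrow> ht (points q ! k) = 0)
     \<and> even (count_list (steps q) E_step)"

definition step_label :: "nat \<Rightarrow> path \<Rightarrow> nat \<Rightarrow> letter" where
  "step_label n q k = (let m = ht (points q ! k) in
     if m < 0 then Pos (nat (int n + 1 + m))
     else if m = 0 \<and> steps q ! k = E_step \<and> even (count_list (take (k + 1) (steps q)) E_step) then Pos n
     else Bar (nat (int n - m)))"

definition labels :: "nat \<Rightarrow> path \<Rightarrow> letter list" where
  "labels n q = map (step_label n q) (filter (\<lambda>k. steps q ! k \<noteq> NW_step) [0..<length (steps q)])"

definition u_pt :: "nat \<Rightarrow> (nat \<Rightarrow> nat) \<Rightarrow> nat \<Rightarrow> point" where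
  "u_pt n mu i = (int (conj_partition mu i) + 1 - int i, - int n - int (conj_partition mu i) - 1 + int i)"

definition v_pt :: "nat \<Rightarrow> (nat \<Rightarrow> nat) \<Rightarrow> nat \<Rightarrow> point" where
  "v_pt n lam i = (int (conj_partition lam i) + 1 - int i, int n - int (conj_partition lam i) - 1 + int i)"

definition pos_at_zero :: "path \<Rightarrow> real" where
  "pos_at_zero q = Min (hp ` {w \<in> set (points q). ht w = 0})"

definition intersecting :: "path \<Rightarrow> path \<Rightarrow> bool" where
  "intersecting q q' \<longleftrightarrow> set (points q) \<inter> set (points q') \<noteq> {}"

definition specially_intersecting :: "path \<Rightarrow> path \<Rightarrow> bool" where
  "specially_intersecting q q' \<longleftrightarrow> intersecting q q'
     \<and> (\<forall>w \<in> set (points q) \<inter> set (points q'). ht w = 0)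
     \<and> (\<exists>k::int. odd k \<and> pos_at_zero q - pos_at_zero q' = of_int k)"

definition ordinarily_intersecting :: "path \<Rightarrow> path \<Rightarrow> bool" where
  "ordinarily_intersecting q q' \<longleftrightarrow> intersecting q q' \<and> \<not> specially_intersecting q q'"

definition P_HV :: "nat \<Rightarrow> (nat \<Rightarrow> nat) \<Rightarrow> (nat \<Rightarrow> nat) \<Rightarrow> (nat \<Rightarrow> path) set" where
  "P_HV n lam mu =
     {p \<in> (\<Pi>\<^sub>E i\<in>{1..lam 1}. {q. is_path n q \<and> start q = u_pt n mu i \<and> finish q = v_pt n lam i}).
        \<forall>i. 1 \<le> i \<and> i < lam 1 \<longrightarrow> \<not> ordinarily_intersecting (p i) (p (i + 1))}"

definition T_v :: "nat \<Rightarrow> (nat \<Rightarrow> nat) \<Rightarrow> (nat \<Rightarrow> nat) \<Rightarrow> (nat \<Rightarrow> path) \<Rightarrow> (nat \<times> nat \<Rightarrow> letter)" where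
  "T_v n lam mu p = (\<lambda>(i, j)\<in>boxes lam mu. labels n (p j) ! (i - conj_partition mu j - 1))"


section \<open>Odd regions\<close>

text \<open>Without its E-steps a path from height \<open>-n\<close> to height \<open>n\<close> has \<open>2 * n\<close> steps, of which the
  first \<open>n\<close> form the lower path and the last \<open>n\<close> the upper path.  The lower path is attached to the
  starting point of the given path, the upper path to its end point.\<close>

definition lower_path :: "nat \<Rightarrow> path \<Rightarrow> path" where
  "lower_path n q = (start q, take n (filter (\<lambda>s. s \<noteq> E_step) (steps q)))"

definition upper_path :: "nat \<Rightarrow> path \<Rightarrow> path" where
  "upper_path n q = (let ss = drop n (filter (\<lambda>s. s \<noteq> E_step) (steps q))
     in (finish q - finish ((0, 0), ss), ss))"

text \<open>The horizontal position at height \<open>r\<close> of a path without E-steps.\<close>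

definition pos_at :: "path \<Rightarrow> int \<Rightarrow> real" where
  "pos_at q r = hp (points q ! nat (r - ht (start q)))"

text \<open>\<open>alpha n p i r\<close> and \<open>beta n l p i r\<close> are the extended positions, with the conventions for
  \<open>i = 0\<close> and \<open>i = l + 1\<close>.\<close>

definition alpha :: "nat \<Rightarrow> (nat \<Rightarrow> path) \<Rightarrow> nat \<Rightarrow> int \<Rightarrow> ereal" where
  "alpha n p i r = (if i = 0 then \<infinity> else ereal (pos_at (lower_path n (p i)) r))"

definition beta :: "nat \<Rightarrow> nat \<Rightarrow> (nat \<Rightarrow> path) \<Rightarrow> nat \<Rightarrow> int \<Rightarrow> ereal" where
  "beta n l p i r = (if i = l + 1 then - \<infinity> else ereal (pos_at (upper_path n (p i)) r))"

definition alpha_dual :: "nat \<Rightarrow> (nat \<Rightarrow> path) \<Rightarrow> nat \<Rightarrow> int \<Rightarrow> ereal" where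
  "alpha_dual n p i r = alpha n p i (- r) - 1"

definition beta_dual :: "nat \<Rightarrow> nat \<Rightarrow> (nat \<Rightarrow> path) \<Rightarrow> nat \<Rightarrow> int \<Rightarrow> ereal" where
  "beta_dual n l p i r = beta n l p i (- r) + 1"

datatype half = Upper | Lower

fun in_half :: "nat \<Rightarrow> half \<Rightarrow> point \<Rightarrow> bool" where
  "in_half n Upper w \<longleftrightarrow> 0 \<le> ht w \<and> ht w \<le> int n"
| "in_half n Lower w \<longleftrightarrow> - int n \<le> ht w \<and> ht w \<le> 0"

text \<open>A unit is determined by the strip containing it, \<open>Upper\<close> for heights from 0 to \<open>n\<close> and
  \<open>Lower\<close> for heights from \<open>-n\<close> to 0, and by its left vertex.  In the
  coordinates \<open>(x, y)\<close> the unit square with left vertex \<open>(x, y)\<close> has right vertex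
  \<open>(x + 1, y - 1)\<close>, top vertex \<open>(x + 1, y)\<close> and bottom vertex \<open>(x, y - 1)\<close>; the vertices of a unit
  are those vertices of the square that belong to the strip.  A lattice point lies in a unit if and
  only if it is one of the vertices of the unit.\<close>

type_synonym zunit = "half \<times> point"

definition is_unit :: "nat \<Rightarrow> zunit \<Rightarrow> bool" where
  "is_unit n U \<longleftrightarrow> in_half n (fst U) (snd U)"

definition left_vertex :: "zunit \<Rightarrow> point" where
  "left_vertex U = snd U"

definition right_vertex :: "zunit \<Rightarrow> point" where
  "right_vertex U = snd U + (1, -1)"

definition vertices :: "nat \<Rightarrow> zunit \<Rightarrow> point set" where
  "vertices n U = {w \<in> {left_vertex U, right_vertex U, snd U + (1, 0), snd U + (0, -1)}.
     in_half n (fst U) w}"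

fun II_at :: "nat \<Rightarrow> nat \<Rightarrow> (nat \<Rightarrow> path) \<Rightarrow> zunit \<Rightarrow> nat \<Rightarrow> bool" where
  "II_at n l p (Upper, w) i \<longleftrightarrow>
     beta n l p (i + 1) (ht w) \<le> hp (left_vertex (Upper, w))
     \<and> hp (right_vertex (Upper, w)) \<le> alpha_dual n p i (ht w)"
| "II_at n l p (Lower, w) i \<longleftrightarrow>
     beta_dual n l p (i + 1) (ht w) \<le> hp (left_vertex (Lower, w))
     \<and> hp (right_vertex (Lower, w)) \<le> alpha n p i (ht w)"

definition II_units :: "nat \<Rightarrow> nat \<Rightarrow> (nat \<Rightarrow> path) \<Rightarrow> zunit set" where
  "II_units n l p = {U. is_unit n U \<and> (\<exists>i\<le>l. II_at n l p U i)}"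

definition boundary_II_units :: "nat \<Rightarrow> nat \<Rightarrow> (nat \<Rightarrow> path) \<Rightarrow> zunit set" where
  "boundary_II_units n l p = {U. is_unit n U \<and>
     (\<exists>i\<le>l. II_at n l p U i \<and> (i = 0 \<or> i = l \<or> \<bar>ht (snd U)\<bar> = int n))}"

text \<open>Adjacency is taken between units of the same strip.  If a path \<open>p i\<close> has no E-steps, then
  at height 0 a lower unit ending at the common endpoint of its two halves touches an upper unit
  starting there, although the two units lie on different sides of the path.  Counting such
  units as adjacent would join the regions on the two sides of \<open>p i\<close>; for the row
  with entries \<open>Pos n\<close>, \<open>Bar n\<close> every unit would then be connected to a boundary unit, whereas the
  weight of this tableau does not occur in \<open>jt_det\<close>.\<close>

definition adjacent :: "nat \<Rightarrow> zunit \<Rightarrow> zunit \<Rightarrow> bool" where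
  "adjacent n U W \<longleftrightarrow> fst U = fst W \<and>
     ({left_vertex U, right_vertex U} \<inter> vertices n W \<noteq> {}
      \<or> {left_vertex W, right_vertex W} \<inter> vertices n U \<noteq> {})"

text \<open>A component, and so a region, is represented by the set of its units.\<close>

definition II_components :: "nat \<Rightarrow> nat \<Rightarrow> (nat \<Rightarrow> path) \<Rightarrow> zunit set set" where
  "II_components n l p =
     II_units n l p // {(U, W). U \<in> II_units n l p \<and> W \<in> II_units n l p \<and> adjacent n U W}\<^sup>*"

definition II_regions :: "nat \<Rightarrow> nat \<Rightarrow> (nat \<Rightarrow> path) \<Rightarrow> zunit set set" where
  "II_regions n l p =
     {V \<in> II_components n l p. (\<exists>U\<in>V. ht (snd U) = 0) \<and> V \<inter> boundary_II_units n l p = {}}"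

definition even_hole :: "nat \<Rightarrow> (nat \<Rightarrow> path) \<Rightarrow> nat \<Rightarrow> bool" where
  "even_hole n p i \<longleftrightarrow> (\<exists>k::int. 0 < k \<and> even k \<and>
     pos_at (lower_path n (p i)) 0 - pos_at (upper_path n (p (i + 1))) 0 = of_int k)"

definition hole_meets :: "nat \<Rightarrow> (nat \<Rightarrow> path) \<Rightarrow> nat \<Rightarrow> zunit set \<Rightarrow> bool" where
  "hole_meets n p i V \<longleftrightarrow>
     (\<exists>U\<in>V. fst U = Lower \<and> finish (lower_path n (p i)) \<in> vertices n U)
     \<or> (\<exists>U\<in>V. fst U = Upper \<and> start (upper_path n (p (i + 1))) \<in> vertices n U)"

definition odd_II_region :: "nat \<Rightarrow> nat \<Rightarrow> (nat \<Rightarrow> path) \<Rightarrow> zunit set \<Rightarrow> bool" where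
  "odd_II_region n l p V \<longleftrightarrow> V \<in> II_regions n l p
     \<and> odd (card {i. 1 \<le> i \<and> i < l \<and> even_hole n p i \<and> hole_meets n p i V})"

definition E_rule where
  "E_rule n lam mu T \<longleftrightarrow>
     (\<nexists>V. odd_II_region n (lam 1) (the_inv_into (P_HV n lam mu) (T_v n lam mu) T) V)"

definition Tab :: "nat \<Rightarrow> (nat \<Rightarrow> nat) \<Rightarrow> (nat \<Rightarrow> nat) \<Rightarrow> (nat \<times> nat \<Rightarrow> letter) set" where
  "Tab n lam mu = {T \<in> tableaux n lam mu. H_rule n lam mu T \<and> V_rule n lam mu T \<and> E_rule n lam mu T}"

end

theory Submission
  imports Defs
begin

text \<open>A tuple of lower and upper paths is turned, by passing to the duals of the lower paths, into a pair
  \<open>(b, a)\<close> of height functions on the cells of a single strip: \<open>b\<close> and \<open>a\<close> count the upper paths and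
  the dual lower paths to the right of a cell.  The units of type \<open>II\<close> are the cells of depth
  \<open>b - a \<le> 0\<close>.  By the relations of the ring the weight depends only on \<open>b + a\<close>, so it does not
  change when \<open>(b, a)\<close> is replaced by \<open>(a + m, b - m)\<close> on a set of cells whose outer neighbours
  all have depth \<open>m\<close>.

  Two applications of the Cauchy-Binet formula expand the determinant into a signed sum over the
  pairs with depth 0, 1 or 2 along the bottom; the sign is a product of colours over the bottom edges
  of the set of cells of depth at least 2.  Reflecting components at \<open>m = 1\<close> cancels all pairs for
  which some component has a negative sign.  Reflecting at \<open>m = N\<close> matches the remaining pairs of
  bottom depth at most \<open>2 * N\<close> with those of bottom depth at most \<open>N\<close>, for \<open>N = 2, 4, 8, \<dots>\<close>, so
  that the bound on the depth can be dropped.  What is left are the pairs of nonnegative bottom depth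
  in which colours are constant where the depth is positive and every inner component of depth at
  most 0 has sign 1.  The first condition describes the tableaux satisfying the horizontal and the
  vertical rule, the second the absence of odd regions.\<close>

section \<open>Cells of the strip\<close>

text \<open>The determinant treats the two parity classes of abscissas separately and allows at most
  one path of a class over a bottom cell. Hence its expansion stops at bottom depth 2, whereas
  tableaux reach any bottom depth as long as parities alternate. The doubling of \<open>N\<close>
  trades the bound on the depth for this colour rule. What drives it is the effect of a reflection
  at level \<open>m\<close> on a colour at odd depth: an odd level keeps it, an even level reverses
  it. So level 1 gives a cancelling involution, while at an even level the reversed colours record
  which bottom cells were folded, and folding is injective. Surjectivity is a planar statement: the
  colours prescribe at which bottom edges of the cells of depth at least \<open>N\<close> the fold
  changes sides, and a consistent choice of sides on the rest of the strip exists when the number of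
  changes is even on each component. This is why evenness conditions accompany the induction, and
  why the cells form a triangulated strip. Weights are compared without inverses of variables, by
  carrying exponents from row to row up to the top.\<close>

type_synonym cell = "int \<times> nat"

text \<open>Together with their reverses the three directions triangulate the strip. The orientation
  is the one along which a count of the points lying further right can only drop, and by at most 1;
  see \<open>hfun\<close>.\<close>

definition arc :: "nat \<Rightarrow> cell \<Rightarrow> cell \<Rightarrow> bool" where
  "arc n u v \<longleftrightarrow> snd u \<le> n \<and> snd v \<le> n \<and>
     ((snd v = snd u \<and> fst v = fst u + 1) \<or> (snd u = Suc (snd v) \<and> fst v = fst u)
      \<or> (snd v = Suc (snd u) \<and> fst v = fst u + 1))"

definition cell_adj :: "nat \<Rightarrow> cell \<Rightarrow> cell \<Rightarrow> bool" where
  "cell_adj n u v \<longleftrightarrow> arc n u v \<or> arc n v u"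

definition adj_rel :: "nat \<Rightarrow> cell set \<Rightarrow> (cell \<times> cell) set" where
  "adj_rel n S = {(u, v). u \<in> S \<and> v \<in> S \<and> cell_adj n u v}"

definition comp_of :: "nat \<Rightarrow> cell set \<Rightarrow> cell \<Rightarrow> cell set" where
  "comp_of n S u = (adj_rel n S)\<^sup>* `` {u}"

lemma cell_adj_sym: "cell_adj n u v \<Longrightarrow> cell_adj n v u"
  by (auto simp: cell_adj_def)

lemma adj_rel_sym: "(u, v) \<in> adj_rel n S \<Longrightarrow> (v, u) \<in> adj_rel n S"
  by (auto simp: adj_rel_def cell_adj_def)

lemma adj_rel_rtrancl_sym: "(u, v) \<in> (adj_rel n S)\<^sup>* \<Longrightarrow> (v, u) \<in> (adj_rel n S)\<^sup>*"
  using sym_rtrancl[of "adj_rel n S"] adj_rel_sym by (metis symD symI)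

lemma comp_of_self [simp]: "u \<in> comp_of n S u"
  by (simp add: comp_of_def)

lemma comp_of_subset: "u \<in> S \<Longrightarrow> comp_of n S u \<subseteq> S"
proof
  fix v assume "u \<in> S" "v \<in> comp_of n S u"
  then have "(u, v) \<in> (adj_rel n S)\<^sup>*" by (simp add: comp_of_def)
  then show "v \<in> S" by (induction rule: rtrancl_induct) (use \<open>u \<in> S\<close> in \<open>auto simp: adj_rel_def\<close>)
qed

lemma comp_of_step: "v \<in> comp_of n S u \<Longrightarrow> u \<in> S \<Longrightarrow> w \<in> S \<Longrightarrow> cell_adj n v w \<Longrightarrow> w \<in> comp_of n S u"
  using comp_of_subset[of u S n]
  unfolding comp_of_def by (auto intro: rtrancl_into_rtrancl simp: adj_rel_def)

lemma comp_of_eq: "v \<in> comp_of n S u \<Longrightarrow> comp_of n S v = comp_of n S u"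
  unfolding comp_of_def by (safe; meson Image_singleton_iff adj_rel_rtrancl_sym rtrancl_trans)

lemma comp_of_induct [consumes 1, case_names base step]:
  assumes "v \<in> comp_of n S u" "P u"
    and "\<And>v w. v \<in> comp_of n S u \<Longrightarrow> P v \<Longrightarrow> v \<in> S \<Longrightarrow> w \<in> S \<Longrightarrow> cell_adj n v w \<Longrightarrow> P w"
  shows "P v"
proof -
  have "(u, v) \<in> (adj_rel n S)\<^sup>*" using assms(1) by (simp add: comp_of_def)
  then show ?thesis
    by (induction rule: rtrancl_induct) (use assms(2,3) in \<open>auto simp: adj_rel_def comp_of_def\<close>)
qed

lemma comp_of_mono: "S \<subseteq> S' \<Longrightarrow> comp_of n S u \<subseteq> comp_of n S' u"
  unfolding comp_of_def by (intro Image_mono rtrancl_mono) (auto simp: adj_rel_def)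

text \<open>A walk can leave the component only through a neighbour of it, and there the two sets
  agree. In this form the components of level sets can be compared before and after a reflection,
  although the level sets differ elsewhere.\<close>

lemma comp_of_cong:
  assumes "u \<in> S" "u \<in> S'"
    and "\<And>v w. v \<in> comp_of n S u \<Longrightarrow> cell_adj n v w \<Longrightarrow> w \<in> S \<longleftrightarrow> w \<in> S'"
  shows "comp_of n S' u = comp_of n S u"
proof (intro equalityI subsetI)
  fix v assume "v \<in> comp_of n S' u"
  then show "v \<in> comp_of n S u"
  proof (induction rule: comp_of_induct)
    case (step v w)
    then show ?case using assms(3)[of v w] comp_of_step[of v n S u w] assms(1) by blast
  qed simp
next
  fix v assume "v \<in> comp_of n S u"
  then show "v \<in> comp_of n S' u"
  proof (induction rule: comp_of_induct)
    case (step v w)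
    then show ?case using assms(3)[of v w] comp_of_step[of v n S' u w] assms(2) by blast
  qed simp
qed

lemma cell_adj_bottom: "cell_adj n (x, 0) (x + 1, 0)" "cell_adj n (x - 1, 0) (x, 0)"
  by (auto simp: cell_adj_def arc_def)

section \<open>Planarity\<close>

lemma prod_telescope_sign:
  fixes c :: "nat \<Rightarrow> int"
  assumes "\<And>k. c k \<in> {1, -1}"
  shows "(\<Prod>k<N. c k * c (Suc k)) = c 0 * c N"
proof (induction N)
  case 0
  then show ?case using assms[of 0] by auto
next
  case (Suc N)
  then show ?case using assms[of N] by auto
qed

text \<open>The ray starts at \<open>w\<close> and runs upwards along the right border of its
  column. For a diagonal step, the row of its end in the column of \<open>w\<close> decides whether
  it passes above \<open>w\<close>.\<close>

definition crossing :: "cell \<Rightarrow> cell \<Rightarrow> cell \<Rightarrow> int" where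
  "crossing w p q =
    (if (fst p = fst w \<and> snd w < snd p \<and> fst q = fst w + 1)
        \<or> (fst q = fst w \<and> snd w < snd q \<and> fst p = fst w + 1) then -1 else 1)"

lemma cell_adj_cases:
  assumes "cell_adj n p q"
  obtains i j where "p = (i, j)" "q = (i + 1, j)" | i j where "p = (i + 1, j)" "q = (i, j)"
    | i j where "p = (i, j)" "q = (i, Suc j)" | i j where "p = (i, Suc j)" "q = (i, j)"
    | i j where "p = (i, j)" "q = (i + 1, Suc j)" | i j where "p = (i + 1, Suc j)" "q = (i, j)"
  using assms by (cases p; cases q) (simp add: cell_adj_def arc_def; metis)

text \<open>When the ray moves one column to the right, the crossings change only by the steps that
  enter or leave the part of column \<open>x + 1\<close> above row \<open>r\<close>, so the change
  telescopes along a walk. The four inequations exclude the steps at the two base cells, for which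
  this can fail.\<close>

lemma crossing_east:
  assumes "cell_adj n p q" "p \<noteq> (x, r)" "q \<noteq> (x, r)" "p \<noteq> (x + 1, r)" "q \<noteq> (x + 1, r)"
  shows "crossing (x, r) p q * crossing (x + 1, r) p q
    = (if fst p = x + 1 \<and> r < snd p then -1 else 1) * (if fst q = x + 1 \<and> r < snd q then -1 else 1)"
  using assms(1)
  by (cases rule: cell_adj_cases; use assms(2-) in \<open>simp add: crossing_def\<close>; arith?)

lemma crossing_north_east:
  assumes "cell_adj n p q" "p \<noteq> (x, r)" "q \<noteq> (x, r)" "p \<noteq> (x + 1, Suc r)" "q \<noteq> (x + 1, Suc r)"
  shows "crossing (x, r) p q * crossing (x + 1, Suc r) p q
    = (if fst p = x + 1 \<and> Suc r < snd p then -1 else 1) * (if fst q = x + 1 \<and> Suc r < snd q then -1 else 1)"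
  using assms(1)
  by (cases rule: cell_adj_cases; use assms(2-) in \<open>simp add: crossing_def\<close>; arith?)

lemma crossing_north:
  assumes "cell_adj n p q" "p \<noteq> (x, r)" "q \<noteq> (x, r)" "p \<noteq> (x, Suc r)" "q \<noteq> (x, Suc r)"
  shows "crossing (x, r) p q = crossing (x, Suc r) p q"
  using assms(1)
  by (cases rule: cell_adj_cases; use assms(2-) in \<open>simp add: crossing_def\<close>; arith?)

text \<open>No cell lies below the bottom row, so a step between columns \<open>x\<close> and
  \<open>x + 1\<close> that avoids \<open>(x, 0)\<close> always meets the ray. It only matters which
  ends of the step are on the left.\<close>

lemma crossing_bottom:
  assumes "cell_adj n p q" "p \<noteq> (x, 0)" "q \<noteq> (x, 0)"
  shows "crossing (x, 0) p q = (if fst p \<le> x then -1 else 1) * (if fst q \<le> x then -1 else 1)"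
  using assms(1)
  by (cases rule: cell_adj_cases; use assms(2-) in \<open>simp add: crossing_def\<close>; arith?)

text \<open>The sign of a cell counts, modulo 2, the steps of the walk that cross the vertical ray above
  it; it can change only on the walk because the ends of the walk lie at the bottom.\<close>

lemma walk_sign:
  assumes uv: "v \<in> comp_of n T u" and bottom: "snd u = 0" "snd v = 0" and uT: "u \<in> T"
    and T: "\<And>w. w \<in> T \<Longrightarrow> snd w < n \<and> \<bar>fst w\<bar> < W"
  obtains \<sigma> :: "cell \<Rightarrow> int"
  where "\<And>w. \<sigma> w \<in> {1, -1}"
    and "\<And>w w'. cell_adj n w w' \<Longrightarrow> w \<notin> T \<Longrightarrow> w' \<notin> T \<Longrightarrow> \<sigma> w = \<sigma> w'"
    and "\<And>w. snd w = n \<or> W \<le> \<bar>fst w\<bar> \<Longrightarrow> \<sigma> w = 1"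
    and "\<And>x. (x, 0) \<notin> T \<Longrightarrow>
      \<sigma> (x, 0) = (if fst u \<le> x then -1 else 1) * (if fst v \<le> x then -1 else 1)"
proof -
  have "(u, v) \<in> (adj_rel n T)\<^sup>*" using uv by (simp add: comp_of_def)
  then obtain N where "(u, v) \<in> adj_rel n T ^^ N" by (auto dest: rtrancl_imp_relpow)
  then obtain f where f: "f 0 = u" "f N = v" "\<And>i. i < N \<Longrightarrow> (f i, f (Suc i)) \<in> adj_rel n T"
    by (auto simp: relpow_fun_conv)
  have fT: "f i \<in> T" if "i \<le> N" for i
    using that f uT by (cases "i") (auto simp: adj_rel_def dest: spec[of _ "i - 1"])
  define \<sigma> where "\<sigma> w = (\<Prod>k<N. crossing w (f k) (f (Suc k)))" for w
  have pm: "\<sigma> w \<in> {1, -1}" for w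
  proof -
    have "(\<Prod>k<M. crossing w (f k) (f (Suc k))) \<in> {1, -1}" for M
      by (induction M) (auto simp: crossing_def)
    then show ?thesis by (simp add: \<sigma>_def)
  qed
  have step: "cell_adj n (f k) (f (Suc k))" "f k \<in> T" "f (Suc k) \<in> T" if "k < N" for k
    using f(3)[OF that] by (auto simp: adj_rel_def)
  have arc: "\<sigma> w = \<sigma> w'" if a: "arc n w w' \<or> arc n w' w" and w: "w \<notin> T" "w' \<notin> T" for w w'
  proof -
    have eq: "\<sigma> w = \<sigma> w'" if "\<sigma> w * \<sigma> w' = 1" for w w'
      using that pm[of w] pm[of w'] by auto
    \<comment> \<open>The crossings with the two rays combine to a coboundary of the indicator of
      \<open>Q\<close>. The product collapses to the two ends of the walk, which lie outside
      \<open>Q\<close>.\<close>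
    have tele: "\<sigma> w * \<sigma> w' = 1"
      if "\<And>k. k < N \<Longrightarrow> crossing w (f k) (f (Suc k)) * crossing w' (f k) (f (Suc k)) =
          (if f k \<in> Q then -1 else 1) * (if f (Suc k) \<in> Q then -1 else 1)"
        and "u \<notin> Q" "v \<notin> Q" for Q w w'
    proof -
      have "\<sigma> w * \<sigma> w' = (\<Prod>k<N. (\<lambda>k. if f k \<in> Q then -1 else 1) k * (\<lambda>k. if f k \<in> Q then -1 else 1) (Suc k))"
        unfolding \<sigma>_def prod.distrib[symmetric] using that(1) by (intro prod.cong) auto
      also have "\<dots> = (if f 0 \<in> Q then -1 else 1) * (if f N \<in> Q then -1 else 1)"
        by (subst prod_telescope_sign) auto
      also have "\<dots> = 1" using that f by auto
      finally show ?thesis .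
    qed
    have main: "\<sigma> w = \<sigma> w'" if a: "arc n w w'" and w: "w \<notin> T" "w' \<notin> T" for w w'
    proof -
      obtain x r where wx: "w = (x, r)" by (cases w)
      have ne: "f k \<noteq> w" "f (Suc k) \<noteq> w" "f k \<noteq> w'" "f (Suc k) \<noteq> w'" if "k < N" for k
        using step[OF that] w by auto
      from a wx consider "w' = (x + 1, r)" | s where "r = Suc s" "w' = (x, s)" | "w' = (x + 1, Suc r)"
        unfolding arc_def by (cases w') auto
      then show ?thesis
      proof cases
        case 1
        show ?thesis
          by (rule eq, rule tele[where Q = "{q. fst q = x + 1 \<and> r < snd q}"])
            (use crossing_east[OF step(1), of _ x r] ne bottom in \<open>auto simp: wx 1\<close>)
      next
        case 2
        have "\<sigma> w' = \<sigma> w" unfolding \<sigma>_def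
          by (rule prod.cong) (use crossing_north[OF step(1), of _ x s] ne in \<open>auto simp: wx 2\<close>)
        then show ?thesis by simp
      next
        case 3
        show ?thesis
          by (rule eq, rule tele[where Q = "{q. fst q = x + 1 \<and> Suc r < snd q}"])
            (use crossing_north_east[OF step(1), of _ x r] ne bottom in \<open>auto simp: wx 3\<close>)
      qed
    qed
    show ?thesis using a main w by metis
  qed
  have bd: "\<sigma> w = 1" if "snd w = n \<or> W \<le> \<bar>fst w\<bar>" for w
    unfolding \<sigma>_def
  proof (rule prod.neutral, safe)
    fix k assume "k < N"
    then have "snd (f k) < n \<and> \<bar>fst (f k)\<bar> < W" "snd (f (Suc k)) < n \<and> \<bar>fst (f (Suc k))\<bar> < W"
      using step T by blast+
    then show "crossing w (f k) (f (Suc k)) = 1" using that by (auto simp: crossing_def)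
  qed
  have bt: "\<sigma> (x, 0) = (if fst u \<le> x then -1 else 1) * (if fst v \<le> x then -1 else 1)"
    if "(x, 0) \<notin> T" for x
  proof -
    have "\<sigma> (x, 0) = (\<Prod>k<N. (\<lambda>k. if fst (f k) \<le> x then -1 else 1) k
        * (\<lambda>k. if fst (f k) \<le> x then -1 else 1) (Suc k))"
      unfolding \<sigma>_def
    proof (rule prod.cong)
      fix k assume "k \<in> {..<N}"
      then show "crossing (x, 0) (f k) (f (Suc k)) = (\<lambda>k. if fst (f k) \<le> x then -1 else 1) k
        * (\<lambda>k. if fst (f k) \<le> x then -1 else 1) (Suc k)"
        using crossing_bottom[OF step(1), of k x] step(2,3)[of k] that by fastforce
    qed simp
    also have "\<dots> = (if fst (f 0) \<le> x then -1 else 1) * (if fst (f N) \<le> x then -1 else 1)"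
      by (subst prod_telescope_sign) auto
    finally show ?thesis by (simp add: f)
  qed
  show ?thesis
    by (rule that[of \<sigma>]) (use pm arc bd bt in \<open>auto simp: cell_adj_def\<close>)
qed

lemma prod_telescope_int:
  fixes c :: "int \<Rightarrow> int"
  assumes "\<And>k. c k \<in> {1, -1}" "a \<le> b + 1"
  shows "(\<Prod>y\<in>{a..b}. c (y - 1) * c y) = c (a - 1) * c b"
proof -
  have "(\<Prod>y\<in>{a..a + int k - 1}. c (y - 1) * c y) = c (a - 1) * c (a + int k - 1)" for k
  proof (induction k)
    case 0
    then show ?case using assms(1)[of "a - 1"] by auto
  next
    case (Suc k)
    have "{a..a + int (Suc k) - 1} = insert (a + int k) {a..a + int k - 1}" by auto
    then show ?case using Suc assms(1)[of "a + int k - 1"] by auto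
  qed
  from this[of "nat (b + 1 - a)"] show ?thesis using assms(2) by simp
qed

text \<open>A union of closed walks inside a finite set of cells: the factors \<open>f y = -1\<close> mark bottom
  edges, evenly many on each component, and are joined in pairs by walks.\<close>

lemma sign_extension:
  assumes T: "\<And>w. w \<in> T \<Longrightarrow> snd w < n \<and> \<bar>fst w\<bar> < W"
    and "\<And>y. f y \<in> {1, -1 :: int}"
    and "\<And>y. f y \<noteq> 1 \<Longrightarrow> ((y - 1, 0) \<in> T) \<noteq> ((y, 0) \<in> T)"
    and "\<And>u. u \<in> T \<Longrightarrow> snd u = 0 \<Longrightarrow>
       (\<Prod>y\<in>{-W..W}. if ((y - 1, 0) \<in> comp_of n T u) \<noteq> ((y, 0) \<in> comp_of n T u) then f y else 1) = 1"
  shows "\<exists>\<sigma> :: cell \<Rightarrow> int. (\<forall>w. \<sigma> w \<in> {1, -1})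
    \<and> (\<forall>w w'. cell_adj n w w' \<longrightarrow> w \<notin> T \<longrightarrow> w' \<notin> T \<longrightarrow> \<sigma> w = \<sigma> w')
    \<and> (\<forall>w. snd w = n \<or> W \<le> \<bar>fst w\<bar> \<longrightarrow> \<sigma> w = 1)
    \<and> (\<forall>x. (x, 0) \<notin> T \<longrightarrow> \<sigma> (x, 0) = (\<Prod>y\<in>{-W..x}. f y))"
  using assms(2-4)
proof (induction "card {y. f y \<noteq> 1}" arbitrary: f rule: less_induct)
  case (less f)
  have rng: "-W < y \<and> y \<le> W" if "f y \<noteq> 1" for y
    using less.prems(2)[OF that] T[of "(y - 1, 0)"] T[of "(y, 0)"] by auto
  have fin: "finite {y. f y \<noteq> 1}"
    by (rule finite_subset[of _ "{-W..W}"]) (use rng in force)+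
  show ?case
  proof (cases "{y. f y \<noteq> 1} = {}")
    case True
    then have "f y = 1" for y by auto
    then show ?thesis by (intro exI[of _ "\<lambda>_. 1"]) auto
  next
    case False
    then obtain y where y: "f y \<noteq> 1" by auto
    \<comment> \<open>The end of bottom edge \<open>y\<close> inside \<open>T\<close>. For a marked
      edge exactly one end is inside, so a marked edge belongs to exactly one component.\<close>
    define t where "t y = (if (y, 0) \<in> T then (y, 0) else (y - 1, 0 :: nat))" for y
    have tT: "t y \<in> T" "snd (t y) = 0" if "f y \<noteq> 1" for y
      using less.prems(2)[OF that] by (auto simp: t_def)
    have fm: "f y = -1" if "f y \<noteq> 1" for y using less.prems(1)[of y] that by auto
    define V where "V = comp_of n T (t y)"
    define E where "E V y \<longleftrightarrow> ((y - 1, 0) \<in> V) \<noteq> ((y, 0) \<in> V)" for V :: "cell set" and y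
    have Ecomp: "E (comp_of n T u) z \<longleftrightarrow> t z \<in> comp_of n T u" if "f z \<noteq> 1" "u \<in> T" for z u
      using less.prems(2)[OF that(1)] comp_of_subset[OF that(2), of n]
      unfolding E_def t_def by auto
    have EV: "E V y" using Ecomp[OF y tT(1)[OF y]] by (simp add: V_def)
    have yW: "y \<in> {-W..W}" using rng[OF y] by auto
    \<comment> \<open>The marks on one component multiply to 1, so no component carries a single
      mark.\<close>
    have "\<exists>y'. y' \<noteq> y \<and> f y' \<noteq> 1 \<and> E V y'"
    proof (rule ccontr)
      assume *: "\<not> ?thesis"
      have "(\<Prod>z\<in>{-W..W}. if E V z then f z else 1) = (\<Prod>z\<in>{-W..W}. if z = y then f y else 1)"
        by (rule prod.cong) (use * EV in auto)
      also have "\<dots> = f y" using yW by simp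
      finally show False
        using less.prems(3)[OF tT[OF y]] y unfolding V_def E_def by simp
    qed
    then obtain y' where y': "y' \<noteq> y" "f y' \<noteq> 1" "E V y'" by auto
    have y'W: "y' \<in> {-W..W}" using rng[OF y'(2)] by auto
    have ty': "t y' \<in> comp_of n T (t y)"
      using Ecomp[OF y'(2) tT(1)[OF y]] y'(3) by (simp add: V_def)
    obtain \<tau> :: "cell \<Rightarrow> int" where \<tau>: "\<And>w. \<tau> w \<in> {1, -1}"
      "\<And>w w'. cell_adj n w w' \<Longrightarrow> w \<notin> T \<Longrightarrow> w' \<notin> T \<Longrightarrow> \<tau> w = \<tau> w'"
      "\<And>w. snd w = n \<or> W \<le> \<bar>fst w\<bar> \<Longrightarrow> \<tau> w = 1"
      "\<And>x. (x, 0) \<notin> T \<Longrightarrow>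
        \<tau> (x, 0) = (if fst (t y) \<le> x then -1 else 1) * (if fst (t y') \<le> x then -1 else 1)"
      using walk_sign[OF ty' tT(2)[OF y] tT(2)[OF y'(2)] tT(1)[OF y] T] by blast
    \<comment> \<open>The two marks are erased, and the sign function of the walk joining them is
      multiplied to the one from the induction hypothesis.\<close>
    define g where "g = f(y := 1, y' := 1)"
    have sub: "{z. g z \<noteq> 1} \<subset> {z. f z \<noteq> 1}"
      using y by (auto simp: g_def)
    have gf: "(\<Prod>z\<in>A. if P z then f z else 1)
        = (\<Prod>z\<in>A. if P z then g z else 1) * (if y \<in> A \<and> P y then -1 else 1) * (if y' \<in> A \<and> P y' then -1 else 1)"
      if "finite A" for A and P :: "int \<Rightarrow> bool"
    proof -
      have "(\<Prod>z\<in>A. if P z then f z else 1) = (\<Prod>z\<in>A. (if P z then g z else 1)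
          * (if z = y then if P y then -1 else 1 else 1) * (if z = y' then if P y' then -1 else 1 else 1))"
        by (rule prod.cong) (use fm[OF y] fm[OF y'(2)] y'(1) in \<open>auto simp: g_def\<close>)
      also have "\<dots> = (\<Prod>z\<in>A. if P z then g z else 1) * (if y \<in> A \<and> P y then -1 else 1) * (if y' \<in> A \<and> P y' then -1 else 1)"
        using that by (auto simp: prod.distrib)
      finally show ?thesis .
    qed
    have "\<exists>\<sigma> :: cell \<Rightarrow> int. (\<forall>w. \<sigma> w \<in> {1, -1})
      \<and> (\<forall>w w'. cell_adj n w w' \<longrightarrow> w \<notin> T \<longrightarrow> w' \<notin> T \<longrightarrow> \<sigma> w = \<sigma> w')
      \<and> (\<forall>w. snd w = n \<or> W \<le> \<bar>fst w\<bar> \<longrightarrow> \<sigma> w = 1)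
      \<and> (\<forall>x. (x, 0) \<notin> T \<longrightarrow> \<sigma> (x, 0) = (\<Prod>y\<in>{-W..x}. g y))"
    proof (rule less.hyps)
      show "card {z. g z \<noteq> 1} < card {z. f z \<noteq> 1}" by (rule psubset_card_mono[OF fin sub])
      show "g z \<in> {1, -1}" for z using less.prems(1)[of z] by (auto simp: g_def)
      show "((z - 1, 0) \<in> T) \<noteq> ((z, 0) \<in> T)" if "g z \<noteq> 1" for z
        using that sub less.prems(2)[of z] by blast
      fix u :: cell assume u: "u \<in> T" "snd u = 0"
      have "E (comp_of n T u) y \<longleftrightarrow> E (comp_of n T u) y'"
        using Ecomp[OF y u(1)] Ecomp[OF y'(2) u(1)] ty' comp_of_eq[of "t y" n T u]
          comp_of_eq[of "t y'" n T u] comp_of_eq[OF ty'] comp_of_self by metis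
      then show "(\<Prod>z\<in>{-W..W}. if ((z - 1, 0) \<in> comp_of n T u) \<noteq> ((z, 0) \<in> comp_of n T u) then g z else 1) = 1"
        using gf[of "{-W..W}" "E (comp_of n T u)"] less.prems(3)[OF u] yW y'W
        unfolding E_def by (auto split: if_splits)
    qed
    then obtain \<sigma> where \<sigma>: "\<And>w. \<sigma> w \<in> {1, -1 :: int}"
      "\<And>w w'. cell_adj n w w' \<Longrightarrow> w \<notin> T \<Longrightarrow> w' \<notin> T \<Longrightarrow> \<sigma> w = \<sigma> w'"
      "\<And>w. snd w = n \<or> W \<le> \<bar>fst w\<bar> \<Longrightarrow> \<sigma> w = 1"
      "\<And>x. (x, 0) \<notin> T \<Longrightarrow> \<sigma> (x, 0) = (\<Prod>y\<in>{-W..x}. g y)"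
      by metis
    have tle: "fst (t z) \<le> x \<longleftrightarrow> z \<le> x" if "(x, 0) \<notin> T" "f z \<noteq> 1" for x z
      using that less.prems(2)[OF that(2)] by (auto simp: t_def) (metis add1_zle_eq diff_add_cancel order_le_less zle_diff1_eq)
    show ?thesis
    proof (intro exI[of _ "\<lambda>w. \<sigma> w * \<tau> w"] conjI allI impI)
      show "\<sigma> w * \<tau> w \<in> {1, -1}" for w using \<sigma>(1)[of w] \<tau>(1)[of w] by auto
      show "\<sigma> w * \<tau> w = \<sigma> w' * \<tau> w'" if "cell_adj n w w'" "w \<notin> T" "w' \<notin> T" for w w'
        using \<sigma>(2)[OF that] \<tau>(2)[OF that] by simp
      show "\<sigma> w * \<tau> w = 1" if "snd w = n \<or> W \<le> \<bar>fst w\<bar>" for w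
        using \<sigma>(3)[OF that] \<tau>(3)[OF that] by simp
      show "\<sigma> (x, 0) * \<tau> (x, 0) = (\<Prod>y\<in>{-W..x}. f y)" if "(x, 0) \<notin> T" for x
        using gf[of "{-W..x}" "\<lambda>_. True"] \<sigma>(4)[OF that] \<tau>(4)[OF that] tle[OF that y] tle[OF that y'(2)]
          yW y'W by auto
    qed
  qed
qed

text \<open>Each triangle of pairwise adjacent cells has an even number of edges between \<open>V\<close> and its
  complement, so these edges form chains joining the bottom edges in pairs.\<close>

lemma triangle_parity:
  fixes \<sigma> :: "cell \<Rightarrow> int"
  assumes V: "\<And>w. w \<in> V \<Longrightarrow> snd w < n \<and> \<bar>fst w\<bar> < W" and pm: "\<And>w. \<sigma> w \<in> {1, -1}"
    and loc: "\<And>v w w'. v \<in> V \<Longrightarrow> w \<notin> V \<Longrightarrow> w' \<notin> V \<Longrightarrow> cell_adj n v w \<Longrightarrow> cell_adj n v w' \<Longrightarrow>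
      cell_adj n w w' \<Longrightarrow> \<sigma> w = \<sigma> w'"
  shows "(\<Prod>y\<in>{-W..W}. if (y - 1, 0) \<in> V \<and> (y, 0) \<notin> V then \<sigma> (y, 0)
      else if (y - 1, 0) \<notin> V \<and> (y, 0) \<in> V then \<sigma> (y - 1, 0) else 1) = 1"
proof -
  \<comment> \<open>An edge leaving \<open>V\<close> takes the sign of its outer end. Of the edges
    of a triangle none or two leave \<open>V\<close>, and in the second case the outer ends carry
    equal signs, so the product over a triangle is 1.\<close>
  define e where "e u v = (if u \<in> V \<and> v \<notin> V then \<sigma> v else if u \<notin> V \<and> v \<in> V then \<sigma> u else 1)" for u v
  define H where "H r = (\<Prod>y\<in>{-W..W}. e (y - 1, r) (y, r))" for r
  have far: "(x, r) \<notin> V" if "W \<le> \<bar>x\<bar>" for x r using V[of "(x, r)"] that by auto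
  have tri: "e u v = e u w * e v w" if "cell_adj n u v" "cell_adj n u w" "cell_adj n v w" for u v w
    using loc[of u v w] loc[of v u w] loc[of w u v] that cell_adj_sym[OF that(1)] cell_adj_sym[OF that(2)]
      cell_adj_sym[OF that(3)] pm[of u] pm[of v] pm[of w]
    unfolding e_def by auto
  \<comment> \<open>Rows \<open>r\<close> and \<open>r + 1\<close> bound a band of triangles. The
    triangles along either row express its product through the same vertical and diagonal edges
    inside the band.\<close>
  have HS: "H r = H (Suc r)" if r: "r < n" for r
  proof -
    have lo: "e (y - 1, r) (y, r) = e (y - 1, r) (y, Suc r) * e (y, r) (y, Suc r)" for y
      by (rule tri) (use r in \<open>auto simp: cell_adj_def arc_def\<close>)
    have up: "e (y - 1, Suc r) (y, Suc r) = e (y - 1, Suc r) (y - 1, r) * e (y, Suc r) (y - 1, r)" for y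
      by (rule tri) (use r in \<open>auto simp: cell_adj_def arc_def\<close>)
    have sym: "e u v = e v u" for u v by (auto simp: e_def)
    have shift: "(\<Prod>y\<in>{-W..W}. e (y - 1, Suc r) (y - 1, r)) = (\<Prod>y\<in>{-W..W}. e (y, Suc r) (y, r))"
    proof (cases "W \<ge> 0")
      case True
      have "(\<Prod>y\<in>{-W..W}. e (y - 1, Suc r) (y - 1, r)) = (\<Prod>y\<in>{-W - 1..W - 1}. e (y, Suc r) (y, r))"
        by (rule prod.reindex_bij_witness[of _ "\<lambda>y. y + 1" "\<lambda>y. y - 1"]) auto
      also have "\<dots> = (\<Prod>y\<in>{-W..W-1}. e (y, Suc r) (y, r))"
        by (rule prod.mono_neutral_right) (auto simp: e_def far)
      also have "\<dots> = (\<Prod>y\<in>{-W..W}. e (y, Suc r) (y, r))"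
        by (rule prod.mono_neutral_left) (auto simp: e_def far)
      finally show ?thesis .
    qed auto
    show ?thesis
      unfolding H_def lo up prod.distrib shift by (simp add: sym mult.commute)
  qed
  have "H r = H 0" if "r \<le> n" for r using that by (induction r) (use HS in auto)
  from this[of n] have "H 0 = H n" by simp
  moreover have "H n = 1" unfolding H_def by (rule prod.neutral) (use V in \<open>fastforce simp: e_def\<close>)
  ultimately show ?thesis by (simp add: H_def e_def)
qed

section \<open>Pairs of height functions\<close>

text \<open>In a configuration \<open>(b, a)\<close> the heights of a cell are the numbers of upper paths and of dual lower
  paths to its right.\<close>

type_synonym conf = "(cell \<Rightarrow> int) \<times> (cell \<Rightarrow> int)"

text \<open>Within a row the condition says that the points counted are distinct, between two rows
  that going up they stay or move one column to the right. So these are families of nonintersecting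
  paths. Above row \<open>n\<close> a default value makes the function unique.\<close>

definition hfun :: "nat \<Rightarrow> (int \<Rightarrow> int) \<Rightarrow> (cell \<Rightarrow> int) \<Rightarrow> bool" where
  "hfun n t b \<longleftrightarrow> (\<forall>u v. arc n u v \<longrightarrow> b u - b v \<in> {0, 1}) \<and> (\<forall>x. b (x, n) = t x)
     \<and> (\<forall>x r. n < r \<longrightarrow> b (x, r) = 0)"

definition depth :: "conf \<Rightarrow> cell \<Rightarrow> int" where
  "depth c u = fst c u - snd c u"

definition tot :: "conf \<Rightarrow> cell \<Rightarrow> int" where
  "tot c u = fst c u + snd c u"

definition sg :: "int \<Rightarrow> int" where
  "sg y = (if even y then 1 else -1)"

definition reflect :: "int \<Rightarrow> cell set \<Rightarrow> conf \<Rightarrow> conf" where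
  "reflect m R c = (\<lambda>u. if u \<in> R then snd c u + m else fst c u, \<lambda>u. if u \<in> R then fst c u - m else snd c u)"

lemma sg_cases: "sg y = 1 \<or> sg y = -1"
  by (simp add: sg_def)

lemma sg_add: "sg (x + y) = sg x * sg y"
  by (auto simp: sg_def)

lemma tot_reflect [simp]: "tot (reflect m R c) = tot c"
  by (auto simp: tot_def reflect_def fun_eq_iff)

lemma depth_reflect: "depth (reflect m R c) u = (if u \<in> R then 2 * m - depth c u else depth c u)"
  by (simp add: depth_def reflect_def)

lemma reflect_reflect [simp]: "reflect m R (reflect m R c) = c"
  by (cases c) (auto simp: reflect_def fun_eq_iff)

lemma hfunD: "hfun n t b \<Longrightarrow> arc n u v \<Longrightarrow> b u - b v = 0 \<or> b u - b v = 1"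
  unfolding hfun_def by blast

text \<open>Down a column the height can only drop, down a diagonal it can only grow. So the top row
  bounds each row from both sides.\<close>

lemma hfun_range:
  assumes "hfun n t b" "r \<le> n"
  shows "b (x, r) \<le> t x" "t (x + int (n - r)) \<le> b (x, r)"
proof -
  have "\<forall>x. b (x, r) \<le> t x \<and> t (x + int (n - r)) \<le> b (x, r)"
    using \<open>r \<le> n\<close>
  proof (induction rule: inc_induct)
    case base
    then show ?case using assms(1) by (simp add: hfun_def)
  next
    case (step r)
    show ?case
    proof
      fix x
      have "b (x, r) \<le> b (x, Suc r)"
        using hfunD[OF assms(1), of "(x, Suc r)" "(x, r)"] step(2) by (auto simp: arc_def)
      moreover have "b (x + 1, Suc r) \<le> b (x, r)"
        using hfunD[OF assms(1), of "(x, r)" "(x + 1, Suc r)"] step(2) by (auto simp: arc_def)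
      moreover have "x + 1 + int (n - Suc r) = x + int (n - r)" using step(2) by simp
      ultimately show "b (x, r) \<le> t x \<and> t (x + int (n - r)) \<le> b (x, r)"
        using step(3)[THEN spec, of x] step(3)[THEN spec, of "x + 1"] by simp
    qed
  qed
  then show "b (x, r) \<le> t x" "t (x + int (n - r)) \<le> b (x, r)" by auto
qed

text \<open>Near and beyond the columns \<open>-W\<close> and \<open>W\<close> both heights are
  constant. On the left the margin contains \<open>n\<close> more columns, because a path may drift
  by one column per row. \<open>top_depth\<close> is what remains of the positivity condition: it
  keeps the cells of depth at least 2 away from the top row.\<close>

locale strip =
  fixes n :: nat and l W :: int and tb ta :: "int \<Rightarrow> int"
  assumes n_pos: "0 < n" and W_ge: "3 \<le> W"
    and tb_right: "\<And>x. W - 2 \<le> x \<Longrightarrow> tb x = 0" and ta_right: "\<And>x. W - 2 \<le> x \<Longrightarrow> ta x = 0"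
    and tb_left: "\<And>x. x \<le> 2 - W + int n \<Longrightarrow> tb x = l" and ta_left: "\<And>x. x \<le> 2 - W + int n \<Longrightarrow> ta x = l"
    and top_depth: "\<And>x. tb x - ta x \<le> 1"
begin

definition Conf :: "conf set" where
  "Conf = {c. hfun n tb (fst c) \<and> hfun n ta (snd c)}"

text \<open>At the bottom row, \<open>Qf c x\<close> counts the path ends to the right of \<open>x\<close>, each with the parity of its
  position as a sign.  Where the depth is odd, \<open>kap c x\<close> is the colour of \<open>x\<close>.  For a component \<open>V\<close>
  of nonpositive depth in the configuration of a tableau, \<open>th c V\<close> is \<open>-1\<close> to the number of even
  holes that meet \<open>V\<close>.\<close>

definition Qf :: "conf \<Rightarrow> int \<Rightarrow> int" where
  "Qf c x = (\<Sum>y\<in>{x + 1..W}. (tot c (y - 1, 0) - tot c (y, 0)) * sg y)"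

definition kap :: "conf \<Rightarrow> int \<Rightarrow> int" where
  "kap c x = Qf c x * sg (fst c (x, 0))"

definition Qbd :: "conf \<Rightarrow> bool" where
  "Qbd c \<longleftrightarrow> (\<forall>x. \<bar>Qf c x\<bar> \<le> 1)"

definition th :: "conf \<Rightarrow> cell set \<Rightarrow> int" where
  "th c V = (\<Prod>y\<in>{-W..W}. if (y - 1, 0) \<in> V \<and> (y, 0) \<notin> V then kap c y
      else if (y - 1, 0) \<notin> V \<and> (y, 0) \<in> V then kap c (y - 1) else 1)"

definition bdry :: "cell set \<Rightarrow> bool" where
  "bdry V \<longleftrightarrow> (\<exists>u\<in>V. snd u = n \<or> W \<le> \<bar>fst u\<bar>)"

text \<open>Genuine colours exist only at odd depth. The extension \<open>\<kappa>\<close> carries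
  them through the even depths, and the set \<open>A\<close> lists the depths at which a new sign
  may be chosen.\<close>

definition kapcond :: "int set \<Rightarrow> conf \<Rightarrow> bool" where
  "kapcond A c \<longleftrightarrow> (\<exists>\<kappa>. (\<forall>x. \<kappa> x \<in> {1, -1}) \<and> (\<forall>x. odd (depth c (x, 0)) \<longrightarrow> \<kappa> x = kap c x)
     \<and> (\<forall>x. depth c (x - 1, 0) \<notin> A \<and> depth c (x, 0) \<notin> A \<longrightarrow> \<kappa> (x - 1) = \<kappa> x))"

definition even_low :: "conf \<Rightarrow> bool" where
  "even_low c \<longleftrightarrow> (\<forall>x. depth c (x, 0) \<le> 0 \<longrightarrow> \<not> bdry (comp_of n {u. depth c u \<le> 0} (x, 0)) \<longrightarrow>
      th c (comp_of n {u. depth c u \<le> 0} (x, 0)) = 1)"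

definition even_high :: "int \<Rightarrow> conf \<Rightarrow> bool" where
  "even_high N c \<longleftrightarrow> (\<forall>x. N \<le> depth c (x, 0) \<longrightarrow> th c (comp_of n {u. N \<le> depth c u} (x, 0)) = 1)"

text \<open>These sets interpolate between the determinant and the tableaux: \<open>Zc 2\<close> is
  what survives the cancellation in the determinant, and for large \<open>N\<close> the conditions
  that mention \<open>N\<close> hold by themselves.\<close>

definition Zc :: "int \<Rightarrow> conf set" where
  "Zc N = {c \<in> Conf. Qbd c \<and> (\<forall>x. 0 \<le> depth c (x, 0) \<and> depth c (x, 0) \<le> N) \<and> kapcond {0, N} c
     \<and> even_low c \<and> even_high N c}"

lemma Conf_far:
  assumes "c \<in> Conf" "r \<le> n"
  shows "W - 2 \<le> x \<Longrightarrow> fst c (x, r) = 0" "W - 2 \<le> x \<Longrightarrow> snd c (x, r) = 0"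
    "x \<le> 2 - W \<Longrightarrow> fst c (x, r) = l" "x \<le> 2 - W \<Longrightarrow> snd c (x, r) = l"
proof -
  have h: "hfun n tb (fst c)" "hfun n ta (snd c)" using assms by (auto simp: Conf_def)
  note hr = hfun_range[OF h(1) assms(2)] hfun_range[OF h(2) assms(2)]
  show "W - 2 \<le> x \<Longrightarrow> fst c (x, r) = 0" "W - 2 \<le> x \<Longrightarrow> snd c (x, r) = 0"
    using hr[of x] tb_right[of x] tb_right[of "x + int (n - r)"] ta_right[of x] ta_right[of "x + int (n - r)"] by auto
  show "x \<le> 2 - W \<Longrightarrow> fst c (x, r) = l" "x \<le> 2 - W \<Longrightarrow> snd c (x, r) = l"
    using hr[of x] tb_left[of x] tb_left[of "x + int (n - r)"] ta_left[of x] ta_left[of "x + int (n - r)"] by auto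
qed

lemma depth_outside: "c \<in> Conf \<Longrightarrow> n < r \<Longrightarrow> depth c (x, r) = 0"
  by (simp add: Conf_def hfun_def depth_def)

lemma depth_far: "c \<in> Conf \<Longrightarrow> W - 2 \<le> \<bar>fst u\<bar> \<Longrightarrow> depth c u = 0"
proof (cases "snd u \<le> n")
  case True
  assume "c \<in> Conf" "W - 2 \<le> \<bar>fst u\<bar>"
  then show ?thesis
    using Conf_far[of c "snd u" "fst u"] True by (cases u) (auto simp: depth_def abs_if split: if_splits)
next
  case False
  assume "c \<in> Conf"
  then show ?thesis using depth_outside[of c "snd u" "fst u"] False by simp
qed

lemma depth_top: "c \<in> Conf \<Longrightarrow> snd u = n \<Longrightarrow> depth c u \<le> 1"
  using top_depth[of "fst u"] by (cases u) (simp add: depth_def Conf_def hfun_def)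

lemma depth_ge2:
  assumes "c \<in> Conf" "2 \<le> depth c u"
  shows "snd u < n" "\<bar>fst u\<bar> < W - 2"
proof -
  show "snd u < n"
  proof (rule ccontr)
    assume "\<not> snd u < n"
    then consider "snd u = n" | "n < snd u" by linarith
    then show False
      using depth_top[OF assms(1), of u] depth_outside[OF assms(1), of "snd u" "fst u"] assms(2) by cases simp_all
  qed
  show "\<bar>fst u\<bar> < W - 2"
    using depth_far[OF assms(1), of u] assms(2) by linarith
qed

lemma depth_adj:
  assumes "c \<in> Conf" "cell_adj n u v"
  shows "depth c u - depth c v \<in> {-1, 0, 1}"
proof -
  have *: "depth c u - depth c v \<in> {-1, 0, 1}" if "arc n u v" for u v
    using that hfunD[of n tb "fst c" u v] hfunD[of n ta "snd c" u v] assms(1)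
    unfolding Conf_def depth_def by auto
  from assms(2) consider "arc n u v" | "arc n v u" by (auto simp: cell_adj_def)
  then show ?thesis by cases (use *[of u v] *[of v u] in auto)
qed

lemma depth_bottom_adj: "c \<in> Conf \<Longrightarrow> \<bar>depth c (x - 1, 0) - depth c (x, 0)\<bar> \<le> 1"
  using depth_adj[OF _ cell_adj_bottom(2), of c x] by auto

text \<open>A height function is determined by its values in the window, and these are bounded by
  the top row.\<close>

lemma finite_Conf: "finite Conf"
proof -
  have fin: "finite {b. hfun n t b}"
    if t: "\<And>x. W - 2 \<le> x \<Longrightarrow> t x = 0" "\<And>x. x \<le> 2 - W + int n \<Longrightarrow> t x = l" for t
  proof -
    let ?A = "{-W..W} \<times> {0..n}"
    have inj: "inj_on (\<lambda>b. restrict b ?A) {b. hfun n t b}"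
    proof (rule inj_onI, rule ext)
      fix b b' :: "cell \<Rightarrow> int" and u :: cell
      assume b: "b \<in> {b. hfun n t b}" "b' \<in> {b. hfun n t b}" and eq: "restrict b ?A = restrict b' ?A"
      obtain x r where u: "u = (x, r)" by (cases u)
      show "b u = b' u"
      proof (cases "r \<le> n")
        case True
        have h: "hfun n t b" "hfun n t b'" using b by auto
        show ?thesis
        proof (cases "u \<in> ?A")
          case True
          then show ?thesis using fun_cong[OF eq, of u] by simp
        next
          case False
          then have "x \<le> 2 - W \<or> W - 2 \<le> x" using u True by auto
          then show ?thesis
            using hfun_range[OF h(1) True, of x] hfun_range[OF h(2) True, of x] t(1)[of x] t(1)[of "x + int (n - r)"]
              t(2)[of x] t(2)[of "x + int (n - r)"] u by auto
        qed
      next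
        case False
        then show ?thesis using b u by (auto simp: hfun_def)
      qed
    qed
    have sub: "(\<lambda>b. restrict b ?A) ` {b. hfun n t b} \<subseteq> (\<Pi>\<^sub>E u\<in>?A. {t (fst u + int (n - snd u))..t (fst u)})"
    proof (rule image_subsetI)
      fix b assume "b \<in> {b. hfun n t b}"
      then show "restrict b ?A \<in> (\<Pi>\<^sub>E u\<in>?A. {t (fst u + int (n - snd u))..t (fst u)})"
        unfolding restrict_PiE_iff using hfun_range[of n t b] by auto
    qed
    have "finite (\<Pi>\<^sub>E u\<in>?A. {t (fst u + int (n - snd u))..t (fst u)})"
      by (intro finite_PiE) auto
    then show ?thesis using finite_imageD[OF finite_subset[OF sub] inj] by simp
  qed
  have "finite ({b. hfun n tb b} \<times> {a. hfun n ta a})"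
    by (intro finite_cartesian_product fin tb_right tb_left ta_right ta_left)
  then show ?thesis by (rule finite_subset[rotated]) (auto simp: Conf_def)
qed

text \<open>At a cell of depth \<open>m\<close> outside \<open>R\<close> the pair
  \<open>(a + m, b - m)\<close> coincides with \<open>(b, a)\<close>. On an arc across the border
  the new pair is therefore the exchanged one at both ends, and it drops by 0 or 1 as well.\<close>

lemma reflect_Conf:
  assumes c: "c \<in> Conf" and R: "\<And>u. u \<in> R \<Longrightarrow> snd u < n"
    and edge: "\<And>u v. u \<in> R \<Longrightarrow> v \<notin> R \<Longrightarrow> cell_adj n u v \<Longrightarrow> depth c v = m"
  shows "reflect m R c \<in> Conf"
proof -
  have h: "hfun n tb (fst c)" "hfun n ta (snd c)" using c by (auto simp: Conf_def)
  have "fst (reflect m R c) u - fst (reflect m R c) v \<in> {0, 1}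
      \<and> snd (reflect m R c) u - snd (reflect m R c) v \<in> {0, 1}" if a: "arc n u v" for u v
    using hfunD[OF h(1) a] hfunD[OF h(2) a] edge[of u v] edge[of v u] a
    by (auto simp: reflect_def depth_def cell_adj_def)
  moreover have "fst (reflect m R c) u = fst c u \<and> snd (reflect m R c) u = snd c u" if "n \<le> snd u" for u
    using R[of u] that by (auto simp: reflect_def)
  ultimately show ?thesis using h unfolding Conf_def hfun_def by auto
qed

lemma tot_far: "c \<in> Conf \<Longrightarrow> W - 2 \<le> x \<Longrightarrow> tot c (x, 0) = 0"
  using Conf_far[of c 0 x] by (simp add: tot_def)

lemma Qf_step:
  assumes "c \<in> Conf"
  shows "Qf c (x - 1) = Qf c x + (tot c (x - 1, 0) - tot c (x, 0)) * sg x"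
proof (cases "x \<le> W")
  case True
  then have "{x - 1 + 1..W} = insert x {x + 1..W}" by auto
  then show ?thesis by (simp add: Qf_def)
next
  case False
  then show ?thesis using tot_far[OF assms, of x] tot_far[OF assms, of "x - 1"] by (simp add: Qf_def)
qed

lemma Qf_right: "W \<le> x \<Longrightarrow> Qf c x = 0"
  by (simp add: Qf_def)

lemma bottom_induct [case_names right step]:
  assumes "\<And>x. W \<le> x \<Longrightarrow> P x" "\<And>x. P x \<Longrightarrow> P (x - 1)"
  shows "P (x :: int)"
proof (cases "W \<le> x")
  case False
  then have "x \<le> W" by simp
  then show ?thesis by (induction rule: int_le_induct) (use assms in auto)
qed (use assms in auto)

text \<open>Modulo 2 the signs in \<open>Qf\<close> do not matter, and both numbers count the path
  ends of both kinds to the right of \<open>x\<close>.\<close>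

lemma Qf_parity:
  assumes "c \<in> Conf"
  shows "even (Qf c x - depth c (x, 0))"
proof (induction x rule: bottom_induct)
  case (right x)
  then show ?case using depth_far[OF assms, of "(x, 0)"] W_ge by (simp add: Qf_right)
next
  case (step x)
  have "odd (sg x)" by (auto simp: sg_def)
  then have "even ((tot c (x - 1, 0) - tot c (x, 0)) * sg x) = even (depth c (x - 1, 0) - depth c (x, 0))"
    by (auto simp: tot_def depth_def)
  moreover have "Qf c x + (tot c (x - 1, 0) - tot c (x, 0)) * sg x - depth c (x - 1, 0)
      = (Qf c x - depth c (x, 0)) + (tot c (x - 1, 0) - tot c (x, 0)) * sg x - (depth c (x - 1, 0) - depth c (x, 0))"
    by simp
  ultimately show ?case using step unfolding Qf_step[OF assms]
    by (metis dvd_diff even_add even_diff)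
qed

lemma Qf_tot: "tot c = tot c' \<Longrightarrow> Qf c = Qf c'"
  by (simp add: Qf_def fun_eq_iff)

lemma Qf_reflect [simp]: "Qf (reflect m R c) = Qf c"
  by (rule Qf_tot) simp

lemma Qbd_reflect [simp]: "Qbd (reflect m R c) = Qbd c"
  by (simp add: Qbd_def)

lemma kap_sign:
  assumes "c \<in> Conf" "Qbd c" "odd (depth c (x, 0))"
  shows "kap c x \<in> {1, -1}"
proof -
  have "odd (Qf c x)" using Qf_parity[OF assms(1), of x] assms(3) by presburger
  moreover have "\<bar>Qf c x\<bar> \<le> 1" using assms(2) by (simp add: Qbd_def)
  ultimately have "Qf c x = 1 \<or> Qf c x = -1" by presburger
  then show ?thesis using sg_cases[of "fst c (x, 0)"] by (auto simp: kap_def)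
qed

text \<open>If both heights drop at \<open>x\<close>, then \<open>Qf\<close> changes by 2 and hence,
  being odd and bounded by 1, changes its sign; the parity of the first height changes at the same
  time.\<close>

lemma kap_adj:
  assumes "c \<in> Conf" "Qbd c" "odd (depth c (x, 0))" "depth c (x - 1, 0) = depth c (x, 0)"
  shows "kap c (x - 1) = kap c x"
proof -
  have a: "arc n (x - 1, 0) (x, 0)" by (simp add: arc_def)
  have b: "fst c (x - 1, 0) - fst c (x, 0) = 0 \<or> fst c (x - 1, 0) - fst c (x, 0) = 1"
    using hfunD[OF _ a, of tb "fst c"] assms(1) by (auto simp: Conf_def)
  show ?thesis
  proof (cases "fst c (x - 1, 0) = fst c (x, 0)")
    case True
    then have "tot c (x - 1, 0) = tot c (x, 0)" using assms(4) by (simp add: tot_def depth_def)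
    then show ?thesis using True by (simp add: kap_def Qf_step[OF assms(1)])
  next
    case False
    then have f: "fst c (x - 1, 0) = fst c (x, 0) + 1" using b by auto
    then have "tot c (x - 1, 0) = tot c (x, 0) + 2" using assms(4) by (simp add: tot_def depth_def)
    then have q: "Qf c (x - 1) = Qf c x + 2 * sg x" by (simp add: Qf_step[OF assms(1)])
    have "odd (Qf c x)" using Qf_parity[OF assms(1), of x] assms(3) by presburger
    then have "Qf c (x - 1) = - Qf c x"
      using q sg_cases[of x] assms(2)[unfolded Qbd_def, rule_format, of x]
        assms(2)[unfolded Qbd_def, rule_format, of "x - 1"] by presburger
    then show ?thesis using f by (simp add: kap_def sg_add) (simp add: sg_def)
  qed
qed

text \<open>\<open>Qf\<close> depends on the sum of the heights alone, so only the parity factor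
  changes. At odd depth an odd \<open>m\<close> keeps the colour and an even \<open>m\<close>
  reverses it.\<close>

lemma kap_reflect:
  "kap (reflect m R c) x = (if (x, 0) \<in> R then sg (m - depth c (x, 0)) else 1) * kap c x"
proof -
  have "snd c (x, 0) + m = fst c (x, 0) + (m - depth c (x, 0))" by (simp add: depth_def)
  then have "sg (snd c (x, 0) + m) = sg (fst c (x, 0)) * sg (m - depth c (x, 0))"
    by (metis sg_add)
  then show ?thesis unfolding kap_def Qf_reflect by (simp add: reflect_def)
qed

lemma th_cong:
  assumes "\<And>y. (y - 1, 0) \<in> V \<Longrightarrow> (y, 0) \<notin> V \<Longrightarrow> kap c y = kap c' y"
    and "\<And>y. (y - 1, 0) \<notin> V \<Longrightarrow> (y, 0) \<in> V \<Longrightarrow> kap c (y - 1) = kap c' (y - 1)"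
  shows "th c V = th c' V"
  unfolding th_def by (rule prod.cong) (use assms in auto)

lemma prod_sign_pair:
  fixes \<chi> :: "int \<Rightarrow> int"
  assumes "\<And>y. \<chi> y \<in> {1, -1}" "\<And>y. W \<le> \<bar>y\<bar> \<Longrightarrow> \<chi> y = 1"
  shows "(\<Prod>y\<in>{-W..W}. \<chi> (y - 1) * \<chi> y) = 1"
  using prod_telescope_int[of \<chi> "-W" W] assms(1) assms(2)[of "-W - 1"] assms(2)[of W] W_ge by auto

text \<open>A set within the window has an even number of bottom edges, because each run of bottom
  cells has two ends. Reversing the colours at all of them leaves the product unchanged.\<close>

lemma th_even_count:
  assumes "\<And>y. (y - 1, 0) \<in> V \<Longrightarrow> (y, 0) \<notin> V \<Longrightarrow> kap c y = - kap c' y"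
    and "\<And>y. (y - 1, 0) \<notin> V \<Longrightarrow> (y, 0) \<in> V \<Longrightarrow> kap c (y - 1) = - kap c' (y - 1)"
    and "\<And>y. W \<le> \<bar>y\<bar> \<Longrightarrow> (y, 0) \<notin> V"
  shows "th c V = th c' V"
proof -
  let ?\<chi> = "\<lambda>y. if (y, 0) \<in> V then -1 else 1 :: int"
  have "th c V = th c' V * (\<Prod>y\<in>{-W..W}. ?\<chi> (y - 1) * ?\<chi> y)"
    unfolding th_def prod.distrib[symmetric]
  proof (rule prod.cong)
    fix y :: int
    show "(if (y - 1, 0) \<in> V \<and> (y, 0) \<notin> V then kap c y else if (y - 1, 0) \<notin> V \<and> (y, 0) \<in> V then kap c (y - 1) else 1)
      = (if (y - 1, 0) \<in> V \<and> (y, 0) \<notin> V then kap c' y else if (y - 1, 0) \<notin> V \<and> (y, 0) \<in> V then kap c' (y - 1) else 1)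
      * (?\<chi> (y - 1) * ?\<chi> y)"
      using assms(1)[of y] assms(2)[of y]
      by (cases "(y - 1, 0) \<in> V"; cases "(y, 0) \<in> V") simp_all
  qed simp
  also have "(\<Prod>y\<in>{-W..W}. ?\<chi> (y - 1) * ?\<chi> y) = 1"
    by (rule prod_sign_pair) (use assms(3) in auto)
  finally show ?thesis by simp
qed

lemma th_split:
  assumes "V \<subseteq> S" "\<And>u v. u \<in> V \<Longrightarrow> v \<in> S - V \<Longrightarrow> \<not> cell_adj n u v"
  shows "th c S = th c V * th c (S - V)"
  unfolding th_def prod.distrib[symmetric]
proof (rule prod.cong)
  fix y :: int
  have "\<not> ((y - 1, 0) \<in> V \<and> (y, 0) \<in> S - V)" "\<not> ((y, 0) \<in> V \<and> (y - 1, 0) \<in> S - V)"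
    using assms(2) cell_adj_bottom(2)[of n y] cell_adj_sym by blast+
  then show "(if (y - 1, 0) \<in> S \<and> (y, 0) \<notin> S then kap c y else if (y - 1, 0) \<notin> S \<and> (y, 0) \<in> S then kap c (y - 1) else 1)
    = (if (y - 1, 0) \<in> V \<and> (y, 0) \<notin> V then kap c y else if (y - 1, 0) \<notin> V \<and> (y, 0) \<in> V then kap c (y - 1) else 1)
    * (if (y - 1, 0) \<in> S - V \<and> (y, 0) \<notin> S - V then kap c y
       else if (y - 1, 0) \<notin> S - V \<and> (y, 0) \<in> S - V then kap c (y - 1) else 1)"
    using subsetD[OF assms(1), of "(y - 1, 0)"] subsetD[OF assms(1), of "(y, 0)"]
    by (cases "(y - 1, 0) \<in> V"; cases "(y, 0) \<in> V"; cases "(y - 1, 0) \<in> S"; cases "(y, 0) \<in> S") simp_all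
qed simp

lemma comp_split:
  assumes "u \<in> S" "v \<in> comp_of n S u" "w \<in> S - comp_of n S u"
  shows "\<not> cell_adj n v w"
  using comp_of_step[of v n S u w] assms by blast

lemma th_one:
  assumes "\<And>y. (y, 0) \<in> S \<Longrightarrow> th c (comp_of n S (y, 0)) = 1" "\<And>y. (y, 0) \<in> S \<Longrightarrow> \<bar>y\<bar> < W"
  shows "th c S = 1"
  using assms
proof (induction "card {y. (y, 0) \<in> S}" arbitrary: S rule: less_induct)
  case less
  have fin: "finite {y. (y, 0) \<in> S}"
    by (rule finite_subset[of _ "{-W..W}"]) (use less.prems(2) in force)+
  show ?case
  proof (cases "{y. (y, 0) \<in> S} = {}")
    case True
    then show ?thesis unfolding th_def by (intro prod.neutral) auto
  next
    case False
    then obtain y where y: "(y, 0) \<in> S" by auto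
    define V where "V = comp_of n S (y, 0)"
    have VS: "V \<subseteq> S" using comp_of_subset[OF y] by (simp add: V_def)
    have sep: "\<not> cell_adj n u v" if "u \<in> V" "v \<in> S - V" for u v
      using comp_split[OF y] that by (simp add: V_def)
    have "th c (S - V) = 1"
    proof (rule less.hyps)
      have "y \<notin> {z. (z, 0) \<in> S - V}" by (simp add: V_def)
      then have "{z. (z, 0) \<in> S - V} \<subset> {z. (z, 0) \<in> S}" using y by blast
      then show "card {z. (z, 0) \<in> S - V} < card {z. (z, 0) \<in> S}" by (rule psubset_card_mono[OF fin])
      show "\<bar>z\<bar> < W" if "(z, 0) \<in> S - V" for z using that less.prems(2) by auto
      fix z assume z: "(z, 0) \<in> S - V"
      have "comp_of n S (z, 0) = comp_of n (S - V) (z, 0)"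
      proof (rule comp_of_cong)
        fix v w assume v: "v \<in> comp_of n (S - V) (z, 0)" "cell_adj n v w"
        then have "v \<in> S - V" using comp_of_subset[OF z] by auto
        then show "w \<in> S - V \<longleftrightarrow> w \<in> S" using sep[of w v] v(2) cell_adj_sym by blast
      qed (use z in auto)
      then show "th c (comp_of n (S - V) (z, 0)) = 1" using less.prems(1)[of z] z by auto
    qed
    then show ?thesis using th_split[OF VS sep] less.prems(1)[OF y] by (simp add: V_def)
  qed
qed


section \<open>Cancellation by reflection at level 1\<close>

definition Xc :: "conf set" where
  "Xc = {c \<in> Conf. Qbd c \<and> (\<forall>x. 0 \<le> depth c (x, 0) \<and> depth c (x, 0) \<le> 2)}"

definition comp1 :: "conf \<Rightarrow> int \<Rightarrow> cell set" where
  "comp1 c x = comp_of n {u. depth c u \<noteq> 1} (x, 0)"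

definition odd_cells :: "conf \<Rightarrow> int set" where
  "odd_cells c = {x. depth c (x, 0) \<noteq> 1 \<and> \<not> bdry (comp1 c x) \<and> th c (comp1 c x) \<noteq> 1}"

lemma comp1_low:
  assumes "c \<in> Conf" "depth c (x, 0) \<le> 0"
  shows "comp1 c x = comp_of n {u. depth c u \<le> 0} (x, 0)"
  unfolding comp1_def
proof (rule comp_of_cong)
  fix v w assume v: "v \<in> comp_of n {u. depth c u \<le> 0} (x, 0)" "cell_adj n v w"
  then have "depth c v \<le> 0" using comp_of_subset[of "(x, 0)" "{u. depth c u \<le> 0}" n] assms by auto
  then show "w \<in> {u. depth c u \<le> 0} \<longleftrightarrow> w \<in> {u. depth c u \<noteq> 1}"
    using depth_adj[OF assms(1) v(2)] by auto
qed (use assms in auto)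

lemma comp1_high:
  assumes "c \<in> Conf" "2 \<le> depth c (x, 0)"
  shows "comp1 c x = comp_of n {u. 2 \<le> depth c u} (x, 0)"
  unfolding comp1_def
proof (rule comp_of_cong)
  fix v w assume v: "v \<in> comp_of n {u. 2 \<le> depth c u} (x, 0)" "cell_adj n v w"
  then have "2 \<le> depth c v" using comp_of_subset[of "(x, 0)" "{u. 2 \<le> depth c u}" n] assms by auto
  then show "w \<in> {u. 2 \<le> depth c u} \<longleftrightarrow> w \<in> {u. depth c u \<noteq> 1}"
    using depth_adj[OF assms(1) v(2)] by auto
qed (use assms in auto)

lemma comp1_high_inner:
  assumes "c \<in> Conf" "2 \<le> depth c (x, 0)"
  shows "\<not> bdry (comp1 c x)"
proof
  assume "bdry (comp1 c x)"
  then obtain u where u: "u \<in> comp1 c x" "snd u = n \<or> W \<le> \<bar>fst u\<bar>" by (auto simp: bdry_def)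
  then have "2 \<le> depth c u"
    using comp_of_subset[of "(x, 0)" "{u. 2 \<le> depth c u}" n] assms unfolding comp1_high[OF assms] by auto
  then show False using depth_ge2[OF assms(1)] u(2) by fastforce
qed

text \<open>The only depth left besides 0 and 2 is 1, where \<open>kap_adj\<close> gives constancy.
  The colour rule thus holds automatically at the start of the doubling.\<close>

lemma kapcond_2:
  assumes "c \<in> Xc"
  shows "kapcond {0, 2} c"
proof -
  have c: "c \<in> Conf" "Qbd c" using assms by (auto simp: Xc_def)
  have one: "depth c (x, 0) = 1" if "depth c (x, 0) \<notin> {0, 2}" for x
    using assms that unfolding Xc_def by (auto dest: spec[of _ x])
  show ?thesis unfolding kapcond_def
  proof (intro exI[of _ "\<lambda>x. if odd (depth c (x, 0)) then kap c x else 1"] conjI allI impI)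
    show "(if odd (depth c (x, 0)) then kap c x else 1) \<in> {1, -1}" for x
      using kap_sign[OF c, of x] by auto
    fix x assume "depth c (x - 1, 0) \<notin> {0, 2} \<and> depth c (x, 0) \<notin> {0, 2}"
    then have "depth c (x - 1, 0) = 1" "depth c (x, 0) = 1" using one by blast+
    then show "(if odd (depth c (x - 1, 0)) then kap c (x - 1) else 1)
        = (if odd (depth c (x, 0)) then kap c x else 1)"
      using kap_adj[OF c, of x] by simp
  qed simp
qed

lemma Zc_2: "c \<in> Zc 2 \<longleftrightarrow> c \<in> Xc \<and> odd_cells c = {}"
proof
  assume Z: "c \<in> Zc 2"
  then have X: "c \<in> Xc" by (auto simp: Xc_def Zc_def)
  have c: "c \<in> Conf" using X by (simp add: Xc_def)
  have "x \<notin> odd_cells c" for x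
  proof
    assume x: "x \<in> odd_cells c"
    then consider "depth c (x, 0) \<le> 0" | "2 \<le> depth c (x, 0)" by (fastforce simp: odd_cells_def)
    then show False
    proof cases
      case 1
      have "even_low c" using Z by (simp add: Zc_def)
      then show ?thesis using 1 x unfolding even_low_def odd_cells_def comp1_low[OF c 1, symmetric]
        by (auto simp: comp1_low[OF c, symmetric])
    next
      case 2
      have "even_high 2 c" using Z by (simp add: Zc_def)
      then show ?thesis using 2 x unfolding even_high_def odd_cells_def
        by (auto simp: comp1_high[OF c, symmetric])
    qed
  qed
  with X show "c \<in> Xc \<and> odd_cells c = {}" by auto
next
  assume a: "c \<in> Xc \<and> odd_cells c = {}"
  then have c: "c \<in> Conf" by (simp add: Xc_def)
  have "even_low c" unfolding even_low_def
  proof (intro allI impI)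
    fix x assume d: "depth c (x, 0) \<le> 0" and b: "\<not> bdry (comp_of n {u. depth c u \<le> 0} (x, 0))"
    have "x \<notin> odd_cells c" using a by simp
    then show "th c (comp_of n {u. depth c u \<le> 0} (x, 0)) = 1"
      using d b unfolding odd_cells_def comp1_low[OF c d] by (simp add: comp1_low[OF c d])
  qed
  moreover have "even_high 2 c" unfolding even_high_def
  proof (intro allI impI)
    fix x assume d: "2 \<le> depth c (x, 0)"
    have "x \<notin> odd_cells c" using a by simp
    then show "th c (comp_of n {u. 2 \<le> depth c u} (x, 0)) = 1"
      using d comp1_high_inner[OF c d] unfolding odd_cells_def by (simp add: comp1_high[OF c d])
  qed
  ultimately show "c \<in> Zc 2" using a kapcond_2[of c] by (auto simp: Zc_def Xc_def)
qed

lemma th_Zc_2: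
  assumes "c \<in> Zc 2"
  shows "th c {u. 2 \<le> depth c u} = 1"
proof (rule th_one)
  show "th c (comp_of n {u. 2 \<le> depth c u} (y, 0)) = 1" if "(y, 0) \<in> {u. 2 \<le> depth c u}" for y
    using assms that by (simp add: Zc_def even_high_def)
  show "\<bar>y\<bar> < W" if "(y, 0) \<in> {u. 2 \<le> depth c u}" for y
    using assms that depth_ge2[of c "(y, 0)"] by (simp add: Zc_def)
qed

lemma finite_odd_cells:
  assumes "c \<in> Conf"
  shows "finite (odd_cells c)"
proof (rule finite_subset)
  show "odd_cells c \<subseteq> {-W..W}"
  proof
    fix x assume "x \<in> odd_cells c"
    then have "\<not> bdry (comp1 c x)" by (simp add: odd_cells_def)
    then have "\<not> W \<le> \<bar>x\<bar>"
      using comp_of_self[of "(x, 0)" n "{u. depth c u \<noteq> 1}"] unfolding bdry_def comp1_def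
      by (metis fst_conv)
    then show "x \<in> {-W..W}" by auto
  qed
qed simp

text \<open>The component must be recognisable after the flip. Reflection at level 1 fixes the set
  of cells of depth 1 and the colours there, hence also \<open>odd_cells\<close>, and its maximum is
  a definite choice.\<close>

definition flip :: "conf \<Rightarrow> conf" where
  "flip c = reflect 1 (comp1 c (Max (odd_cells c))) c"

context
  fixes c
  assumes cX: "c \<in> Xc" and ne: "odd_cells c \<noteq> {}"
begin

abbreviation "x0 \<equiv> Max (odd_cells c)"
abbreviation "V0 \<equiv> comp1 c x0"

lemma cC: "c \<in> Conf" "Qbd c" using cX by (auto simp: Xc_def)

lemma x0: "depth c (x0, 0) \<noteq> 1" "\<not> bdry V0" "th c V0 \<noteq> 1"
  using Max_in[OF finite_odd_cells[OF cC(1)] ne] by (auto simp: odd_cells_def)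

lemma V0_sub: "V0 \<subseteq> {u. depth c u \<noteq> 1}"
  unfolding comp1_def by (rule comp_of_subset) (use x0 in simp)

lemma V0_inner: "u \<in> V0 \<Longrightarrow> snd u < n" "u \<in> V0 \<Longrightarrow> \<bar>fst u\<bar> < W"
proof -
  assume u: "u \<in> V0"
  have "snd v \<le> n" if "v \<in> V0" for v
    using that unfolding comp1_def
    by (induction rule: comp_of_induct) (auto simp: cell_adj_def arc_def)
  then show "snd u < n" "\<bar>fst u\<bar> < W" using x0(2) u by (fastforce simp: bdry_def)+
qed

lemma V0_edge: "u \<in> V0 \<Longrightarrow> v \<notin> V0 \<Longrightarrow> cell_adj n u v \<Longrightarrow> depth c v = 1"
  using comp_of_step[of u n "{u. depth c u \<noteq> 1}" "(x0, 0)" v] x0(1) unfolding comp1_def by auto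

lemma flip_Conf: "flip c \<in> Conf"
  unfolding flip_def by (rule reflect_Conf[OF cC(1)]) (use V0_inner V0_edge in auto)

lemma depth_flip: "depth (flip c) u = (if u \<in> V0 then 2 - depth c u else depth c u)"
  by (simp add: flip_def depth_reflect)

lemma flip_X: "flip c \<in> Xc"
  using flip_Conf cX by (auto simp: Xc_def depth_flip) (simp_all add: flip_def)

lemma depth_flip_1: "depth (flip c) u = 1 \<longleftrightarrow> depth c u = 1"
  by (simp add: depth_flip)

lemma comp1_flip: "comp1 (flip c) x = comp1 c x"
  by (simp add: comp1_def depth_flip_1)

lemma kap_flip: "depth c (x, 0) = 1 \<Longrightarrow> kap (flip c) x = kap c x"
  using V0_sub by (auto simp: flip_def kap_reflect sg_def)

lemma comp1_bottom_edge:
  assumes "depth c (x, 0) \<noteq> 1" "u \<in> comp1 c x" "v \<notin> comp1 c x" "cell_adj n u v"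
  shows "depth c v = 1"
  using comp_of_step[of u n "{u. depth c u \<noteq> 1}" "(x, 0)" v] assms unfolding comp1_def by auto

lemma th_comp1_flip: "depth c (x, 0) \<noteq> 1 \<Longrightarrow> th (flip c) (comp1 c x) = th c (comp1 c x)"
  by (rule th_cong; rule kap_flip)
    (use comp1_bottom_edge cell_adj_bottom(2) cell_adj_sym[OF cell_adj_bottom(2)] in blast)+

lemma odd_cells_flip: "odd_cells (flip c) = odd_cells c"
  unfolding odd_cells_def using th_comp1_flip by (auto simp: comp1_flip depth_flip_1)

lemma flip_flip: "flip (flip c) = c"
  unfolding flip_def[of "flip c"] odd_cells_flip comp1_flip by (simp add: flip_def)

lemma th_V0: "th c V0 = -1"
proof -
  have "th c V0 \<in> {1, -1}"
  proof -
    have *: "kap c x \<in> {1, -1}" if "depth c (x, 0) = 1" for x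
      using kap_sign[OF cC, of x] that by simp
    have "(\<Prod>y\<in>A. if (y - 1, 0) \<in> V0 \<and> (y, 0) \<notin> V0 then kap c y
        else if (y - 1, 0) \<notin> V0 \<and> (y, 0) \<in> V0 then kap c (y - 1) else 1) \<in> {1, -1}" for A
    proof (induction A rule: infinite_finite_induct)
      case (insert y A)
      have "(if (y - 1, 0) \<in> V0 \<and> (y, 0) \<notin> V0 then kap c y
        else if (y - 1, 0) \<notin> V0 \<and> (y, 0) \<in> V0 then kap c (y - 1) else 1) \<in> {1, -1}"
        using *[of y] *[of "y - 1"] V0_edge[of "(y - 1, 0)" "(y, 0)"] V0_edge[of "(y, 0)" "(y - 1, 0)"]
          cell_adj_bottom(2)[of n y] cell_adj_sym[OF cell_adj_bottom(2)[of n y]] by (simp split: if_split)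
      then show ?case using insert by auto
    qed auto
    then show ?thesis unfolding th_def .
  qed
  then show ?thesis using x0(3) by auto
qed

lemma V0_cases: "V0 \<subseteq> {u. depth c u \<le> 0} \<or> V0 \<subseteq> {u. 2 \<le> depth c u}"
proof -
  consider "depth c (x0, 0) \<le> 0" | "2 \<le> depth c (x0, 0)" using x0(1) by linarith
  then show ?thesis
  proof cases
    case 1
    then show ?thesis using comp_of_subset[of "(x0, 0)" "{u. depth c u \<le> 0}" n] comp1_low[OF cC(1) 1] by simp
  next
    case 2
    then show ?thesis using comp_of_subset[of "(x0, 0)" "{u. 2 \<le> depth c u}" n] comp1_high[OF cC(1) 2] by simp
  qed
qed

text \<open>The flip moves \<open>V0\<close> into or out of the set of cells of depth at least 2,
  and the other components keep their colours. The sign changes by the factor of \<open>V0\<close>,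
  which is -1 by the choice of \<open>V0\<close>.\<close>

lemma th_flip: "th (flip c) {u. 2 \<le> depth (flip c) u} = - th c {u. 2 \<le> depth c u}"
proof -
  let ?S = "{u. 2 \<le> depth c u}" and ?S' = "{u. 2 \<le> depth (flip c) u}"
  have same: "th (flip c) V = th c V" if "\<And>u v. u \<in> V \<Longrightarrow> v \<notin> V \<Longrightarrow> cell_adj n u v \<Longrightarrow> depth c v = 1" for V
    by (rule th_cong; rule kap_flip)
      (use that cell_adj_bottom(2) cell_adj_sym[OF cell_adj_bottom(2)] in blast)+
  have cl: "depth c v = 1" if "u \<in> ?S - V0" "v \<notin> ?S - V0" "cell_adj n u v" for u v
  proof -
    have "v \<notin> V0" using V0_edge[of v u] that cell_adj_sym[OF that(3)] by fastforce
    then show ?thesis using that depth_adj[OF cC(1) that(3)] by auto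
  qed
  from V0_cases show ?thesis
  proof
    assume lo: "V0 \<subseteq> {u. depth c u \<le> 0}"
    then have S': "?S' = ?S \<union> V0" and dis: "?S \<inter> V0 = {}" by (auto simp: depth_flip)
    have eq: "?S' - V0 = ?S - V0" using S' by auto
    have "th (flip c) ?S' = th (flip c) V0 * th (flip c) (?S - V0)"
      unfolding eq[symmetric]
    proof (rule th_split)
      show "V0 \<subseteq> ?S'" using S' by auto
      show "\<not> cell_adj n u v" if "u \<in> V0" "v \<in> ?S' - V0" for u v
        using V0_edge[of u v] that S' by auto
    qed
    also have "th (flip c) V0 = th c V0" by (rule same) (rule V0_edge)
    also have "th (flip c) (?S - V0) = th c (?S - V0)" by (rule same) (rule cl)
    also have "?S - V0 = ?S" using dis by auto
    finally show ?thesis by (simp add: th_V0)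
  next
    assume hi: "V0 \<subseteq> {u. 2 \<le> depth c u}"
    then have S': "?S' = ?S - V0" by (auto simp: depth_flip)
    have "th c ?S = th c V0 * th c (?S - V0)"
    proof (rule th_split[OF hi])
      show "\<not> cell_adj n u v" if "u \<in> V0" "v \<in> ?S - V0" for u v
        using V0_edge[of u v] that by auto
    qed
    moreover have "th (flip c) (?S - V0) = th c (?S - V0)" by (rule same) (rule cl)
    ultimately show ?thesis by (simp add: S' th_V0)
  qed
qed

lemma tot_flip: "tot (flip c) = tot c"
  by (simp add: flip_def)

end

lemma sum_Xc:
  fixes wt :: "conf \<Rightarrow> 'r::comm_ring_1"
  assumes wt: "\<And>c c'. c \<in> Xc \<Longrightarrow> c' \<in> Xc \<Longrightarrow> tot c = tot c' \<Longrightarrow> wt c = wt c'"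
  shows "(\<Sum>c\<in>Xc. of_int (th c {u. 2 \<le> depth c u}) * wt c) = (\<Sum>c\<in>Zc 2. wt c)"
proof -
  let ?s = "\<lambda>c. th c {u. 2 \<le> depth c u}"
  define P where "P = {c \<in> Xc. odd_cells c \<noteq> {}}"
  have fin: "finite Xc" by (rule finite_subset[OF _ finite_Conf]) (auto simp: Xc_def)
  have Xc: "Xc = Zc 2 \<union> P" "Zc 2 \<inter> P = {}" using Zc_2 by (auto simp: P_def)
  have flipP: "flip c \<in> P" "flip (flip c) = c" "?s (flip c) = - ?s c" "wt (flip c) = wt c" if "c \<in> P" for c
    using that flip_X[of c] odd_cells_flip[of c] flip_flip[of c] th_flip[of c]
      wt[of "flip c" c] tot_flip[of c] by (auto simp: P_def)
  have "(\<Sum>c\<in>P. of_int (?s c) * wt c) = 0"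
  proof -
    have finP: "finite P" using fin Xc by auto
    \<comment> \<open>The ring is arbitrary, so it would not suffice that the sum equals its own
      negative. The flip pairs positive terms with negative ones instead.\<close>
    define P1 P2 P3 where "P1 = {c \<in> P. ?s c > 0}" and "P2 = {c \<in> P. ?s c < 0}" and "P3 = {c \<in> P. ?s c = 0}"
    have PP: "P = P1 \<union> (P2 \<union> P3)" and dis: "P1 \<inter> (P2 \<union> P3) = {}" "P2 \<inter> P3 = {}"
      by (auto simp: P1_def P2_def P3_def)
    have f123: "finite P1" "finite P2" "finite P3" using finP by (auto simp: P1_def P2_def P3_def)
    have "(\<Sum>c\<in>P. of_int (?s c) * wt c) = (\<Sum>c\<in>P1. of_int (?s c) * wt c)
       + ((\<Sum>c\<in>P2. of_int (?s c) * wt c) + (\<Sum>c\<in>P3. of_int (?s c) * wt c))"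
      unfolding PP using f123 dis by (simp add: sum.union_disjoint)
    moreover have "(\<Sum>c\<in>P3. of_int (?s c) * wt c) = 0"
      by (rule sum.neutral) (auto simp: P3_def)
    moreover have "(\<Sum>c\<in>P2. of_int (?s c) * wt c) = (\<Sum>c\<in>P1. - (of_int (?s c) * wt c))"
      by (rule sum.reindex_bij_witness[of _ flip flip])
        (use flipP in \<open>auto simp: P1_def P2_def\<close>)
    ultimately show ?thesis by (simp add: sum_negf)
  qed
  moreover have "(\<Sum>c\<in>Zc 2. of_int (?s c) * wt c) = (\<Sum>c\<in>Zc 2. wt c)"
    by (rule sum.cong) (use th_Zc_2 in auto)
  moreover have "finite (Zc 2)" "finite P" using fin Xc(1) by (metis finite_Un)+
  then have "(\<Sum>c\<in>Xc. of_int (?s c) * wt c) = (\<Sum>c\<in>Zc 2. of_int (?s c) * wt c) + (\<Sum>c\<in>P. of_int (?s c) * wt c)"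
    unfolding Xc(1) by (rule sum.union_disjoint[OF _ _ Xc(2)])
  ultimately show ?thesis by simp
qed


section \<open>Folding at an even level\<close>

definition above :: "int \<Rightarrow> conf \<Rightarrow> cell set" where
  "above N c = {u. \<exists>x. N < depth c (x, 0) \<and> u \<in> comp_of n {v. N < depth c v} (x, 0)}"

text \<open>Only the components that reach the bottom are folded. Colours live on the bottom, and
  for a component that does not reach it nothing would record whether it was folded.\<close>

definition fold_conf :: "int \<Rightarrow> conf \<Rightarrow> conf" where
  "fold_conf N c = reflect N (above N c) c"

lemma above_sub: "u \<in> above N c \<Longrightarrow> N < depth c u"
  unfolding above_def using comp_of_subset[of _ "{v. N < depth c v}" n] by auto

lemma above_closed: "u \<in> above N c \<Longrightarrow> cell_adj n u v \<Longrightarrow> N < depth c v \<Longrightarrow> v \<in> above N c"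
  unfolding above_def using comp_of_step[of u n "{v. N < depth c v}" _ v] by auto

lemma above_bottom: "(x, 0) \<in> above N c \<longleftrightarrow> N < depth c (x, 0)"
  using above_sub[of "(x, 0)" N c] unfolding above_def by auto

lemma comp_bottom_edge:
  assumes "(x, 0) \<in> S" "(y, 0) \<in> comp_of n S (x, 0)" "(z, 0) \<notin> comp_of n S (x, 0)" "\<bar>y - z\<bar> = 1"
  shows "(z, 0) \<notin> S"
proof -
  have "cell_adj n (y, 0) (z, 0)" using assms(4) by (auto simp: cell_adj_def arc_def)
  then show ?thesis using comp_of_step[OF assms(2) assms(1)] assms(3) by blast
qed

lemma depth_fold: "depth (fold_conf N c) u = (if u \<in> above N c then 2 * N - depth c u else depth c u)"
  by (simp add: fold_conf_def depth_reflect)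

lemma depth_fold_bottom:
  "depth (fold_conf N c) (x, 0) = (if N < depth c (x, 0) then 2 * N - depth c (x, 0) else depth c (x, 0))"
  by (simp add: depth_fold above_bottom)

lemma tot_fold [simp]: "tot (fold_conf N c) = tot c"
  by (simp add: fold_conf_def)

context
  fixes N :: int
  assumes N: "2 \<le> N" "even N"
begin

context
  fixes c
  assumes cZ: "c \<in> Zc (2 * N)"
begin

abbreviation "c1 \<equiv> fold_conf N c"

lemma cZ': "c \<in> Conf" "Qbd c" "0 \<le> depth c (x, 0)" "depth c (x, 0) \<le> 2 * N" "even_low c" "even_high (2 * N) c"
  using cZ by (auto simp: Zc_def)

lemma above_edge: "u \<in> above N c \<Longrightarrow> v \<notin> above N c \<Longrightarrow> cell_adj n u v \<Longrightarrow> depth c v = N"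
  using above_sub[of u N c] above_closed[of u N c v] depth_adj[OF cZ'(1), of u v] by fastforce

lemma fold_Conf: "c1 \<in> Conf"
  unfolding fold_conf_def
proof (rule reflect_Conf[OF cZ'(1)])
  show "snd u < n" if "u \<in> above N c" for u
    using depth_ge2[OF cZ'(1), of u] above_sub[OF that] N by auto
qed (use above_edge in auto)

lemma fold_range: "0 \<le> depth c1 (x, 0)" "depth c1 (x, 0) \<le> N"
  using cZ'(3,4)[of x] by (auto simp: depth_fold_bottom)

lemma kap_fold:
  assumes "odd (depth c (x, 0))"
  shows "kap c1 x = (if N < depth c (x, 0) then - kap c x else kap c x)"
  using assms N by (auto simp: fold_conf_def kap_reflect above_bottom sg_def)

lemma odd_fold: "odd (depth c1 (x, 0)) \<longleftrightarrow> odd (depth c (x, 0))"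
  by (simp add: depth_fold_bottom)

text \<open>The extended colour is reversed on the folded bottom cells, like the colours themselves.
  If only one of two neighbours is folded, the other has depth \<open>N\<close>, where a jump is
  allowed.\<close>

lemma fold_kapcond: "kapcond {0, N} c1"
proof -
  obtain \<kappa> where \<kappa>: "\<And>x. \<kappa> x \<in> {1, -1}" "\<And>x. odd (depth c (x, 0)) \<Longrightarrow> \<kappa> x = kap c x"
    "\<And>x. depth c (x - 1, 0) \<notin> {0, 2 * N} \<Longrightarrow> depth c (x, 0) \<notin> {0, 2 * N} \<Longrightarrow> \<kappa> (x - 1) = \<kappa> x"
    using cZ unfolding Zc_def kapcond_def by blast
  let ?k = "\<lambda>x. (if N < depth c (x, 0) then -1 else 1) * \<kappa> x"
  show ?thesis unfolding kapcond_def
  proof (intro exI[of _ ?k] conjI allI impI)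
    show "?k x \<in> {1, -1}" for x using \<kappa>(1)[of x] by auto
    show "?k x = kap c1 x" if "odd (depth c1 (x, 0))" for x
      using that \<kappa>(2)[of x] kap_fold[of x] by (simp add: odd_fold)
    fix x assume a: "depth c1 (x - 1, 0) \<notin> {0, N} \<and> depth c1 (x, 0) \<notin> {0, N}"
    then have "depth c (x - 1, 0) \<notin> {0, N, 2 * N}" "depth c (x, 0) \<notin> {0, N, 2 * N}"
      using N by (auto simp: depth_fold_bottom split: if_splits)
    moreover have "\<bar>depth c (x - 1, 0) - depth c (x, 0)\<bar> \<le> 1" by (rule depth_bottom_adj[OF cZ'(1)])
    ultimately have "N < depth c (x - 1, 0) \<longleftrightarrow> N < depth c (x, 0)" "\<kappa> (x - 1) = \<kappa> x"
      using \<kappa>(3)[of x] by auto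
    then show "?k (x - 1) = ?k x" by simp
  qed
qed

text \<open>A component of nonpositive depth after folding was either such a component before, with
  the same colours at its edges, or a component of depth at least \<open>2 * N\<close>, all of whose
  edge colours are reversed. In the second case the reversals cancel, being even in number. So both
  evenness conditions on \<open>c\<close> enter here.\<close>

lemma fold_low: "even_low c1"
  unfolding even_low_def
proof (intro allI impI)
  fix x
  let ?S = "{u. depth c1 u \<le> 0}"
  assume d: "depth c1 (x, 0) \<le> 0" and nb: "\<not> bdry (comp_of n ?S (x, 0))"
  show "th c1 (comp_of n ?S (x, 0)) = 1"
  proof (cases "N < depth c (x, 0)")
    case False
    let ?S' = "{u. depth c u \<le> 0}"
    have x: "depth c (x, 0) \<le> 0" using d False by (simp add: depth_fold_bottom)
    have eq: "comp_of n ?S (x, 0) = comp_of n ?S' (x, 0)"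
    proof (rule comp_of_cong)
      fix v w assume v: "v \<in> comp_of n ?S' (x, 0)" "cell_adj n v w"
      then have "depth c v \<le> 0" using comp_of_subset[of "(x, 0)" ?S' n] x by auto
      then have "depth c w \<le> 1" using depth_adj[OF cZ'(1) v(2)] by auto
      then have "w \<notin> above N c" using above_sub[of w N c] N by auto
      then show "w \<in> ?S' \<longleftrightarrow> w \<in> ?S" by (simp add: depth_fold)
    qed (use x d in auto)
    have "th c1 (comp_of n ?S' (x, 0)) = th c (comp_of n ?S' (x, 0))"
    proof (rule th_cong)
      have *: "kap c1 z = kap c z" if "(y, 0) \<in> comp_of n ?S' (x, 0)" "(z, 0) \<notin> comp_of n ?S' (x, 0)" "\<bar>y - z\<bar> = 1" for y z
      proof -
        have "depth c (z, 0) > 0" using comp_bottom_edge[OF _ that] x by auto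
        moreover have "depth c (y, 0) \<le> 0" using that(1) comp_of_subset[of "(x, 0)" ?S' n] x by auto
        moreover have "cell_adj n (y, 0) (z, 0)" using that(3) by (auto simp: cell_adj_def arc_def)
        ultimately have "depth c (z, 0) = 1" using depth_adj[OF cZ'(1)] by fastforce
        then show ?thesis using kap_fold[of z] N by simp
      qed
      show "kap c1 y = kap c y" if "(y - 1, 0) \<in> comp_of n ?S' (x, 0)" "(y, 0) \<notin> comp_of n ?S' (x, 0)" for y
        using *[OF that] by simp
      show "kap c1 (y - 1) = kap c (y - 1)" if "(y - 1, 0) \<notin> comp_of n ?S' (x, 0)" "(y, 0) \<in> comp_of n ?S' (x, 0)" for y
        using *[OF that(2,1)] by simp
    qed
    then show ?thesis using cZ'(5) x nb unfolding eq even_low_def by simp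
  next
    case True
    let ?S' = "{u. 2 * N \<le> depth c u}"
    have x: "2 * N \<le> depth c (x, 0)" using d True by (simp add: depth_fold_bottom)
    have sub: "v \<in> above N c" if "v \<in> comp_of n ?S' (x, 0)" for v
    proof -
      have "v \<in> comp_of n {v. N < depth c v} (x, 0)"
        using that comp_of_mono[of ?S' "{v. N < depth c v}" n "(x, 0)"] N by fastforce
      then show ?thesis unfolding above_def using True by blast
    qed
    have nbr: "w \<in> above N c" if "v \<in> comp_of n ?S' (x, 0)" "cell_adj n v w" for v w
    proof -
      have "2 * N \<le> depth c v" using that(1) comp_of_subset[of "(x, 0)" ?S' n] x by auto
      then have "N < depth c w" using depth_adj[OF cZ'(1) that(2)] N by auto
      then show ?thesis using above_closed[OF sub[OF that(1)] that(2)] by simp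
    qed
    have eq: "comp_of n ?S (x, 0) = comp_of n ?S' (x, 0)"
    proof (rule comp_of_cong)
      fix v w assume v: "v \<in> comp_of n ?S' (x, 0)" "cell_adj n v w"
      show "w \<in> ?S' \<longleftrightarrow> w \<in> ?S" using nbr[OF v] by (auto simp: depth_fold)
    qed (use x d in auto)
    have "th c1 (comp_of n ?S' (x, 0)) = th c (comp_of n ?S' (x, 0))"
    proof (rule th_even_count)
      have *: "kap c1 z = - kap c z" if "(y, 0) \<in> comp_of n ?S' (x, 0)" "(z, 0) \<notin> comp_of n ?S' (x, 0)" "\<bar>y - z\<bar> = 1" for y z
      proof -
        have zd: "depth c (z, 0) < 2 * N" using comp_bottom_edge[OF _ that] x by auto
        moreover have "2 * N \<le> depth c (y, 0)" using that(1) comp_of_subset[of "(x, 0)" ?S' n] x by auto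
        moreover have a: "cell_adj n (y, 0) (z, 0)" using that(3) by (auto simp: cell_adj_def arc_def)
        ultimately have "depth c (z, 0) = 2 * N - 1" using depth_adj[OF cZ'(1) a] by auto
        then show ?thesis using kap_fold[of z] N by simp
      qed
      show "kap c1 y = - kap c y" if "(y - 1, 0) \<in> comp_of n ?S' (x, 0)" "(y, 0) \<notin> comp_of n ?S' (x, 0)" for y
        using *[OF that] by simp
      show "kap c1 (y - 1) = - kap c (y - 1)" if "(y - 1, 0) \<notin> comp_of n ?S' (x, 0)" "(y, 0) \<in> comp_of n ?S' (x, 0)" for y
        using *[OF that(2,1)] by simp
      show "(y, 0) \<notin> comp_of n ?S' (x, 0)" if "W \<le> \<bar>y\<bar>" for y
        using comp_of_subset[of "(x, 0)" ?S' n] x depth_far[OF cZ'(1), of "(y, 0)"] that N by force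
    qed
    then show ?thesis using cZ'(6) x unfolding eq even_high_def by simp
  qed
qed

text \<open>On the bottom a component of depth at least \<open>N\<close> has depth exactly
  \<open>N\<close>, so the extended colour is constant on each of its runs and cancels between the
  two ends. There remains the side of the outer neighbours, folded or not. Adjacent outer cells lie
  on the same side, since the side can only change at a cell where \<open>c\<close> has depth
  \<open>N\<close>; hence \<open>triangle_parity\<close> applies.\<close>

lemma fold_high: "even_high N c1"
  unfolding even_high_def
proof (intro allI impI)
  fix x
  let ?S = "{u. N \<le> depth c1 u}"
  assume x: "N \<le> depth c1 (x, 0)"
  let ?V = "comp_of n ?S (x, 0)"
  have VS: "?V \<subseteq> ?S" by (rule comp_of_subset) (use x in simp)
  obtain \<kappa> where \<kappa>: "\<And>x. \<kappa> x \<in> {1, -1}" "\<And>x. odd (depth c (x, 0)) \<Longrightarrow> \<kappa> x = kap c x"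
    "\<And>x. depth c (x - 1, 0) \<notin> {0, 2 * N} \<Longrightarrow> depth c (x, 0) \<notin> {0, 2 * N} \<Longrightarrow> \<kappa> (x - 1) = \<kappa> x"
    using cZ unfolding Zc_def kapcond_def by blast
  define \<sigma> where "\<sigma> u = (if u \<in> above N c then -1 else 1 :: int)" for u
  \<comment> \<open>The telescoping product of \<open>\<chi>\<close> picks up the extended colour at
    the inner cell of every bottom edge of the component.\<close>
  define \<chi> where "\<chi> y = (if (y, 0) \<in> ?V then \<kappa> y else 1)" for y
  have Vd: "depth c (y, 0) = N" if "(y, 0) \<in> ?V" for y
    using that VS fold_range[of y] by (fastforce simp: depth_fold_bottom split: if_splits)
  have out: "depth c1 v < N" if "u \<in> ?V" "v \<notin> ?V" "cell_adj n u v" for u v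
    using comp_of_step[of u n ?S "(x, 0)" v] that x by fastforce
  have one: "(\<Prod>y\<in>{-W..W}. if (y - 1, 0) \<in> ?V \<and> (y, 0) \<notin> ?V then \<sigma> (y, 0)
      else if (y - 1, 0) \<notin> ?V \<and> (y, 0) \<in> ?V then \<sigma> (y - 1, 0) else 1) = 1"
  proof (rule triangle_parity[where n = n])
    show "snd w < n \<and> \<bar>fst w\<bar> < W" if "w \<in> ?V" for w
      using that VS depth_ge2[OF fold_Conf, of w] N by fastforce
    show "\<sigma> w \<in> {1, -1}" for w by (simp add: \<sigma>_def)
    fix v w w' assume a: "v \<in> ?V" "w \<notin> ?V" "w' \<notin> ?V" "cell_adj n v w" "cell_adj n v w'" "cell_adj n w w'"
    have "depth c w \<noteq> N" "depth c w' \<noteq> N"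
      using out[OF a(1,2,4)] out[OF a(1,3,5)] by (auto simp: depth_fold split: if_splits)
    then show "\<sigma> w = \<sigma> w'"
      using above_edge[OF _ _ a(6)] above_edge[OF _ _ cell_adj_sym[OF a(6)]] unfolding \<sigma>_def by metis
  qed
  have two: "(\<Prod>y\<in>{-W..W}. \<chi> (y - 1) * \<chi> y) = 1"
  proof (rule prod_sign_pair)
    show "\<chi> y \<in> {1, -1}" for y using \<kappa>(1)[of y] by (simp add: \<chi>_def)
    show "\<chi> y = 1" if "W \<le> \<bar>y\<bar>" for y
      using Vd[of y] depth_far[OF cZ'(1), of "(y, 0)"] that N by (auto simp: \<chi>_def)
  qed
  have edge: "kap c1 z = \<sigma> (z, 0) * \<kappa> y" if yz: "(y, 0) \<in> ?V" "(z, 0) \<notin> ?V" "z = y + 1 \<or> y = z + 1" for y z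
  proof -
    have a: "cell_adj n (y, 0) (z, 0)" using yz(3) by (auto simp: cell_adj_def arc_def)
    have zN: "depth c (z, 0) \<noteq> N" using out[OF yz(1,2) a] by (auto simp: depth_fold split: if_splits)
    have "depth c (y, 0) = N" by (rule Vd[OF yz(1)])
    then have z: "depth c (z, 0) = N + 1 \<or> depth c (z, 0) = N - 1"
      using depth_adj[OF cZ'(1) a] zN by auto
    then have od: "odd (depth c (z, 0))" using N by auto
    have "depth c (z, 0) \<notin> {0, 2 * N}" "depth c (y, 0) \<notin> {0, 2 * N}"
      using z \<open>depth c (y, 0) = N\<close> N by auto
    then have "\<kappa> y = \<kappa> z" using \<kappa>(3)[of y] \<kappa>(3)[of z] yz(3) by auto
    then show ?thesis using kap_fold[OF od] \<kappa>(2)[OF od] by (auto simp: \<sigma>_def above_bottom)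
  qed
  have "th c1 ?V = (\<Prod>y\<in>{-W..W}. (if (y - 1, 0) \<in> ?V \<and> (y, 0) \<notin> ?V then \<sigma> (y, 0)
      else if (y - 1, 0) \<notin> ?V \<and> (y, 0) \<in> ?V then \<sigma> (y - 1, 0) else 1) * (\<chi> (y - 1) * \<chi> y))"
    unfolding th_def
  proof (rule prod.cong)
    fix y :: int
    consider "(y - 1, 0) \<in> ?V" "(y, 0) \<notin> ?V" | "(y - 1, 0) \<notin> ?V" "(y, 0) \<in> ?V"
      | "(y - 1, 0) \<notin> ?V" "(y, 0) \<notin> ?V" | "(y - 1, 0) \<in> ?V" "(y, 0) \<in> ?V" by blast
    then show "(if (y - 1, 0) \<in> ?V \<and> (y, 0) \<notin> ?V then kap c1 y
        else if (y - 1, 0) \<notin> ?V \<and> (y, 0) \<in> ?V then kap c1 (y - 1) else 1)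
      = (if (y - 1, 0) \<in> ?V \<and> (y, 0) \<notin> ?V then \<sigma> (y, 0)
        else if (y - 1, 0) \<notin> ?V \<and> (y, 0) \<in> ?V then \<sigma> (y - 1, 0) else 1) * (\<chi> (y - 1) * \<chi> y)"
    proof cases
      case 1
      then show ?thesis using edge[of "y - 1" y] by (simp add: \<chi>_def)
    next
      case 2
      then show ?thesis using edge[of y "y - 1"] by (simp add: \<chi>_def)
    next
      case 3
      then show ?thesis by (simp add: \<chi>_def)
    next
      case 4
      have "\<kappa> (y - 1) = \<kappa> y" by (rule \<kappa>(3)) (use Vd[OF 4(1)] Vd[OF 4(2)] N in auto)
      then show ?thesis using 4 \<kappa>(1)[of y] by (auto simp: \<chi>_def)
    qed
  qed simp
  also have "\<dots> = 1" unfolding prod.distrib[of _ "\<lambda>y. \<chi> (y - 1) * \<chi> y"] one two by simp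
  finally show "th c1 ?V = 1" .
qed

lemma fold_Zc: "c1 \<in> Zc N"
  using fold_Conf fold_range fold_kapcond fold_low fold_high cZ'(2)
  by (auto simp: Zc_def) (simp add: fold_conf_def)

text \<open>Describes the folded region by the folded configuration and the folded bottom cells
  alone. For injectivity it then suffices to recover these bottom cells.\<close>

lemma above_eq: "above N c = {u. \<exists>x. N < depth c (x, 0) \<and> u \<in> comp_of n {v. depth c1 v < N} (x, 0)}"
proof -
  have "comp_of n {v. depth c1 v < N} (x, 0) = comp_of n {v. N < depth c v} (x, 0)" if x: "N < depth c (x, 0)" for x
  proof (rule comp_of_cong)
    fix v w assume v: "v \<in> comp_of n {v. N < depth c v} (x, 0)" "cell_adj n v w"
    have vR: "v \<in> above N c" using v(1) x by (auto simp: above_def)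
    show "w \<in> {v. N < depth c v} \<longleftrightarrow> w \<in> {v. depth c1 v < N}"
      using above_edge[OF vR _ v(2)] above_sub[of w N c] by (auto simp: depth_fold)
  qed (use x in \<open>auto simp: depth_fold_bottom\<close>)
  then show ?thesis unfolding above_def by blast
qed

end

text \<open>The sweep goes along the bottom from right to left. At odd depth \<open>kap d\<close>
  is, up to the side, the extended colour of either preimage, so the preimages agree in the side
  exactly if they agree in the extended colour. The side can change only at depth \<open>N\<close>,
  and the depths next to it are odd because \<open>N\<close> is even.\<close>

lemma fold_inj: "inj_on (fold_conf N) (Zc (2 * N))"
proof (rule inj_onI)
  fix c c' assume c: "c \<in> Zc (2 * N)" and c': "c' \<in> Zc (2 * N)" and eq: "fold_conf N c = fold_conf N c'"
  define d where "d = fold_conf N c"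
  have dc: "d = fold_conf N c" "d = fold_conf N c'" using eq by (simp_all add: d_def)
  note C = cZ'[OF c] and C' = cZ'[OF c']
  have dC: "d \<in> Conf" "Qbd d" using fold_Zc[OF c] by (simp_all add: Zc_def d_def)
  obtain \<kappa> where \<kappa>: "\<And>x. \<kappa> x \<in> {1, -1}" "\<And>x. odd (depth c (x, 0)) \<Longrightarrow> \<kappa> x = kap c x"
    "\<And>x. depth c (x - 1, 0) \<notin> {0, 2 * N} \<Longrightarrow> depth c (x, 0) \<notin> {0, 2 * N} \<Longrightarrow> \<kappa> (x - 1) = \<kappa> x"
    using c unfolding Zc_def kapcond_def by blast
  obtain \<kappa>' where \<kappa>': "\<And>x. \<kappa>' x \<in> {1, -1}" "\<And>x. odd (depth c' (x, 0)) \<Longrightarrow> \<kappa>' x = kap c' x"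
    "\<And>x. depth c' (x - 1, 0) \<notin> {0, 2 * N} \<Longrightarrow> depth c' (x, 0) \<notin> {0, 2 * N} \<Longrightarrow> \<kappa>' (x - 1) = \<kappa>' x"
    using c' unfolding Zc_def kapcond_def by blast
  have bot: "depth d (x, 0) = (if N < depth c (x, 0) then 2 * N - depth c (x, 0) else depth c (x, 0))"
    "depth d (x, 0) = (if N < depth c' (x, 0) then 2 * N - depth c' (x, 0) else depth c' (x, 0))" for x
    using dc depth_fold_bottom by metis+
  have kd: "kap d x = (if N < depth c (x, 0) then -1 else 1) * \<kappa> x"
    "kap d x = (if N < depth c' (x, 0) then -1 else 1) * \<kappa>' x" if od: "odd (depth d (x, 0))" for x
  proof -
    have o: "odd (depth c (x, 0))" "odd (depth c' (x, 0))"
      using od odd_fold[OF c, of x] odd_fold[OF c', of x] by (simp_all add: d_def eq)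
    show "kap d x = (if N < depth c (x, 0) then -1 else 1) * \<kappa> x"
      using kap_fold[OF c o(1)] \<kappa>(2)[OF o(1)] by (simp add: dc(1))
    show "kap d x = (if N < depth c' (x, 0) then -1 else 1) * \<kappa>' x"
      using kap_fold[OF c' o(2)] \<kappa>'(2)[OF o(2)] by (simp add: dc(2))
  qed
  \<comment> \<open>The invariant records the side where there is one. Across the cells of depth
    \<open>N\<close>, where neither preimage has a side, it is the extended colour that carries the
    information.\<close>
  have "(depth d (x, 0) \<noteq> N \<longrightarrow> (N < depth c (x, 0) \<longleftrightarrow> N < depth c' (x, 0)))
    \<and> (depth d (x, 0) = N \<longrightarrow> \<kappa> x = \<kappa>' x)" for x
  proof (induction x rule: bottom_induct)
    case (right x)
    then show ?case
      using depth_far[OF C(1), of "(x, 0)"] depth_far[OF C'(1), of "(x, 0)"] depth_far[OF dC(1), of "(x, 0)"] N W_ge by auto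
  next
    case (step x)
    have adj: "\<bar>depth d (x - 1, 0) - depth d (x, 0)\<bar> \<le> 1" "\<bar>depth c (x - 1, 0) - depth c (x, 0)\<bar> \<le> 1"
      "\<bar>depth c' (x - 1, 0) - depth c' (x, 0)\<bar> \<le> 1"
      using depth_bottom_adj[OF dC(1)] depth_bottom_adj[OF C(1)] depth_bottom_adj[OF C'(1)] by blast+
    have same: "\<kappa> (x - 1) = \<kappa> x" "\<kappa>' (x - 1) = \<kappa>' x"
      if "depth d (x, 0) = N \<or> depth d (x - 1, 0) = N"
    proof -
      have "depth d (x, 0) \<noteq> 0 \<and> depth d (x - 1, 0) \<noteq> 0" using that adj(1) N by auto
      then have "depth c (x - 1, 0) \<notin> {0, 2 * N}" "depth c (x, 0) \<notin> {0, 2 * N}"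
        "depth c' (x - 1, 0) \<notin> {0, 2 * N}" "depth c' (x, 0) \<notin> {0, 2 * N}"
        using bot[of x] bot[of "x - 1"] N by (auto split: if_splits)
      then show "\<kappa> (x - 1) = \<kappa> x" "\<kappa>' (x - 1) = \<kappa>' x" using \<kappa>(3)[of x] \<kappa>'(3)[of x] by auto
    qed
    have sgn: "(N < depth c (z, 0) \<longleftrightarrow> N < depth c' (z, 0)) \<longleftrightarrow> \<kappa> z = \<kappa>' z"
      if "odd (depth d (z, 0))" for z
      using kd[OF that] \<kappa>(1)[of z] \<kappa>'(1)[of z] by (auto split: if_splits)
    consider "depth d (x, 0) \<noteq> N" "depth d (x - 1, 0) \<noteq> N"
      | "depth d (x, 0) \<noteq> N" "depth d (x - 1, 0) = N"
      | "depth d (x, 0) = N" "depth d (x - 1, 0) = N"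
      | "depth d (x, 0) = N" "depth d (x - 1, 0) \<noteq> N" by blast
    then show ?case
    proof cases
      case 1
      then have "depth c (x, 0) \<noteq> N" "depth c (x - 1, 0) \<noteq> N" "depth c' (x, 0) \<noteq> N" "depth c' (x - 1, 0) \<noteq> N"
        using bot[of x] bot[of "x - 1"] by (auto split: if_splits)
      then show ?thesis using step 1 adj by auto
    next
      case 2
      then have "depth d (x, 0) = N - 1 \<or> depth d (x, 0) = N + 1" using adj(1) by arith
      then have "odd (depth d (x, 0))" using N by auto
      then show ?thesis using sgn[of x] step 2 same by auto
    next
      case 3
      then show ?thesis using step same by auto
    next
      case 4
      then have "depth d (x - 1, 0) = N - 1 \<or> depth d (x - 1, 0) = N + 1" using adj(1) by arith
      then have "odd (depth d (x - 1, 0))" using N by auto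
      then show ?thesis using sgn[of "x - 1"] step 4 same by auto
    qed
  qed
  then have iff: "N < depth c (x, 0) \<longleftrightarrow> N < depth c' (x, 0)" for x
    using bot[of x] by (cases "depth d (x, 0) = N") (auto split: if_splits)
  have "above N c = above N c'"
    unfolding above_eq[OF c] above_eq[OF c'] dc[symmetric] iff ..
  then have "reflect N (above N c) d = reflect N (above N c') d" by simp
  then show "c = c'"
    unfolding dc(1) by (subst (asm) (2) eq) (simp add: fold_conf_def)
qed

end


text \<open>The colours at the bottom edges of the cells of depth at least \<open>N\<close> say
  where the side has to change, and \<open>even_high N\<close> is the hypothesis under which
  \<open>sign_extension\<close> turns these changes into a side for every cell of smaller
  depth.\<close>

lemma unfold_exists:
  assumes N: "2 \<le> N" "even N" and cZ: "c \<in> Zc N"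
  shows "\<exists>c'\<in>Zc (2 * N). fold_conf N c' = c"
proof -
  have C: "c \<in> Conf" "Qbd c" "\<And>x. 0 \<le> depth c (x, 0)" "\<And>x. depth c (x, 0) \<le> N" "even_low c" "even_high N c"
    using cZ by (auto simp: Zc_def)
  obtain \<kappa> where \<kappa>: "\<And>x. \<kappa> x \<in> {1, -1}" "\<And>x. odd (depth c (x, 0)) \<Longrightarrow> \<kappa> x = kap c x"
    "\<And>x. depth c (x - 1, 0) \<notin> {0, N} \<Longrightarrow> depth c (x, 0) \<notin> {0, N} \<Longrightarrow> \<kappa> (x - 1) = \<kappa> x"
    using cZ unfolding Zc_def kapcond_def by blast
  define T where "T = {u. N \<le> depth c u}"
  \<comment> \<open>The mark of an edge is the colour of its outer cell. That cell has depth
    \<open>N - 1\<close>, which is odd, so the colour is a genuine sign.\<close>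
  define f where "f y = (if (y - 1, 0) \<in> T \<and> (y, 0) \<notin> T then kap c y
      else if (y - 1, 0) \<notin> T \<and> (y, 0) \<in> T then kap c (y - 1) else 1)" for y
  have T: "snd w < n \<and> \<bar>fst w\<bar> < W - 2" if "w \<in> T" for w
    using that depth_ge2[OF C(1), of w] N by (simp add: T_def)
  have Tb: "(x, 0) \<in> T \<longleftrightarrow> depth c (x, 0) = N" for x
    using C(4)[of x] by (auto simp: T_def)
  have outer: "depth c (z, 0) = N - 1" if "(y, 0) \<in> T" "(z, 0) \<notin> T" "z = y + 1 \<or> y = z + 1" for y z
  proof -
    have "cell_adj n (y, 0) (z, 0)" using that(3) by (auto simp: cell_adj_def arc_def)
    then show ?thesis using depth_adj[OF C(1)] that(1,2) C(4)[of z] unfolding Tb by fastforce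
  qed
  have outer_odd: "odd (depth c (z, 0))" if "(y, 0) \<in> T" "(z, 0) \<notin> T" "z = y + 1 \<or> y = z + 1" for y z
    using outer[OF that] N by simp
  have fpm: "f y \<in> {1, -1}" for y
    using kap_sign[OF C(1,2), of y] kap_sign[OF C(1,2), of "y - 1"] outer_odd[of "y - 1" y] outer_odd[of y "y - 1"]
    by (simp add: f_def)
  have fT: "f y \<noteq> 1 \<Longrightarrow> ((y - 1, 0) \<in> T) \<noteq> ((y, 0) \<in> T)" for y
    by (auto simp: f_def split: if_splits)
  have "\<exists>\<sigma> :: cell \<Rightarrow> int. (\<forall>w. \<sigma> w \<in> {1, -1})
    \<and> (\<forall>w w'. cell_adj n w w' \<longrightarrow> w \<notin> T \<longrightarrow> w' \<notin> T \<longrightarrow> \<sigma> w = \<sigma> w')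
    \<and> (\<forall>w. snd w = n \<or> W \<le> \<bar>fst w\<bar> \<longrightarrow> \<sigma> w = 1)
    \<and> (\<forall>x. (x, 0) \<notin> T \<longrightarrow> \<sigma> (x, 0) = (\<Prod>y\<in>{-W..x}. f y))"
  proof (rule sign_extension[OF _ fpm fT])
    show "snd w < n \<and> \<bar>fst w\<bar> < W" if "w \<in> T" for w using T[OF that] by auto
    fix u assume u: "u \<in> T" "snd u = 0"
    then obtain x where x: "u = (x, 0)" by (cases u) auto
    let ?V = "comp_of n T u"
    have VT: "?V \<subseteq> T" by (rule comp_of_subset[OF u(1)])
    have "(\<Prod>y\<in>{-W..W}. if ((y - 1, 0) \<in> ?V) \<noteq> ((y, 0) \<in> ?V) then f y else 1) = th c ?V"
      unfolding th_def
    proof (rule prod.cong)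
      fix y :: int
      have "(y, 0) \<notin> T" if "(y - 1, 0) \<in> ?V" "(y, 0) \<notin> ?V"
        using comp_bottom_edge[of x T "y - 1" y] that u x by auto
      moreover have "(y - 1, 0) \<notin> T" if "(y, 0) \<in> ?V" "(y - 1, 0) \<notin> ?V"
        using comp_bottom_edge[of x T y "y - 1"] that u x by auto
      moreover have "(y, 0) \<in> ?V \<Longrightarrow> (y, 0) \<in> T" "(y - 1, 0) \<in> ?V \<Longrightarrow> (y - 1, 0) \<in> T" using VT by auto
      ultimately show "(if ((y - 1, 0) \<in> ?V) \<noteq> ((y, 0) \<in> ?V) then f y else 1)
        = (if (y - 1, 0) \<in> ?V \<and> (y, 0) \<notin> ?V then kap c y
           else if (y - 1, 0) \<notin> ?V \<and> (y, 0) \<in> ?V then kap c (y - 1) else 1)"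
        by (cases "(y - 1, 0) \<in> ?V"; cases "(y, 0) \<in> ?V") (simp_all add: f_def)
    qed simp
    also have "\<dots> = 1" using C(6) u unfolding even_high_def x T_def by simp
    finally show "(\<Prod>y\<in>{-W..W}. if ((y - 1, 0) \<in> ?V) \<noteq> ((y, 0) \<in> ?V) then f y else 1) = 1" .
  qed
  then obtain \<sigma> :: "cell \<Rightarrow> int" where \<sigma>: "\<And>w. \<sigma> w \<in> {1, -1}"
    "\<And>w w'. cell_adj n w w' \<Longrightarrow> w \<notin> T \<Longrightarrow> w' \<notin> T \<Longrightarrow> \<sigma> w = \<sigma> w'"
    "\<And>w. snd w = n \<or> W \<le> \<bar>fst w\<bar> \<Longrightarrow> \<sigma> w = 1"
    "\<And>x. (x, 0) \<notin> T \<Longrightarrow> \<sigma> (x, 0) = (\<Prod>y\<in>{-W..x}. f y)"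
    by metis
  \<comment> \<open>At the bottom \<open>\<tau>\<close> agrees with \<open>\<sigma>\<close> outside
    \<open>T\<close> and continues it through \<open>T\<close>. Inside \<open>T\<close> it serves as
    the extended colour of the unfolded configuration, outside it multiplies the old one.\<close>
  define \<tau> where "\<tau> x = (\<Prod>y\<in>{-W..x}. f y)" for x
  have \<tau>_step: "\<tau> x = \<tau> (x - 1) * f x" for x
  proof (cases "-W \<le> x")
    case True
    then have "{-W..x} = insert x {-W..x - 1}" by auto
    then show ?thesis by (simp add: \<tau>_def)
  next
    case False
    then have "f x = 1" using fT[of x] T[of "(x, 0)"] T[of "(x - 1, 0)"] by force
    then show ?thesis using False by (simp add: \<tau>_def)
  qed
  have \<tau>pm: "\<tau> x \<in> {1, -1}" for x
  proof -
    have "(\<Prod>y\<in>A. f y) \<in> {1, -1}" for A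
      by (induction A rule: infinite_finite_induct) (use fpm in fastforce)+
    then show ?thesis by (simp add: \<tau>_def)
  qed
  \<comment> \<open>The cells on the negative side, restricted to components that reach the bottom:
    exactly these are found again by \<open>above\<close> in the reflected configuration.\<close>
  define R where "R = {u. depth c u < N \<and> \<sigma> u = -1 \<and> (\<exists>x. depth c (x, 0) < N \<and> u \<in> comp_of n {v. depth c v < N} (x, 0))}"
  have Rlt: "u \<in> R \<Longrightarrow> depth c u < N" for u by (simp add: R_def)
  have Rclosed: "v \<in> R" if uR: "u \<in> R" and "cell_adj n u v" "depth c v < N" for u v
  proof -
    obtain x where x: "depth c (x, 0) < N" "u \<in> comp_of n {v. depth c v < N} (x, 0)" using uR by (auto simp: R_def)
    have "v \<in> comp_of n {v. depth c v < N} (x, 0)"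
      by (rule comp_of_step[OF x(2)]) (use x that in auto)
    moreover have "\<sigma> v = \<sigma> u" using \<sigma>(2)[OF that(2)] that Rlt[OF that(1)] by (simp add: T_def)
    ultimately show ?thesis using that x by (auto simp: R_def)
  qed
  have Redge: "depth c v = N" if "u \<in> R" "v \<notin> R" "cell_adj n u v" for u v
    using Rclosed[OF that(1,3)] that(2) Rlt[OF that(1)] depth_adj[OF C(1) that(3)] by fastforce
  have Rrow: "snd u < n" "\<bar>fst u\<bar> < W" if uR: "u \<in> R" for u
  proof -
    obtain x where x: "u \<in> comp_of n {v. depth c v < N} (x, 0)" using uR by (auto simp: R_def)
    then have "snd u \<le> n" by (induction rule: comp_of_induct) (auto simp: cell_adj_def arc_def)
    then show "snd u < n" "\<bar>fst u\<bar> < W" using uR \<sigma>(3)[of u] by (fastforce simp: R_def)+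
  qed
  have Rbot: "(x, 0) \<in> R \<longleftrightarrow> depth c (x, 0) < N \<and> \<sigma> (x, 0) = -1" for x
    by (auto simp: R_def)
  define c' where "c' = reflect N R c"
  have C': "c' \<in> Conf" unfolding c'_def by (rule reflect_Conf[OF C(1)]) (use Rrow Redge in auto)
  have d': "depth c' u = (if u \<in> R then 2 * N - depth c u else depth c u)" for u
    by (simp add: c'_def depth_reflect)
  have rng: "0 \<le> depth c' (x, 0)" "depth c' (x, 0) \<le> 2 * N" for x
    using C(3,4)[of x] N by (auto simp: d')
  have kap': "kap c' x = (if (x, 0) \<in> R then - kap c x else kap c x)" if "odd (depth c (x, 0))" for x
    using that N by (auto simp: c'_def kap_reflect sg_def)
  have kc: "kapcond {0, 2 * N} c'"
    unfolding kapcond_def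
  proof (intro exI[of _ "\<lambda>x. \<tau> x * (if (x, 0) \<in> T then 1 else \<kappa> x)"] conjI allI impI)
    show "\<tau> x * (if (x, 0) \<in> T then 1 else \<kappa> x) \<in> {1, -1}" for x
      using \<tau>pm[of x] \<kappa>(1)[of x] by auto
    show "\<tau> x * (if (x, 0) \<in> T then 1 else \<kappa> x) = kap c' x" if "odd (depth c' (x, 0))" for x
    proof -
      have o: "odd (depth c (x, 0))" using that by (auto simp: d' split: if_splits)
      then have nT: "(x, 0) \<notin> T" using N unfolding Tb by auto
      then have "depth c (x, 0) < N" by (simp add: T_def)
      then show ?thesis using kap'[OF o] \<kappa>(2)[OF o] nT \<sigma>(4)[OF nT] \<sigma>(1)[of "(x, 0)"] by (auto simp: Rbot \<tau>_def)
    qed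
    fix x assume a: "depth c' (x - 1, 0) \<notin> {0, 2 * N} \<and> depth c' (x, 0) \<notin> {0, 2 * N}"
    then have nz: "depth c (x - 1, 0) \<noteq> 0" "depth c (x, 0) \<noteq> 0" using N by (auto simp: d' split: if_splits)
    consider "(x - 1, 0) \<notin> T" "(x, 0) \<notin> T" | "(x - 1, 0) \<notin> T" "(x, 0) \<in> T"
      | "(x - 1, 0) \<in> T" "(x, 0) \<in> T" | "(x - 1, 0) \<in> T" "(x, 0) \<notin> T" by blast
    then show "\<tau> (x - 1) * (if (x - 1, 0) \<in> T then 1 else \<kappa> (x - 1)) = \<tau> x * (if (x, 0) \<in> T then 1 else \<kappa> x)"
    proof cases
      case 1
      then have "\<kappa> (x - 1) = \<kappa> x" "f x = 1" using \<kappa>(3)[of x] nz by (auto simp: Tb f_def)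
      then show ?thesis using 1 by (simp add: \<tau>_step[of x])
    next
      case 2
      then have "\<kappa> (x - 1) = kap c (x - 1)" using \<kappa>(2) outer_odd[of x "x - 1"] by auto
      then show ?thesis using 2 by (simp add: \<tau>_step[of x] f_def)
    next
      case 3
      then show ?thesis by (simp add: \<tau>_step[of x] f_def)
    next
      case 4
      then have "\<kappa> x = kap c x" using \<kappa>(2) outer_odd[of "x - 1" x] by auto
      then show ?thesis using 4 \<kappa>(1)[of x] by (auto simp: \<tau>_step[of x] f_def)
    qed
  qed
  have low: "even_low c'"
    unfolding even_low_def
  proof (intro allI impI)
    fix x
    let ?S = "{u. depth c' u \<le> 0}" and ?S' = "{u. depth c u \<le> 0}"
    assume x: "depth c' (x, 0) \<le> 0" and nb: "\<not> bdry (comp_of n ?S (x, 0))"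
    have big: "2 \<le> depth c' u" if "u \<in> R" for u using that Rlt[OF that] N by (simp add: d')
    have x': "depth c (x, 0) \<le> 0" using x big[of "(x, 0)"] d'[of "(x, 0)"] by (cases "(x, 0) \<in> R") simp_all
    have eq: "comp_of n ?S' (x, 0) = comp_of n ?S (x, 0)"
    proof (rule comp_of_cong)
      fix v w assume v: "v \<in> comp_of n ?S (x, 0)" "cell_adj n v w"
      then have "depth c' v \<le> 0" using comp_of_subset[of "(x, 0)" ?S n] x by auto
      then have "depth c' w \<le> 1" using depth_adj[OF C' v(2)] by auto
      then show "w \<in> ?S \<longleftrightarrow> w \<in> ?S'" using big[of w] by (auto simp: d')
    qed (use x x' in auto)
    have *: "kap c' z = kap c z" if yz: "(y, 0) \<in> comp_of n ?S (x, 0)" "(z, 0) \<notin> comp_of n ?S (x, 0)" "\<bar>y - z\<bar> = 1" for y z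
    proof -
      have "depth c' (z, 0) > 0" using comp_bottom_edge[OF _ yz] x by auto
      moreover have "depth c' (y, 0) \<le> 0" using yz(1) comp_of_subset[of "(x, 0)" ?S n] x by auto
      moreover have "cell_adj n (y, 0) (z, 0)" using yz(3) by (auto simp: cell_adj_def arc_def)
      ultimately have "depth c' (z, 0) = 1" using depth_adj[OF C'] by fastforce
      then have "(z, 0) \<notin> R" using big[of "(z, 0)"] by auto
      then show ?thesis by (simp add: c'_def kap_reflect)
    qed
    have "th c' (comp_of n ?S (x, 0)) = th c (comp_of n ?S (x, 0))"
      by (rule th_cong) (use * in auto)
    then show "th c' (comp_of n ?S (x, 0)) = 1"
      using C(5) x' nb unfolding even_low_def eq[symmetric] by simp
  qed
  have high: "even_high (2 * N) c'"
    unfolding even_high_def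
  proof (intro allI impI)
    fix x
    let ?S = "{u. 2 * N \<le> depth c' u}" and ?S' = "{u. depth c u \<le> 0}"
    assume x: "2 * N \<le> depth c' (x, 0)"
    then have xR: "(x, 0) \<in> R" and x': "depth c (x, 0) \<le> 0" using C(4)[of x] N by (auto simp: d' split: if_splits)
    have sub: "v \<in> R" if "v \<in> comp_of n ?S' (x, 0)" for v
      using that
    proof (induction rule: comp_of_induct)
      case (step v w)
      then show ?case using Rclosed[of v w] N by auto
    qed (rule xR)
    have low': "depth c v \<le> 0" if "v \<in> comp_of n ?S' (x, 0)" for v
      using that comp_of_subset[of "(x, 0)" ?S' n] x' by auto
    have nbr: "w \<in> R" if "v \<in> comp_of n ?S' (x, 0)" "cell_adj n v w" for v w
      using Rclosed[OF sub[OF that(1)] that(2)] low'[OF that(1)] depth_adj[OF C(1) that(2)] N by auto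
    have eq: "comp_of n ?S (x, 0) = comp_of n ?S' (x, 0)"
    proof (rule comp_of_cong)
      fix v w assume "v \<in> comp_of n ?S' (x, 0)" "cell_adj n v w"
      then show "w \<in> ?S' \<longleftrightarrow> w \<in> ?S" using nbr by (auto simp: d')
    qed (use x x' in auto)
    have *: "kap c' z = - kap c z" if yz: "(y, 0) \<in> comp_of n ?S' (x, 0)" "(z, 0) \<notin> comp_of n ?S' (x, 0)" "\<bar>y - z\<bar> = 1" for y z
    proof -
      have a: "cell_adj n (y, 0) (z, 0)" using yz(3) by (auto simp: cell_adj_def arc_def)
      have "depth c (z, 0) > 0" using comp_bottom_edge[OF _ yz] x' by auto
      then have "depth c (z, 0) = 1" using depth_adj[OF C(1) a] low'[OF yz(1)] by fastforce
      then show ?thesis using kap'[of z] nbr[OF yz(1) a] by simp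
    qed
    have "th c' (comp_of n ?S' (x, 0)) = th c (comp_of n ?S' (x, 0))"
      by (rule th_even_count) (use * sub Rrow in fastforce)+
    moreover have "\<not> bdry (comp_of n ?S' (x, 0))"
      using sub Rrow unfolding bdry_def by fastforce
    ultimately show "th c' (comp_of n ?S (x, 0)) = 1"
      using C(5) x' unfolding even_low_def eq by simp
  qed
  have "c' \<in> Zc (2 * N)"
    using C' C(2) rng kc low high by (auto simp: Zc_def) (simp add: c'_def)
  moreover have "above N c' = R"
  proof -
    have bot: "N < depth c' (x, 0) \<longleftrightarrow> (x, 0) \<in> R" for x
      using Rlt[of "(x, 0)"] C(4)[of x] by (auto simp: d')
    have inR: "v \<in> R" if "(x, 0) \<in> R" "v \<in> comp_of n {v. depth c v < N} (x, 0)" for v x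
      using that(2)
    proof (induction rule: comp_of_induct)
      case (step v w)
      then show ?case using Rclosed[of v w] by auto
    qed (rule that(1))
    have comp: "comp_of n {v. N < depth c' v} (x, 0) = comp_of n {v. depth c v < N} (x, 0)" if x: "(x, 0) \<in> R" for x
    proof (rule comp_of_cong)
      fix v w assume v: "v \<in> comp_of n {v. depth c v < N} (x, 0)" "cell_adj n v w"
      have vR: "v \<in> R" using inR[OF x v(1)] .
      show "w \<in> {v. depth c v < N} \<longleftrightarrow> w \<in> {v. N < depth c' v}"
        using Redge[OF vR _ v(2)] Rlt[of w] by (auto simp: d')
    qed (use x bot Rlt in auto)
    \<comment> \<open>\<open>\<sigma>\<close> is constant on a component of depth below
      \<open>N\<close>, so \<open>R\<close> consists of whole components.\<close>
    have rback: "(x, 0) \<in> R" if "u \<in> R" "depth c (x, 0) < N" "u \<in> comp_of n {v. depth c v < N} (x, 0)" for u x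
    proof -
      have "\<sigma> u = \<sigma> (x, 0)" using that(3)
      proof (induction rule: comp_of_induct)
        case (step v w)
        then show ?case using \<sigma>(2)[of v w] by (auto simp: T_def)
      qed simp
      then show ?thesis using that by (simp add: Rbot) (simp add: R_def)
    qed
    show ?thesis
    proof (intro equalityI subsetI)
      fix u assume "u \<in> above N c'"
      then obtain x where "(x, 0) \<in> R" "u \<in> comp_of n {v. N < depth c' v} (x, 0)" by (auto simp: above_def bot)
      then show "u \<in> R" using comp inR by blast
    next
      fix u assume u: "u \<in> R"
      then obtain x where x: "depth c (x, 0) < N" "u \<in> comp_of n {v. depth c v < N} (x, 0)" by (auto simp: R_def)
      have "(x, 0) \<in> R" using rback[OF u x] .
      then show "u \<in> above N c'" using x(2) comp unfolding above_def bot by blast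
    qed
  qed
  ultimately show ?thesis by (intro bexI[of _ c']) (simp_all add: fold_conf_def c'_def)
qed

section \<open>Dropping the bound on the depth\<close>

definition Tc :: "conf set" where
  "Tc = {c \<in> Conf. Qbd c \<and> (\<forall>x. 0 \<le> depth c (x, 0)) \<and> kapcond {0} c \<and> even_low c}"

text \<open>There are finitely many configurations, and in each the depth vanishes outside the
  window. Beyond the largest bottom depth the conditions that involve \<open>N\<close> say nothing
  new.\<close>

lemma Zc_large: "\<exists>M. \<forall>N>M. Zc N = Tc"
proof -
  let ?A = "(\<lambda>(c, x). depth c (x, 0)) ` (Conf \<times> {-W..W})"
  have fin: "finite ?A" using finite_Conf by auto
  define M where "M = Max (insert 0 ?A)"
  have M: "depth c (x, 0) \<le> M" if "c \<in> Conf" for c x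
  proof (cases "x \<in> {-W..W}")
    case True
    then have "depth c (x, 0) \<in> insert 0 ?A" using that by force
    then show ?thesis unfolding M_def using fin by (intro Max_ge) auto
  next
    case False
    then have "depth c (x, 0) = 0" using depth_far[OF that, of "(x, 0)"] by auto
    then show ?thesis unfolding M_def using fin by (intro Max_ge) auto
  qed
  have "Zc N = Tc" if N: "M < N" for N
  proof -
    have ne: "depth c (x, 0) < N" if "c \<in> Conf" for c x using M[OF that, of x] N by simp
    have "even_high N c" if "c \<in> Conf" for c using ne[OF that] by (auto simp: even_high_def not_less[symmetric])
    moreover have "kapcond {0, N} c \<longleftrightarrow> kapcond {0} c" if "c \<in> Conf" for c
    proof -
      have e: "depth c (x, 0) \<notin> {0, N} \<longleftrightarrow> depth c (x, 0) \<notin> {0}" for x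
        using ne[OF that, of x] by auto
      show ?thesis unfolding kapcond_def e ..
    qed
    moreover have "depth c (x, 0) \<le> N" if "c \<in> Conf" for c x using ne[OF that, of x] by simp
    ultimately show ?thesis unfolding Zc_def Tc_def by blast
  qed
  then show ?thesis by blast
qed

text \<open>The powers of 2 start at the bottom depth of the determinant, are even, and exceed every
  bound. The hypothesis on \<open>wt\<close> is tailored to the reflections, which preserve the sum
  of the heights, hence \<open>Qf\<close>, and keep the bottom depth nonnegative.\<close>

theorem sum_Xc_Tc:
  fixes wt :: "conf \<Rightarrow> 'r::comm_ring_1"
  assumes wt: "\<And>c c'. c \<in> Conf \<Longrightarrow> c' \<in> Conf \<Longrightarrow> Qbd c \<Longrightarrow> (\<And>x. 0 \<le> depth c (x, 0)) \<Longrightarrow>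
    (\<And>x. 0 \<le> depth c' (x, 0)) \<Longrightarrow> tot c = tot c' \<Longrightarrow> wt c = wt c'"
  shows "(\<Sum>c\<in>Xc. of_int (th c {u. 2 \<le> depth c u}) * wt c) = (\<Sum>c\<in>Tc. wt c)"
proof -
  have dbl: "(\<Sum>c\<in>Zc N. wt c) = (\<Sum>c\<in>Zc (2 * N). wt c)" if N: "2 \<le> N" "even N" for N
  proof -
    have bij: "bij_betw (fold_conf N) (Zc (2 * N)) (Zc N)"
      unfolding bij_betw_def using fold_inj[OF N] fold_Zc[OF N] unfold_exists[OF N] by blast
    have "(\<Sum>c\<in>Zc N. wt c) = (\<Sum>c\<in>Zc (2 * N). wt (fold_conf N c))"
      by (rule sum.reindex_bij_betw[OF bij, symmetric])
    also have "\<dots> = (\<Sum>c\<in>Zc (2 * N). wt c)"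
    proof (rule sum.cong)
      fix c assume c: "c \<in> Zc (2 * N)"
      show "wt (fold_conf N c) = wt c"
        by (rule wt) (use c fold_Zc[OF N c] in \<open>auto simp: Zc_def\<close>)
    qed simp
    finally show ?thesis .
  qed
  have pow: "(\<Sum>c\<in>Zc 2. wt c) = (\<Sum>c\<in>Zc (2 ^ Suc k). wt c)" for k
  proof (induction k)
    case (Suc k)
    then show ?case using dbl[of "2 ^ Suc k"] self_le_power[of "2::int" "Suc k"] by simp
  qed simp
  obtain M where M: "\<And>N. M < N \<Longrightarrow> Zc N = Tc" using Zc_large by blast
  have "M < 2 ^ Suc (nat M)"
  proof -
    have "nat M < 2 ^ nat M" by (rule less_exp)
    then have "int (nat M) < 2 ^ nat M" by (metis of_nat_less_iff of_nat_numeral of_nat_power)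
    moreover have "M \<le> int (nat M)" "(0::int) < 2 ^ nat M" by simp_all
    ultimately show ?thesis unfolding power_Suc by linarith
  qed
  then have "(\<Sum>c\<in>Zc 2. wt c) = (\<Sum>c\<in>Tc. wt c)" using pow[of "nat M"] M by simp
  moreover have "(\<Sum>c\<in>Xc. of_int (th c {u. 2 \<le> depth c u}) * wt c) = (\<Sum>c\<in>Zc 2. wt c)"
    by (rule sum_Xc, rule wt) (auto simp: Xc_def)
  ultimately show ?thesis by simp
qed

end

section \<open>Invariance of the weight\<close>

lemma exponent_exchange:
  fixes a1 a2 a1' a2' :: int
  assumes "a1 - a2 \<in> {0, 1}" "a1' - a2' \<in> {0, 1}"
  shows "\<exists>F. nat (a1 - a2) + nat (a1' - a1) = F + nat (a2' - a2)
     \<and> nat (a1' - a2') + nat (a1 - a1') = F + nat (a2 - a2')"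
proof (intro exI conjI)
  \<comment> \<open>A difference of exponents enters through its positive part on one side and its
    negative part on the other, so that no inverse of a variable occurs. \<open>?F\<close> is the
    rest common to both sides.\<close>
  let ?F = "nat (a1 - a2 + max 0 (a1' - a1) - max 0 (a2' - a2))"
  show "nat (a1 - a2) + nat (a1' - a1) = ?F + nat (a2' - a2)" using assms by (auto simp: max_def)
  show "nat (a1' - a2') + nat (a1 - a1') = ?F + nat (a2 - a2')" using assms by (auto simp: max_def)
qed

context strip
begin

text \<open>The first exponent counts the dual lower paths that stay at \<open>x\<close> between row
  \<open>r\<close> and the next one, the second the upper paths that leave \<open>x\<close>: these
  are the steps that carry a label.\<close>

definition row_wt :: "(int \<Rightarrow> nat \<Rightarrow> 'r) \<Rightarrow> (int \<Rightarrow> nat \<Rightarrow> 'r) \<Rightarrow> conf \<Rightarrow> nat \<Rightarrow> 'r::comm_ring_1" where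
  "row_wt zf zg c r = (\<Prod>x\<in>{-W..W}. zf x r ^ nat (snd c (x - 1, r) - snd c (x, Suc r))
     * zg x r ^ nat (fst c (x, Suc r) - fst c (x, r)))"

text \<open>The depth of the parity class of \<open>x\<close> alone. For a tableau it is the number
  of columns with a pair of E-steps that starts at \<open>x\<close>.\<close>

definition mid_exp :: "conf \<Rightarrow> int \<Rightarrow> int" where
  "mid_exp c x = (depth c (x, 0) + sg x * Qf c x) div 2"

definition conf_wt :: "(int \<Rightarrow> nat \<Rightarrow> 'r) \<Rightarrow> (int \<Rightarrow> nat \<Rightarrow> 'r) \<Rightarrow> conf \<Rightarrow> 'r::comm_ring_1" where
  "conf_wt zf zg c = (\<Prod>r<n. row_wt zf zg c r) * (\<Prod>x\<in>{-W..W}. (zf (x + 1) 0 * zg x 0) ^ nat (mid_exp c x))"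

text \<open>The relation trades the product of two variables of row \<open>r\<close> for a product
  of variables of row \<open>r + 1\<close>. So the discrepancy between two configurations with equal
  sums is moved up by one row, and the factor \<open>M\<close> left behind is the same for
  both.\<close>

lemma row_exchange:
  fixes zf zg :: "int \<Rightarrow> nat \<Rightarrow> 'r::comm_ring_1"
  assumes c: "c \<in> Conf" "c' \<in> Conf" "tot c = tot c'" and r: "r < n"
    and rel: "\<And>x. zf x r * zg x r = zf (x + 1) (Suc r) * zg x (Suc r)"
  shows "\<exists>M. row_wt zf zg c r * (\<Prod>x\<in>{-W..W}. (zf (x + 1) r * zg x r) ^ nat (fst c (x, r) - fst c' (x, r)))
      = M * (\<Prod>x\<in>{-W..W}. (zf (x + 1) (Suc r) * zg x (Suc r)) ^ nat (fst c (x, Suc r) - fst c' (x, Suc r)))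
    \<and> row_wt zf zg c' r * (\<Prod>x\<in>{-W..W}. (zf (x + 1) r * zg x r) ^ nat (fst c' (x, r) - fst c (x, r)))
      = M * (\<Prod>x\<in>{-W..W}. (zf (x + 1) (Suc r) * zg x (Suc r)) ^ nat (fst c' (x, Suc r) - fst c (x, Suc r)))"
proof -
  have swap: "fst c u - fst c' u = snd c' u - snd c u" for u
    using fun_cong[OF c(3), of u] by (simp add: tot_def)
  have h: "hfun n tb (fst c)" "hfun n ta (snd c)" "hfun n tb (fst c')" "hfun n ta (snd c')"
    using c by (auto simp: Conf_def)
  have arcs: "arc n (x - 1, r) (x, Suc r)" "arc n (x, Suc r) (x, r)" for x using r by (auto simp: arc_def)
  have "\<forall>x. \<exists>F. nat (snd c (x - 1, r) - snd c (x, Suc r)) + nat (fst c (x - 1, r) - fst c' (x - 1, r))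
        = F + nat (fst c (x, Suc r) - fst c' (x, Suc r))
      \<and> nat (snd c' (x - 1, r) - snd c' (x, Suc r)) + nat (fst c' (x - 1, r) - fst c (x - 1, r))
        = F + nat (fst c' (x, Suc r) - fst c (x, Suc r))"
  proof
    fix x
    have s: "fst c' u - fst c u = snd c u - snd c' u" for u using swap[of u] by simp
    show "\<exists>F. nat (snd c (x - 1, r) - snd c (x, Suc r)) + nat (fst c (x - 1, r) - fst c' (x - 1, r))
        = F + nat (fst c (x, Suc r) - fst c' (x, Suc r))
      \<and> nat (snd c' (x - 1, r) - snd c' (x, Suc r)) + nat (fst c' (x - 1, r) - fst c (x - 1, r))
        = F + nat (fst c' (x, Suc r) - fst c (x, Suc r))"
      unfolding swap s
      by (rule exponent_exchange) (use hfunD[OF h(2) arcs(1)[of x]] hfunD[OF h(4) arcs(1)[of x]] in auto)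
  qed
  then obtain F where F: "\<And>x. nat (snd c (x - 1, r) - snd c (x, Suc r)) + nat (fst c (x - 1, r) - fst c' (x - 1, r))
        = F x + nat (fst c (x, Suc r) - fst c' (x, Suc r))"
      "\<And>x. nat (snd c' (x - 1, r) - snd c' (x, Suc r)) + nat (fst c' (x - 1, r) - fst c (x - 1, r))
        = F x + nat (fst c' (x, Suc r) - fst c (x, Suc r))" by metis
  have "\<forall>x. \<exists>G. nat (fst c (x, Suc r) - fst c (x, r)) + nat (fst c (x, r) - fst c' (x, r))
        = G + nat (fst c (x, Suc r) - fst c' (x, Suc r))
      \<and> nat (fst c' (x, Suc r) - fst c' (x, r)) + nat (fst c' (x, r) - fst c (x, r))
        = G + nat (fst c' (x, Suc r) - fst c (x, Suc r))"
  proof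
    fix x
    have "\<exists>G. nat (- fst c (x, r) - - fst c (x, Suc r)) + nat (- fst c' (x, r) - - fst c (x, r))
        = G + nat (- fst c' (x, Suc r) - - fst c (x, Suc r))
      \<and> nat (- fst c' (x, r) - - fst c' (x, Suc r)) + nat (- fst c (x, r) - - fst c' (x, r))
        = G + nat (- fst c (x, Suc r) - - fst c' (x, Suc r))"
      by (rule exponent_exchange) (use hfunD[OF h(1) arcs(2)[of x]] hfunD[OF h(3) arcs(2)[of x]] in auto)
    then show "\<exists>G. nat (fst c (x, Suc r) - fst c (x, r)) + nat (fst c (x, r) - fst c' (x, r))
        = G + nat (fst c (x, Suc r) - fst c' (x, Suc r))
      \<and> nat (fst c' (x, Suc r) - fst c' (x, r)) + nat (fst c' (x, r) - fst c (x, r))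
        = G + nat (fst c' (x, Suc r) - fst c (x, Suc r))" by simp
  qed
  then obtain G where G: "\<And>x. nat (fst c (x, Suc r) - fst c (x, r)) + nat (fst c (x, r) - fst c' (x, r))
        = G x + nat (fst c (x, Suc r) - fst c' (x, Suc r))"
      "\<And>x. nat (fst c' (x, Suc r) - fst c' (x, r)) + nat (fst c' (x, r) - fst c (x, r))
        = G x + nat (fst c' (x, Suc r) - fst c (x, Suc r))" by metis
  have main: "row_wt zf zg c r * (\<Prod>x\<in>{-W..W}. (zf (x + 1) r * zg x r) ^ nat (fst c (x, r) - fst c' (x, r)))
      = (\<Prod>x\<in>{-W..W}. zf x r ^ F x * zg x r ^ G x)
       * (\<Prod>x\<in>{-W..W}. (zf (x + 1) (Suc r) * zg x (Suc r)) ^ nat (fst c (x, Suc r) - fst c' (x, Suc r)))"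
    if c: "c \<in> Conf" "c' \<in> Conf"
      and F: "\<And>x. nat (snd c (x - 1, r) - snd c (x, Suc r)) + nat (fst c (x - 1, r) - fst c' (x - 1, r))
        = F x + nat (fst c (x, Suc r) - fst c' (x, Suc r))"
      and G: "\<And>x. nat (fst c (x, Suc r) - fst c (x, r)) + nat (fst c (x, r) - fst c' (x, r))
        = G x + nat (fst c (x, Suc r) - fst c' (x, Suc r))" for c c'
  proof -
    let ?d = "\<lambda>x. nat (fst c (x, r) - fst c' (x, r))"
    have d0: "?d x = 0" if "W - 2 \<le> \<bar>x\<bar>" for x
      using that Conf_far[OF c(1), of r x] Conf_far[OF c(2), of r x] r by (auto simp: abs_if split: if_splits)
    have "(\<Prod>x\<in>{-W..W}. zf (x + 1) r ^ ?d x) = (\<Prod>x\<in>{-W + 1..W + 1}. zf x r ^ ?d (x - 1))"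
      by (rule prod.reindex_bij_witness[of _ "\<lambda>x. x - 1" "\<lambda>x. x + 1"]) auto
    also have "\<dots> = (\<Prod>x\<in>{-W + 1..W}. zf x r ^ ?d (x - 1))"
      by (rule prod.mono_neutral_right) (use d0 in auto)
    also have "\<dots> = (\<Prod>x\<in>{-W..W}. zf x r ^ ?d (x - 1))"
      by (rule prod.mono_neutral_left) (use d0 in auto)
    finally have sh: "(\<Prod>x\<in>{-W..W}. zf (x + 1) r ^ ?d x) = (\<Prod>x\<in>{-W..W}. zf x r ^ ?d (x - 1))" .
    have "row_wt zf zg c r * (\<Prod>x\<in>{-W..W}. (zf (x + 1) r * zg x r) ^ ?d x)
      = (\<Prod>x\<in>{-W..W}. zf x r ^ (nat (snd c (x - 1, r) - snd c (x, Suc r)) + ?d (x - 1))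
          * zg x r ^ (nat (fst c (x, Suc r) - fst c (x, r)) + ?d x))"
      unfolding row_wt_def power_mult_distrib prod.distrib sh power_add by (simp add: ac_simps)
    also have "\<dots> = (\<Prod>x\<in>{-W..W}. (zf x r ^ F x * zg x r ^ G x)
        * (zf (x + 1) (Suc r) * zg x (Suc r)) ^ nat (fst c (x, Suc r) - fst c' (x, Suc r)))"
      unfolding F G rel[symmetric] by (simp add: power_add power_mult_distrib ac_simps)
    finally show ?thesis by (simp only: prod.distrib)
  qed
  show ?thesis
    by (intro exI conjI, rule main[OF c(1,2) F(1) G(1)], rule main[OF c(2,1) F(2) G(2)])
qed

text \<open>At the top row the two configurations agree, so the discrepancy that has been moved up
  vanishes there.\<close>

lemma rows_exchange:
  fixes zf zg :: "int \<Rightarrow> nat \<Rightarrow> 'r::comm_ring_1"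
  assumes c: "c \<in> Conf" "c' \<in> Conf" "tot c = tot c'" and "r \<le> n"
    and rel: "\<And>x r. r < n \<Longrightarrow> zf x r * zg x r = zf (x + 1) (Suc r) * zg x (Suc r)"
  shows "(\<Prod>s\<in>{r..<n}. row_wt zf zg c s) * (\<Prod>x\<in>{-W..W}. (zf (x + 1) r * zg x r) ^ nat (fst c (x, r) - fst c' (x, r)))
    = (\<Prod>s\<in>{r..<n}. row_wt zf zg c' s) * (\<Prod>x\<in>{-W..W}. (zf (x + 1) r * zg x r) ^ nat (fst c' (x, r) - fst c (x, r)))"
  using \<open>r \<le> n\<close>
proof (induction rule: inc_induct)
  case base
  have "fst c (x, n) = fst c' (x, n)" for x using c by (simp add: Conf_def hfun_def)
  then show ?case by simp
next
  case (step r)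
  obtain M where M: "row_wt zf zg c r * (\<Prod>x\<in>{-W..W}. (zf (x + 1) r * zg x r) ^ nat (fst c (x, r) - fst c' (x, r)))
      = M * (\<Prod>x\<in>{-W..W}. (zf (x + 1) (Suc r) * zg x (Suc r)) ^ nat (fst c (x, Suc r) - fst c' (x, Suc r)))"
    "row_wt zf zg c' r * (\<Prod>x\<in>{-W..W}. (zf (x + 1) r * zg x r) ^ nat (fst c' (x, r) - fst c (x, r)))
      = M * (\<Prod>x\<in>{-W..W}. (zf (x + 1) (Suc r) * zg x (Suc r)) ^ nat (fst c' (x, Suc r) - fst c (x, Suc r)))"
    using row_exchange[of c c' r zf zg, OF c step(2) rel[OF step(2)]] by blast
  have ins: "(\<Prod>s\<in>{r..<n}. row_wt zf zg c s) = row_wt zf zg c r * (\<Prod>s\<in>{Suc r..<n}. row_wt zf zg c s)" for c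
    using step(2) by (rule prod.atLeast_Suc_lessThan)
  have "(\<Prod>s\<in>{r..<n}. row_wt zf zg c s) * (\<Prod>x\<in>{-W..W}. (zf (x + 1) r * zg x r) ^ nat (fst c (x, r) - fst c' (x, r)))
    = (\<Prod>s\<in>{Suc r..<n}. row_wt zf zg c s) * (row_wt zf zg c r * (\<Prod>x\<in>{-W..W}. (zf (x + 1) r * zg x r) ^ nat (fst c (x, r) - fst c' (x, r))))"
    unfolding ins by (simp only: ac_simps)
  also have "\<dots> = M * ((\<Prod>s\<in>{Suc r..<n}. row_wt zf zg c s)
      * (\<Prod>x\<in>{-W..W}. (zf (x + 1) (Suc r) * zg x (Suc r)) ^ nat (fst c (x, Suc r) - fst c' (x, Suc r))))"
    unfolding M by (simp only: ac_simps)
  also have "\<dots> = M * ((\<Prod>s\<in>{Suc r..<n}. row_wt zf zg c' s)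
      * (\<Prod>x\<in>{-W..W}. (zf (x + 1) (Suc r) * zg x (Suc r)) ^ nat (fst c' (x, Suc r) - fst c (x, Suc r))))"
    unfolding step(3) ..
  also have "\<dots> = (\<Prod>s\<in>{Suc r..<n}. row_wt zf zg c' s) * (row_wt zf zg c' r * (\<Prod>x\<in>{-W..W}. (zf (x + 1) r * zg x r) ^ nat (fst c' (x, r) - fst c (x, r))))"
    unfolding M by (simp only: ac_simps)
  also have "\<dots> = (\<Prod>s\<in>{r..<n}. row_wt zf zg c' s) * (\<Prod>x\<in>{-W..W}. (zf (x + 1) r * zg x r) ^ nat (fst c' (x, r) - fst c (x, r)))"
    unfolding ins by (simp only: ac_simps)
  finally show ?case .
qed

lemma mid_exp_double: "c \<in> Conf \<Longrightarrow> 2 * mid_exp c x = depth c (x, 0) + sg x * Qf c x"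
proof -
  assume c: "c \<in> Conf"
  have "even (depth c (x, 0) + sg x * Qf c x)"
    using Qf_parity[OF c, of x] sg_cases[of x] by auto
  then show ?thesis by (simp add: mid_exp_def)
qed

lemma mid_exp_nonneg: "c \<in> Conf \<Longrightarrow> Qbd c \<Longrightarrow> 0 \<le> depth c (x, 0) \<Longrightarrow> 0 \<le> mid_exp c x"
  using mid_exp_double[of c x] sg_cases[of x] by (auto simp: Qbd_def abs_le_iff dest: spec[of _ x])

lemma conf_wt_tot:
  fixes zf zg :: "int \<Rightarrow> nat \<Rightarrow> 'r::comm_ring_1"
  assumes c: "c \<in> Conf" "c' \<in> Conf" "tot c = tot c'" and Q: "Qbd c"
    and nn: "\<And>x. 0 \<le> depth c (x, 0)" "\<And>x. 0 \<le> depth c' (x, 0)"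
    and rel: "\<And>x r. r < n \<Longrightarrow> zf x r * zg x r = zf (x + 1) (Suc r) * zg x (Suc r)"
  shows "conf_wt zf zg c = conf_wt zf zg c'"
proof -
  have QQ: "Qf c = Qf c'" by (rule Qf_tot[OF c(3)])
  then have Q': "Qbd c'" using Q by (simp add: Qbd_def)
  let ?w = "\<lambda>x. zf (x + 1) 0 * zg x 0"
  \<comment> \<open>The middle exponents differ exactly by the discrepancy in the bottom row. Their
    minimum is split off, and what remains is consumed by \<open>rows_exchange\<close>. Both
    exponents are nonnegative by the conditions on the depth and on \<open>Qf\<close>.\<close>
  let ?R = "\<lambda>x. nat (min (mid_exp c x) (mid_exp c' x))"
  have d: "mid_exp c x - mid_exp c' x = fst c (x, 0) - fst c' (x, 0)" for x
    using mid_exp_double[OF c(1), of x] mid_exp_double[OF c(2), of x] fun_cong[OF c(3), of "(x, 0)"]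
    by (simp add: QQ depth_def tot_def)
  have e: "nat (mid_exp c x) = ?R x + nat (fst c (x, 0) - fst c' (x, 0))"
    "nat (mid_exp c' x) = ?R x + nat (fst c' (x, 0) - fst c (x, 0))" for x
    using d[of x] mid_exp_nonneg[OF c(1) Q nn(1), of x] mid_exp_nonneg[OF c(2) Q' nn(2), of x] by auto
  have "(\<Prod>r<n. row_wt zf zg c r) * (\<Prod>x\<in>{-W..W}. ?w x ^ nat (fst c (x, 0) - fst c' (x, 0)))
    = (\<Prod>r<n. row_wt zf zg c' r) * (\<Prod>x\<in>{-W..W}. ?w x ^ nat (fst c' (x, 0) - fst c (x, 0)))"
    using rows_exchange[OF c, of 0 zf zg] rel by (simp add: lessThan_atLeast0)
  then have "(\<Prod>x\<in>{-W..W}. ?w x ^ ?R x) * ((\<Prod>r<n. row_wt zf zg c r) * (\<Prod>x\<in>{-W..W}. ?w x ^ nat (fst c (x, 0) - fst c' (x, 0))))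
    = (\<Prod>x\<in>{-W..W}. ?w x ^ ?R x) * ((\<Prod>r<n. row_wt zf zg c' r) * (\<Prod>x\<in>{-W..W}. ?w x ^ nat (fst c' (x, 0) - fst c (x, 0))))"
    by simp
  then show ?thesis
    unfolding conf_wt_def e power_add prod.distrib by (simp only: ac_simps)
qed

end

section \<open>Determinants of path matrices\<close>

definition dt :: "nat \<Rightarrow> (nat \<Rightarrow> nat \<Rightarrow> 'r::comm_ring_1) \<Rightarrow> 'r" where
  "dt l M = det (mat l l (\<lambda>(i, j). M i j))"

definition dec :: "nat \<Rightarrow> (nat \<Rightarrow> int) \<Rightarrow> bool" where
  "dec l f \<longleftrightarrow> (\<forall>i k. i < k \<longrightarrow> k < l \<longrightarrow> f k < f i)"

lemma dt_sum: "dt l M = (\<Sum>p | p permutes {0..<l}. signof p * (\<Prod>i = 0..<l. M i (p i)))"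
proof -
  have "(\<Prod>i = 0..<l. mat l l (\<lambda>(i, j). M i j) $$ (i, p i)) = (\<Prod>i = 0..<l. M i (p i))"
    if "p permutes {0..<l}" for p
    by (rule prod.cong) (use that permutes_in_image[OF that] in auto)
  then show ?thesis unfolding dt_def by (subst det_def') (auto intro!: sum.cong)
qed

lemma dt_cong: "(\<And>i j. i < l \<Longrightarrow> j < l \<Longrightarrow> M i j = N i j) \<Longrightarrow> dt l M = dt l N"
  unfolding dt_def by (rule arg_cong[of _ _ det], rule cong_mat) auto

lemma dt_transpose: "dt l (\<lambda>i j. M j i) = dt l M"
proof -
  have "transpose_mat (mat l l (\<lambda>(i, j). M i j)) = mat l l (\<lambda>(i, j). M j i)"
    by (rule eq_matI) auto
  then show ?thesis unfolding dt_def by (metis det_transpose mat_carrier)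
qed

lemma dt_rows_expand:
  assumes "\<And>i. finite (S i)"
  shows "dt l (\<lambda>i j. \<Sum>y\<in>S i. g i y * R y j)
    = (\<Sum>h\<in>Pi\<^sub>E {0..<l} S. (\<Prod>i = 0..<l. g i (h i)) * dt l (\<lambda>i j. R (h i) j))"
proof -
  have "dt l (\<lambda>i j. \<Sum>y\<in>S i. g i y * R y j)
      = (\<Sum>p | p permutes {0..<l}. signof p * (\<Sum>h\<in>Pi\<^sub>E {0..<l} S. \<Prod>i = 0..<l. g i (h i) * R (h i) (p i)))"
    unfolding dt_sum by (subst prod_sum_PiE) (use assms in auto)
  also have "\<dots> = (\<Sum>h\<in>Pi\<^sub>E {0..<l} S. (\<Prod>i = 0..<l. g i (h i)) * dt l (\<lambda>i j. R (h i) j))"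
    unfolding dt_sum sum_distrib_left
    by (subst sum.swap) (simp add: prod.distrib ac_simps)
  finally show ?thesis .
qed

lemma dt_equal_rows:
  assumes "i \<noteq> k" "i < l" "k < l" "\<And>j. j < l \<Longrightarrow> M i j = M k j"
  shows "dt l M = 0"
  unfolding dt_def
  by (rule det_identical_rows[of _ l i k]) (use assms in \<open>auto intro!: eq_vecI\<close>)

lemma dt_scale_rows: "dt l (\<lambda>i j. w i * N i j) = (\<Prod>i = 0..<l. w i) * dt l N"
  unfolding dt_sum sum_distrib_left by (simp add: prod.distrib ac_simps)

lemma dt_proportional_columns:
  assumes "k \<noteq> m" "k < l" "m < l" "\<And>i. i < l \<Longrightarrow> M i k = c * M i m"
  shows "dt l M = 0"
proof -
  have "dt l M = dt l (\<lambda>i j. M j i)" by (rule dt_transpose[symmetric])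
  also have "\<dots> = dt l (\<lambda>i j. (if i = k then c else 1) * M j (if i = k then m else i))"
    by (rule dt_cong) (use assms(4) in auto)
  also have "\<dots> = (\<Prod>i = 0..<l. if i = k then c else 1) * dt l (\<lambda>i j. M j (if i = k then m else i))"
    by (rule dt_scale_rows)
  also have "dt l (\<lambda>i j. M j (if i = k then m else i)) = 0"
    by (rule dt_equal_rows[of k m]) (use assms in auto)
  finally show ?thesis by simp
qed

lemma dt_permute_rows:
  assumes "p permutes {0..<l}"
  shows "dt l (\<lambda>i j. M (p i) j) = signof p * dt l M"
proof -
  have "mat l l (\<lambda>(i, j). mat l l (\<lambda>(i, j). M i j) $$ (p i, j)) = mat l l (\<lambda>(i, j). M (p i) j)"
    by (rule cong_mat) (use permutes_in_image[OF assms] in auto)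
  then show ?thesis unfolding dt_def using det_permute_rows[of "mat l l (\<lambda>(i, j). M i j)" l p] assms by simp
qed

lemma dt_first_row:
  assumes "m < Suc k" "\<And>j. j < Suc k \<Longrightarrow> j \<noteq> m \<Longrightarrow> M 0 j = 0"
  shows "dt (Suc k) M = (-1) ^ m * M 0 m * dt k (\<lambda>i j. M (Suc i) (if j < m then j else Suc j))"
proof -
  let ?A = "mat (Suc k) (Suc k) (\<lambda>(i, j). M i j)"
  have "det ?A = (\<Sum>j<Suc k. ?A $$ (0, j) * cofactor ?A 0 j)"
    by (rule laplace_expansion_row) auto
  also have "\<dots> = (\<Sum>j<Suc k. if j = m then M 0 m * cofactor ?A 0 m else 0)"
    by (rule sum.cong) (use assms in auto)
  also have "\<dots> = M 0 m * cofactor ?A 0 m" using assms(1) by simp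
  also have "mat_delete ?A 0 m = mat k k (\<lambda>(i, j). M (Suc i) (if j < m then j else Suc j))"
    unfolding mat_delete_def by (rule eq_matI) auto
  then have "cofactor ?A 0 m = (-1) ^ m * dt k (\<lambda>i j. M (Suc i) (if j < m then j else Suc j))"
    by (simp add: cofactor_def dt_def)
  finally show ?thesis by (simp add: dt_def ac_simps)
qed

lemma dec_inj: "dec l f \<Longrightarrow> i < l \<Longrightarrow> k < l \<Longrightarrow> f i = f k \<Longrightarrow> i = k"
  unfolding dec_def by (metis less_irrefl nat_neq_iff)

lemma dec_less_iff: "dec l f \<Longrightarrow> i < l \<Longrightarrow> k < l \<Longrightarrow> f k < f i \<longleftrightarrow> i < k"
  unfolding dec_def by (metis less_asym' linorder_less_linear less_irrefl)

lemma permutes_mono_id: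
  fixes p :: "nat \<Rightarrow> nat"
  assumes p: "p permutes {0..<l}" and mono: "\<And>i k. i < k \<Longrightarrow> k < l \<Longrightarrow> p i < p k"
  shows "p = id"
proof -
  have ge: "i \<le> p i" if "i < l" for i
    using that
  proof (induction i)
    case (Suc i)
    then show ?case using mono[of i "Suc i"] by simp
  qed simp
  have "(\<Sum>i\<in>{0..<l}. p i) = (\<Sum>i\<in>{0..<l}. i)"
    using sum.permute[OF p, of id] by (simp add: comp_def)
  then have "p i = i" if "i < l" for i
    using sum_mono_inv[of "\<lambda>i. i" "{0..<l}" p i] ge that by simp
  then have "p i = i" for i using permutes_not_in[OF p, of i] by (cases "i < l") auto
  then show ?thesis by (simp add: fun_eq_iff)
qed

text \<open>Only the identity can contribute, because a permutation carrying one decreasing map into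
  another is increasing.\<close>

lemma dt_delta:
  assumes "dec l g" "dec l w"
  shows "dt l (\<lambda>i j. if g i = w j then 1 else 0 :: 'r::comm_ring_1) = (if \<forall>i<l. g i = w i then 1 else 0)"
proof (cases "\<forall>i<l. g i = w i")
  case True
  have "dt l (\<lambda>i j. if g i = w j then 1 else 0 :: 'r) = det (1\<^sub>m l)"
    unfolding dt_def one_mat_def
    by (rule arg_cong[of _ _ det], rule cong_mat) (use True dec_inj[OF assms(2)] in auto)
  then show ?thesis using True by simp
next
  case False
  have "(\<Prod>i = 0..<l. if g i = w (p i) then 1 else 0 :: 'r) = 0" if p: "p permutes {0..<l}" for p
  proof (rule ccontr)
    assume "(\<Prod>i = 0..<l. if g i = w (p i) then 1 else 0 :: 'r) \<noteq> 0"
    then have e: "g i = w (p i)" if "i < l" for i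
      using that prod_zero[of "{0..<l}" "\<lambda>i. if g i = w (p i) then 1 else 0 :: 'r"] by fastforce
    have pl: "p i < l" if "i < l" for i using permutes_in_image[OF p, of i] that by simp
    have "p i < p k" if "i < k" "k < l" for i k
    proof -
      have "g k < g i" using assms(1) that by (simp add: dec_def)
      then have "w (p k) < w (p i)" using e that by simp
      then show ?thesis using dec_less_iff[OF assms(2), of "p i" "p k"] pl that by simp
    qed
    then have "p = id" by (rule permutes_mono_id[OF p])
    then show False using e False by auto
  qed
  then have "dt l (\<lambda>i j. if g i = w j then 1 else 0 :: 'r) = 0"
    unfolding dt_sum by (intro sum.neutral) auto
  then show ?thesis using False by auto
qed

definition moves :: "nat \<Rightarrow> (nat \<Rightarrow> int) \<Rightarrow> (nat \<Rightarrow> int) set" where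
  "moves l f = {h \<in> Pi\<^sub>E {0..<l} (\<lambda>i. {f i, f i + 1}). dec l h}"

lemma finite_moves: "finite (moves l f)"
  unfolding moves_def
  by (rule finite_subset[of _ "Pi\<^sub>E {0..<l} (\<lambda>i. {f i, f i + 1})"]) (auto intro!: finite_PiE)

text \<open>One layer of the Lindstroem-Gessel-Viennot expansion. The points of a decreasing family
  move by at most 1, so their order can only break by two of them meeting, and a meeting gives two
  equal rows. This takes the place of exchanging the ends of intersecting paths.\<close>

lemma dt_layer:
  assumes f: "dec l f" and C: "\<And>x j. C x j = p x * C' x j + q x * C' (x + 1) j"
  shows "dt l (\<lambda>i j. C (f i) j)
    = (\<Sum>h\<in>moves l f. (\<Prod>i = 0..<l. if h i = f i then p (f i) else q (f i)) * dt l (\<lambda>i j. C' (h i) j))"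
proof -
  let ?P = "Pi\<^sub>E {0..<l} (\<lambda>i. {f i, f i + 1})"
  have "C (f i) j = (\<Sum>y\<in>{f i, f i + 1}. (if y = f i then p (f i) else q (f i)) * C' y j)" for i j
    by (simp add: C)
  then have "dt l (\<lambda>i j. C (f i) j)
      = (\<Sum>h\<in>?P. (\<Prod>i = 0..<l. if h i = f i then p (f i) else q (f i)) * dt l (\<lambda>i j. C' (h i) j))"
    using dt_rows_expand[of "\<lambda>i. {f i, f i + 1}" l "\<lambda>i y. if y = f i then p (f i) else q (f i)" C'] by simp
  also have "\<dots> = (\<Sum>h\<in>moves l f. (\<Prod>i = 0..<l. if h i = f i then p (f i) else q (f i)) * dt l (\<lambda>i j. C' (h i) j))"
  proof (rule sum.mono_neutral_right)
    show "finite ?P" by (intro finite_PiE) auto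
    show "moves l f \<subseteq> ?P" by (auto simp: moves_def)
    show "\<forall>h\<in>?P - moves l f. (\<Prod>i = 0..<l. if h i = f i then p (f i) else q (f i)) * dt l (\<lambda>i j. C' (h i) j) = 0"
    proof
      fix h assume h: "h \<in> ?P - moves l f"
      then obtain i k where ik: "i < k" "k < l" "\<not> h k < h i" by (auto simp: moves_def dec_def)
      have "h i \<in> {f i, f i + 1}" "h k \<in> {f k, f k + 1}" using h ik by (auto simp: PiE_iff)
      moreover have "f k < f i" using f ik by (simp add: dec_def)
      ultimately have "h i = h k" using ik(3) by auto
      then have "dt l (\<lambda>i j. C' (h i) j) = 0" by (intro dt_equal_rows[of i k]) (use ik in auto)
      then show "(\<Prod>i = 0..<l. if h i = f i then p (f i) else q (f i)) * dt l (\<lambda>i j. C' (h i) j) = 0" by simp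
    qed
  qed
  finally show ?thesis .
qed

text \<open>Row \<open>s\<close> lists the abscissas of all paths, so nonintersection is the
  decrease of each row. Extensionality on both levels makes a family of paths a unique function, as
  sums over families and bijections require.\<close>

definition path_chains :: "nat \<Rightarrow> nat \<Rightarrow> (nat \<Rightarrow> int) \<Rightarrow> nat \<Rightarrow> (nat \<Rightarrow> nat \<Rightarrow> int) set" where
  "path_chains n l w r = {F \<in> extensional {r..n}. (\<forall>s\<in>{r..n}. dec l (F s) \<and> F s \<in> extensional {0..<l}) \<and> F n = w
     \<and> (\<forall>s\<in>{r..<n}. \<forall>i<l. F (Suc s) i = F s i \<or> F (Suc s) i = F s i + 1)}"

lemma path_chainsD: "F \<in> path_chains n l w r \<Longrightarrow> F \<in> extensional {r..n}" "F \<in> path_chains n l w r \<Longrightarrow> F n = w"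
  by (auto simp: path_chains_def)

lemma path_chains_top:
  assumes "dec l w" "w \<in> extensional {0..<l}"
  shows "path_chains n l w n = {restrict (\<lambda>_. w) {n}}"
proof (intro equalityI subsetI)
  fix F assume F: "F \<in> path_chains n l w n"
  have "F = restrict F {n..n}" using extensional_restrict[OF path_chainsD(1)[OF F]] by simp
  also have "\<dots> = restrict (\<lambda>_. w) {n}" using path_chainsD(2)[OF F] by (intro ext) (simp add: restrict_def)
  finally show "F \<in> {restrict (\<lambda>_. w) {n}}" by simp
qed (use assms in \<open>auto simp: path_chains_def\<close>)

lemma path_chains_cons:
  assumes "r < n" "dec l g" "g \<in> extensional {0..<l}"
  shows "bij_betw (\<lambda>F. restrict (F(r := g)) {r..n}) {F \<in> path_chains n l w (Suc r). F (Suc r) \<in> moves l g}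
    {F \<in> path_chains n l w r. F r = g}"
proof (rule bij_betw_byWitness[where f' = "\<lambda>F. restrict F {Suc r..n}"])
  show "\<forall>F\<in>{F \<in> path_chains n l w (Suc r). F (Suc r) \<in> moves l g}. restrict (restrict (F(r := g)) {r..n}) {Suc r..n} = F"
  proof
    fix F assume F: "F \<in> {F \<in> path_chains n l w (Suc r). F (Suc r) \<in> moves l g}"
    have "restrict (restrict (F(r := g)) {r..n}) {Suc r..n} = restrict F {Suc r..n}" by (rule restrict_ext) simp
    then show "restrict (restrict (F(r := g)) {r..n}) {Suc r..n} = F"
      using F extensional_restrict[OF path_chainsD(1)] by force
  qed
  show "\<forall>F\<in>{F \<in> path_chains n l w r. F r = g}. restrict ((restrict F {Suc r..n})(r := g)) {r..n} = F"
  proof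
    fix F assume F: "F \<in> {F \<in> path_chains n l w r. F r = g}"
    have "restrict ((restrict F {Suc r..n})(r := g)) {r..n} = restrict F {r..n}" by (rule restrict_ext) (use F in auto)
    then show "restrict ((restrict F {Suc r..n})(r := g)) {r..n} = F"
      using F extensional_restrict[OF path_chainsD(1)] by force
  qed
  show "(\<lambda>F. restrict (F(r := g)) {r..n}) ` {F \<in> path_chains n l w (Suc r). F (Suc r) \<in> moves l g} \<subseteq> {F \<in> path_chains n l w r. F r = g}"
  proof safe
    fix F assume F: "F \<in> path_chains n l w (Suc r)" "F (Suc r) \<in> moves l g"
    let ?F = "restrict (F(r := g)) {r..n}"
    show "?F r = g" using assms(1) by simp
    have v: "?F s = (if s = r then g else F s)" if "r \<le> s" "s \<le> n" for s using that by simp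
    have "dec l (?F s) \<and> ?F s \<in> extensional {0..<l}" if "s \<in> {r..n}" for s
    proof (cases "s = r")
      case False
      then have "s \<in> {Suc r..n}" using that by auto
      then show ?thesis using F(1) v[of s] that False unfolding path_chains_def by auto
    qed (use v[of s] that assms in auto)
    moreover have "?F (Suc s) i = ?F s i \<or> ?F (Suc s) i = ?F s i + 1" if s: "s \<in> {r..<n}" "i < l" for s i
    proof (cases "s = r")
      case True
      then show ?thesis using F(2) v[of r] v[of "Suc r"] s unfolding moves_def by (auto simp: PiE_iff)
    next
      case False
      then have "s \<in> {Suc r..<n}" using s by auto
      then show ?thesis using F(1) v[of s] v[of "Suc s"] s False unfolding path_chains_def by auto
    qed
    moreover have "?F n = w" using F(1) v[of n] assms(1) by (auto simp: path_chains_def)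
    ultimately show "?F \<in> path_chains n l w r" unfolding path_chains_def by blast
  qed
  show "(\<lambda>F. restrict F {Suc r..n}) ` {F \<in> path_chains n l w r. F r = g} \<subseteq> {F \<in> path_chains n l w (Suc r). F (Suc r) \<in> moves l g}"
  proof (rule image_subsetI)
    fix F assume "F \<in> {F \<in> path_chains n l w r. F r = g}"
    then have F: "\<And>s. s \<in> {r..n} \<Longrightarrow> dec l (F s)" "\<And>s. s \<in> {r..n} \<Longrightarrow> F s \<in> extensional {0..<l}" "F n = w"
      "\<And>s i. s \<in> {r..<n} \<Longrightarrow> i < l \<Longrightarrow> F (Suc s) i = F s i \<or> F (Suc s) i = F s i + 1" "F r = g"
      unfolding path_chains_def by auto
    let ?G = "restrict F {Suc r..n}"
    have v: "?G s = F s" if "Suc r \<le> s" "s \<le> n" for s using that by simp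
    have "?G \<in> path_chains n l w (Suc r)"
      unfolding path_chains_def
    proof (intro CollectI conjI ballI allI impI)
      fix s i assume "s \<in> {Suc r..<n}" "i < l"
      then show "?G (Suc s) i = ?G s i \<or> ?G (Suc s) i = ?G s i + 1"
        using F(4)[of s i] v[of s] v[of "Suc s"] by simp
    next
      fix s assume "s \<in> {Suc r..n}"
      then show "dec l (?G s)" "?G s \<in> extensional {0..<l}" using F(1,2)[of s] v[of s] by simp_all
    qed (use F(3) v[of n] assms(1) in simp_all)
    moreover have "?G (Suc r) \<in> moves l g"
      using F(1,2)[of "Suc r"] F(4)[of r] F(5) assms(1) v[of "Suc r"] by (auto simp: moves_def PiE_iff)
    ultimately show "?G \<in> {F \<in> path_chains n l w (Suc r). F (Suc r) \<in> moves l g}" by simp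
  qed
qed

lemma finite_chains_from:
  assumes "r \<le> n" "dec l g" "g \<in> extensional {0..<l}"
  shows "finite {F \<in> path_chains n l w r. F r = g}"
  using assms
proof (induction arbitrary: g rule: inc_induct)
  case base
  have "{F \<in> path_chains n l w n. F n = g} \<subseteq> {restrict (\<lambda>_. g) {n}}"
  proof
    fix F assume F: "F \<in> {F \<in> path_chains n l w n. F n = g}"
    then have "w = g" using path_chainsD(2) by blast
    then show "F \<in> {restrict (\<lambda>_. g) {n}}" using F path_chains_top[OF base(1,2), of n] by simp
  qed
  then show ?case by (rule finite_subset) simp
next
  case (step r)
  have "{F \<in> path_chains n l w (Suc r). F (Suc r) \<in> moves l g}
    = (\<Union>h\<in>moves l g. {F \<in> path_chains n l w (Suc r). F (Suc r) = h})" by auto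
  also have "finite \<dots>" using finite_moves step.IH by (auto simp: moves_def PiE_iff)
  finally show ?case using bij_betw_finite[OF path_chains_cons[OF step(2) step.prems, of w]] by simp
qed

text \<open>The rows are peeled off from the bottom by \<open>dt_layer\<close>. At the top the
  matrix compares positions with \<open>w\<close>, and \<open>dt_delta\<close> keeps only the
  families that end there.\<close>

theorem dt_chains:
  fixes C :: "nat \<Rightarrow> int \<Rightarrow> nat \<Rightarrow> 'r::comm_ring_1"
  assumes w: "dec l w" "w \<in> extensional {0..<l}"
    and top: "\<And>x j. C n x j = (if x = w j then 1 else 0)"
    and C: "\<And>s x j. s < n \<Longrightarrow> C s x j = p s x * C (Suc s) x j + q s x * C (Suc s) (x + 1) j"
    and "r \<le> n" "dec l g" "g \<in> extensional {0..<l}"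
  shows "dt l (\<lambda>i j. C r (g i) j) = (\<Sum>F | F \<in> path_chains n l w r \<and> F r = g.
    \<Prod>s = r..<n. \<Prod>i = 0..<l. if F (Suc s) i = F s i then p s (F s i) else q s (F s i))"
  using assms(5-)
proof (induction arbitrary: g rule: inc_induct)
  case base
  have "{F. F \<in> path_chains n l w n \<and> F n = g} = (if g = w then {restrict (\<lambda>_. w) {n}} else {})"
    unfolding path_chains_top[OF w] by auto
  moreover have "g = w \<longleftrightarrow> (\<forall>i<l. g i = w i)"
    using base w(2) by (auto simp: fun_eq_iff extensional_def) (metis not_less)
  ultimately show ?case unfolding top dt_delta[OF base(1) w(1)] by (cases "g = w") simp_all
next
  case (step r)
  let ?wt = "\<lambda>F s. \<Prod>i = 0..<l. if F (Suc s) i = F s i then p s (F s i) else q s (F s i)"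
  let ?A = "{F \<in> path_chains n l w (Suc r). F (Suc r) \<in> moves l g}"
  let ?\<phi> = "\<lambda>F. restrict (F(r := g)) {r..n}"
  note bij = path_chains_cons[OF step(2) step.prems, of w]
  have mv: "dec l h \<and> h \<in> extensional {0..<l}" if "h \<in> moves l g" for h
    using that by (auto simp: moves_def PiE_iff)
  have "(\<Sum>F | F \<in> path_chains n l w r \<and> F r = g. \<Prod>s = r..<n. ?wt F s) = (\<Sum>F\<in>?A. \<Prod>s = r..<n. ?wt (?\<phi> F) s)"
    using sum.reindex_bij_betw[OF bij, of "\<lambda>F. \<Prod>s = r..<n. ?wt F s"] by simp
  also have "\<dots> = (\<Sum>F\<in>?A. (\<Prod>i = 0..<l. if F (Suc r) i = g i then p r (g i) else q r (g i)) * (\<Prod>s = Suc r..<n. ?wt F s))"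
  proof (rule sum.cong)
    fix F assume "F \<in> ?A"
    have "(\<Prod>s = r..<n. ?wt (?\<phi> F) s) = ?wt (?\<phi> F) r * (\<Prod>s = Suc r..<n. ?wt (?\<phi> F) s)"
      using step(2) by (rule prod.atLeast_Suc_lessThan)
    also have "(\<Prod>s = Suc r..<n. ?wt (?\<phi> F) s) = (\<Prod>s = Suc r..<n. ?wt F s)"
    proof (rule prod.cong)
      fix s assume "s \<in> {Suc r..<n}"
      then have "?\<phi> F s = F s" "?\<phi> F (Suc s) = F (Suc s)" by auto
      then show "?wt (?\<phi> F) s = ?wt F s" by (simp only:)
    qed simp
    also have "?wt (?\<phi> F) r = (\<Prod>i = 0..<l. if F (Suc r) i = g i then p r (g i) else q r (g i))"
      using step(2) by (intro prod.cong) auto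
    finally show "(\<Prod>s = r..<n. ?wt (?\<phi> F) s) = \<dots> * (\<Prod>s = Suc r..<n. ?wt F s)" .
  qed simp
  also have "\<dots> = (\<Sum>h\<in>moves l g. \<Sum>F | F \<in> ?A \<and> F (Suc r) = h.
      (\<Prod>i = 0..<l. if F (Suc r) i = g i then p r (g i) else q r (g i)) * (\<Prod>s = Suc r..<n. ?wt F s))"
  proof (rule sum.group[symmetric])
    show "finite ?A"
      using bij_betw_finite[OF bij] finite_chains_from[of r n l g w] step(2) step.prems by simp
  qed (use finite_moves in auto)
  also have "\<dots> = (\<Sum>h\<in>moves l g. (\<Prod>i = 0..<l. if h i = g i then p r (g i) else q r (g i)) * dt l (\<lambda>i j. C (Suc r) (h i) j))"
  proof (rule sum.cong)
    fix h assume h: "h \<in> moves l g"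
    have "dt l (\<lambda>i j. C (Suc r) (h i) j) = (\<Sum>F | F \<in> path_chains n l w (Suc r) \<and> F (Suc r) = h. \<Prod>s = Suc r..<n. ?wt F s)"
      by (rule step.IH) (use mv[OF h] in auto)
    moreover have "{F. F \<in> ?A \<and> F (Suc r) = h} = {F. F \<in> path_chains n l w (Suc r) \<and> F (Suc r) = h}" using h by auto
    ultimately show "(\<Sum>F | F \<in> ?A \<and> F (Suc r) = h.
      (\<Prod>i = 0..<l. if F (Suc r) i = g i then p r (g i) else q r (g i)) * (\<Prod>s = Suc r..<n. ?wt F s))
      = (\<Prod>i = 0..<l. if h i = g i then p r (g i) else q r (g i)) * dt l (\<lambda>i j. C (Suc r) (h i) j)"
      by (simp add: sum_distrib_left)
  qed simp
  also have "\<dots> = dt l (\<lambda>i j. C r (g i) j)"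
    by (rule dt_layer[symmetric]) (use step.prems C[OF step(2)] in auto)
  finally show ?case ..
qed

section \<open>The Cauchy-Binet formula\<close>

definition decs :: "nat \<Rightarrow> int set \<Rightarrow> (nat \<Rightarrow> int) set" where
  "decs l S = {f \<in> Pi\<^sub>E {0..<l} (\<lambda>_. S). dec l f}"

lemma finite_decs: "finite S \<Longrightarrow> finite (decs l S)"
  unfolding decs_def
  by (rule finite_subset[of _ "Pi\<^sub>E {0..<l} (\<lambda>_. S)"]) (auto intro!: finite_PiE)

lemma dec_enum:
  assumes "finite T" "card T = l"
  obtains f where "dec l f" "f ` {0..<l} = (T :: int set)"
proof
  let ?xs = "rev (sorted_list_of_set T)"
  have len: "length ?xs = l" using assms by simp
  show "dec l (\<lambda>i. ?xs ! i)"
    unfolding dec_def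
  proof (intro allI impI)
    fix i k assume ik: "i < k" "k < l"
    have "sorted_wrt (<) (sorted_list_of_set T)" by simp
    then have "sorted_list_of_set T ! (l - Suc k) < sorted_list_of_set T ! (l - Suc i)"
      using ik len by (intro sorted_wrt_nth_less[of "(<)"]) auto
    then show "?xs ! k < ?xs ! i" using ik len by (simp add: rev_nth)
  qed
  show "(\<lambda>i. ?xs ! i) ` {0..<l} = T"
    using len assms(1) set_conv_nth[of ?xs] by (auto simp: atLeast0LessThan image_def)
qed

lemma dec_unique:
  assumes f: "dec l f" and g: "dec l g" and im: "f ` {0..<l} = g ` {0..<l}" and "i < l"
  shows "f i = g i"
proof -
  define p where "p i = (if i < l then inv_into {0..<l} g (f i) else i)" for i
  have p: "p i < l" "g (p i) = f i" if "i < l" for i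
  proof -
    have "f i \<in> g ` {0..<l}" using im that by auto
    then show "p i < l" "g (p i) = f i"
      using that inv_into_into[of "f i" g "{0..<l}"] f_inv_into_f[of "f i" g "{0..<l}"] by (auto simp: p_def)
  qed
  have mono: "p i < p k" if "i < k" "k < l" for i k
  proof -
    have "f k < f i" using f that by (simp add: dec_def)
    then have "g (p k) < g (p i)" using p[of i] p[of k] that by simp
    then show ?thesis using dec_less_iff[OF g, of "p i" "p k"] p[of i] p[of k] that by simp
  qed
  have "inj_on p {0..<l}" using mono by (intro linorder_inj_onI) force+
  then have "bij_betw p {0..<l} {0..<l}"
    unfolding bij_betw_def using endo_inj_surj[of "{0..<l}" p] p(1) by (simp add: image_subset_iff)
  then have "p permutes {0..<l}" by (rule bij_imp_permutes) (simp add: p_def)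
  then have "p = id" by (rule permutes_mono_id) (use mono in auto)
  then show ?thesis using p(2)[OF assms(4)] by simp
qed

text \<open>Expanding the rows gives a sum over all index maps. A map with a repeated value yields
  two equal rows; every other one is in a unique way a decreasing map composed with a permutation,
  and the permutations assemble the first determinant.\<close>

theorem cauchy_binet:
  fixes P :: "nat \<Rightarrow> int \<Rightarrow> 'r::comm_ring_1"
  assumes S: "finite S"
  shows "dt l (\<lambda>i j. \<Sum>x\<in>S. P i x * R x j)
    = (\<Sum>f\<in>decs l S. dt l (\<lambda>i k. P i (f k)) * dt l (\<lambda>i j. R (f i) j))"
proof -
  let ?H = "Pi\<^sub>E {0..<l} (\<lambda>_. S)" and ?p = "{p. p permutes {0..<l}}"
  let ?\<phi> = "\<lambda>(f, p). restrict (\<lambda>i. f (p i)) {0..<l}"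
  let ?t = "\<lambda>h. (\<Prod>i = 0..<l. P i (h i)) * dt l (\<lambda>i j. R (h i) j)"
  have inj: "inj_on ?\<phi> (decs l S \<times> ?p)"
  proof (rule inj_onI, clarify)
    fix f p f' p' assume a: "f \<in> decs l S" "f' \<in> decs l S" "p permutes {0..<l}" "p' permutes {0..<l}"
      and eq: "restrict (\<lambda>i. f (p i)) {0..<l} = restrict (\<lambda>i. f' (p' i)) {0..<l}"
    have e: "f (p i) = f' (p' i)" if "i < l" for i using fun_cong[OF eq, of i] that by simp
    have d: "dec l f" "dec l f'" using a by (auto simp: decs_def)
    have "f ` {0..<l} = (\<lambda>i. f (p i)) ` {0..<l}" using permutes_image[OF a(3)] by (metis image_image)
    also have "\<dots> = (\<lambda>i. f' (p' i)) ` {0..<l}" using e by auto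
    also have "\<dots> = f' ` {0..<l}" using permutes_image[OF a(4)] by (metis image_image)
    finally have ff: "f i = f' i" if "i < l" for i using dec_unique[OF d _ that] by simp
    have "f = f'"
    proof
      fix i show "f i = f' i" using ff[of i] a(1,2) by (cases "i < l") (auto simp: decs_def PiE_iff extensional_def)
    qed
    moreover have "p i = p' i" for i
    proof (cases "i < l")
      case True
      then have "p i < l" "p' i < l" using permutes_in_image[OF a(3), of i] permutes_in_image[OF a(4), of i] by auto
      then show ?thesis using dec_inj[OF d(1)] e[OF True] ff by metis
    next
      case False
      then show ?thesis using permutes_not_in[OF a(3), of i] permutes_not_in[OF a(4), of i] by simp
    qed
    ultimately show "f = f' \<and> p = p'" by auto
  qed
  have im: "?\<phi> ` (decs l S \<times> ?p) = {h \<in> ?H. inj_on h {0..<l}}"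
  proof (intro equalityI subsetI)
    fix h assume "h \<in> ?\<phi> ` (decs l S \<times> ?p)"
    then obtain f p where fp: "f \<in> decs l S" "p permutes {0..<l}" and h: "h = restrict (\<lambda>i. f (p i)) {0..<l}" by auto
    have pl: "p i < l" if "i < l" for i using permutes_in_image[OF fp(2), of i] that by simp
    have "inj_on h {0..<l}"
    proof (rule inj_onI)
      fix i k assume ik: "i \<in> {0..<l}" "k \<in> {0..<l}" "h i = h k"
      then have "f (p i) = f (p k)" by (simp add: h)
      then have "p i = p k" using fp(1) dec_inj[of l f "p i" "p k"] pl[of i] pl[of k] ik by (simp add: decs_def)
      then show "i = k" using permutes_inj[OF fp(2)] by (simp add: inj_eq)
    qed
    then show "h \<in> {h \<in> ?H. inj_on h {0..<l}}" using fp(1) pl by (auto simp: h decs_def PiE_iff)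
  next
    fix h assume "h \<in> {h \<in> ?H. inj_on h {0..<l}}"
    then have h: "h \<in> ?H" "inj_on h {0..<l}" by auto
    obtain f0 where f0: "dec l f0" "f0 ` {0..<l} = h ` {0..<l}"
      using dec_enum[of "h ` {0..<l}" l] card_image[OF h(2)] by auto
    define f where "f = restrict f0 {0..<l}"
    have f: "dec l f" "f ` {0..<l} = h ` {0..<l}" using f0 by (auto simp: f_def dec_def)
    have "f \<in> decs l S"
    proof -
      have "f i \<in> S" if "i < l" for i
      proof -
        have "f i \<in> h ` {0..<l}" using f(2) that by auto
        then show ?thesis using h(1) by (auto simp: PiE_iff)
      qed
      then show ?thesis using f(1) by (auto simp: decs_def f_def)
    qed
    moreover define p where "p i = (if i < l then inv_into {0..<l} f (h i) else i)" for i
    have p: "p i < l" "f (p i) = h i" if "i < l" for i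
    proof -
      have "h i \<in> f ` {0..<l}" using f(2) that by auto
      then show "p i < l" "f (p i) = h i"
        using that inv_into_into[of "h i" f "{0..<l}"] f_inv_into_f[of "h i" f "{0..<l}"] by (auto simp: p_def)
    qed
    have "inj_on p {0..<l}"
    proof (rule inj_onI)
      fix i k assume ik: "i \<in> {0..<l}" "k \<in> {0..<l}" "p i = p k"
      then have "h i = h k" using p(2)[of i] p(2)[of k] by simp
      then show "i = k" using h(2) ik(1,2) by (simp add: inj_on_eq_iff)
    qed
    then have "bij_betw p {0..<l} {0..<l}"
      unfolding bij_betw_def using endo_inj_surj[of "{0..<l}" p] p(1) by (simp add: image_subset_iff)
    then have "p permutes {0..<l}" by (rule bij_imp_permutes) (simp add: p_def)
    moreover have "h = ?\<phi> (f, p)"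
      using h(1) p(2) by (auto simp: fun_eq_iff PiE_iff extensional_def)
    ultimately show "h \<in> ?\<phi> ` (decs l S \<times> ?p)" by blast
  qed
  have "dt l (\<lambda>i j. \<Sum>x\<in>S. P i x * R x j) = (\<Sum>h\<in>?H. ?t h)"
    by (rule dt_rows_expand) (rule S)
  also have "\<dots> = (\<Sum>h | h \<in> ?H \<and> inj_on h {0..<l}. ?t h)"
  proof (rule sum.mono_neutral_right)
    show "finite ?H" using S by (intro finite_PiE) auto
    show "\<forall>h\<in>?H - {h \<in> ?H. inj_on h {0..<l}}. ?t h = 0"
    proof
      fix h assume "h \<in> ?H - {h \<in> ?H. inj_on h {0..<l}}"
      then obtain i k where ik: "i < l" "k < l" "i \<noteq> k" "h i = h k" by (auto simp: inj_on_def)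
      have "dt l (\<lambda>i j. R (h i) j) = 0" by (rule dt_equal_rows[of i k]) (use ik in auto)
      then show "?t h = 0" by simp
    qed
  qed auto
  also have "\<dots> = (\<Sum>x\<in>decs l S \<times> ?p. ?t (?\<phi> x))"
    unfolding im[symmetric] by (rule sum.reindex[OF inj, unfolded comp_def])
  also have "\<dots> = (\<Sum>f\<in>decs l S. \<Sum>p\<in>?p. ?t (?\<phi> (f, p)))"
    unfolding sum.cartesian_product by (rule sum.cong) auto
  also have "\<dots> = (\<Sum>f\<in>decs l S. dt l (\<lambda>i k. P i (f k)) * dt l (\<lambda>i j. R (f i) j))"
  proof (rule sum.cong)
    fix f
    have "?t (?\<phi> (f, p)) = (signof p * (\<Prod>i = 0..<l. P i (f (p i)))) * dt l (\<lambda>i j. R (f i) j)"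
      if p: "p permutes {0..<l}" for p
    proof -
      have "dt l (\<lambda>i j. R (?\<phi> (f, p) i) j) = dt l (\<lambda>i j. R (f (p i)) j)" by (rule dt_cong) simp
      also have "\<dots> = signof p * dt l (\<lambda>i j. R (f i) j)" by (rule dt_permute_rows[OF p])
      finally show ?thesis by (simp add: ac_simps)
    qed
    then show "(\<Sum>p\<in>?p. ?t (?\<phi> (f, p))) = dt l (\<lambda>i k. P i (f k)) * dt l (\<lambda>i j. R (f i) j)"
      unfolding dt_sum[of l "\<lambda>i k. P i (f k)"] sum_distrib_right by (intro sum.cong) auto
  qed simp
  finally show ?thesis .
qed

text \<open>The coefficients of a geometric series whose ratio moves the abscissa by two:
  \<open>\<omega>\<close> is collected at the start of each double step between \<open>a\<close> and
  \<open>b\<close>. Such a double step is a pair of E-steps.\<close>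

definition mid_kernel :: "(int \<Rightarrow> 'r::comm_ring_1) \<Rightarrow> int \<Rightarrow> int \<Rightarrow> 'r" where
  "mid_kernel \<omega> a b = (if a \<le> b \<and> even (b - a) then \<Prod>q\<in>{a..<b}. if even (q - a) then \<omega> q else 1 else 0)"

text \<open>The number of paths of the parity class of \<open>q\<close> above the cell \<open>x\<close> when points \<open>a i\<close> and
  \<open>b j\<close> are joined within the parity classes.\<close>

definition class_depth :: "nat \<Rightarrow> (nat \<Rightarrow> int) \<Rightarrow> (nat \<Rightarrow> int) \<Rightarrow> int \<Rightarrow> int \<Rightarrow> int" where
  "class_depth l a b q x = (\<Sum>j<l. if x < b j \<and> even (b j - q) then 1 else 0)
     - (\<Sum>i<l. if x < a i - 1 \<and> even (a i - q) then 1 else 0)"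

definition interlaced :: "nat \<Rightarrow> (nat \<Rightarrow> int) \<Rightarrow> (nat \<Rightarrow> int) \<Rightarrow> bool" where
  "interlaced l a b \<longleftrightarrow> (\<forall>q x. class_depth l a b q x \<in> {0, 1})"

text \<open>For interlaced ends a factor -1 is the Laplace sign of a row whose partner is the second
  of the remaining columns, see \<open>dt_mid_kernel\<close>.\<close>

definition kernel_sign :: "nat \<Rightarrow> (nat \<Rightarrow> int) \<Rightarrow> (nat \<Rightarrow> int) \<Rightarrow> int" where
  "kernel_sign l a b = (\<Prod>i<l - 1. if a i \<le> b (Suc i) \<and> even (a i - b (Suc i)) then -1 else 1)"

definition skip :: "nat \<Rightarrow> nat \<Rightarrow> nat" where
  "skip m j = (if j < m then j else Suc j)"

lemma skip_image: "m \<le> k \<Longrightarrow> {..<Suc k} = insert m (skip m ` {..<k})"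
proof (intro equalityI subsetI)
  fix j assume j: "m \<le> k" "j \<in> {..<Suc k}"
  show "j \<in> insert m (skip m ` {..<k})"
  proof (cases j m rule: linorder_cases)
    case less
    then have "j = skip m j" "j < k" using j by (auto simp: skip_def)
    then show ?thesis by blast
  next
    case greater
    then have "j = skip m (j - 1)" "j - 1 < k" using j by (auto simp: skip_def)
    then show ?thesis by blast
  qed simp
qed (auto simp: skip_def)

lemma sum_skip:
  fixes g :: "nat \<Rightarrow> int"
  assumes "m \<le> k"
  shows "(\<Sum>j<Suc k. g j) = g m + (\<Sum>j<k. g (skip m j))"
proof -
  have "inj_on (skip m) {..<k}" "m \<notin> skip m ` {..<k}" by (auto simp: skip_def inj_on_def split: if_splits)
  then show ?thesis unfolding skip_image[OF assms] by (simp add: sum.reindex)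
qed

text \<open>Within a parity class every walk of double steps to \<open>b\<close> passes through
  \<open>b'\<close>. Two columns of one class are therefore proportional when no row starts to the
  right of \<open>b'\<close>.\<close>

lemma mid_kernel_extend:
  assumes "a \<le> b'" "b' < b" "even (b - b')"
  shows "mid_kernel \<omega> a b = (\<Prod>q\<in>{b'..<b}. if even (q - b') then \<omega> q else 1) * mid_kernel \<omega> a b'"
proof (cases "even (b' - a)")
  case True
  have "{a..<b} = {a..<b'} \<union> {b'..<b}" using assms by auto
  then have "(\<Prod>q\<in>{a..<b}. if even (q - a) then \<omega> q else 1)
    = (\<Prod>q\<in>{a..<b'}. if even (q - a) then \<omega> q else 1) * (\<Prod>q\<in>{b'..<b}. if even (q - a) then \<omega> q else 1)"
    by (simp add: prod.union_disjoint)
  also have "(\<Prod>q\<in>{b'..<b}. if even (q - a) then \<omega> q else 1) = (\<Prod>q\<in>{b'..<b}. if even (q - b') then \<omega> q else 1)"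
    by (rule prod.cong) (use True in auto)
  finally show ?thesis using assms True by (simp add: mid_kernel_def ac_simps)
next
  case False
  then have "odd (b - a)" using assms(3) by presburger
  then show ?thesis using False by (simp add: mid_kernel_def)
qed

text \<open>Induction removing the row with the largest start \<open>a 0\<close>. If two columns of
  one parity class lie at or beyond \<open>a 0\<close>, they are proportional, so the determinant
  vanishes, and the class depth reaches 2 below them. Otherwise this row has at most one nonzero
  entry. Without such an entry the class depth becomes negative just left of \<open>a 0\<close>;
  with it, removing row and column changes the class depth exactly along the matched pair.\<close>

theorem dt_mid_kernel:
  fixes \<omega> :: "int \<Rightarrow> 'r::comm_ring_1"
  assumes "dec l a" "dec l b" "\<And>i. i < l \<Longrightarrow> -W \<le> a i" "\<And>i. i < l \<Longrightarrow> b i \<le> W"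
  shows "dt l (\<lambda>i j. mid_kernel \<omega> (a i) (b j)) =
    (if interlaced l a b then of_int (kernel_sign l a b) * (\<Prod>x\<in>{-W..W}. \<omega> x ^ nat (class_depth l a b x x)) else 0)"
  using assms
proof (induction l arbitrary: a b)
  case 0
  then show ?case by (simp add: dt_sum interlaced_def class_depth_def kernel_sign_def)
next
  case (Suc k)
  let ?M = "\<lambda>i j. mid_kernel \<omega> (a i) (b j)"
  have a0: "a i \<le> a 0" if "i < Suc k" for i
    using Suc.prems(1) that by (cases "i = 0") (auto simp: dec_def less_imp_le)
  show ?case
  proof (cases "\<exists>j j'. j < j' \<and> j' < Suc k \<and> a 0 \<le> b j' \<and> even (b j - b j')")
    case True
    then obtain j j' where j: "j < j'" "j' < Suc k" "a 0 \<le> b j'" "even (b j - b j')" by blast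
    have lt: "b j' < b j" using Suc.prems(2) j by (simp add: dec_def)
    have "dt (Suc k) ?M = 0"
    proof (rule dt_proportional_columns[of j j'])
      show "mid_kernel \<omega> (a i) (b j) = (\<Prod>q\<in>{b j'..<b j}. if even (q - b j') then \<omega> q else 1) * mid_kernel \<omega> (a i) (b j')"
        if "i < Suc k" for i
        by (rule mid_kernel_extend) (use a0[OF that] j lt in auto)
    qed (use j in auto)
    moreover have "\<not> interlaced (Suc k) a b"
    proof
      assume "interlaced (Suc k) a b"
      then have c: "class_depth (Suc k) a b (b j') (b j' - 1) \<in> {0, 1}" unfolding interlaced_def by blast
      have "(\<Sum>i<Suc k. if b j' - 1 < a i - 1 \<and> even (a i - b j') then 1 else 0) = (0 :: int)"
        by (rule sum.neutral) (use a0 j(3) in fastforce)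
      moreover have "(\<Sum>i\<in>{j, j'}. if b j' - 1 < b i \<and> even (b i - b j') then 1 else 0)
          \<le> (\<Sum>i<Suc k. if b j' - 1 < b i \<and> even (b i - b j') then 1 else 0 :: int)"
        by (rule sum_mono2) (use j in auto)
      moreover have "(\<Sum>i\<in>{j, j'}. if b j' - 1 < b i \<and> even (b i - b j') then 1 else 0 :: int) = 2"
        using j lt by simp
      ultimately show False using c unfolding class_depth_def by auto
    qed
    ultimately show ?thesis by simp
  next
    case False
    then have uniq: "odd (b j - b j')" if "j < j'" "j' < Suc k" "a 0 \<le> b j'" for j j' using that by blast
    show ?thesis
    proof (cases "\<exists>m<Suc k. a 0 \<le> b m \<and> even (b m - a 0)")
      case False
      have "dt (Suc k) ?M = (-1) ^ 0 * ?M 0 0 * dt k (\<lambda>i j. ?M (Suc i) (if j < 0 then j else Suc j))"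
        by (rule dt_first_row) (use False in \<open>auto simp: mid_kernel_def\<close>)
      also have "\<dots> = 0" using False by (auto simp: mid_kernel_def)
      finally have "dt (Suc k) ?M = 0" .
      moreover have "\<not> interlaced (Suc k) a b"
      proof
        assume "interlaced (Suc k) a b"
        then have c: "class_depth (Suc k) a b (a 0) (a 0 - 2) \<in> {0, 1}" unfolding interlaced_def by blast
        have "(\<Sum>j<Suc k. if a 0 - 2 < b j \<and> even (b j - a 0) then 1 else 0) = (0 :: int)"
        proof (rule sum.neutral, safe)
          fix j assume "j < Suc k"
          then have n: "\<not> (a 0 \<le> b j \<and> even (b j - a 0))" using False by blast
          have "\<not> (a 0 - 2 < b j \<and> even (b j - a 0))"
          proof
            assume h: "a 0 - 2 < b j \<and> even (b j - a 0)"
            then have "b j \<noteq> a 0 - 1" by auto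
            then show False using h n by linarith
          qed
          then show "(if a 0 - 2 < b j \<and> even (b j - a 0) then 1 else 0) = (0 :: int)" by simp
        qed
        moreover have "(\<Sum>i\<in>{0}. if a 0 - 2 < a i - 1 \<and> even (a i - a 0) then 1 else 0)
            \<le> (\<Sum>i<Suc k. if a 0 - 2 < a i - 1 \<and> even (a i - a 0) then 1 else 0 :: int)"
          by (rule sum_mono2) auto
        ultimately show False using c unfolding class_depth_def by auto
      qed
      ultimately show ?thesis by simp
    next
      case True
      then obtain m where m: "m < Suc k" "a 0 \<le> b m" "even (b m - a 0)" by blast
      have other: "\<not> (a 0 \<le> b j \<and> even (b j - a 0))" if "j < Suc k" "j \<noteq> m" for j
      proof
        assume j: "a 0 \<le> b j \<and> even (b j - a 0)"
        then have "even (b j - b m)" "even (b m - b j)" using m(3) by presburger+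
        then show False using uniq[of j m] uniq[of m j] that j m by (cases "j < m") auto
      qed
      \<comment> \<open>Otherwise columns 0, 1 and \<open>m\<close> would all lie at or beyond
        \<open>a 0\<close> and in three different parity classes.\<close>
      have m1: "m \<le> 1"
      proof (rule ccontr)
        assume "\<not> m \<le> 1"
        then have "b m < b 1" "b m < b 0" using Suc.prems(2) m(1) by (auto simp: dec_def)
        then have "odd (b 0 - b 1)" "\<not> even (b 0 - a 0)" "\<not> even (b 1 - a 0)"
          using uniq[of 0 1] other[of 0] other[of 1] m \<open>\<not> m \<le> 1\<close> by auto
        then show False by presburger
      qed
      let ?a = "\<lambda>i. a (Suc i)" and ?b = "\<lambda>j. b (skip m j)"
      have da: "dec k ?a" using Suc.prems(1) by (auto simp: dec_def)
      have db: "dec k ?b" using Suc.prems(2) by (auto simp: dec_def skip_def)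
      have "dt (Suc k) ?M = (-1) ^ m * ?M 0 m * dt k (\<lambda>i j. ?M (Suc i) (if j < m then j else Suc j))"
        by (rule dt_first_row) (use m other in \<open>auto simp: mid_kernel_def\<close>)
      also have "dt k (\<lambda>i j. ?M (Suc i) (if j < m then j else Suc j)) = dt k (\<lambda>i j. mid_kernel \<omega> (?a i) (?b j))"
        by (rule dt_cong) (simp add: skip_def)
      also have "\<dots> = (if interlaced k ?a ?b then of_int (kernel_sign k ?a ?b)
          * (\<Prod>x\<in>{-W..W}. \<omega> x ^ nat (class_depth k ?a ?b x x)) else 0)"
        by (rule Suc.IH[OF da db]) (use Suc.prems m in \<open>auto simp: skip_def\<close>)
      finally have main: "dt (Suc k) ?M = (-1) ^ m * ?M 0 m * (if interlaced k ?a ?b then of_int (kernel_sign k ?a ?b)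
          * (\<Prod>x\<in>{-W..W}. \<omega> x ^ nat (class_depth k ?a ?b x x)) else 0)" .
      define e where "e q x = (if even (q - a 0) \<and> a 0 - 1 \<le> x \<and> x < b m then 1 else 0 :: int)" for q x
      have cd: "class_depth (Suc k) a b q x = class_depth k ?a ?b q x + e q x" for q x
      proof -
        have "(if x < b m \<and> even (b m - q) then 1 else 0) - (if x < a 0 - 1 \<and> even (a 0 - q) then 1 else 0) = e q x"
          using m(2,3) unfolding e_def by (auto; presburger)
        moreover have "(\<Sum>j<Suc k. if x < b j \<and> even (b j - q) then 1 else 0 :: int)
          = (if x < b m \<and> even (b m - q) then 1 else 0) + (\<Sum>j<k. if x < ?b j \<and> even (?b j - q) then 1 else 0)"
          by (rule sum_skip) (use m(1) in simp)
        moreover have "(\<Sum>i<Suc k. if x < a i - 1 \<and> even (a i - q) then 1 else 0 :: int)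
          = (if x < a 0 - 1 \<and> even (a 0 - q) then 1 else 0) + (\<Sum>i<k. if x < ?a i - 1 \<and> even (?a i - q) then 1 else 0)"
          by (rule sum.lessThan_Suc_shift)
        ultimately show ?thesis unfolding class_depth_def by linarith
      qed
      \<comment> \<open>Along the matched pair the remaining rows and columns have class depth 0, so
        adding 1 keeps the values within 0 and 1.\<close>
      have zero: "class_depth k ?a ?b q x = 0" if "even (q - a 0)" "a 0 - 1 \<le> x" for q x
      proof -
        have "(\<Sum>j<k. if x < ?b j \<and> even (?b j - q) then 1 else 0) = (0 :: int)"
        proof (rule sum.neutral, safe)
          fix j assume "j < k"
          then have "\<not> (a 0 \<le> ?b j \<and> even (?b j - a 0))" by (intro other) (auto simp: skip_def)
          moreover have "even (?b j - a 0)" if "even (?b j - q)" using that \<open>even (q - a 0)\<close> by presburger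
          ultimately show "(if x < ?b j \<and> even (?b j - q) then 1 else 0) = (0 :: int)" using that(2) by auto
        qed
        moreover have "(\<Sum>i<k. if x < ?a i - 1 \<and> even (?a i - q) then 1 else 0) = (0 :: int)"
          by (rule sum.neutral) (use a0 that(2) in fastforce)
        ultimately show ?thesis by (simp add: class_depth_def)
      qed
      have iff: "interlaced (Suc k) a b \<longleftrightarrow> interlaced k ?a ?b"
      proof -
        have "class_depth k ?a ?b q x + e q x \<in> {0, 1} \<longleftrightarrow> class_depth k ?a ?b q x \<in> {0, 1}" for q x
        proof (cases "even (q - a 0) \<and> a 0 - 1 \<le> x \<and> x < b m")
          case True
          then show ?thesis using zero[of q x] by (simp add: e_def)
        next
          case False
          then have "e q x = 0" unfolding e_def by (rule if_not_P)
          then show ?thesis by simp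
        qed
        then show ?thesis unfolding interlaced_def cd by blast
      qed
      have sign: "kernel_sign (Suc k) a b = (-1) ^ m * kernel_sign k ?a ?b"
      proof (cases k)
        case 0
        then show ?thesis using m by (simp add: kernel_sign_def)
      next
        case (Suc k')
        have "kernel_sign (Suc k) a b = (if a 0 \<le> b 1 \<and> even (a 0 - b 1) then -1 else 1)
            * (\<Prod>i<k'. if a (Suc i) \<le> b (Suc (Suc i)) \<and> even (a (Suc i) - b (Suc (Suc i))) then -1 else 1)"
          unfolding kernel_sign_def Suc by (simp add: prod.lessThan_Suc_shift del: prod.lessThan_Suc)
        also have "(\<Prod>i<k'. if a (Suc i) \<le> b (Suc (Suc i)) \<and> even (a (Suc i) - b (Suc (Suc i))) then -1 else 1) = kernel_sign k ?a ?b"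
          unfolding kernel_sign_def Suc using m1 by (intro prod.cong) (auto simp: skip_def)
        also have "(if a 0 \<le> b 1 \<and> even (a 0 - b 1) then -1 else 1) = (-1 :: int) ^ m"
        proof (cases "m = 0")
          case True
          have "\<not> (a 0 \<le> b 1 \<and> even (b 1 - a 0))" by (rule other) (use True Suc in auto)
          then show ?thesis using True by (auto simp: even_diff_iff)
        next
          case False
          then have "m = 1" using m1 by simp
          then show ?thesis using m by (auto simp: even_diff_iff)
        qed
        finally show ?thesis .
      qed
      have wt: "(\<Prod>x\<in>{-W..W}. \<omega> x ^ nat (class_depth (Suc k) a b x x))
          = ?M 0 m * (\<Prod>x\<in>{-W..W}. \<omega> x ^ nat (class_depth k ?a ?b x x))" if il: "interlaced k ?a ?b"
      proof -
        have nn: "0 \<le> class_depth k ?a ?b x x" for x using il unfolding interlaced_def by (metis insert_iff order_refl singletonD zero_le_one)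
        have "(\<Prod>x\<in>{-W..W}. \<omega> x ^ nat (class_depth (Suc k) a b x x))
          = (\<Prod>x\<in>{-W..W}. \<omega> x ^ nat (class_depth k ?a ?b x x) * (if x \<in> {a 0..<b m} then if even (x - a 0) then \<omega> x else 1 else 1))"
        proof (rule prod.cong)
          fix x
          have "nat (class_depth (Suc k) a b x x) = nat (class_depth k ?a ?b x x) + nat (e x x)"
            unfolding cd using nn[of x] by (simp add: nat_add_distrib e_def)
          moreover have "\<omega> x ^ nat (e x x) = (if x \<in> {a 0..<b m} then if even (x - a 0) then \<omega> x else 1 else 1)"
          proof (cases "x = a 0 - 1")
            case False
            then show ?thesis by (auto simp: e_def)
          qed (simp add: e_def)
          ultimately show "\<omega> x ^ nat (class_depth (Suc k) a b x x) = \<omega> x ^ nat (class_depth k ?a ?b x x)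
            * (if x \<in> {a 0..<b m} then if even (x - a 0) then \<omega> x else 1 else 1)" by (simp add: power_add)
        qed simp
        also have "\<dots> = (\<Prod>x\<in>{-W..W}. \<omega> x ^ nat (class_depth k ?a ?b x x))
            * (\<Prod>x\<in>{-W..W}. if x \<in> {a 0..<b m} then if even (x - a 0) then \<omega> x else 1 else 1)"
          by (rule prod.distrib)
        also have "(\<Prod>x\<in>{-W..W}. if x \<in> {a 0..<b m} then if even (x - a 0) then \<omega> x else 1 else 1)
            = (\<Prod>x\<in>{a 0..<b m}. if even (x - a 0) then \<omega> x else 1)"
        proof (rule prod.mono_neutral_cong_right)
          show "{a 0..<b m} \<subseteq> {-W..W}" using Suc.prems(3)[of 0] Suc.prems(4)[OF m(1)] by auto
        qed auto
        also have "\<dots> = ?M 0 m" using m by (simp add: mid_kernel_def)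
        finally show ?thesis by (simp add: ac_simps)
      qed
      show ?thesis
        unfolding main iff using sign wt by (simp add: ac_simps)
    qed
  qed
qed

section \<open>Path families and height functions\<close>

definition count_above :: "nat \<Rightarrow> (nat \<Rightarrow> int) \<Rightarrow> int \<Rightarrow> int" where
  "count_above l f x = int (card {i. i < l \<and> x < f i})"

definition height_fun :: "nat \<Rightarrow> nat \<Rightarrow> (nat \<Rightarrow> nat \<Rightarrow> int) \<Rightarrow> cell \<Rightarrow> int" where
  "height_fun n l F = (\<lambda>(x, r). if r \<le> n then count_above l (F r) x else 0)"

lemma card_sum_indicator: "int (card {i. i < l \<and> P i}) = (\<Sum>i<l. if P i then 1 else 0)" for l :: nat
proof -
  have e: "{i. i < l \<and> P i} = {i \<in> {..<l}. P i}" by auto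
  have "int (card {i. i < l \<and> P i}) = (\<Sum>i\<in>{i \<in> {..<l}. P i}. 1)" unfolding e by simp
  also have "\<dots> = (\<Sum>i<l. if P i then 1 else 0)" by (rule sum.inter_filter) simp
  finally show ?thesis .
qed

lemma count_above_sum: "count_above l f x = (\<Sum>i<l. if x < f i then 1 else 0)"
  unfolding count_above_def by (rule card_sum_indicator)

text \<open>In a decreasing family the points to the right of \<open>x\<close> form an initial
  segment of the indices, so counts and positions determine each other.\<close>

lemma count_above_less_iff:
  assumes "dec l f" "i < l"
  shows "int i < count_above l f x \<longleftrightarrow> x < f i"
proof
  assume "int i < count_above l f x"
  then have "i < card {k. k < l \<and> x < f k}" by (simp add: count_above_def)
  then have "\<not> {k. k < l \<and> x < f k} \<subseteq> {..<i}"
    using card_mono[of "{..<i}" "{k. k < l \<and> x < f k}"] by auto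
  then obtain k where "k \<in> {k. k < l \<and> x < f k}" "k \<notin> {..<i}" by (meson subsetI)
  then have k: "k < l" "x < f k" "i \<le> k" by simp_all
  have "i = k \<or> f k < f i" using assms(1)[unfolded dec_def, rule_format, of i k] k by (cases "i = k") auto
  then show "x < f i" using k(2) by auto
next
  assume "x < f i"
  then have "{..i} \<subseteq> {k. k < l \<and> x < f k}"
  proof (intro subsetI CollectI)
    fix k assume "k \<in> {..i}"
    then have "k = i \<or> f i < f k" "k < l"
      using assms(1)[unfolded dec_def, rule_format, of k i] assms(2) by (cases "k = i"; auto)+
    then show "k < l \<and> x < f k" using \<open>x < f i\<close> by auto
  qed
  then have "card {..i} \<le> card {k. k < l \<and> x < f k}" by (intro card_mono) auto
  then show "int i < count_above l f x" by (simp add: count_above_def)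
qed

lemma count_above_range: "0 \<le> count_above l f x" "count_above l f x \<le> int l"
proof -
  have "card {i. i < l \<and> x < f i} \<le> card {..<l}" by (rule card_mono) auto
  then show "0 \<le> count_above l f x" "count_above l f x \<le> int l" by (auto simp: count_above_def)
qed

lemma dec_eqI:
  assumes "dec l f" "dec l g" "\<And>x. count_above l f x = count_above l g x" "i < l"
  shows "f i = g i"
  using count_above_less_iff[OF assms(1,4)] count_above_less_iff[OF assms(2,4)] assms(3)
  by (metis linorder_neq_iff)

lemma count_above_step: "count_above l f (x - 1) - count_above l f x = int (card {i. i < l \<and> f i = x})"
proof -
  have "count_above l f (x - 1) = (\<Sum>i<l. (if x < f i then 1 else 0) + (if f i = x then 1 else 0))"
    unfolding count_above_sum by (rule sum.cong) auto
  also have "\<dots> = count_above l f x + int (card {i. i < l \<and> f i = x})"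
    unfolding sum.distrib count_above_sum card_sum_indicator ..
  finally show ?thesis by linarith
qed

lemma dec_point_card:
  assumes "dec l f"
  shows "card {i. i < l \<and> f i = x} \<le> 1"
proof (rule card_le_Suc0_iff_eq[THEN iffD2, unfolded One_nat_def[symmetric]])
  show "\<forall>i\<in>{i. i < l \<and> f i = x}. \<forall>k\<in>{i. i < l \<and> f i = x}. i = k" using dec_inj[OF assms] by auto
qed simp

text \<open>Point number \<open>i\<close> is the least \<open>x\<close> with
  \<open>\<beta> x \<le> i\<close>. The values at both ends make all of these points exist, and the
  unit steps make them distinct.\<close>

lemma row_from_counts:
  fixes \<beta> :: "int \<Rightarrow> int"
  assumes step: "\<And>x. \<beta> (x - 1) - \<beta> x \<in> {0, 1}" and far: "\<And>x. u \<le> x \<Longrightarrow> \<beta> x = 0" "\<And>x. x \<le> v \<Longrightarrow> \<beta> x = int l"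
  shows "\<exists>f. dec l f \<and> f \<in> extensional {0..<l} \<and> (\<forall>x. count_above l f x = \<beta> x)"
proof -
  have anti: "\<beta> y \<le> \<beta> x" if "x \<le> y" for x y
    using that
  proof (induction rule: int_ge_induct)
    case (step y)
    then show ?case using assms(1)[of "y + 1"] by auto
  qed simp
  have ex: "\<exists>y. \<forall>x. x < y \<longleftrightarrow> int i < \<beta> x" if i: "i < l" for i
  proof -
    have vu: "v < u"
      using far(1)[of v] far(2)[of v] i by (cases "u \<le> v") simp_all
    define S where "S = {x \<in> {v..u}. \<beta> x \<le> int i}"
    have S: "finite S" "u \<in> S"
      unfolding S_def by (rule finite_subset[of _ "{v..u}"]) (use vu far(1)[of u] in auto)
    let ?y = "Min S"
    have y: "?y \<in> S" using S Min_in by blast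
    have "x < ?y \<longleftrightarrow> int i < \<beta> x" for x
    proof
      assume x: "x < ?y"
      show "int i < \<beta> x"
      proof (rule ccontr)
        assume "\<not> int i < \<beta> x"
        then have "v \<le> x" using far(2)[of x] i by force
        moreover have "x \<le> u" using x y by (auto simp: S_def)
        ultimately have "x \<in> S" using \<open>\<not> int i < \<beta> x\<close> by (simp add: S_def)
        then have "?y \<le> x" using S by simp
        then show False using x by simp
      qed
    next
      assume "int i < \<beta> x"
      then show "x < ?y" using anti[of ?y x] y by (force simp: S_def)
    qed
    then show ?thesis by blast
  qed
  define f where "f i = (if i < l then SOME y. \<forall>x. x < y \<longleftrightarrow> int i < \<beta> x else undefined)" for i
  have f: "x < f i \<longleftrightarrow> int i < \<beta> x" if "i < l" for x i
    using someI_ex[OF ex[OF that]] that by (simp add: f_def)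
  have d: "dec l f"
    unfolding dec_def
  proof (intro allI impI)
    fix i k assume ik: "i < k" "k < l"
    have "\<not> int i < \<beta> (f i)" "int i < \<beta> (f i - 1)" using f[of i "f i"] f[of i "f i - 1"] ik by auto
    then have "\<not> int k < \<beta> (f i - 1)" using step[of "f i"] ik(1) by auto
    then show "f k < f i" using f[OF ik(2), of "f i - 1"] by simp
  qed
  have rng: "0 \<le> \<beta> x" "\<beta> x \<le> int l" for x
    using anti[of x "max x u"] far(1)[of "max x u"] anti[of "min x v" x] far(2)[of "min x v"] by auto
  have "count_above l f x = \<beta> x" for x
  proof -
    have "{i. i < l \<and> x < f i} = {..<nat (\<beta> x)}"
      using f rng[of x] by (auto simp: zless_nat_eq_int_zless)
    then show ?thesis using rng[of x] by (simp add: count_above_def)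
  qed
  then show ?thesis using d by (intro exI[of _ f]) (auto simp: f_def extensional_def)
qed

text \<open>Each row corresponds to its counts by \<open>row_from_counts\<close>. That a point stays
  or advances from one row to the next is the condition of \<open>hfun\<close> along the vertical
  and diagonal arcs.\<close>

theorem height_fun_bij:
  assumes w: "dec l w" "w \<in> extensional {0..<l}"
  shows "bij_betw (height_fun n l) (path_chains n l w 0) {b. hfun n (count_above l w) b}"
proof (rule bij_betwI')
  fix F G assume FG: "F \<in> path_chains n l w 0" "G \<in> path_chains n l w 0"
  show "height_fun n l F = height_fun n l G \<longleftrightarrow> F = G"
  proof
    assume eq: "height_fun n l F = height_fun n l G"
    show "F = G"
    proof (rule ext, rule ext)
      fix s i
      show "F s i = G s i"
      proof (cases "s \<le> n \<and> i < l")
        case True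
        have "count_above l (F s) x = count_above l (G s) x" for x
          using fun_cong[OF eq, of "(x, s)"] True by (simp add: height_fun_def)
        then show ?thesis using dec_eqI[of l "F s" "G s" i] FG True by (auto simp: path_chains_def)
      next
        case False
        then show ?thesis
        proof (cases "s \<le> n")
          case True
          then have "F s \<in> extensional {0..<l}" "G s \<in> extensional {0..<l}" using FG by (auto simp: path_chains_def)
          then show ?thesis using False True by (auto simp: extensional_def)
        next
          case False
          then show ?thesis using path_chainsD(1)[OF FG(1)] path_chainsD(1)[OF FG(2)] by (auto simp: extensional_def)
        qed
      qed
    qed
  qed simp
next
  fix F assume F: "F \<in> path_chains n l w 0"
  have d: "dec l (F s)" if "s \<le> n" for s using F that by (auto simp: path_chains_def)
  have mv: "F (Suc s) i = F s i \<or> F (Suc s) i = F s i + 1" if "s < n" "i < l" for s i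
    using F that by (auto simp: path_chains_def)
  have c1: "count_above l (F s) (x - 1) - count_above l (F s) x \<in> {0, 1}" if "s \<le> n" for s x
    using dec_point_card[OF d[OF that], of x] unfolding count_above_step by (auto simp: le_Suc_eq)
  have c2: "count_above l (F (Suc s)) x - count_above l (F s) x \<in> {0, 1}
      \<and> count_above l (F s) (x - 1) - count_above l (F (Suc s)) x \<in> {0, 1}" if s: "s < n" for s x
  proof -
    have "count_above l (F s) x \<le> count_above l (F (Suc s)) x"
      unfolding count_above_sum by (rule sum_mono) (use mv[OF s] in force)
    moreover have "count_above l (F (Suc s)) x \<le> count_above l (F s) (x - 1)"
      unfolding count_above_sum by (rule sum_mono) (use mv[OF s] in force)
    moreover have "count_above l (F s) (x - 1) - count_above l (F s) x \<le> 1"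
      using dec_point_card[OF d, of s x] s unfolding count_above_step by auto
    ultimately show ?thesis by auto
  qed
  have Fn: "F n = w" using path_chainsD(2)[OF F] .
  have "height_fun n l F u - height_fun n l F v \<in> {0, 1}" if uv: "arc n u v" for u v
  proof -
    obtain x s where u: "u = (x, s)" by (cases u)
    consider "v = (x + 1, s)" "s \<le> n" | t where "s = Suc t" "v = (x, t)" "t < n" | "v = (x + 1, Suc s)" "s < n"
      using uv u unfolding arc_def by (cases v) auto
    then show ?thesis
      using c1[of s "x + 1"] c2[of s "x + 1"] c2[of _ x] by cases (auto simp: u height_fun_def)
  qed
  moreover have "height_fun n l F (x, n) = count_above l w x" for x using Fn by (simp add: height_fun_def)
  moreover have "height_fun n l F (x, r) = 0" if "n < r" for x r using that by (simp add: height_fun_def)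
  ultimately show "height_fun n l F \<in> {b. hfun n (count_above l w) b}"
    unfolding hfun_def by blast
next
  fix b assume "b \<in> {b. hfun n (count_above l w) b}"
  then have b: "hfun n (count_above l w) b" by simp
  define M where "M = Max (insert 0 ((\<lambda>i. \<bar>w i\<bar>) ` {0..<l}))"
  have M: "\<bar>w i\<bar> \<le> M" if "i < l" for i unfolding M_def by (rule Max_ge) (use that in auto)
  have wfar: "count_above l w x = 0" if "M \<le> x" for x
  proof -
    have "{i. i < l \<and> x < w i} = {}" using that M by force
    then show ?thesis by (simp add: count_above_def)
  qed
  have wnear: "count_above l w x = int l" if "x < - M" for x
  proof -
    have "{i. i < l \<and> x < w i} = {..<l}" using that M by force
    then show ?thesis by (simp add: count_above_def)
  qed
  have "\<exists>f. dec l f \<and> f \<in> extensional {0..<l} \<and> (\<forall>x. count_above l f x = b (x, s))" if s: "s \<le> n" for s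
  proof (rule row_from_counts[where u = M and v = "- M - 1 - int n"])
    show "b (x - 1, s) - b (x, s) \<in> {0, 1}" for x
      using hfunD[OF b, of "(x - 1, s)" "(x, s)"] s by (auto simp: arc_def)
    show "b (x, s) = 0" if "M \<le> x" for x
      using hfun_range[OF b s, of x] wfar[of x] wfar[of "x + int (n - s)"] that by simp
    show "b (x, s) = int l" if "x \<le> - M - 1 - int n" for x
      using hfun_range[OF b s, of x] wnear[of x] wnear[of "x + int (n - s)"] that by simp
  qed
  then obtain F0 where F0: "\<And>s. s \<le> n \<Longrightarrow> dec l (F0 s)" "\<And>s. s \<le> n \<Longrightarrow> F0 s \<in> extensional {0..<l}"
    "\<And>s x. s \<le> n \<Longrightarrow> count_above l (F0 s) x = b (x, s)" by metis
  define F where "F = restrict F0 {0..n}"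
  have Fn: "F n = w"
  proof
    fix i
    have "count_above l (F0 n) x = count_above l w x" for x using F0(3)[of n x] b by (simp add: hfun_def)
    then show "F n i = w i"
      using dec_eqI[OF F0(1)[of n] w(1), of i] F0(2)[of n] w(2)
      by (cases "i < l") (auto simp: F_def extensional_def)
  qed
  have mv: "F0 (Suc s) i = F0 s i \<or> F0 (Suc s) i = F0 s i + 1" if s: "s < n" and i: "i < l" for s i
  proof -
    have iff: "x < F0 s i \<longleftrightarrow> int i < b (x, s)" "x < F0 (Suc s) i \<longleftrightarrow> int i < b (x, Suc s)" for x
      using count_above_less_iff[OF F0(1) i, of s x] count_above_less_iff[OF F0(1) i, of "Suc s" x] F0(3)[of s x] F0(3)[of "Suc s" x] s
      by auto
    have "b (x, s) \<le> b (x, Suc s)" "b (x, Suc s) \<le> b (x - 1, s)" for x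
      using hfunD[OF b, of "(x, Suc s)" "(x, s)"] hfunD[OF b, of "(x - 1, s)" "(x, Suc s)"] s by (auto simp: arc_def)
    then have "F0 s i - 1 < F0 (Suc s) i" "F0 (Suc s) i - 1 - 1 < F0 s i"
      using iff(1)[of "F0 s i - 1"] iff(2)[of "F0 s i - 1"] iff(2)[of "F0 (Suc s) i - 1"] iff(1)[of "F0 (Suc s) i - 1 - 1"]
      by (smt (verit))+
    then show ?thesis by linarith
  qed
  have "F \<in> path_chains n l w 0"
    unfolding path_chains_def
  proof (intro CollectI conjI ballI allI impI)
    fix s i assume "s \<in> {0..<n}" "i < l"
    then show "F (Suc s) i = F s i \<or> F (Suc s) i = F s i + 1" using mv[of s i] by (simp add: F_def)
  next
    fix s assume "s \<in> {0..n}"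
    then show "dec l (F s)" "F s \<in> extensional {0..<l}" using F0(1,2)[of s] by (simp_all add: F_def)
  qed (simp_all add: Fn, simp add: F_def)
  moreover have "b = height_fun n l F"
  proof
    fix u :: cell
    show "b u = height_fun n l F u"
      using F0(3)[of "snd u" "fst u"] b by (cases u) (auto simp: height_fun_def F_def hfun_def)
  qed
  ultimately show "\<exists>F\<in>path_chains n l w 0. b = height_fun n l F" by blast
qed

text \<open>The bounds on the ends leave \<open>n\<close> further columns on the left, as
  \<open>strip\<close> demands. \<open>positivity\<close> concerns the ends alone and yields the
  bound on the depth of the top row.\<close>

locale families =
  fixes n l :: nat and W :: int and wB wA :: "nat \<Rightarrow> int"
  assumes n_pos': "0 < n" and W_ge': "3 \<le> W"
    and wB: "dec l wB" "wB \<in> extensional {0..<l}" and wA: "dec l wA" "wA \<in> extensional {0..<l}"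
    and wB_bound: "\<And>i. i < l \<Longrightarrow> 3 - W + int n \<le> wB i \<and> wB i \<le> W - 2"
    and wA_bound: "\<And>i. i < l \<Longrightarrow> 3 - W + int n \<le> wA i \<and> wA i \<le> W - 2"
    and positivity: "\<And>i. Suc i < l \<Longrightarrow> wB (Suc i) \<le> wA i"

lemma count_above_right: "(\<And>i. i < l \<Longrightarrow> w i \<le> x) \<Longrightarrow> count_above l w x = 0"
  unfolding count_above_sum by (rule sum.neutral) (force simp: not_less)

lemma count_above_left:
  assumes "\<And>i. i < l \<Longrightarrow> x < w i"
  shows "count_above l w x = int l"
proof -
  have "count_above l w x = (\<Sum>i<l. 1)" unfolding count_above_sum by (rule sum.cong) (use assms in auto)
  then show ?thesis by simp
qed

sublocale families \<subseteq> strip n "int l" W "count_above l wB" "count_above l wA"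
proof
  show "0 < n" "3 \<le> W" by (rule n_pos', rule W_ge')
  fix x
  show "W - 2 \<le> x \<Longrightarrow> count_above l wB x = 0" by (rule count_above_right) (use wB_bound in force)
  show "W - 2 \<le> x \<Longrightarrow> count_above l wA x = 0" by (rule count_above_right) (use wA_bound in force)
  show "x \<le> 2 - W + int n \<Longrightarrow> count_above l wB x = int l" by (rule count_above_left) (use wB_bound in force)
  show "x \<le> 2 - W + int n \<Longrightarrow> count_above l wA x = int l" by (rule count_above_left) (use wA_bound in force)
  show "count_above l wB x - count_above l wA x \<le> 1"
  proof (rule ccontr)
    assume a: "\<not> ?thesis"
    \<comment> \<open>If two more upper than dual lower ends lay to the right of \<open>x\<close>,
      upper end number \<open>i + 1\<close> would be beyond \<open>x\<close> while lower end number
      \<open>i\<close> is not.\<close>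
    define i where "i = nat (count_above l wA x)"
    have i: "int i = count_above l wA x" using count_above_range(1)[of l wA x] by (simp add: i_def)
    have lt: "int (Suc i) < count_above l wB x" using a i by simp
    then have il: "Suc i < l" using count_above_range(2)[of l wB x] by linarith
    then have "x < wB (Suc i)" using lt count_above_less_iff[OF wB(1)] by blast
    then have "x < wA i" using positivity[OF il] by simp
    then show False using count_above_less_iff[OF wA(1), of i x] il i by simp
  qed
qed

section \<open>The determinant as a signed sum over configurations\<close>

context families
begin

definition BC where "BC = path_chains n l wB 0"
definition AC where "AC = path_chains n l wA 0"

definition conf_of :: "(nat \<Rightarrow> nat \<Rightarrow> int) \<times> (nat \<Rightarrow> nat \<Rightarrow> int) \<Rightarrow> conf" where
  "conf_of = map_prod (height_fun n l) (height_fun n l)"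

lemma conf_of_bij: "bij_betw conf_of (BC \<times> AC) Conf"
proof -
  have "Conf = {b. hfun n (count_above l wB) b} \<times> {a. hfun n (count_above l wA) a}"
    by (auto simp: Conf_def)
  then show ?thesis
    unfolding conf_of_def BC_def AC_def
    using bij_betw_map_prod[OF height_fun_bij[OF wB] height_fun_bij[OF wA]] by simp
qed

lemma chain_facts:
  assumes "F \<in> path_chains n l w 0"
  shows "s \<le> n \<Longrightarrow> dec l (F s)" "s \<le> n \<Longrightarrow> F s \<in> extensional {0..<l}"
    "s < n \<Longrightarrow> i < l \<Longrightarrow> F (Suc s) i = F s i \<or> F (Suc s) i = F s i + 1" "F n = w"
  using assms by (auto simp: path_chains_def)

lemma chain_bound:
  assumes "F \<in> path_chains n l w 0" "i < l" "s \<le> n"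
  shows "F s i \<le> w i" "w i - int n \<le> F s i"
proof -
  have "F s i \<le> w i \<and> w i - int (n - s) \<le> F s i"
    using assms(3)
  proof (induction rule: inc_induct)
    case base
    then show ?case using chain_facts(4)[OF assms(1)] by simp
  next
    case (step s)
    then show ?case using chain_facts(3)[OF assms(1) step(2) assms(2)] by (auto simp: of_nat_diff)
  qed
  then show "F s i \<le> w i" "w i - int n \<le> F s i" by auto
qed

lemma BC_window: "F \<in> BC \<Longrightarrow> i < l \<Longrightarrow> s \<le> n \<Longrightarrow> 3 - W \<le> F s i \<and> F s i \<le> W - 2"
  using chain_bound[of F wB i s] wB_bound[of i] by (simp add: BC_def)

lemma AC_window: "F \<in> AC \<Longrightarrow> i < l \<Longrightarrow> s \<le> n \<Longrightarrow> 3 - W \<le> F s i \<and> F s i \<le> W - 2"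
  using chain_bound[of F wA i s] wA_bound[of i] by (simp add: AC_def)

lemma finite_AC: "finite AC" and finite_BC: "finite BC"
proof -
  have f: "finite (BC \<times> AC)" using bij_betw_finite[OF conf_of_bij] finite_Conf by simp
  \<comment> \<open>A finite product has finite factors once both are nonempty; the constant
    families show this.\<close>
  have "restrict (\<lambda>_. wA) {0..n} \<in> AC"
    using wA unfolding AC_def path_chains_def by (auto simp: dec_def extensional_restrict)
  moreover have "restrict (\<lambda>_. wB) {0..n} \<in> BC"
    using wB unfolding BC_def path_chains_def by (auto simp: dec_def extensional_restrict)
  ultimately have "BC \<noteq> {}" "AC \<noteq> {}" by auto
  then show "finite AC" "finite BC"
    using f by (auto simp: finite_cartesian_product_iff)
qed

lemma prod_swap_points:
  fixes z :: "int \<Rightarrow> 'r::comm_ring_1"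
  assumes "\<And>i. i < l \<Longrightarrow> -W \<le> f i \<and> f i \<le> W"
  shows "(\<Prod>x\<in>{-W..W}. z x ^ (\<Sum>i<l. if f i = x \<and> P i then 1 else 0)) = (\<Prod>i<l. if P i then z (f i) else 1)"
proof -
  have "(\<Prod>x\<in>{-W..W}. z x ^ (\<Sum>i<l. if f i = x \<and> P i then 1 else 0))
    = (\<Prod>i<l. \<Prod>x\<in>{-W..W}. z x ^ (if f i = x \<and> P i then 1 else 0))"
    unfolding power_sum by (rule prod.swap)
  also have "\<dots> = (\<Prod>i<l. if P i then z (f i) else 1)"
  proof (rule prod.cong)
    fix i assume "i \<in> {..<l}"
    then have fi: "f i \<in> {-W..W}" using assms[of i] by simp
    have "(\<Prod>x\<in>{-W..W}. z x ^ (if f i = x \<and> P i then 1 else 0)) = (\<Prod>x\<in>{-W..W}. if x = f i then (if P i then z x else 1) else 1)"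
      by (rule prod.cong) auto
    also have "\<dots> = (if P i then z (f i) else 1)" using fi by simp
    finally show "(\<Prod>x\<in>{-W..W}. z x ^ (if f i = x \<and> P i then 1 else 0)) = (if P i then z (f i) else 1)" .
  qed simp
  finally show ?thesis .
qed

lemma nat_sum_diff:
  assumes "\<And>i. i < l \<Longrightarrow> (if A i then 1 else 0) - (if B i then 1 else 0) = (if C i then 1 else 0 :: int)"
  shows "nat ((\<Sum>i<l. if A i then 1 else 0) - (\<Sum>i<l. if B i then 1 else 0)) = (\<Sum>i<l. if C i then 1 else 0)"
proof -
  have "(\<Sum>i<l. if A i then 1 else 0) - (\<Sum>i<l. if B i then 1 else 0) = (\<Sum>i<l. if C i then 1 else 0 :: int)"
    unfolding sum_subtractf[symmetric] by (rule sum.cong) (use assms in auto)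
  also have "\<dots> = int (\<Sum>i<l. if C i then 1 else 0)" by (induction l) auto
  finally show ?thesis by (simp only: nat_int)
qed

lemma row_wt_conf_of:
  fixes zf zg :: "int \<Rightarrow> nat \<Rightarrow> 'r::comm_ring_1"
  assumes B: "B \<in> BC" and A: "A \<in> AC" and s: "s < n"
  shows "row_wt zf zg (conf_of (B, A)) s
    = (\<Prod>i = 0..<l. if A (Suc s) i = A s i then zf (A s i) s else 1) * (\<Prod>i = 0..<l. if B (Suc s) i = B s i then 1 else zg (B s i) s)"
proof -
  have sB: "B (Suc s) i = B s i \<or> B (Suc s) i = B s i + 1" if "i < l" for i
    using chain_facts(3)[of B wB s i] B s that by (simp add: BC_def)
  have sA: "A (Suc s) i = A s i \<or> A (Suc s) i = A s i + 1" if "i < l" for i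
    using chain_facts(3)[of A wA s i] A s that by (simp add: AC_def)
  have a: "nat (count_above l (A s) (x - 1) - count_above l (A (Suc s)) x)
      = (\<Sum>i<l. if A s i = x \<and> A (Suc s) i = A s i then 1 else 0)" for x
    unfolding count_above_sum by (rule nat_sum_diff) (use sA in force)
  have b: "nat (count_above l (B (Suc s)) x - count_above l (B s) x)
      = (\<Sum>i<l. if B s i = x \<and> B (Suc s) i \<noteq> B s i then 1 else 0)" for x
    unfolding count_above_sum by (rule nat_sum_diff) (use sB in force)
  have bdA: "-W \<le> A s i \<and> A s i \<le> W" and bdB: "-W \<le> B s i \<and> B s i \<le> W" if "i < l" for i
    using AC_window[OF A that, of s] BC_window[OF B that, of s] s by auto
  have "row_wt zf zg (conf_of (B, A)) s = (\<Prod>x\<in>{-W..W}. zf x s ^ (\<Sum>i<l. if A s i = x \<and> A (Suc s) i = A s i then 1 else 0)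
      * zg x s ^ (\<Sum>i<l. if B s i = x \<and> B (Suc s) i \<noteq> B s i then 1 else 0))"
    unfolding row_wt_def conf_of_def using s by (simp add: height_fun_def a b)
  also have "\<dots> = (\<Prod>i<l. if A (Suc s) i = A s i then zf (A s i) s else 1)
      * (\<Prod>i<l. if B (Suc s) i \<noteq> B s i then zg (B s i) s else 1)"
    unfolding prod.distrib
    by (subst (1 2) prod_swap_points) (use bdA bdB in auto)
  also have "(\<Prod>i<l. if B (Suc s) i \<noteq> B s i then zg (B s i) s else 1) = (\<Prod>i<l. if B (Suc s) i = B s i then 1 else zg (B s i) s)"
    by (rule prod.cong) auto
  finally show ?thesis by (simp only: atLeast0LessThan)
qed

lemma Qf_conf_of:
  assumes B: "B \<in> BC" and A: "A \<in> AC"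
  shows "Qf (conf_of (B, A)) x = (\<Sum>j<l. if x < B 0 j then sg (B 0 j) else 0) + (\<Sum>i<l. if x < A 0 i then sg (A 0 i) else 0)"
proof -
  have c: "conf_of (B, A) \<in> Conf" using conf_of_bij B A by (auto simp: bij_betw_def)
  have t: "tot (conf_of (B, A)) (y, 0) = (\<Sum>j<l. if y < B 0 j then 1 else 0) + (\<Sum>i<l. if y < A 0 i then 1 else 0)" for y
    by (simp add: tot_def conf_of_def height_fun_def count_above_sum)
  show ?thesis
  proof (induction x rule: bottom_induct)
    case (right x)
    have "\<not> x < B 0 j" "\<not> x < A 0 j" if "j < l" for j
      using BC_window[OF B that, of 0] AC_window[OF A that, of 0] right by auto
    then show ?case by (simp add: Qf_right[OF right])
  next
    case (step x)
    have e: "(\<Sum>j<l. if x - 1 < f j then sg (f j) else 0) = (\<Sum>j<l. if x < f j then sg (f j) else 0)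
        + ((\<Sum>j<l. if x - 1 < f j then 1 else 0) - (\<Sum>j<l. if x < f j then 1 else 0)) * sg x" for f :: "nat \<Rightarrow> int"
    proof -
      have "(if x - 1 < f j then sg (f j) else 0) = (if x < f j then sg (f j) else 0)
          + ((if x - 1 < f j then 1 else 0) - (if x < f j then 1 else 0)) * sg x" for j
        by (cases "f j = x") auto
      then show ?thesis
        by (simp add: sum.distrib sum_subtractf sum_distrib_right[symmetric])
    qed
    show ?case unfolding Qf_step[OF c] step t e[of "B 0"] e[of "A 0"] by (simp add: algebra_simps)
  qed
qed

lemma depth_conf_of:
  "depth (conf_of (B, A)) (x, 0) = (\<Sum>j<l. if x < B 0 j then 1 else 0) - (\<Sum>i<l. if x < A 0 i then 1 else 0)"
  by (simp add: depth_def conf_of_def height_fun_def count_above_sum)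

text \<open>A dual lower end enters the depth with a minus sign, and \<open>Qf\<close> with the
  parity of \<open>A 0 i\<close>, opposite to that of the start \<open>A 0 i + 1\<close>. Relative
  to the starts both carry a minus sign, so adding or subtracting \<open>Qf\<close> isolates one
  parity class.\<close>

lemma class_depth_conf_of:
  assumes "B \<in> BC" "A \<in> AC"
  shows "2 * class_depth l (\<lambda>i. A 0 i + 1) (B 0) q x = depth (conf_of (B, A)) (x, 0) + sg q * Qf (conf_of (B, A)) x"
proof -
  have b: "2 * (if x < B 0 j \<and> even (B 0 j - q) then 1 else 0) = (if x < B 0 j then 1 else 0) + sg q * (if x < B 0 j then sg (B 0 j) else 0)" for j
    by (auto simp: sg_def)
  have a: "2 * (if x < A 0 i + 1 - 1 \<and> even (A 0 i + 1 - q) then 1 else 0) = (if x < A 0 i then 1 else 0) - sg q * (if x < A 0 i then sg (A 0 i) else 0)" for i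
    by (auto simp: sg_def)
  show ?thesis
    unfolding Qf_conf_of[OF assms] depth_conf_of class_depth_def right_diff_distrib sum_distrib_left a b distrib_left
    by (simp add: sum.distrib sum_subtractf)
qed

lemma mid_exp_conf_of:
  assumes "B \<in> BC" "A \<in> AC"
  shows "mid_exp (conf_of (B, A)) x = class_depth l (\<lambda>i. A 0 i + 1) (B 0) x x"
  using class_depth_conf_of[OF assms, of x x] unfolding mid_exp_def by simp

text \<open>There are two parity classes, whose depths are half the sum and half the difference of
  the depth and \<open>Qf\<close>. Both lie in \<open>{0, 1}\<close> exactly under the bounds that
  define \<open>Xc\<close>.\<close>

lemma interlaced_conf_of:
  assumes "B \<in> BC" "A \<in> AC"
  shows "interlaced l (\<lambda>i. A 0 i + 1) (B 0) \<longleftrightarrow> conf_of (B, A) \<in> Xc"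
proof -
  have c: "conf_of (B, A) \<in> Conf" using conf_of_bij assms by (auto simp: bij_betw_def)
  let ?d = "\<lambda>x. depth (conf_of (B, A)) (x, 0)" and ?q = "\<lambda>x. Qf (conf_of (B, A)) x"
  have "(\<forall>q. class_depth l (\<lambda>i. A 0 i + 1) (B 0) q x \<in> {0, 1}) \<longleftrightarrow> \<bar>?q x\<bar> \<le> 1 \<and> 0 \<le> ?d x \<and> ?d x \<le> 2" for x
  proof -
    have "(\<forall>q. class_depth l (\<lambda>i. A 0 i + 1) (B 0) q x \<in> {0, 1})
        \<longleftrightarrow> class_depth l (\<lambda>i. A 0 i + 1) (B 0) 0 x \<in> {0, 1} \<and> class_depth l (\<lambda>i. A 0 i + 1) (B 0) 1 x \<in> {0, 1}"
    proof (intro iffI conjI allI)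
      fix q assume a: "class_depth l (\<lambda>i. A 0 i + 1) (B 0) 0 x \<in> {0, 1} \<and> class_depth l (\<lambda>i. A 0 i + 1) (B 0) 1 x \<in> {0, 1}"
      have "class_depth l (\<lambda>i. A 0 i + 1) (B 0) q x = class_depth l (\<lambda>i. A 0 i + 1) (B 0) (if even q then 0 else 1) x"
        using class_depth_conf_of[OF assms, of q x] class_depth_conf_of[OF assms, of "if even q then 0 else 1" x]
        by (simp add: sg_def split: if_splits)
      then show "class_depth l (\<lambda>i. A 0 i + 1) (B 0) q x \<in> {0, 1}" using a by (simp split: if_splits)
    qed auto
    moreover have "2 * class_depth l (\<lambda>i. A 0 i + 1) (B 0) 0 x = ?d x + ?q x"
      "2 * class_depth l (\<lambda>i. A 0 i + 1) (B 0) 1 x = ?d x - ?q x"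
      using class_depth_conf_of[OF assms, of 0 x] class_depth_conf_of[OF assms, of 1 x] by (simp_all add: sg_def)
    ultimately show ?thesis by auto
  qed
  then show ?thesis using c unfolding interlaced_def Xc_def Qbd_def by auto
qed

text \<open>The bottom cells of depth 2 form the intervals from \<open>A 0 i\<close> to
  \<open>B 0 (Suc i)\<close>. The colours next to the two ends of such an interval multiply to a
  sign given by the parity of its length, and this is the factor in
  \<open>kernel_sign\<close>.\<close>

lemma kernel_sign_conf_of:
  assumes B: "B \<in> BC" and A: "A \<in> AC" and X: "conf_of (B, A) \<in> Xc"
  shows "th (conf_of (B, A)) {u. 2 \<le> depth (conf_of (B, A)) u} = kernel_sign l (\<lambda>i. A 0 i + 1) (B 0)"
proof -
  define c where "c = conf_of (B, A)"
  define T where "T = {u. 2 \<le> depth c u}"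
  define I where "I = {i. Suc i < l \<and> A 0 i < B 0 (Suc i)}"
  have C: "c \<in> Conf" "Qbd c" "\<And>x. 0 \<le> depth c (x, 0)" "\<And>x. depth c (x, 0) \<le> 2" using X by (auto simp: Xc_def c_def)
  have dA: "dec l (A 0)" and dB: "dec l (B 0)"
    using chain_facts(1)[of A wA 0] chain_facts(1)[of B wB 0] A B by (auto simp: AC_def BC_def)
  have fb: "fst c (x, 0) = count_above l (B 0) x" "snd c (x, 0) = count_above l (A 0) x" for x
    by (simp_all add: c_def conf_of_def height_fun_def)
  have dep: "depth c (x, 0) = count_above l (B 0) x - count_above l (A 0) x" for x by (simp add: depth_def fb)
  \<comment> \<open>At depth 2 the signed count is even and bounded by 1, so it vanishes. Just
    outside an interval it is then known up to the parity of the end, which makes the colours there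
    explicit.\<close>
  have Q0: "Qf c x = 0" if "depth c (x, 0) = 2" for x
  proof -
    have "even (Qf c x)" using Qf_parity[OF C(1), of x] that by simp
    moreover have "\<bar>Qf c x\<bar> \<le> 1" using C(2) by (simp add: Qbd_def)
    ultimately show ?thesis by presburger
  qed
  have T_iff: "(x, 0) \<in> T \<longleftrightarrow> (\<exists>i\<in>I. A 0 i \<le> x \<and> x < B 0 (Suc i))" for x
  proof
    assume "(x, 0) \<in> T"
    then have e: "count_above l (B 0) x = count_above l (A 0) x + 2" using C(4)[of x] dep[of x] by (simp add: T_def)
    define i where "i = nat (count_above l (A 0) x)"
    have i: "int i = count_above l (A 0) x" using count_above_range(1)[of l "A 0" x] by (simp add: i_def)
    have il: "Suc i < l" using count_above_range(2)[of l "B 0" x] e i by linarith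
    then have "x < B 0 (Suc i)" "\<not> x < A 0 i"
      using count_above_less_iff[OF dB il, of x] count_above_less_iff[OF dA, of i x] e i by auto
    then show "\<exists>i\<in>I. A 0 i \<le> x \<and> x < B 0 (Suc i)" using il by (auto simp: I_def)
  next
    assume "\<exists>i\<in>I. A 0 i \<le> x \<and> x < B 0 (Suc i)"
    then obtain i where i: "Suc i < l" "A 0 i \<le> x" "x < B 0 (Suc i)" by (auto simp: I_def)
    then have "int (Suc i) < count_above l (B 0) x" "\<not> int i < count_above l (A 0) x"
      using count_above_less_iff[OF dB i(1), of x] count_above_less_iff[OF dA, of i x] by auto
    then show "(x, 0) \<in> T" using dep[of x] by (simp add: T_def)
  qed
  have dTx: "(x, 0) \<in> T \<longleftrightarrow> depth c (x, 0) = 2" for x using C(4)[of x] by (auto simp: T_def)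
  have Tcount: "count_above l (A 0) x = int i" "count_above l (B 0) x = int i + 2"
    if "i \<in> I" "A 0 i \<le> x" "x < B 0 (Suc i)" for i x
  proof -
    have i: "Suc i < l" using that by (simp add: I_def)
    have "depth c (x, 0) = 2" using T_iff[of x] that dTx[of x] by blast
    moreover have "int (Suc i) < count_above l (B 0) x" "\<not> int i < count_above l (A 0) x"
      using count_above_less_iff[OF dB i, of x] count_above_less_iff[OF dA, of i x] that i by auto
    ultimately show "count_above l (A 0) x = int i" "count_above l (B 0) x = int i + 2" using dep[of x] by auto
  qed
  have jump: "tot c (x - 1, 0) - tot c (x, 0) = 1 \<and> Qf c (x - 1) = Qf c x + sg x"
    if "depth c (x, 0) = 2 \<and> depth c (x - 1, 0) \<noteq> 2 \<or> depth c (x, 0) \<noteq> 2 \<and> depth c (x - 1, 0) = 2" for x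
  proof -
    have a: "arc n (x - 1, 0) (x, 0)" by (simp add: arc_def)
    have "tot c (x - 1, 0) - tot c (x, 0) = 1"
      using hfunD[OF _ a, of "count_above l wB" "fst c"] hfunD[OF _ a, of "count_above l wA" "snd c"] C(1) that
      by (auto simp: Conf_def tot_def depth_def)
    then show ?thesis using Qf_step[OF C(1), of x] by simp
  qed
  have left: "(y - 1, 0) \<notin> T \<and> (y, 0) \<in> T \<and> kap c (y - 1) = sg (A 0 i) * sg (int i)" if i: "i \<in> I" and y: "y = A 0 i" for i y
  proof -
    have iI: "Suc i < l" "A 0 i < B 0 (Suc i)" using i by (auto simp: I_def)
    have yT: "(y, 0) \<in> T" unfolding T_iff by (rule bexI[of _ i]) (use i iI y in auto)
    have cA: "count_above l (A 0) y = int i" and cB: "count_above l (B 0) y = int i + 2" using Tcount[OF i, of y] iI y by auto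
    have "int i < count_above l (A 0) (y - 1)" using count_above_less_iff[OF dA, of i "y - 1"] iI y by simp
    then have n1: "tot c (y - 1, 0) \<ge> tot c (y, 0) + 1"
      using cA hfunD[of n "count_above l wB" "fst c" "(y - 1, 0)" "(y, 0)"] C(1) by (auto simp: tot_def fb Conf_def arc_def)
    have nT: "(y - 1, 0) \<notin> T"
    proof
      assume "(y - 1, 0) \<in> T"
      then have d: "depth c (y - 1, 0) = 2" "depth c (y, 0) = 2" using yT dTx by auto
      have "(tot c (y - 1, 0) - tot c (y, 0)) * sg y = 0" using Qf_step[OF C(1), of y] Q0[OF d(1)] Q0[OF d(2)] by simp
      then show False using n1 by (auto simp: sg_def split: if_splits)
    qed
    have "Qf c (y - 1) = sg y" "tot c (y - 1, 0) - tot c (y, 0) = 1"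
      using jump[of y] yT nT Q0[of y] dTx by auto
    moreover have "count_above l (B 0) (y - 1) = int i + 2"
      using \<open>int i < count_above l (A 0) (y - 1)\<close> calculation(2) cA cB
        hfunD[of n "count_above l wB" "fst c" "(y - 1, 0)" "(y, 0)"] C(1) by (auto simp: tot_def fb Conf_def arc_def)
    ultimately show ?thesis using nT yT y by (simp add: kap_def fb sg_add) (simp add: sg_def)
  qed
  have right: "(y - 1, 0) \<in> T \<and> (y, 0) \<notin> T \<and> kap c y = sg (B 0 (Suc i)) * sg (int i)" if i: "i \<in> I" and y: "y = B 0 (Suc i)" for i y
  proof -
    have iI: "Suc i < l" "A 0 i < B 0 (Suc i)" using i by (auto simp: I_def)
    have yT: "(y - 1, 0) \<in> T" unfolding T_iff by (rule bexI[of _ i]) (use i iI y in auto)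
    have cA: "count_above l (A 0) (y - 1) = int i" and cB: "count_above l (B 0) (y - 1) = int i + 2" using Tcount[OF i, of "y - 1"] iI y by auto
    have cB': "count_above l (B 0) y \<le> int i + 1" using count_above_less_iff[OF dB iI(1), of y] y by auto
    then have n1: "tot c (y - 1, 0) \<ge> tot c (y, 0) + 1"
      using cB hfunD[of n "count_above l wA" "snd c" "(y - 1, 0)" "(y, 0)"] C(1) by (auto simp: tot_def fb Conf_def arc_def)
    have nT: "(y, 0) \<notin> T"
    proof
      assume "(y, 0) \<in> T"
      then have d: "depth c (y - 1, 0) = 2" "depth c (y, 0) = 2" using yT dTx by auto
      have "(tot c (y - 1, 0) - tot c (y, 0)) * sg y = 0" using Qf_step[OF C(1), of y] Q0[OF d(1)] Q0[OF d(2)] by simp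
      then show False using n1 by (auto simp: sg_def split: if_splits)
    qed
    have "Qf c y = - sg y" "tot c (y - 1, 0) - tot c (y, 0) = 1"
      using jump[of y] yT nT Q0[of "y - 1"] dTx by auto
    moreover have "count_above l (B 0) y = int i + 1"
      using cB' calculation(2) cA cB
        hfunD[of n "count_above l wA" "snd c" "(y - 1, 0)" "(y, 0)"] C(1) by (auto simp: tot_def fb Conf_def arc_def)
    ultimately show ?thesis using nT yT y by (simp add: kap_def fb sg_add) (simp add: sg_def)
  qed
  let ?fl = "\<lambda>y. if (y - 1, 0) \<notin> T \<and> (y, 0) \<in> T then kap c (y - 1) else 1"
  let ?fr = "\<lambda>y. if (y - 1, 0) \<in> T \<and> (y, 0) \<notin> T then kap c y else 1"
  have "th c T = (\<Prod>y\<in>{-W..W}. ?fl y * ?fr y)" unfolding th_def by (rule prod.cong) auto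
  also have "\<dots> = (\<Prod>y\<in>{-W..W}. ?fl y) * (\<Prod>y\<in>{-W..W}. ?fr y)" by (rule prod.distrib)
  also have "(\<Prod>y\<in>{-W..W}. ?fl y) = (\<Prod>y\<in>A 0 ` I. ?fl y)"
  proof (rule prod.mono_neutral_right)
    show "A 0 ` I \<subseteq> {-W..W}"
    proof (rule image_subsetI)
      fix i assume "i \<in> I"
      then have "i < l" by (simp add: I_def)
      from AC_window[OF A this, of 0] show "A 0 i \<in> {-W..W}" by simp
    qed
    show "\<forall>y\<in>{-W..W} - A 0 ` I. ?fl y = 1"
    proof
      fix y assume y: "y \<in> {-W..W} - A 0 ` I"
      have "\<not> ((y - 1, 0) \<notin> T \<and> (y, 0) \<in> T)"
      proof
        assume a: "(y - 1, 0) \<notin> T \<and> (y, 0) \<in> T"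
        then obtain i where i: "i \<in> I" "A 0 i \<le> y" "y < B 0 (Suc i)" using T_iff by blast
        then have "A 0 i \<le> y - 1" using y by auto
        then show False using a T_iff[of "y - 1"] i by auto
      qed
      then show "?fl y = 1" by (rule if_not_P)
    qed
  qed simp
  also have "\<dots> = (\<Prod>i\<in>I. ?fl (A 0 i))"
    by (rule prod.reindex[unfolded comp_def]) (use dec_inj[OF dA] in \<open>auto simp: inj_on_def I_def\<close>)
  also have "\<dots> = (\<Prod>i\<in>I. sg (A 0 i) * sg (int i))" by (rule prod.cong) (use left in auto)
  also have "(\<Prod>y\<in>{-W..W}. ?fr y) = (\<Prod>y\<in>(\<lambda>i. B 0 (Suc i)) ` I. ?fr y)"
  proof (rule prod.mono_neutral_right)
    show "(\<lambda>i. B 0 (Suc i)) ` I \<subseteq> {-W..W}"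
    proof (rule image_subsetI)
      fix i assume "i \<in> I"
      then have "Suc i < l" by (simp add: I_def)
      from BC_window[OF B this, of 0] show "B 0 (Suc i) \<in> {-W..W}" by simp
    qed
    show "\<forall>y\<in>{-W..W} - (\<lambda>i. B 0 (Suc i)) ` I. ?fr y = 1"
    proof
      fix y assume y: "y \<in> {-W..W} - (\<lambda>i. B 0 (Suc i)) ` I"
      have "\<not> ((y - 1, 0) \<in> T \<and> (y, 0) \<notin> T)"
      proof
        assume a: "(y - 1, 0) \<in> T \<and> (y, 0) \<notin> T"
        then obtain i where i: "i \<in> I" "A 0 i \<le> y - 1" "y - 1 < B 0 (Suc i)" using T_iff by blast
        then have "y \<noteq> B 0 (Suc i)" using y by blast
        then have "y < B 0 (Suc i)" using i(3) by simp
        then show False using a T_iff[of y] i by auto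
      qed
      then show "?fr y = 1" by (rule if_not_P)
    qed
  qed simp
  also have "\<dots> = (\<Prod>i\<in>I. ?fr (B 0 (Suc i)))"
    by (rule prod.reindex[unfolded comp_def]) (use dec_inj[OF dB, of "Suc _" "Suc _"] in \<open>auto simp: inj_on_def I_def\<close>)
  also have "\<dots> = (\<Prod>i\<in>I. sg (B 0 (Suc i)) * sg (int i))" by (rule prod.cong) (use right in auto)
  also have "(\<Prod>i\<in>I. sg (A 0 i) * sg (int i)) * (\<Prod>i\<in>I. sg (B 0 (Suc i)) * sg (int i))
    = (\<Prod>i\<in>I. if even (A 0 i + 1 - B 0 (Suc i)) then -1 else 1)"
    unfolding prod.distrib[symmetric] by (rule prod.cong) (auto simp: sg_def)
  also have "\<dots> = kernel_sign l (\<lambda>i. A 0 i + 1) (B 0)"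
    unfolding kernel_sign_def
    by (rule prod.mono_neutral_cong_left) (auto simp: I_def)
  finally show ?thesis by (simp add: c_def T_def)
qed

text \<open>An entry is composed of a sum over dual lower paths, a walk of double steps and a sum
  over upper paths. \<open>dt_chains\<close> expands the outer two factors and
  \<open>dt_mid_kernel\<close> the inner one; the latter is the source of the sign and of the bound
  on the depth.\<close>

theorem path_sum:
  fixes zf zg :: "int \<Rightarrow> nat \<Rightarrow> 'r::comm_ring_1"
  assumes CB_top: "\<And>x j. CB n x j = (if x = wB j then 1 else 0)"
    and CB: "\<And>s x j. s < n \<Longrightarrow> CB s x j = CB (Suc s) x j + zg x s * CB (Suc s) (x + 1) j"
    and CA_top: "\<And>x j. CA n x j = (if x = wA j then 1 else 0)"
    and CA: "\<And>s x j. s < n \<Longrightarrow> CA s x j = zf x s * CA (Suc s) x j + CA (Suc s) (x + 1) j"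
  shows "dt l (\<lambda>i j. \<Sum>x\<in>{-W..W}. CA 0 x i * (\<Sum>y\<in>{-W..W}. mid_kernel (\<lambda>x. zf (x + 1) 0 * zg x 0) (x + 1) y * CB 0 y j))
    = (\<Sum>c\<in>Xc. of_int (th c {u. 2 \<le> depth c u}) * conf_wt zf zg c)"
proof -
  let ?S = "{-W..W}" and ?\<omega> = "\<lambda>x. zf (x + 1) 0 * zg x 0"
  let ?K = "\<lambda>f g. dt l (\<lambda>i j. mid_kernel ?\<omega> (f i + 1) (g j))"
  let ?wA = "\<lambda>F. \<Prod>s = 0..<n. \<Prod>i = 0..<l. if F (Suc s) i = F s i then zf (F s i) s else 1"
  let ?wB = "\<lambda>F. \<Prod>s = 0..<n. \<Prod>i = 0..<l. if F (Suc s) i = F s i then 1 else zg (F s i) s"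
  have dA: "dt l (\<lambda>i j. CA 0 (f i) j) = (\<Sum>F | F \<in> AC \<and> F 0 = f. ?wA F)" if "f \<in> decs l ?S" for f
    unfolding AC_def
    by (rule dt_chains[of l wA CA n "\<lambda>s x. zf x s" "\<lambda>s x. 1" 0 f])
      (use wA CA_top CA that in \<open>auto simp: decs_def PiE_iff\<close>)
  have dB: "dt l (\<lambda>i j. CB 0 (g i) j) = (\<Sum>F | F \<in> BC \<and> F 0 = g. ?wB F)" if "g \<in> decs l ?S" for g
    unfolding BC_def
    by (rule dt_chains[of l wB CB n "\<lambda>s x. 1" "\<lambda>s x. zg x s" 0 g])
      (use wB CB_top CB that in \<open>auto simp: decs_def PiE_iff\<close>)
  have AS: "F 0 \<in> decs l ?S" if "F \<in> AC" for F
    using AC_window[OF that, of _ 0] chain_facts(1,2)[of F wA 0] that by (fastforce simp: decs_def PiE_iff AC_def)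
  have BS: "F 0 \<in> decs l ?S" if "F \<in> BC" for F
    using BC_window[OF that, of _ 0] chain_facts(1,2)[of F wB 0] that by (fastforce simp: decs_def PiE_iff BC_def)
  have "dt l (\<lambda>i j. \<Sum>x\<in>?S. CA 0 x i * (\<Sum>y\<in>?S. mid_kernel ?\<omega> (x + 1) y * CB 0 y j))
    = (\<Sum>f\<in>decs l ?S. dt l (\<lambda>i k. CA 0 (f k) i) * dt l (\<lambda>i j. \<Sum>y\<in>?S. mid_kernel ?\<omega> (f i + 1) y * CB 0 y j))"
    by (rule cauchy_binet[where P = "\<lambda>i x. CA 0 x i" and R = "\<lambda>x j. \<Sum>y\<in>?S. mid_kernel ?\<omega> (x + 1) y * CB 0 y j"]) simp
  also have "\<dots> = (\<Sum>f\<in>decs l ?S. dt l (\<lambda>i j. CA 0 (f i) j) * (\<Sum>g\<in>decs l ?S. ?K f g * dt l (\<lambda>i j. CB 0 (g i) j)))"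
  proof (rule sum.cong)
    fix f
    have "dt l (\<lambda>i k. CA 0 (f k) i) = dt l (\<lambda>i j. CA 0 (f i) j)" by (rule dt_transpose)
    moreover have "dt l (\<lambda>i j. \<Sum>y\<in>?S. mid_kernel ?\<omega> (f i + 1) y * CB 0 y j) = (\<Sum>g\<in>decs l ?S. ?K f g * dt l (\<lambda>i j. CB 0 (g i) j))"
      by (rule cauchy_binet[where P = "\<lambda>i y. mid_kernel ?\<omega> (f i + 1) y" and R = "\<lambda>y j. CB 0 y j"]) simp
    ultimately show "dt l (\<lambda>i k. CA 0 (f k) i) * dt l (\<lambda>i j. \<Sum>y\<in>?S. mid_kernel ?\<omega> (f i + 1) y * CB 0 y j)
      = dt l (\<lambda>i j. CA 0 (f i) j) * (\<Sum>g\<in>decs l ?S. ?K f g * dt l (\<lambda>i j. CB 0 (g i) j))" by simp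
  qed simp
  also have "\<dots> = (\<Sum>f\<in>decs l ?S. (\<Sum>F | F \<in> AC \<and> F 0 = f. ?wA F) * (\<Sum>g\<in>decs l ?S. ?K f g * (\<Sum>G | G \<in> BC \<and> G 0 = g. ?wB G)))"
    by (intro sum.cong refl) (simp add: dA dB)
  also have "\<dots> = (\<Sum>f\<in>decs l ?S. \<Sum>F | F \<in> AC \<and> F 0 = f. \<Sum>g\<in>decs l ?S. \<Sum>G | G \<in> BC \<and> G 0 = g. ?wA F * ?wB G * ?K (F 0) (G 0))"
  proof (rule sum.cong)
    fix f
    show "(\<Sum>F | F \<in> AC \<and> F 0 = f. ?wA F) * (\<Sum>g\<in>decs l ?S. ?K f g * (\<Sum>G | G \<in> BC \<and> G 0 = g. ?wB G))
      = (\<Sum>F | F \<in> AC \<and> F 0 = f. \<Sum>g\<in>decs l ?S. \<Sum>G | G \<in> BC \<and> G 0 = g. ?wA F * ?wB G * ?K (F 0) (G 0))"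
      unfolding sum_distrib_right[of ?wA]
    proof (rule sum.cong)
      fix F assume "F \<in> {F. F \<in> AC \<and> F 0 = f}"
      then show "?wA F * (\<Sum>g\<in>decs l ?S. ?K f g * (\<Sum>G | G \<in> BC \<and> G 0 = g. ?wB G))
        = (\<Sum>g\<in>decs l ?S. \<Sum>G | G \<in> BC \<and> G 0 = g. ?wA F * ?wB G * ?K (F 0) (G 0))"
        unfolding sum_distrib_left by (intro sum.cong refl) (auto simp: ac_simps)
    qed simp
  qed simp
  also have "\<dots> = (\<Sum>F\<in>AC. \<Sum>g\<in>decs l ?S. \<Sum>G | G \<in> BC \<and> G 0 = g. ?wA F * ?wB G * ?K (F 0) (G 0))"
    by (rule sum.group) (use finite_AC finite_decs AS in auto)
  also have "\<dots> = (\<Sum>F\<in>AC. \<Sum>G\<in>BC. ?wA F * ?wB G * ?K (F 0) (G 0))"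
    by (intro sum.cong refl sum.group) (use finite_BC finite_decs BS in auto)
  also have "\<dots> = (\<Sum>G\<in>BC. \<Sum>F\<in>AC. ?wA F * ?wB G * ?K (F 0) (G 0))" by (rule sum.swap)
  also have "\<dots> = (\<Sum>(G, F)\<in>BC \<times> AC. ?wA F * ?wB G * ?K (F 0) (G 0))" by (rule sum.cartesian_product)
  also have "\<dots> = (\<Sum>p\<in>BC \<times> AC. if conf_of p \<in> Xc then of_int (th (conf_of p) {u. 2 \<le> depth (conf_of p) u}) * conf_wt zf zg (conf_of p) else 0)"
  proof (rule sum.cong)
    fix p assume "p \<in> BC \<times> AC"
    then obtain G F where p: "p = (G, F)" "G \<in> BC" "F \<in> AC" by auto
    have "?K (F 0) (G 0) = (if interlaced l (\<lambda>i. F 0 i + 1) (G 0) then of_int (kernel_sign l (\<lambda>i. F 0 i + 1) (G 0))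
        * (\<Prod>x\<in>{-W..W}. ?\<omega> x ^ nat (class_depth l (\<lambda>i. F 0 i + 1) (G 0) x x)) else 0)"
    proof (rule dt_mid_kernel)
      show "dec l (\<lambda>i. F 0 i + 1)" "dec l (G 0)" using AS[OF p(3)] BS[OF p(2)] unfolding decs_def dec_def add_less_cancel_right by blast+
      show "-W \<le> F 0 i + 1" if "i < l" for i using AC_window[OF p(3) that, of 0] by simp
      show "G 0 i \<le> W" if "i < l" for i using BC_window[OF p(2) that, of 0] by simp
    qed
    also have "\<dots> = (if conf_of p \<in> Xc then of_int (th (conf_of p) {u. 2 \<le> depth (conf_of p) u})
        * (\<Prod>x\<in>{-W..W}. ?\<omega> x ^ nat (mid_exp (conf_of p) x)) else 0)"
      using interlaced_conf_of[OF p(2,3)] kernel_sign_conf_of[OF p(2,3)] mid_exp_conf_of[OF p(2,3)] p(1) by simp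
    finally have K: "?K (F 0) (G 0) = \<dots>" .
    have rows: "?wA F * ?wB G = (\<Prod>r<n. row_wt zf zg (conf_of p) r)"
    proof -
      have "?wA F * ?wB G = (\<Prod>s = 0..<n. (\<Prod>i = 0..<l. if F (Suc s) i = F s i then zf (F s i) s else 1)
          * (\<Prod>i = 0..<l. if G (Suc s) i = G s i then 1 else zg (G s i) s))"
        by (rule prod.distrib[symmetric])
      also have "\<dots> = (\<Prod>s = 0..<n. row_wt zf zg (conf_of p) s)"
        by (rule prod.cong) (simp_all add: row_wt_conf_of[OF p(2,3)] p(1) del: prod.distrib)
      finally show ?thesis by (simp only: atLeast0LessThan)
    qed
    show "(case p of (G, F) \<Rightarrow> ?wA F * ?wB G * ?K (F 0) (G 0))
      = (if conf_of p \<in> Xc then of_int (th (conf_of p) {u. 2 \<le> depth (conf_of p) u}) * conf_wt zf zg (conf_of p) else 0)"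
      unfolding p(1) case_prod_conv rows[unfolded p(1)] K[unfolded p(1)] conf_wt_def by (simp add: ac_simps)
  qed simp
  also have "\<dots> = (\<Sum>c\<in>Conf. if c \<in> Xc then of_int (th c {u. 2 \<le> depth c u}) * conf_wt zf zg c else 0)"
    by (rule sum.reindex_bij_betw[OF conf_of_bij])
  also have "\<dots> = (\<Sum>c\<in>Xc. of_int (th c {u. 2 \<le> depth c u}) * conf_wt zf zg c)"
    by (rule sum.mono_neutral_cong_right) (use finite_Conf in \<open>auto simp: Xc_def\<close>)
  finally show ?thesis .
qed

end

section \<open>The coefficients of the series as path sums\<close>

lemma tps_nth_add: "tps_nth (f + g) k = tps_nth f k + tps_nth g k"
  and tps_nth_diff: "tps_nth (f - g) k = tps_nth f k - tps_nth g k"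
  by (transfer; simp)+

lemma tps_nth_zX: "tps_nth (zX x c :: 'n tps) k = (if k = 1 then zgen x c else 0)"
proof -
  have "tps_nth (zX x c :: 'n tps) k
    = (\<Sum>i\<le>k. (if i = 0 then zgen x c else 0) * (zshift ^^ i) (if k - i = 1 then 1 else 0))"
    by (simp add: zX_def tps_nth_mult tps_const_def tps_X_def Abs_tps_inverse)
  also have "\<dots> = (\<Sum>i\<le>k. if i = 0 then (if k = 1 then zgen x c else 0) else 0)"
    by (rule sum.cong) auto
  finally show ?thesis by simp
qed

lemma zshift_pow_zgen: "(zshift ^^ i) (zgen x c) = zgen x (c - 2 * of_nat i)"
  by (induction i) (simp_all add: algebra_simps)

lemma tps_mult_factor_right:
  "tps_nth (f * (1 + zX x c)) m = tps_nth f m + (if m = 0 then 0 else tps_nth f (m - 1) * zgen x (c - 2 * of_nat (m - 1)))"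
proof -
  have "tps_nth (f * zX x c) m = (\<Sum>i\<le>m. tps_nth f i * (zshift ^^ i) (if m - i = 1 then zgen x c else 0))"
    by (simp add: tps_nth_mult tps_nth_zX)
  also have "\<dots> = (\<Sum>i\<le>m. if i = m - 1 then (if m = 0 then 0 else tps_nth f (m - 1) * zgen x (c - 2 * of_nat (m - 1))) else 0)"
  proof (rule sum.cong)
    fix i assume "i \<in> {..m}"
    then show "tps_nth f i * (zshift ^^ i) (if m - i = 1 then zgen x c else 0)
      = (if i = m - 1 then (if m = 0 then 0 else tps_nth f (m - 1) * zgen x (c - 2 * of_nat (m - 1))) else 0)"
      by (cases "m - i = 1"; cases "m = 0") (auto simp: zshift_pow_zgen zshift_pow_zero)
  qed simp
  finally show ?thesis by (simp add: distrib_left tps_nth_add)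
qed

lemma tps_mult_factor_left:
  "tps_nth ((1 + zX x c) * f) m = tps_nth f m + (if m = 0 then 0 else zgen x c * zshift (tps_nth f (m - 1)))"
proof -
  have "tps_nth (zX x c * f) m = (\<Sum>i\<le>m. (if i = 1 then zgen x c else 0) * (zshift ^^ i) (tps_nth f (m - i)))"
    by (simp add: tps_nth_mult tps_nth_zX)
  also have "\<dots> = (\<Sum>i\<le>m. if i = 1 then zgen x c * zshift (tps_nth f (m - 1)) else 0)"
    by (rule sum.cong) auto
  also have "\<dots> = (if m = 0 then 0 else zgen x c * zshift (tps_nth f (m - 1)))" by auto
  finally show ?thesis by (simp add: distrib_right tps_nth_add)
qed

definition lower_series :: "nat \<Rightarrow> complex \<Rightarrow> 'n tps" where
  "lower_series k c = prod_list (map (\<lambda>i. 1 + zX (Pos i) c) [1..<k + 1])"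

definition upper_series :: "nat \<Rightarrow> complex \<Rightarrow> 'n tps" where
  "upper_series k c = prod_list (map (\<lambda>i. 1 + zX (Bar i) c) (rev [1..<k + 1]))"

definition mid_series :: "complex \<Rightarrow> 'n tps" where
  "mid_series c = tps_inverse (1 - zX (Bar CARD('n)) c * zX (Pos CARD('n)) c)"

lemma lower_series_0: "lower_series 0 c = 1" and upper_series_0: "upper_series 0 c = 1"
  by (simp_all add: lower_series_def upper_series_def)

lemma lower_series_Suc: "lower_series (Suc k) c = lower_series k c * (1 + zX (Pos (Suc k)) c)"
  and upper_series_Suc: "upper_series (Suc k) c = (1 + zX (Bar (Suc k)) c) * upper_series k c"
  by (simp_all add: lower_series_def upper_series_def)

lemma zshift_upper_series: "zshift (tps_nth (upper_series k c) m) = tps_nth (upper_series k (c - 2)) m"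
proof (induction k arbitrary: m)
  case 0
  then show ?case by (simp add: upper_series_0 tps_nth_one)
next
  case (Suc k)
  then show ?case by (simp add: upper_series_Suc tps_mult_factor_left zshift_add zshift_mult)
qed

lemma zshift_pow_upper_series: "(zshift ^^ i) (tps_nth (upper_series k c) m) = tps_nth (upper_series k (c - 2 * of_nat i)) m"
  by (induction i) (simp_all add: zshift_upper_series algebra_simps)

context
  fixes a :: complex
begin

text \<open>Row \<open>r\<close> carries the index \<open>n - r\<close>. The argument is that of a
  box at abscissa \<open>x - r\<close>: a lower path with dual abscissa \<open>x\<close> in row
  \<open>r\<close> enters this row by an NE-step starting there.\<close>

definition zlow :: "int \<Rightarrow> nat \<Rightarrow> 'n zring" where
  "zlow x r = zgen (Pos (CARD('n) - r)) (a - 2 * of_int x + 2 * of_nat r)"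

definition zupp :: "int \<Rightarrow> nat \<Rightarrow> 'n zring" where
  "zupp x r = zgen (Bar (CARD('n) - r)) (a - 2 * of_int x)"

text \<open>The defining relation of the ring with index \<open>n - r\<close>. The arguments of
  \<open>zlow\<close> and \<open>zupp\<close> are arranged such that its two sides belong to
  neighbouring rows.\<close>

lemma zlow_zupp:
  assumes "r < CARD('n)"
  shows "(zlow x r * zupp x r :: 'n zring) = zlow (x + 1) (Suc r) * zupp x (Suc r)"
proof -
  let ?i = "CARD('n) - r"
  have "(a - 2 * of_int x + 2 * of_nat r) - 2 * of_nat CARD('n) + 2 * of_nat ?i = a - 2 * of_int x"
    using assms by (simp add: of_nat_diff algebra_simps)
  then have "(zgen (Pos ?i) (a - 2 * of_int x + 2 * of_nat r) * zgen (Bar ?i) (a - 2 * of_int x) :: 'n zring)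
    = zgen (Pos (?i - 1)) (a - 2 * of_int x + 2 * of_nat r) * zgen (Bar (?i - 1)) (a - 2 * of_int x)"
    using z_relation[where 'n = 'n, of ?i "a - 2 * of_int x + 2 * of_nat r"] assms by simp
  moreover have e: "a - 2 * of_int (x + 1) + 2 * of_nat (Suc r) = a - 2 * of_int x + 2 * of_nat r" by simp
  ultimately show ?thesis unfolding zlow_def zupp_def e by simp
qed

definition zmid :: "int \<Rightarrow> 'n zring" where
  "zmid x = zlow (x + 1) 0 * zupp x 0"

lemma zshift_zmid: "zshift (zmid x :: 'n zring) = zmid (x + 1)"
  by (simp add: zmid_def zlow_def zupp_def zshift_mult algebra_simps)

lemma zshift_pow_prod: "(zshift ^^ i) (prod h A) = (\<Prod>x\<in>A. (zshift ^^ i) (h x))"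
  by (induction A rule: infinite_finite_induct) (simp_all add: zshift_pow_one zshift_pow_mult)

lemma zshift_pow_zmid: "(zshift ^^ i) (zmid x :: 'n zring) = zmid (x + int i)"
  by (induction i) (simp_all add: zshift_zmid algebra_simps)

lemma zshift_pow_mid_kernel: "(zshift ^^ i) (mid_kernel zmid x y :: 'n zring) = mid_kernel zmid (x + int i) (y + int i)"
proof -
  have "(\<Prod>q\<in>{x..<y}. (zshift ^^ i) (if even (q - x) then zmid q else 1 :: 'n zring))
    = (\<Prod>q\<in>{x + int i..<y + int i}. if even (q - (x + int i)) then zmid q else 1)"
    by (rule prod.reindex_bij_witness[of _ "\<lambda>q. q - int i" "\<lambda>q. q + int i"])
      (auto simp: zshift_pow_zmid zshift_pow_one)
  then show ?thesis by (simp add: mid_kernel_def zshift_pow_prod zshift_pow_zero)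
qed

text \<open>Comparing coefficients in \<open>(1 - y) * g = 1\<close>, with \<open>y\<close>
  concentrated in degree 2, gives a recursion in steps of two, and the twist moves the abscissa by
  two at the same time.\<close>

lemma mid_series_nth: "tps_nth (mid_series (a - 2 * of_int x) :: 'n tps) m = mid_kernel zmid x (x + int m)"
proof (induction m rule: less_induct)
  case (less m)
  let ?c = "a - 2 * of_int x"
  let ?y = "zX (Bar CARD('n)) ?c * zX (Pos CARD('n)) ?c :: 'n tps"
  let ?g = "mid_series ?c :: 'n tps"
  have y: "tps_nth ?y k = (if k = 2 then zmid x else 0)" for k
  proof -
    have "tps_nth ?y k = (\<Sum>i\<le>k. if i = 1 then (if k = 2 then zmid x else 0) else 0)"
      unfolding tps_nth_mult tps_nth_zX
      by (rule sum.cong) (auto simp: zmid_def zlow_def zupp_def mult.commute algebra_simps)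
    then show ?thesis by auto
  qed
  have "tps_nth (1 - ?y) 0 = 1" by (simp add: tps_nth_diff y tps_nth_one)
  then have "(1 - ?y) * ?g = 1" unfolding mid_series_def by (rule tps_inverse(1))
  then have "?g = 1 + ?y * ?g" by (simp add: algebra_simps)
  then have "tps_nth ?g m = tps_nth (1 + ?y * ?g) m" by simp
  also have "\<dots> = (if m = 0 then 1 else 0) + (\<Sum>i\<le>m. (if i = 2 then zmid x else 0) * (zshift ^^ i) (tps_nth ?g (m - i)))"
    by (simp only: tps_nth_add tps_nth_one tps_nth_mult[of ?y ?g] y)
  also have "(\<Sum>i\<le>m. (if i = 2 then zmid x else 0) * (zshift ^^ i) (tps_nth ?g (m - i)))
      = (\<Sum>i\<le>m. if i = 2 then zmid x * (zshift ^^ 2) (tps_nth ?g (m - 2)) else 0)"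
    by (rule sum.cong) auto
  also have "\<dots> = (if 2 \<le> m then zmid x * (zshift ^^ 2) (tps_nth ?g (m - 2)) else 0)" by simp
  finally have rec: "tps_nth ?g m = (if m = 0 then 1 else 0) + (if 2 \<le> m then zmid x * (zshift ^^ 2) (tps_nth ?g (m - 2)) else 0)" .
  consider "m = 0" | "m = 1" | "2 \<le> m" by linarith
  then show ?case
  proof cases
    case 3
    have "tps_nth ?g m = zmid x * mid_kernel zmid (x + 2) (x + int m)"
      using rec 3 less[of "m - 2"] zshift_pow_mid_kernel[where 'n = 'n and i = 2 and x = x and y = "x + int (m - 2)"] by (simp add: of_nat_diff)
    also have "\<dots> = mid_kernel zmid x (x + int m)"
    proof (cases "even m")
      case True
      have "{x..<x + int m} = insert x (insert (x + 1) {x + 2..<x + int m})" using 3 by auto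
      then have "(\<Prod>q\<in>{x..<x + int m}. if even (q - x) then zmid q else 1 :: 'n zring)
        = zmid x * (\<Prod>q\<in>{x + 2..<x + int m}. if even (q - x) then zmid q else 1)" by simp
      moreover have "even (q - (x + 2)) \<longleftrightarrow> even (q - x)" for q by presburger
      ultimately show ?thesis using True 3 by (simp add: mid_kernel_def)
    next
      case False
      then have "odd (x + int m - (x + 2))" "odd (x + int m - x)" by simp_all
      then show ?thesis unfolding mid_kernel_def by simp
    qed
    finally show ?thesis .
  qed (use rec in \<open>simp_all add: mid_kernel_def\<close>)
qed

text \<open>What a lower path collects between its start \<open>u\<close> and height
  \<open>-r\<close>, where its abscissa is \<open>x - r + 1\<close>. The degree is the number of
  NE-steps made so far.\<close>

definition low_coeff :: "nat \<Rightarrow> int \<Rightarrow> int \<Rightarrow> 'n zring" where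
  "low_coeff r u x = (if u \<le> x - int r + 1
     then tps_nth (lower_series (CARD('n) - r) (a - 2 * of_int u)) (nat (x - int r + 1 - u)) else 0)"

definition upp_coeff :: "nat \<Rightarrow> int \<Rightarrow> int \<Rightarrow> 'n zring" where
  "upp_coeff r v x = (if x \<le> v then tps_nth (upper_series (CARD('n) - r) (a - 2 * of_int x)) (nat (v - x)) else 0)"

lemma low_coeff_top: "(low_coeff CARD('n::finite) u x :: 'n zring) = (if x = u + int CARD('n) - 1 then 1 else 0)"
  by (simp add: low_coeff_def lower_series_0 tps_nth_one)

lemma upp_coeff_top: "(upp_coeff CARD('n::finite) v x :: 'n zring) = (if x = v then 1 else 0)"
  by (simp add: upp_coeff_def upper_series_0 tps_nth_one)

text \<open>Splitting off the last factor: its term of degree 1 is an NE-step, which keeps the dual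
  abscissa, and its constant term an NW-step, which changes it.\<close>

lemma low_coeff_step:
  assumes r: "r < CARD('n)"
  shows "(low_coeff r u x :: 'n zring) = zlow x r * low_coeff (Suc r) u x + low_coeff (Suc r) u (x + 1)"
proof (cases "u \<le> x - int r + 1")
  case False
  then show ?thesis by (simp add: low_coeff_def)
next
  case True
  define m where "m = nat (x - int r + 1 - u)"
  have x: "x = u + int m + int r - 1" using True by (simp add: m_def)
  have k: "CARD('n) - r = Suc (CARD('n) - Suc r)" using r by simp
  let ?L = "lower_series (CARD('n) - Suc r) (a - 2 * of_int u) :: 'n tps"
  have l0: "(low_coeff r u x :: 'n zring) = tps_nth (lower_series (CARD('n) - r) (a - 2 * of_int u)) m"
    and l1: "(low_coeff (Suc r) u (x + 1) :: 'n zring) = tps_nth ?L m"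
    and l2: "(low_coeff (Suc r) u x :: 'n zring) = (if m = 0 then 0 else tps_nth ?L (m - 1))"
    unfolding low_coeff_def x by (auto simp: nat_diff_distrib' intro!: arg_cong2[of _ _ _ _ tps_nth])
  have z: "zgen (Pos (CARD('n) - r)) (a - 2 * of_int u - 2 * of_nat (m - 1)) = (zlow x r :: 'n zring)" if "m \<noteq> 0"
    using that unfolding zlow_def x by (intro arg_cong2[of _ _ _ _ zgen]) (auto simp: of_nat_diff algebra_simps)
  show ?thesis
    unfolding l0 l1 l2 k lower_series_Suc tps_mult_factor_right
    using z by (cases "m = 0") (simp_all add: k mult.commute)
qed

lemma upp_coeff_step:
  assumes r: "r < CARD('n)"
  shows "(upp_coeff r v x :: 'n zring) = upp_coeff (Suc r) v x + zupp x r * upp_coeff (Suc r) v (x + 1)"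
proof (cases "x \<le> v")
  case False
  then show ?thesis by (simp add: upp_coeff_def)
next
  case True
  define m where "m = nat (v - x)"
  have v: "v = x + int m" using True by (simp add: m_def)
  have k: "CARD('n) - r = Suc (CARD('n) - Suc r)" using r by simp
  have c: "a - 2 * of_int x - 2 = a - 2 * of_int (x + 1)" by simp
  have l2: "(upp_coeff (Suc r) v (x + 1) :: 'n zring)
      = (if m = 0 then 0 else tps_nth (upper_series (CARD('n) - Suc r) (a - 2 * of_int (x + 1))) (m - 1))"
    unfolding upp_coeff_def v by (auto simp: nat_diff_distrib' intro!: arg_cong2[of _ _ _ _ tps_nth])
  show ?thesis
    unfolding l2 unfolding upp_coeff_def v k upper_series_Suc tps_mult_factor_left zshift_upper_series c
    by (simp add: zupp_def k)
qed

text \<open>Multiplying the three factors of \<open>E_series\<close> gives a sum over partial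
  degrees. These are replaced by the dual abscissa \<open>x\<close> at which the lower path reaches
  height 0 and the abscissa \<open>y\<close> at which the upper path leaves it; all nonzero terms
  lie in the window.\<close>

lemma e_coeff_sum:
  assumes "-W \<le> u - 1" "v \<le> W"
  shows "(e_coeff (v - u) (a - 2 * of_int u) :: 'n::finite zring)
    = (\<Sum>x\<in>{-W..W}. low_coeff 0 u x * (\<Sum>y\<in>{-W..W}. mid_kernel zmid (x + 1) y * upp_coeff 0 v y))"
proof -
  let ?G = "\<lambda>x y. low_coeff 0 u x * (mid_kernel zmid (x + 1) y * upp_coeff 0 v y) :: 'n zring"
  have G0: "?G x y = 0" if "\<not> (u \<le> x + 1 \<and> x + 1 \<le> y \<and> y \<le> v)" for x y
    using that by (auto simp: low_coeff_def upp_coeff_def mid_kernel_def)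
  have "(\<Sum>x\<in>{-W..W}. low_coeff 0 u x * (\<Sum>y\<in>{-W..W}. mid_kernel zmid (x + 1) y * upp_coeff 0 v y))
    = (\<Sum>x\<in>{-W..W}. \<Sum>y\<in>{-W..W}. ?G x y)"
    by (simp add: sum_distrib_left)
  also have "\<dots> = (\<Sum>y\<in>{-W..W}. \<Sum>x\<in>{-W..W}. ?G x y)" by (rule sum.swap)
  also have "\<dots> = (\<Sum>y\<in>{u..v}. \<Sum>x\<in>{u - 1..y - 1}. ?G x y)"
  proof (rule sum.mono_neutral_cong_right)
    show "{u..v} \<subseteq> {-W..W}" using assms by auto
    show "\<forall>y\<in>{-W..W} - {u..v}. (\<Sum>x\<in>{-W..W}. ?G x y) = 0"
      by (intro ballI sum.neutral G0) auto
    fix y assume y: "y \<in> {u..v}"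
    show "(\<Sum>x\<in>{-W..W}. ?G x y) = (\<Sum>x\<in>{u - 1..y - 1}. ?G x y)"
      by (rule sum.mono_neutral_right) (use y assms in \<open>auto intro!: G0\<close>)
  qed simp
  also have "\<dots> = e_coeff (v - u) (a - 2 * of_int u)"
  proof (cases "u \<le> v")
    case False
    then show ?thesis by (simp add: e_coeff_def)
  next
    case True
    define m where "m = nat (v - u)"
    have v: "v = u + int m" using True by (simp add: m_def)
    let ?c = "a - 2 * of_int u"
    have E: "(E_series ?c :: 'n tps) = lower_series CARD('n) ?c * mid_series ?c * upper_series CARD('n) ?c"
      by (simp add: E_series_def lower_series_def mid_series_def upper_series_def)
    have "(\<Sum>y\<in>{u..v}. \<Sum>x\<in>{u - 1..y - 1}. ?G x y) = (\<Sum>i\<le>m. \<Sum>x\<in>{u - 1..u + int i - 1}. ?G x (u + int i))"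
      by (rule sum.reindex_bij_witness[of _ "\<lambda>i. u + int i" "\<lambda>y. nat (y - u)"]) (auto simp: v)
    also have "\<dots> = (\<Sum>i\<le>m. \<Sum>j\<le>i. ?G (u - 1 + int j) (u + int i))"
      by (intro sum.cong refl, rule sum.reindex_bij_witness[of _ "\<lambda>j. u - 1 + int j" "\<lambda>x. nat (x - u + 1)"]) auto
    also have "\<dots> = (\<Sum>i\<le>m. (\<Sum>j\<le>i. tps_nth (lower_series CARD('n) ?c) j * (zshift ^^ j) (tps_nth (mid_series ?c) (i - j)))
        * (zshift ^^ i) (tps_nth (upper_series CARD('n) ?c) (m - i)))"
    proof (intro sum.cong refl)
      fix i assume i: "i \<in> {..m}"
      have up: "(upp_coeff 0 v (u + int i) :: 'n zring) = (zshift ^^ i) (tps_nth (upper_series CARD('n) ?c) (m - i))"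
        using i unfolding zshift_pow_upper_series upp_coeff_def v
        by (auto simp: nat_diff_distrib' algebra_simps intro!: arg_cong2[of _ _ _ _ tps_nth])
      have "?G (u - 1 + int j) (u + int i) = tps_nth (lower_series CARD('n) ?c) j * (zshift ^^ j) (tps_nth (mid_series ?c) (i - j))
        * (zshift ^^ i) (tps_nth (upper_series CARD('n) ?c) (m - i))" if j: "j \<in> {..i}" for j
      proof -
        have "(zshift ^^ j) (tps_nth (mid_series ?c :: 'n tps) (i - j)) = mid_kernel zmid (u + int j) (u + int i)"
          unfolding mid_series_nth zshift_pow_mid_kernel using j by (simp add: of_nat_diff)
        moreover have "(low_coeff 0 u (u - 1 + int j) :: 'n zring) = tps_nth (lower_series CARD('n) ?c) j"
          by (simp add: low_coeff_def)
        ultimately show ?thesis unfolding up by (simp add: algebra_simps)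
      qed
      then show "(\<Sum>j\<le>i. ?G (u - 1 + int j) (u + int i)) = (\<Sum>j\<le>i. tps_nth (lower_series CARD('n) ?c) j * (zshift ^^ j) (tps_nth (mid_series ?c) (i - j)))
        * (zshift ^^ i) (tps_nth (upper_series CARD('n) ?c) (m - i))"
        unfolding sum_distrib_right by (rule sum.cong[OF refl])
    qed
    also have "\<dots> = tps_nth (E_series ?c) m"
      unfolding E tps_nth_mult ..
    finally show ?thesis by (simp add: e_coeff_def v)
  qed
  finally show ?thesis ..
qed

end

section \<open>A single path\<close>

definition xcount :: "step list \<Rightarrow> int" where
  "xcount ss = int (length (filter (\<lambda>s. s \<noteq> NW_step) ss))"

definition hcount :: "step list \<Rightarrow> int" where
  "hcount ss = int (length (filter (\<lambda>s. s \<noteq> E_step) ss))"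

lemma xcount_simps [simp]: "xcount [] = 0" "xcount (s # ss) = (if s = NW_step then 0 else 1) + xcount ss"
    "xcount (ss @ ts) = xcount ss + xcount ts"
  and hcount_simps [simp]: "hcount [] = 0" "hcount (s # ss) = (if s = E_step then 0 else 1) + hcount ss"
    "hcount (ss @ ts) = hcount ss + hcount ts"
  by (simp_all add: xcount_def hcount_def)

lemma length_points [simp]: "length (points (w, ss)) = Suc (length ss)"
  by (induction ss arbitrary: w) auto

lemma points_nth:
  "k \<le> length ss \<Longrightarrow> points ((x, y), ss) ! k
    = (x + xcount (take k ss), y + hcount (take k ss) - xcount (take k ss))"
proof (induction ss arbitrary: x y k)
  case (Cons s ss)
  then show ?case by (cases k; cases s) auto
qed simp

lemma finish_eq: "finish ((x, y), ss) = (x + xcount ss, y + hcount ss - xcount ss)"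
proof -
  have "finish ((x, y), ss) = points ((x, y), ss) ! length ss"
    unfolding finish_def by (subst last_conv_nth) (auto simp flip: length_greater_0_conv)
  then show ?thesis by (simp add: points_nth)
qed

text \<open>Both halves are indexed by the distance from height 0. \<open>L\<close> is the dual
  lower path, so the start \<open>u\<close> appears as \<open>u + int n - 1\<close>, and
  \<open>U 0 - L 0 - 1\<close> is the number of E-steps.\<close>

definition is_col :: "nat \<Rightarrow> int \<Rightarrow> int \<Rightarrow> (nat \<Rightarrow> int) \<Rightarrow> (nat \<Rightarrow> int) \<Rightarrow> bool" where
  "is_col n u v L U \<longleftrightarrow> L n = u + int n - 1 \<and> U n = v
     \<and> (\<forall>s<n. L (Suc s) = L s \<or> L (Suc s) = L s + 1) \<and> (\<forall>s<n. U (Suc s) = U s \<or> U (Suc s) = U s + 1)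
     \<and> L 0 + 1 \<le> U 0 \<and> even (U 0 - L 0 - 1)"

text \<open>A lower path is stored through its dual: \<open>low_x L s\<close> is its abscissa at height \<open>-s\<close>.\<close>

definition low_x :: "(nat \<Rightarrow> int) \<Rightarrow> nat \<Rightarrow> int" where
  "low_x L s = L s - int s + 1"

definition low_steps :: "nat \<Rightarrow> (nat \<Rightarrow> int) \<Rightarrow> step list" where
  "low_steps n L = map (\<lambda>s. if L (Suc s) = L s then NE_step else NW_step) (rev [0..<n])"

definition up_steps :: "nat \<Rightarrow> (nat \<Rightarrow> int) \<Rightarrow> step list" where
  "up_steps n U = map (\<lambda>s. if U (Suc s) = U s then NW_step else NE_step) [0..<n]"

definition mid_len :: "(nat \<Rightarrow> int) \<Rightarrow> (nat \<Rightarrow> int) \<Rightarrow> nat" where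
  "mid_len L U = nat (U 0 - L 0 - 1)"

definition col_path :: "nat \<Rightarrow> int \<Rightarrow> (nat \<Rightarrow> int) \<Rightarrow> (nat \<Rightarrow> int) \<Rightarrow> path" where
  "col_path n u L U = ((u, - int n - u), low_steps n L @ replicate (mid_len L U) E_step @ up_steps n U)"

lemma length_low_steps [simp]: "length (low_steps n L) = n"
  and length_up_steps [simp]: "length (up_steps n U) = n"
  by (simp_all add: low_steps_def up_steps_def)

lemma low_steps_nth: "k < n \<Longrightarrow> low_steps n L ! k = (if L (n - k) = L (n - k - 1) then NE_step else NW_step)"
  by (simp add: low_steps_def rev_nth Suc_diff_Suc)

lemma up_steps_nth: "k < n \<Longrightarrow> up_steps n U ! k = (if U (Suc k) = U k then NW_step else NE_step)"
  by (simp add: up_steps_def)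

lemma no_E_low: "E_step \<notin> set (low_steps n L)" and no_E_up: "E_step \<notin> set (up_steps n U)"
  by (auto simp: low_steps_def up_steps_def)

lemma hcount_no_E: "E_step \<notin> set ss \<Longrightarrow> hcount ss = int (length ss)"
proof -
  assume "E_step \<notin> set ss"
  then have "filter (\<lambda>s. s \<noteq> E_step) ss = ss" by (intro filter_True) auto
  then show ?thesis by (simp add: hcount_def)
qed

lemma xcount_replicate [simp]: "xcount (replicate k E_step) = int k" "hcount (replicate k E_step) = 0"
  by (simp_all add: xcount_def hcount_def)

lemma xcount_low:
  assumes c: "is_col n u v L U" and "k \<le> n"
  shows "xcount (take k (low_steps n L)) = low_x L (n - k) - u"
  using \<open>k \<le> n\<close>
proof (induction k)
  case 0
  then show ?case using c by (simp add: is_col_def low_x_def)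
next
  case (Suc k)
  have s: "n - k = Suc (n - Suc k)" using Suc.prems by simp
  have "L (Suc (n - Suc k)) = L (n - Suc k) \<or> L (Suc (n - Suc k)) = L (n - Suc k) + 1"
    using c Suc.prems by (simp add: is_col_def)
  then show ?case using Suc
    by (auto simp: take_Suc_conv_app_nth low_steps_nth low_x_def s)
qed

lemma xcount_up:
  assumes c: "is_col n u v L U" and "k \<le> n"
  shows "xcount (take k (up_steps n U)) = U k - U 0"
  using \<open>k \<le> n\<close>
proof (induction k)
  case (Suc k)
  have "U (Suc k) = U k \<or> U (Suc k) = U k + 1" using c Suc.prems by (simp add: is_col_def)
  then show ?case using Suc by (auto simp: take_Suc_conv_app_nth up_steps_nth)
qed simp

lemma hcount_take_low: "k \<le> n \<Longrightarrow> hcount (take k (low_steps n L)) = int k"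
  using no_E_low[of n L] by (subst hcount_no_E) (auto dest: in_set_takeD)

lemma hcount_take_up: "k \<le> n \<Longrightarrow> hcount (take k (up_steps n U)) = int k"
  using no_E_up[of n U] by (subst hcount_no_E) (auto dest: in_set_takeD)

lemma mid_len_eq: "is_col n u v L U \<Longrightarrow> int (mid_len L U) = U 0 - L 0 - 1"
  by (simp add: is_col_def mid_len_def)

lemma xcount_low_all: "is_col n u v L U \<Longrightarrow> xcount (low_steps n L) = L 0 + 1 - u"
  using xcount_low[of n u v L U n] by (simp add: low_x_def)

lemma xcount_up_all: "is_col n u v L U \<Longrightarrow> xcount (up_steps n U) = v - U 0"
  using xcount_up[of n u v L U n] by (simp add: is_col_def)

lemma col_points:
  assumes c: "is_col n u v L U"
  shows "k \<le> n \<Longrightarrow> points (col_path n u L U) ! k = (low_x L (n - k), int k - int n - low_x L (n - k))"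
    and "t \<le> mid_len L U \<Longrightarrow> points (col_path n u L U) ! (n + t) = (L 0 + 1 + int t, - L 0 - 1 - int t)"
    and "k \<le> n \<Longrightarrow> points (col_path n u L U) ! (n + mid_len L U + k) = (U k, int k - U k)"
proof -
  show "points (col_path n u L U) ! k = (low_x L (n - k), int k - int n - low_x L (n - k))" if "k \<le> n"
    unfolding col_path_def using that xcount_low[OF c that] hcount_take_low[OF that, of L]
    by (subst points_nth) auto
  show "points (col_path n u L U) ! (n + t) = (L 0 + 1 + int t, - L 0 - 1 - int t)" if "t \<le> mid_len L U"
    unfolding col_path_def using that xcount_low_all[OF c] hcount_take_low[of n n L]
    by (subst points_nth) (auto simp: min_def)
  show "points (col_path n u L U) ! (n + mid_len L U + k) = (U k, int k - U k)" if "k \<le> n"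
    unfolding col_path_def
    using that xcount_low_all[OF c] hcount_take_low[of n n L] hcount_take_up[OF that, of U] xcount_up[OF c that] mid_len_eq[OF c]
    by (subst points_nth) auto
qed

lemma length_col_points: "length (points (col_path n u L U)) = Suc (n + mid_len L U + n)"
  by (simp add: col_path_def)

lemma col_points_set:
  assumes c: "is_col n u v L U"
  shows "(x, y) \<in> set (points (col_path n u L U)) \<longleftrightarrow>
    (\<exists>s\<le>n. x + y = - int s \<and> x = low_x L s) \<or> (x + y = 0 \<and> L 0 + 1 \<le> x \<and> x \<le> U 0) \<or> (\<exists>s\<le>n. x + y = int s \<and> x = U s)"
    (is "_ \<longleftrightarrow> ?R")
proof
  assume "(x, y) \<in> set (points (col_path n u L U))"
  then obtain k where k: "k < Suc (n + mid_len L U + n)" "points (col_path n u L U) ! k = (x, y)"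
    by (auto simp: in_set_conv_nth length_col_points)
  consider "k \<le> n" | t where "k = n + t" "t \<le> mid_len L U" | t where "k = n + mid_len L U + t" "t \<le> n"
  proof -
    have "k \<le> n \<or> (k = n + (k - n) \<and> k - n \<le> mid_len L U) \<or> (k = n + mid_len L U + (k - n - mid_len L U) \<and> k - n - mid_len L U \<le> n)"
      using k(1) by auto
    then show ?thesis using that by blast
  qed
  then show ?R
  proof cases
    case 1
    then have "x + y = - int (n - k)" "x = low_x L (n - k)" using k(2) col_points(1)[OF c 1] by auto
    then show ?thesis by (intro disjI1 exI[of _ "n - k"]) auto
  next
    case 2
    then show ?thesis using k(2) col_points(2)[OF c 2(2)] mid_len_eq[OF c] by auto
  next
    case 3
    then show ?thesis using k(2) col_points(3)[OF c 3(2)] by (intro disjI2) (auto intro!: exI[of _ t])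
  qed
next
  have mem: "points (col_path n u L U) ! k \<in> set (points (col_path n u L U))" if "k \<le> n + mid_len L U + n" for k
    using that by (intro nth_mem) (simp add: length_col_points)
  assume ?R
  then consider s where "s \<le> n" "x + y = - int s" "x = low_x L s" | "x + y = 0" "L 0 + 1 \<le> x" "x \<le> U 0"
    | s where "s \<le> n" "x + y = int s" "x = U s" by blast
  then show "(x, y) \<in> set (points (col_path n u L U))"
  proof cases
    case 1
    then have "points (col_path n u L U) ! (n - s) = (x, y)" using col_points(1)[OF c, of "n - s"] by auto
    then show ?thesis using mem[of "n - s"] by auto
  next
    case 2
    have "points (col_path n u L U) ! (n + nat (x - L 0 - 1)) = (x, y)"
      using 2 col_points(2)[OF c, of "nat (x - L 0 - 1)"] mid_len_eq[OF c] by auto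
    moreover have "nat (x - L 0 - 1) \<le> mid_len L U" using 2 mid_len_eq[OF c] by auto
    ultimately show ?thesis using mem[of "n + nat (x - L 0 - 1)"] by auto
  next
    case 3
    then have "points (col_path n u L U) ! (n + mid_len L U + s) = (x, y)" using col_points(3)[OF c, of s] by auto
    then show ?thesis using mem[of "n + mid_len L U + s"] 3 by auto
  qed
qed

lemma start_col: "start (col_path n u L U) = (u, - int n - u)"
  by (simp add: start_def col_path_def)

lemma finish_col: "is_col n u v L U \<Longrightarrow> finish (col_path n u L U) = (v, int n - v)"
  using hcount_take_low[of n n L] hcount_take_up[of n n U]
  by (simp add: col_path_def finish_eq xcount_low_all xcount_up_all mid_len_eq)

lemma count_list_no_E: "E_step \<notin> set ss \<Longrightarrow> count_list ss E_step = 0"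
  by (simp add: count_list_0_iff)

lemma is_path_col:
  assumes c: "is_col n u v L U"
  shows "is_path n (col_path n u L U)"
proof -
  have E: "ht (points (col_path n u L U) ! k) = 0"
    if k: "k < length (steps (col_path n u L U))" "steps (col_path n u L U) ! k = E_step" for k
  proof -
    have "n \<le> k"
    proof (rule ccontr)
      assume "\<not> n \<le> k"
      then have "steps (col_path n u L U) ! k \<in> set (low_steps n L)" by (simp add: steps_def col_path_def nth_append)
      then show False using no_E_low k(2) by metis
    qed
    moreover have "k - n < mid_len L U"
    proof (rule ccontr)
      assume a: "\<not> k - n < mid_len L U"
      then have "steps (col_path n u L U) ! k = up_steps n U ! (k - n - mid_len L U)"
        using \<open>n \<le> k\<close> by (simp add: steps_def col_path_def nth_append)
      moreover have "k - n - mid_len L U < n" using k(1) a \<open>n \<le> k\<close> by (auto simp: steps_def col_path_def)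
      ultimately show False using no_E_up k(2) by (metis length_up_steps nth_mem)
    qed
    ultimately show ?thesis using col_points(2)[OF c, of "k - n"] by (simp add: ht_def)
  qed
  have "count_list (steps (col_path n u L U)) E_step = mid_len L U"
  proof -
    have "count_list (replicate m E_step) E_step = m" for m by (induction m) auto
    then show ?thesis by (simp add: steps_def col_path_def count_list_no_E no_E_low no_E_up)
  qed
  moreover have "even (mid_len L U)" using c mid_len_eq[OF c] unfolding is_col_def by (metis even_of_nat)
  ultimately show ?thesis
    using E unfolding is_path_def by (simp add: start_col finish_col[OF c] ht_def)
qed

lemma hcount_take_le: "k \<le> m \<Longrightarrow> hcount (take k ss) \<le> hcount (take m ss)"
proof -
  assume "k \<le> m"
  then have "take m ss = take k ss @ take (m - k) (drop k ss)" by (metis le_add_diff_inverse take_add)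
  then show ?thesis by (simp add: hcount_def)
qed

text \<open>All E-steps start at height 0 and every other step raises the height, so the E-steps are
  consecutive and exactly \<open>n\<close> steps precede them.\<close>

lemma path_is_col:
  assumes p: "is_path n q" and q: "start q = (u, - int n - u)" "finish q = (v, int n - v)"
  shows "\<exists>L U. is_col n u v L U \<and> q = col_path n u L U"
proof -
  obtain ss where qs: "q = ((u, - int n - u), ss)" using q(1) by (cases q) (auto simp: start_def)
  have hs: "hcount ss = 2 * int n" and xs: "xcount ss = v - u" using q(2) by (auto simp: qs finish_eq)
  have E: "hcount (take k ss) = int n" if "k < length ss" "ss ! k = E_step" for k
  proof -
    have "ht (points q ! k) = 0" using p that by (auto simp: is_path_def steps_def qs)
    then show ?thesis using that points_nth[of k ss u "- int n - u"] by (simp add: qs ht_def)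
  qed
  have split: "\<exists>lo m up. ss = lo @ replicate m E_step @ up \<and> E_step \<notin> set lo \<and> E_step \<notin> set up \<and> (m = 0 \<longrightarrow> length lo = n)
    \<and> (m \<noteq> 0 \<longrightarrow> length lo = n)"
  proof (cases "E_step \<in> set ss")
    case False
    then have "length ss = 2 * n" using hs hcount_no_E[OF False] by simp
    then show ?thesis using False
      by (intro exI[of _ "take n ss"] exI[of _ 0] exI[of _ "drop n ss"]) (auto dest: in_set_takeD in_set_dropD)
  next
    case True
    define lo where "lo = takeWhile (\<lambda>s. s \<noteq> E_step) ss"
    define r1 where "r1 = dropWhile (\<lambda>s. s \<noteq> E_step) ss"
    define m where "m = length (takeWhile (\<lambda>s. s = E_step) r1)"
    define up where "up = dropWhile (\<lambda>s. s = E_step) r1"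
    have ss: "ss = lo @ r1" by (simp add: lo_def r1_def)
    have "takeWhile (\<lambda>s. s = E_step) r1 = replicate m E_step"
      unfolding m_def by (rule replicate_length_same[symmetric]) (auto dest: set_takeWhileD)
    then have r1: "r1 = replicate m E_step @ up" unfolding up_def by (metis takeWhile_dropWhile_id)
    have loE: "E_step \<notin> set lo" unfolding lo_def by (auto dest: set_takeWhileD)
    have r1ne: "r1 \<noteq> []" "hd r1 = E_step"
      using True hd_dropWhile[of "\<lambda>s. s \<noteq> E_step" ss] unfolding r1_def by (auto simp: dropWhile_eq_Nil_conv)
    then have m0: "m \<noteq> 0" unfolding m_def by (cases r1) auto
    have "ss ! length lo = E_step" "length lo < length ss" using r1ne unfolding ss by (auto simp: nth_append hd_conv_nth)
    from E[OF this(2,1)] have lo_n: "length lo = n" using hcount_no_E[OF loE] by (simp add: ss)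
    \<comment> \<open>A further E-step would start at height 0 again, although the first step of
      \<open>up\<close> has raised the height.\<close>
    have "E_step \<notin> set up"
    proof
      assume "E_step \<in> set up"
      then obtain i where i: "i < length up" "up ! i = E_step" by (auto simp: in_set_conv_nth)
      have "up \<noteq> []" using i by auto
      then have "hd up \<noteq> E_step" unfolding up_def by (rule hd_dropWhile)
      then have "i \<noteq> 0" using i \<open>up \<noteq> []\<close> by (cases i) (auto simp: hd_conv_nth)
      have "ss ! (length lo + m + i) = E_step" "length lo + m + i < length ss"
        using i unfolding ss r1 by (auto simp: nth_append)
      from E[OF this(2,1)] have "hcount (take i up) = 0"
        using hcount_no_E[OF loE] by (simp add: ss r1 lo_n)
      moreover have "hcount (take 1 up) \<le> hcount (take i up)" using \<open>i \<noteq> 0\<close> by (intro hcount_take_le) auto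
      moreover have "hcount (take 1 up) = 1" using \<open>up \<noteq> []\<close> \<open>hd up \<noteq> E_step\<close> by (cases up) auto
      ultimately show False by simp
    qed
    then show ?thesis using ss r1 loE lo_n m0 by (intro exI[of _ lo] exI[of _ m] exI[of _ up]) auto
  qed
  then obtain lo m up where ss: "ss = lo @ replicate m E_step @ up" and loE: "E_step \<notin> set lo" and upE: "E_step \<notin> set up"
    and lo_n: "length lo = n" by blast
  have up_n: "length up = n" using hs hcount_no_E[OF loE] hcount_no_E[OF upE] lo_n by (simp add: ss)
  have "count_list ss E_step = m"
  proof -
    have "count_list (replicate k E_step) E_step = k" for k by (induction k) auto
    then show ?thesis by (simp add: ss count_list_no_E loE upE)
  qed
  then have m_even: "even m" using p by (simp add: is_path_def steps_def qs)
  \<comment> \<open>Chosen such that \<open>low_x L s\<close> is \<open>u\<close> plus the number of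
    NE-steps among the first \<open>n - s\<close> steps.\<close>
  define L where "L s = u + xcount (take (n - s) lo) + int s - 1" for s
  define U where "U s = v - xcount (drop s up)" for s
  have lo_nth: "lo ! k = NE_step \<or> lo ! k = NW_step" if "k < n" for k
    using loE that lo_n nth_mem[of k lo] by (cases "lo ! k") auto
  have up_nth: "up ! k = NE_step \<or> up ! k = NW_step" if "k < n" for k
    using upE that up_n nth_mem[of k up] by (cases "up ! k") auto
  have Ls: "L (Suc s) = (if lo ! (n - Suc s) = NE_step then L s else L s + 1)" if "s < n" for s
  proof -
    have "n - s = Suc (n - Suc s)" using that by simp
    then have "take (n - s) lo = take (n - Suc s) lo @ [lo ! (n - Suc s)]"
      using that lo_n by (simp add: take_Suc_conv_app_nth)
    then show ?thesis using lo_nth[of "n - Suc s"] that by (auto simp: L_def)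
  qed
  have Us: "U (Suc s) = (if up ! s = NE_step then U s + 1 else U s)" if "s < n" for s
  proof -
    have "drop s up = up ! s # drop (Suc s) up" using that up_n by (simp add: Cons_nth_drop_Suc)
    then show ?thesis using up_nth[OF that] by (auto simp: U_def)
  qed
  have len: "U 0 - L 0 - 1 = int m"
    using xs lo_n by (simp add: L_def U_def ss)
  have "is_col n u v L U"
    unfolding is_col_def using Ls Us len m_even up_n by (auto simp: L_def U_def)
  moreover have "q = col_path n u L U"
  proof -
    have "lo = low_steps n L"
    proof (rule nth_equalityI)
      fix k assume "k < length lo"
      then have k: "k < n" using lo_n by simp
      have "n - k = Suc (n - Suc k)" "n - Suc (n - Suc k) = k" using k by auto
      then show "lo ! k = low_steps n L ! k"
        using Ls[of "n - Suc k"] k lo_nth[OF k] by (auto simp: low_steps_nth)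
    qed (simp add: lo_n)
    moreover have "up = up_steps n U"
    proof (rule nth_equalityI)
      fix k assume "k < length up"
      then have k: "k < n" using up_n by simp
      then show "up ! k = up_steps n U ! k" using Us[OF k] up_nth[OF k] by (auto simp: up_steps_nth)
    qed (simp add: up_n)
    ultimately show ?thesis using len by (simp add: qs ss col_path_def mid_len_def)
  qed
  ultimately show ?thesis by blast
qed

lemma hp_height: "hp (x, y) = real_of_int x - real_of_int (x + y) / 2"
  by (simp add: hp_def field_simps)

lemma pos_at_zero_col:
  assumes c: "is_col n u v L U"
  shows "pos_at_zero (col_path n u L U) = real_of_int (L 0 + 1)"
proof -
  have "{w \<in> set (points (col_path n u L U)). ht w = 0} = (\<lambda>x. (x, - x)) ` {L 0 + 1..U 0}"
  proof (intro equalityI subsetI)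
    fix w assume w: "w \<in> {w \<in> set (points (col_path n u L U)). ht w = 0}"
    obtain x y where xy: "w = (x, y)" by (cases w)
    have "L 0 + 1 \<le> U 0" using c by (simp add: is_col_def)
    then have "L 0 + 1 \<le> x \<and> x \<le> U 0 \<and> y = - x"
      using w col_points_set[OF c, of x y] by (auto simp: xy ht_def low_x_def)
    then show "w \<in> (\<lambda>x. (x, - x)) ` {L 0 + 1..U 0}" by (auto simp: xy)
  qed (use col_points_set[OF c] in \<open>auto simp: ht_def\<close>)
  then have "hp ` {w \<in> set (points (col_path n u L U)). ht w = 0} = real_of_int ` {L 0 + 1..U 0}"
    by (auto simp: image_image hp_def)
  moreover have "Min (real_of_int ` {L 0 + 1..U 0}) = real_of_int (L 0 + 1)"
  proof (rule Min_eqI)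
    show "real_of_int (L 0 + 1) \<in> real_of_int ` {L 0 + 1..U 0}" using c by (intro imageI) (simp add: is_col_def)
  qed auto
  ultimately show ?thesis by (simp add: pos_at_zero_def)
qed

lemma filter_no_E: "filter (\<lambda>s. s \<noteq> E_step) (steps (col_path n u L U)) = low_steps n L @ up_steps n U"
proof -
  have "filter (\<lambda>s. s \<noteq> E_step) (low_steps n L) = low_steps n L" "filter (\<lambda>s. s \<noteq> E_step) (up_steps n U) = up_steps n U"
    using no_E_low[of n L] no_E_up[of n U] by (auto simp: filter_id_conv)
  then show ?thesis by (simp add: steps_def col_path_def)
qed

lemma lower_path_col: "lower_path n (col_path n u L U) = ((u, - int n - u), low_steps n L)"
  by (simp add: lower_path_def filter_no_E start_col)

lemma upper_path_col:
  assumes c: "is_col n u v L U"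
  shows "upper_path n (col_path n u L U) = ((U 0, - U 0), up_steps n U)"
  using finish_col[OF c] hcount_take_up[of n n U] xcount_up_all[OF c]
  by (simp add: upper_path_def filter_no_E Let_def finish_eq minus_prod_def zero_prod_def)

lemma pos_at_lower:
  assumes c: "is_col n u v L U" and "s \<le> n"
  shows "pos_at (lower_path n (col_path n u L U)) (- int s) = real_of_int (L s + 1) - real s / 2"
proof -
  have k: "nat (- int s - ht (start (lower_path n (col_path n u L U)))) = n - s"
    using assms(2) by (simp add: lower_path_col start_def ht_def nat_diff_distrib')
  show ?thesis
    unfolding pos_at_def k unfolding lower_path_col
    using assms(2) xcount_low[OF c, of "n - s"] hcount_take_low[of "n - s" n L]
    by (subst points_nth) (auto simp: hp_height low_x_def of_nat_diff field_simps)
qed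

lemma pos_at_upper:
  assumes c: "is_col n u v L U" and "s \<le> n"
  shows "pos_at (upper_path n (col_path n u L U)) (int s) = real_of_int (U s) - real s / 2"
proof -
  have k: "nat (int s - ht (start (upper_path n (col_path n u L U)))) = s"
    by (simp add: upper_path_col[OF c] start_def ht_def)
  show ?thesis
    unfolding pos_at_def k unfolding upper_path_col[OF c]
    using assms(2) xcount_up[OF c, of s] hcount_take_up[of s n U]
    by (subst points_nth) (auto simp: hp_height field_simps)
qed

lemma finish_lower: "is_col n u v L U \<Longrightarrow> finish (lower_path n (col_path n u L U)) = (L 0 + 1, - L 0 - 1)"
  using hcount_take_low[of n n L] by (simp add: lower_path_col finish_eq xcount_low_all)

lemma start_upper: "is_col n u v L U \<Longrightarrow> start (upper_path n (col_path n u L U)) = (U 0, - U 0)"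
  by (simp add: upper_path_col start_def)

section \<open>Labels\<close>

lemma upt_split: "k < m \<Longrightarrow> [0..<m] = [0..<k] @ k # [Suc k..<m]"
  using upt_add_eq_append[of 0 k "m - k"] upt_conv_Cons[of k m] by simp

lemma filter_upt_nth: "k < m \<Longrightarrow> P k \<Longrightarrow> filter P [0..<m] ! length (filter P [0..<k]) = k"
proof -
  assume k: "k < m" "P k"
  from k(1) have "[0..<m] = [0..<k] @ k # [Suc k..<m]"
    by (rule upt_split)
  then show ?thesis using k by simp
qed

text \<open>The labelled steps are those that raise the abscissa by one, so the place of a label in
  the list is its distance in abscissa from the start.\<close>

lemma labels_nth:
  assumes "k < length (steps q)" "steps q ! k \<noteq> NW_step"
  shows "labels n q ! nat (xcount (take k (steps q))) = step_label n q k"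
    and "nat (xcount (take k (steps q))) < length (labels n q)"
proof -
  let ?P = "\<lambda>i. steps q ! i \<noteq> NW_step"
  have "take k (steps q) = map (\<lambda>i. steps q ! i) [0..<k]" using assms(1) by (intro nth_equalityI) auto
  then have e: "nat (xcount (take k (steps q))) = length (filter ?P [0..<k])"
    by (simp add: xcount_def filter_map comp_def)
  have "length (filter ?P [0..<k]) < length (filter ?P [0..<length (steps q)])"
  proof -
    have "[0..<length (steps q)] = [0..<k] @ k # [Suc k..<length (steps q)]"
      using assms(1) by (rule upt_split)
    then show ?thesis using assms(2) by simp
  qed
  then show "nat (xcount (take k (steps q))) < length (labels n q)" by (simp add: e labels_def)
  then show "labels n q ! nat (xcount (take k (steps q))) = step_label n q k"
    using filter_upt_nth[of k "length (steps q)" ?P] assms by (simp add: e labels_def)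
qed

text \<open>Indexing by the abscissa aligns the columns: horizontal neighbours have abscissas
  \<open>x\<close> and \<open>x - 1\<close>, whatever the column lengths are.\<close>

definition col_label :: "nat \<Rightarrow> int \<Rightarrow> (nat \<Rightarrow> int) \<Rightarrow> (nat \<Rightarrow> int) \<Rightarrow> int \<Rightarrow> letter" where
  "col_label n u L U x = labels n (col_path n u L U) ! nat (x - u)"

lemma col_label_low:
  assumes c: "is_col n u v L U" and s: "s < n" "L (Suc s) = L s"
  shows "col_label n u L U (low_x L (Suc s)) = Pos (n - s)"
proof -
  let ?q = "col_path n u L U" and ?k = "n - Suc s"
  have k: "?k < length (steps ?q)" "steps ?q ! ?k = NE_step"
    using s by (simp_all add: steps_def col_path_def nth_append low_steps_nth Suc_diff_Suc)
  have "take ?k (steps ?q) = take ?k (low_steps n L)" by (simp add: steps_def col_path_def)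
  then have x: "xcount (take ?k (steps ?q)) = low_x L (Suc s) - u" using xcount_low[OF c, of ?k] s by simp
  have "ht (points ?q ! ?k) = - int (Suc s)" using col_points(1)[OF c, of ?k] s by (simp add: ht_def of_nat_diff)
  then have "step_label n ?q ?k = Pos (n - s)" using s by (simp add: step_label_def Let_def nat_diff_distrib')
  then show ?thesis using labels_nth(1)[OF k(1), of n] k(2) by (simp add: col_label_def x)
qed

lemma col_label_mid:
  assumes c: "is_col n u v L U" and t: "t < mid_len L U"
  shows "col_label n u L U (L 0 + 1 + int t) = (if even t then Bar n else Pos n)"
proof -
  let ?q = "col_path n u L U" and ?k = "n + t"
  have k: "?k < length (steps ?q)" "steps ?q ! ?k = E_step"
    using t by (simp_all add: steps_def col_path_def nth_append)
  have tk: "take ?k (steps ?q) = low_steps n L @ replicate t E_step" using t by (simp add: steps_def col_path_def min_def)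
  have x: "xcount (take ?k (steps ?q)) = L 0 + 1 + int t - u" unfolding tk using xcount_low_all[OF c] by simp
  have "ht (points ?q ! ?k) = 0" using col_points(2)[OF c, of t] t by (simp add: ht_def)
  moreover have "count_list (take (?k + 1) (steps ?q)) E_step = Suc t"
  proof -
    have "take (?k + 1) (steps ?q) = low_steps n L @ replicate (Suc t) E_step"
      using t by (simp add: steps_def col_path_def min_def)
    moreover have "count_list (replicate m E_step) E_step = m" for m by (induction m) auto
    ultimately show ?thesis by (simp only: count_list_append count_list_no_E[OF no_E_low])
  qed
  ultimately have "step_label n ?q ?k = (if even t then Bar n else Pos n)"
    using k(2) by (simp add: step_label_def Let_def del: take_Suc)
  then show ?thesis using labels_nth(1)[OF k(1), of n] k(2) by (simp add: col_label_def x)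
qed

lemma col_label_up:
  assumes c: "is_col n u v L U" and s: "s < n" "U (Suc s) = U s + 1"
  shows "col_label n u L U (U s) = Bar (n - s)"
proof -
  let ?q = "col_path n u L U" and ?k = "n + mid_len L U + s"
  have k: "?k < length (steps ?q)" "steps ?q ! ?k = NE_step"
    using s by (simp_all add: steps_def col_path_def nth_append up_steps_nth)
  have tk: "take ?k (steps ?q) = low_steps n L @ replicate (mid_len L U) E_step @ take s (up_steps n U)"
    using s by (simp add: steps_def col_path_def)
  have x: "xcount (take ?k (steps ?q)) = U s - u"
    unfolding tk using xcount_low_all[OF c] mid_len_eq[OF c] xcount_up[OF c, of s] s by simp
  have "ht (points ?q ! ?k) = int s" using col_points(3)[OF c, of s] s by (simp add: ht_def)
  then have "step_label n ?q ?k = Bar (n - s)" using k(2) s by (simp add: step_label_def Let_def nat_diff_distrib')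
  then show ?thesis using labels_nth(1)[OF k(1), of n] k(2) by (simp add: col_label_def x)
qed

lemma unit_steps_value:
  fixes f :: "nat \<Rightarrow> int"
  assumes "\<And>s. s < n \<Longrightarrow> f (Suc s) = f s \<or> f (Suc s) = f s + 1" "f 0 \<le> x" "x < f n"
  shows "\<exists>s<n. f s = x \<and> f (Suc s) = x + 1"
  using assms
proof (induction n)
  case (Suc n)
  then show ?case
  proof (cases "x < f n")
    case True
    then show ?thesis using Suc by (metis less_Suc_eq)
  next
    case False
    then have "f n = x \<and> f (Suc n) = x + 1" using Suc.prems(1)[of n] Suc.prems(3) by auto
    then show ?thesis by blast
  qed
qed simp

lemma unit_steps_mono:
  fixes f :: "nat \<Rightarrow> int"
  assumes "\<And>s. s < n \<Longrightarrow> f (Suc s) = f s \<or> f (Suc s) = f s + 1" "s \<le> t" "t \<le> n"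
  shows "f s \<le> f t" "f t - int t \<le> f s - int s"
proof -
  have "f s \<le> f t \<and> f t - int t \<le> f s - int s"
    using assms(2,3)
  proof (induction rule: dec_induct)
    case (step t)
    then show ?case using assms(1)[of t] by auto
  qed simp
  then show "f s \<le> f t" "f t - int t \<le> f s - int s" by auto
qed

lemma is_colD:
  assumes "is_col n u v L U"
  shows "s < n \<Longrightarrow> L (Suc s) = L s \<or> L (Suc s) = L s + 1" "s < n \<Longrightarrow> U (Suc s) = U s \<or> U (Suc s) = U s + 1"
    "L n = u + int n - 1" "U n = v" "L 0 + 1 \<le> U 0" "even (U 0 - L 0 - 1)"
  using assms by (auto simp: is_col_def)

lemma col_low_mono: "is_col n u v L U \<Longrightarrow> s \<le> t \<Longrightarrow> t \<le> n \<Longrightarrow> low_x L t \<le> low_x L s"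
  using unit_steps_mono(2)[of n L s t] by (auto simp: is_col_def low_x_def)

lemma col_up_mono: "is_col n u v L U \<Longrightarrow> s \<le> t \<Longrightarrow> t \<le> n \<Longrightarrow> U s \<le> U t"
  using unit_steps_mono(1)[of n U s t] by (auto simp: is_col_def)

lemma col_order: "is_col n u v L U \<Longrightarrow> u \<le> L 0 + 1 \<and> U 0 \<le> v"
  using col_low_mono[of n u v L U 0 n] col_up_mono[of n u v L U 0 n] by (auto simp: is_col_def low_x_def)

lemma col_low_value:
  assumes c: "is_col n u v L U" and "u \<le> x" "x < L 0 + 1"
  shows "\<exists>s<n. low_x L (Suc s) = x \<and> L (Suc s) = L s"
proof -
  let ?f = "\<lambda>k. low_x L (n - k)"
  have st: "?f (Suc k) = ?f k \<or> ?f (Suc k) = ?f k + 1" if "k < n" for k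
  proof -
    have "n - k = Suc (n - Suc k)" using that by simp
    then show ?thesis using is_colD(1)[OF c, of "n - Suc k"] that by (auto simp: low_x_def)
  qed
  obtain k where k: "k < n" "?f k = x" "?f (Suc k) = x + 1"
    using unit_steps_value[of n ?f x, OF st] assms(2,3) is_colD(3)[OF c] by (auto simp: low_x_def)
  have "n - k = Suc (n - Suc k)" using k by simp
  then show ?thesis using k by (intro exI[of _ "n - Suc k"]) (auto simp: low_x_def)
qed

lemma col_up_value:
  assumes c: "is_col n u v L U" and "U 0 \<le> x" "x < v"
  shows "\<exists>s<n. U s = x \<and> U (Suc s) = U s + 1"
  using unit_steps_value[of n U x] assms is_colD[OF c] by auto

lemma col_label_cases:
  assumes c: "is_col n u v L U" and x: "u \<le> x" "x < v"
  obtains (low) s where "s < n" "low_x L (Suc s) = x" "L (Suc s) = L s" "col_label n u L U x = Pos (n - s)" "x < L 0 + 1"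
  | (mid) "L 0 + 1 \<le> x" "x < U 0" "col_label n u L U x = (if even (x - L 0 - 1) then Bar n else Pos n)"
  | (up) s where "s < n" "U s = x" "U (Suc s) = U s + 1" "col_label n u L U x = Bar (n - s)" "U 0 \<le> x"
proof -
  consider "x < L 0 + 1" | "L 0 + 1 \<le> x" "x < U 0" | "U 0 \<le> x" by linarith
  then show ?thesis
  proof cases
    case 1
    then obtain s where s: "s < n" "low_x L (Suc s) = x" "L (Suc s) = L s" using col_low_value[OF c x(1)] by blast
    then show ?thesis using col_label_low[OF c s(1,3)] 1 low by auto
  next
    case 2
    define t where "t = nat (x - L 0 - 1)"
    have t: "x = L 0 + 1 + int t" "t < mid_len L U" using 2 mid_len_eq[OF c] by (auto simp: t_def)
    then show ?thesis using col_label_mid[OF c t(2)] 2 mid by auto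
  next
    case 3
    then obtain s where s: "s < n" "U s = x" "U (Suc s) = U s + 1" using col_up_value[OF c _ x(2)] by blast
    then show ?thesis using col_label_up[OF c s(1,3)] 3 up by auto
  qed
qed

section \<open>Pairs of adjacent columns\<close>

text \<open>The inequalities exclude common points off height 0 and nested stretches at height 0.
  The stretches then overlap exactly if \<open>L 0 + 1 \<le> U' 0\<close>, and in that case the
  intersection has to be special.\<close>

definition col_sep :: "nat \<Rightarrow> (nat \<Rightarrow> int) \<Rightarrow> (nat \<Rightarrow> int) \<Rightarrow> (nat \<Rightarrow> int) \<Rightarrow> (nat \<Rightarrow> int) \<Rightarrow> bool" where
  "col_sep n L U L' U' \<longleftrightarrow> (\<forall>s\<le>n. L' s < L s) \<and> (\<forall>s\<le>n. U' s < U s) \<and> (L 0 + 1 \<le> U' 0 \<longrightarrow> odd (L 0 - L' 0))"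

lemma col_point_low: "is_col n u v L U \<Longrightarrow> s \<le> n \<Longrightarrow> (low_x L s, - int s - low_x L s) \<in> set (points (col_path n u L U))"
  by (subst col_points_set) auto

lemma col_point_mid: "is_col n u v L U \<Longrightarrow> L 0 + 1 \<le> x \<Longrightarrow> x \<le> U 0 \<Longrightarrow> (x, - x) \<in> set (points (col_path n u L U))"
  by (subst col_points_set) auto

lemma col_point_up: "is_col n u v L U \<Longrightarrow> s \<le> n \<Longrightarrow> (U s, int s - U s) \<in> set (points (col_path n u L U))"
  by (subst col_points_set) auto

lemma unit_steps_pos:
  fixes f g :: "nat \<Rightarrow> int"
  assumes st: "\<And>s. s < n \<Longrightarrow> f (Suc s) = f s \<or> f (Suc s) = f s + 1" "\<And>s. s < n \<Longrightarrow> g (Suc s) = g s \<or> g (Suc s) = g s + 1"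
    and top: "g n < f n" and ne: "\<And>s. 0 < s \<Longrightarrow> s \<le> n \<Longrightarrow> f s \<noteq> g s" and s: "s \<le> n"
  shows "g s \<le> f s \<and> (0 < s \<longrightarrow> g s < f s)"
  using s
proof (induction rule: inc_induct)
  case base
  then show ?case using top by simp
next
  case (step s)
  then show ?case using st[of s] ne[of s] by auto
qed

lemma ordinarily_intersecting_col:
  assumes c: "is_col n u v L U" and c': "is_col n u' v' L' U'" and uv: "u' < u" "v' < v"
  shows "\<not> ordinarily_intersecting (col_path n u L U) (col_path n u' L' U') \<longleftrightarrow> col_sep n L U L' U'"
proof
  let ?q = "col_path n u L U" and ?q' = "col_path n u' L' U'"
  let ?I = "set (points ?q) \<inter> set (points ?q')"
  have par: "(\<exists>k::int. odd k \<and> pos_at_zero ?q - pos_at_zero ?q' = of_int k) \<longleftrightarrow> odd (L 0 - L' 0)"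
  proof -
    have "pos_at_zero ?q - pos_at_zero ?q' = real_of_int (L 0 - L' 0)"
      by (simp add: pos_at_zero_col[OF c] pos_at_zero_col[OF c'])
    then show ?thesis by (simp only: of_int_eq_iff) auto
  qed
  {
    assume "\<not> ordinarily_intersecting ?q ?q'"
    then have I: "?I = {} \<or> (\<forall>w\<in>?I. ht w = 0) \<and> odd (L 0 - L' 0)"
      by (auto simp: ordinarily_intersecting_def specially_intersecting_def intersecting_def par)
    have ne: "L s \<noteq> L' s" "U s \<noteq> U' s" if "0 < s" "s \<le> n" for s
    proof -
      show "L s \<noteq> L' s"
      proof
        assume "L s = L' s"
        then have "(low_x L s, - int s - low_x L s) \<in> ?I"
          using col_point_low[OF c that(2)] col_point_low[OF c' that(2)] by (simp add: low_x_def)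
        then have "ht (low_x L s, - int s - low_x L s) = 0" using I by blast
        then show False using that(1) by (simp add: ht_def)
      qed
      show "U s \<noteq> U' s"
      proof
        assume "U s = U' s"
        then have "(U s, int s - U s) \<in> ?I" using col_point_up[OF c that(2)] col_point_up[OF c' that(2)] by simp
        then have "ht (U s, int s - U s) = 0" using I by blast
        then show False using that(1) by (simp add: ht_def)
      qed
    qed
    have low: "L' s \<le> L s \<and> (0 < s \<longrightarrow> L' s < L s)" if "s \<le> n" for s
      by (rule unit_steps_pos[of n L L', OF is_colD(1)[OF c] is_colD(1)[OF c']])
        (use is_colD(3)[OF c] is_colD(3)[OF c'] uv ne(1) that in auto)
    have up: "U' s \<le> U s \<and> (0 < s \<longrightarrow> U' s < U s)" if "s \<le> n" for s
      by (rule unit_steps_pos[of n U U', OF is_colD(2)[OF c] is_colD(2)[OF c']])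
        (use is_colD(4)[OF c] is_colD(4)[OF c'] uv ne(2) that in auto)
    have z: "odd (L 0 - L' 0)" if "L 0 + 1 \<le> x" "x \<le> U 0" "L' 0 + 1 \<le> x" "x \<le> U' 0" for x
    proof -
      have "(x, - x) \<in> ?I" using col_point_mid[OF c] col_point_mid[OF c'] that by blast
      then show ?thesis using I by auto
    qed
    note d = is_colD(5,6)[OF c] is_colD(5,6)[OF c']
    have a0: "L 0 \<noteq> L' 0" using z[of "L 0 + 1"] d by auto
    \<comment> \<open>Both stretches have even length, so a common right end would make the
      difference of the left ends even, against the parity of a special intersection.\<close>
    have "U 0 \<noteq> U' 0"
    proof
      assume e: "U 0 = U' 0"
      then have "odd (L 0 - L' 0)" using z[of "U 0"] d by auto
      moreover have "L 0 - L' 0 = (U' 0 - L' 0 - 1) - (U 0 - L 0 - 1)" using e by simp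
      ultimately show False using d by presburger
    qed
    then have b0: "U' 0 < U 0" using up[of 0] by auto
    have lows: "L' s < L s" if "s \<le> n" for s using low[OF that] a0 by (cases s) auto
    have ups: "U' s < U s" if "s \<le> n" for s using up[OF that] b0 by (cases s) auto
    have "odd (L 0 - L' 0)" if "L 0 + 1 \<le> U' 0"
      by (rule z[of "L 0 + 1"]) (use that d lows[OF le0] in linarith)+
    then show "col_sep n L U L' U'" unfolding col_sep_def using lows ups by blast
  }
  assume s: "col_sep n L U L' U'"
  then have lows: "L' s < L s" and ups: "U' s < U s" if "s \<le> n" for s
    using that by (auto simp: col_sep_def)
  have "x + y = 0 \<and> odd (L 0 - L' 0)" if "(x, y) \<in> ?I" for x y
  proof -
    have m: "(\<exists>s\<le>n. x + y = - int s \<and> x = low_x L s) \<or> (x + y = 0 \<and> L 0 + 1 \<le> x \<and> x \<le> U 0) \<or> (\<exists>s\<le>n. x + y = int s \<and> x = U s)"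
      "(\<exists>s\<le>n. x + y = - int s \<and> x = low_x L' s) \<or> (x + y = 0 \<and> L' 0 + 1 \<le> x \<and> x \<le> U' 0) \<or> (\<exists>s\<le>n. x + y = int s \<and> x = U' s)"
      using that col_points_set[OF c, of x y] col_points_set[OF c', of x y] by auto
    have z: "x + y = 0"
    proof (rule ccontr)
      assume "x + y \<noteq> 0"
      then consider "x + y < 0" | "0 < x + y" by linarith
      then show False
      proof cases
        case 1
        then have "\<exists>s\<le>n. x + y = - int s \<and> x = low_x L s" "\<exists>s\<le>n. x + y = - int s \<and> x = low_x L' s" using m by auto
        then obtain s t where "s \<le> n" "x + y = - int s" "x = low_x L s" "x + y = - int t" "x = low_x L' t" by blast
        moreover from this have "t = s" by linarith
        ultimately show False using lows[of s] by (simp add: low_x_def)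
      next
        case 2
        then have "\<exists>s\<le>n. x + y = int s \<and> x = U s" "\<exists>s\<le>n. x + y = int s \<and> x = U' s" using m by auto
        then obtain s t where "s \<le> n" "x + y = int s" "x = U s" "x + y = int t" "x = U' t" by blast
        moreover from this have "t = s" by linarith
        ultimately show False using ups[of s] by simp
      qed
    qed
    then have "L 0 + 1 \<le> x \<and> x \<le> U' 0"
      using m is_colD(5)[OF c] is_colD(5)[OF c'] by (auto simp: low_x_def)
    then show ?thesis using z s by (auto simp: col_sep_def)
  qed
  then have "?I = {} \<or> (\<forall>w\<in>?I. ht w = 0) \<and> odd (L 0 - L' 0)"
    unfolding ht_def by (metis equals0I prod.collapse)
  then show "\<not> ordinarily_intersecting ?q ?q'"
    by (auto simp: ordinarily_intersecting_def specially_intersecting_def intersecting_def par)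
qed

definition row_ok :: "nat \<Rightarrow> letter \<Rightarrow> letter \<Rightarrow> bool" where
  "row_ok n p q \<longleftrightarrow> letter_le n p q \<or> (p, q) = (Pos n, Bar n)"

lemma row_ok_simps [simp]:
  "row_ok n (Pos i) (Pos j) \<longleftrightarrow> i \<le> j" "row_ok n (Bar i) (Bar j) \<longleftrightarrow> j \<le> i"
  "row_ok n (Pos i) (Bar j)" "\<not> row_ok n (Bar i) (Pos j)"
  by (auto simp: row_ok_def)

text \<open>On overlapping stretches the labels alternate from \<open>Bar n\<close> on, and the odd
  offset together with the shift of the abscissa by one puts equal letters side by side. Elsewhere
  the separation orders the heights of the two labelled steps.\<close>

lemma col_sep_imp_row_ok:
  assumes c: "is_col n u v L U" and c': "is_col n u' v' L' U'" and sep: "col_sep n L U L' U'"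
    and x: "u \<le> x" "x < v" "u' \<le> x - 1" "x - 1 < v'"
  shows "row_ok n (col_label n u L U x) (col_label n u' L' U' (x - 1))"
proof -
  have lows: "L' s < L s" and ups: "U' s < U s" if "s \<le> n" for s
    using that sep by (auto simp: col_sep_def)
  note d = is_colD(5)[OF c] is_colD(5)[OF c'] lows[of 0] ups[of 0]
  show ?thesis
  proof (rule col_label_cases[OF c x(1,2)])
    fix s assume s: "s < n" "low_x L (Suc s) = x" "L (Suc s) = L s" "col_label n u L U x = Pos (n - s)" "x < L 0 + 1"
    show ?thesis
    proof (rule col_label_cases[OF c' x(3,4)])
      fix t assume t: "t < n" "low_x L' (Suc t) = x - 1" "L' (Suc t) = L' t" "col_label n u' L' U' (x - 1) = Pos (n - t)"
      have "t \<le> s"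
      proof (rule ccontr)
        assume "\<not> t \<le> s"
        then have "low_x L' t \<le> low_x L' (Suc s)" using col_low_mono[OF c', of "Suc s" t] t(1) by simp
        then show False using lows[of "Suc s"] s t by (simp add: low_x_def)
      qed
      then show ?thesis by (simp add: s(4) t(4))
    qed (auto simp: s(4))
  next
    assume m: "L 0 + 1 \<le> x" "x < U 0" "col_label n u L U x = (if even (x - L 0 - 1) then Bar n else Pos n)"
    show ?thesis
    proof (rule col_label_cases[OF c' x(3,4)])
      assume m': "L' 0 + 1 \<le> x - 1" "x - 1 < U' 0" "col_label n u' L' U' (x - 1) = (if even (x - 1 - L' 0 - 1) then Bar n else Pos n)"
      have "odd (L 0 - L' 0)" using sep m m' by (simp add: col_sep_def)
      then have "even (x - L 0 - 1) \<longleftrightarrow> even (x - 1 - L' 0 - 1)" by presburger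
      then show ?thesis unfolding m(3) m'(3) by auto
    qed (use m d in auto)
  next
    fix s assume s: "s < n" "U s = x" "U (Suc s) = U s + 1" "col_label n u L U x = Bar (n - s)" "U 0 \<le> x"
    show ?thesis
    proof (rule col_label_cases[OF c' x(3,4)])
      fix t assume t: "t < n" "U' t = x - 1" "U' (Suc t) = U' t + 1" "col_label n u' L' U' (x - 1) = Bar (n - t)"
      have "s \<le> t"
      proof (rule ccontr)
        assume "\<not> s \<le> t"
        then have "U' (Suc t) \<le> U' s" using col_up_mono[OF c', of "Suc t" s] s(1) by simp
        then show False using ups[of s] s t by simp
      qed
      then show ?thesis by (simp add: s(4) t(4))
    qed (use s d in auto)
  qed
qed

text \<open>Coming from row \<open>n\<close>, at the first row where the separation fails one path
  changes its value and the other does not, and the label read there cannot stand beside its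
  neighbour.\<close>

lemma row_ok_imp_col_sep:
  assumes c: "is_col n u v L U" and c': "is_col n u' v' L' U'" and uv: "u' < u" "v' < v"
    and ok: "\<And>x. u \<le> x \<Longrightarrow> x < v \<Longrightarrow> u' \<le> x - 1 \<Longrightarrow> x - 1 < v' \<Longrightarrow>
      row_ok n (col_label n u L U x) (col_label n u' L' U' (x - 1))"
  shows "col_sep n L U L' U'"
proof -
  note d = is_colD(5,6)[OF c] is_colD(5,6)[OF c'] col_order[OF c] col_order[OF c']
  have lows: "L' s < L s" if "s \<le> n" for s
    using that
  proof (induction rule: inc_induct)
    case base
    then show ?case using is_colD(3)[OF c] is_colD(3)[OF c'] uv by simp
  next
    case (step s)
    show ?case
    proof (rule ccontr)
      assume "\<not> L' s < L s"
      then have e: "L (Suc s) = L s + 1" "L' (Suc s) = L' s" "L' s = L s"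
        using is_colD(1)[OF c step(2)] is_colD(1)[OF c' step(2)] step(3) by auto
      define x where "x = low_x L s"
      have lx: "low_x L' (Suc s) = x - 1" "low_x L' s = x" using e by (simp_all add: x_def low_x_def)
      have lab': "col_label n u' L' U' (x - 1) = Pos (n - s)" using col_label_low[OF c' step(2) e(2)] by (simp add: lx)
      have "u \<le> x" using col_low_mono[OF c, of s n] step(2) is_colD(3)[OF c] by (simp add: x_def low_x_def)
      moreover have xa: "x \<le> L 0 + 1" using col_low_mono[OF c, of 0 s] step(2) by (simp add: x_def low_x_def)
      moreover have "x \<le> L' 0 + 1" using col_low_mono[OF c', of 0 s] step(2) lx by (simp add: low_x_def)
      moreover have "u' \<le> x - 1" using calculation(1) uv by simp
      ultimately have x: "u \<le> x" "x < v" "u' \<le> x - 1" "x - 1 < v'" using d uv by auto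
      show False
      proof (rule col_label_cases[OF c x(1,2)])
        fix t assume t: "t < n" "low_x L (Suc t) = x" "L (Suc t) = L t" "col_label n u L U x = Pos (n - t)"
        have "t < s"
        proof (rule ccontr)
          assume "\<not> t < s"
          then have "low_x L t \<le> low_x L s" using col_low_mono[OF c, of s t] t(1) by simp
          then show False using t by (simp add: x_def low_x_def)
        qed
        then show False using ok[OF x] step(2) by (simp add: t(4) lab')
      next
        assume m: "L 0 + 1 \<le> x" "col_label n u L U x = (if even (x - L 0 - 1) then Bar n else Pos n)"
        then have "x - L 0 - 1 = 0" using xa by simp
        then show False using ok[OF x] by (simp add: m(2) lab')
      next
        fix t assume "col_label n u L U x = Bar (n - t)"
        then show False using ok[OF x] by (simp add: lab')
      qed
    qed
  qed
  have ups: "U' s < U s" if "s \<le> n" for s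
    using that
  proof (induction rule: inc_induct)
    case base
    then show ?case using is_colD(4)[OF c] is_colD(4)[OF c'] uv by simp
  next
    case (step s)
    show ?case
    proof (rule ccontr)
      assume "\<not> U' s < U s"
      then have e: "U (Suc s) = U s + 1" "U' (Suc s) = U' s" "U' s = U s"
        using is_colD(2)[OF c step(2)] is_colD(2)[OF c' step(2)] step(3) by auto
      define x where "x = U s"
      have lab: "col_label n u L U x = Bar (n - s)" using col_label_up[OF c step(2) e(1)] by (simp add: x_def)
      have "U 0 \<le> x" using col_up_mono[OF c, of 0 s] step(2) by (simp add: x_def)
      moreover have "x < v" using col_up_mono[OF c, of "Suc s" n] step(2) e is_colD(4)[OF c] by (simp add: x_def)
      moreover have "x \<le> v'" using col_up_mono[OF c', of s n] step(2) e is_colD(4)[OF c'] by (simp add: x_def)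
      moreover have b0: "U' 0 \<le> x" using col_up_mono[OF c', of 0 s] step(2) e by (simp add: x_def)
      ultimately have x: "u \<le> x" "x < v" "u' \<le> x - 1" "x - 1 < v'" using d uv by auto
      show False
      proof (rule col_label_cases[OF c' x(3,4)])
        fix t assume "col_label n u' L' U' (x - 1) = Pos (n - t)"
        then show False using ok[OF x] by (simp add: lab)
      next
        assume m: "L' 0 + 1 \<le> x - 1" "x - 1 < U' 0" "col_label n u' L' U' (x - 1) = (if even (x - 1 - L' 0 - 1) then Bar n else Pos n)"
        then have "x - 1 - L' 0 - 1 = (U' 0 - L' 0 - 1) - 1" using b0 by simp
        then have "odd (x - 1 - L' 0 - 1)" using d by presburger
        then show False using ok[OF x] by (simp add: m(3) lab)
      next
        fix t assume t: "t < n" "U' t = x - 1" "U' (Suc t) = U' t + 1" "col_label n u' L' U' (x - 1) = Bar (n - t)"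
        have "t < s"
        proof (rule ccontr)
          assume "\<not> t < s"
          then have "U' s \<le> U' t" using col_up_mono[OF c', of s t] t(1) by simp
          then show False using t e by (simp add: x_def)
        qed
        then show False using ok[OF x] step(2) by (simp add: t(4) lab)
      qed
    qed
  qed
  \<comment> \<open>With an even offset the first E-step, labelled \<open>Bar n\<close>, would have
    \<open>Pos n\<close> as its right neighbour.\<close>
  have "odd (L 0 - L' 0)" if a: "L 0 + 1 \<le> U' 0"
  proof (rule ccontr)
    assume ev: "\<not> odd (L 0 - L' 0)"
    define x where "x = L 0 + 1"
    have x: "u \<le> x" "x < v" "u' \<le> x - 1" "x - 1 < v'" using d a uv lows[of 0] ups[of 0] by (auto simp: x_def)
    have "0 < mid_len L U" using a ups[of 0] by (simp add: mid_len_def)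
    then have lab: "col_label n u L U x = Bar n" using col_label_mid[OF c, of 0] by (simp add: x_def)
    have t: "x - 1 = L' 0 + 1 + int (nat (L 0 - L' 0 - 1))" using lows[of 0] by (simp add: x_def)
    have "odd (L 0 - L' 0 - 1)" using ev by simp
    then have "odd (nat (L 0 - L' 0 - 1))" using lows[of 0] by (simp add: even_nat_iff)
    moreover have "nat (L 0 - L' 0 - 1) < mid_len L' U'" using a lows[of 0] by (simp add: mid_len_def)
    ultimately have "col_label n u' L' U' (x - 1) = Pos n" unfolding t by (subst col_label_mid[OF c']) simp_all
    then show False using ok[OF x] by (simp add: lab)
  qed
  then show ?thesis using lows ups by (simp add: col_sep_def)
qed

section \<open>Words read down a column\<close>

lemma col_label_letters:
  assumes c: "is_col n u v L U" and x: "u \<le> x" "x < v" and n: "0 < n"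
  shows "col_label n u L U x \<in> letters n"
  by (rule col_label_cases[OF c x]) (use n in \<open>auto simp: letters_def\<close>)

text \<open>Off height 0 the letters are ordered because the height increases along the path. At
  height 0 the letters \<open>Bar n\<close> and \<open>Pos n\<close> alternate, and these are
  incomparable.\<close>

lemma col_label_vertical:
  assumes c: "is_col n u v L U" and x: "u \<le> x" "x + 1 < v"
  shows "\<not> letter_le n (col_label n u L U (x + 1)) (col_label n u L U x)"
proof -
  have x': "u \<le> x" "x < v" "u \<le> x + 1" "x + 1 < v" using x by auto
  note d = is_colD(5,6)[OF c]
  show ?thesis
  proof (rule col_label_cases[OF c x'(1,2)])
    fix s assume s: "s < n" "low_x L (Suc s) = x" "L (Suc s) = L s" "col_label n u L U x = Pos (n - s)" "x < L 0 + 1"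
    show ?thesis
    proof (rule col_label_cases[OF c x'(3,4)])
      fix t assume t: "t < n" "low_x L (Suc t) = x + 1" "L (Suc t) = L t" "col_label n u L U (x + 1) = Pos (n - t)"
      have "t < s"
      proof (rule ccontr)
        assume "\<not> t < s"
        then have "low_x L t \<le> low_x L s" using col_low_mono[OF c, of s t] t(1) by simp
        then show False using s t by (simp add: low_x_def)
      qed
      then show ?thesis using s(1) by (simp add: s(4) t(4))
    next
      assume m: "L 0 + 1 \<le> x + 1" "x + 1 < U 0" "col_label n u L U (x + 1) = (if even (x + 1 - L 0 - 1) then Bar n else Pos n)"
      then have "x + 1 - L 0 - 1 = 0" using s by simp
      then have "col_label n u L U (x + 1) = Bar n" unfolding m(3) by (simp only: even_zero if_True)
      then show ?thesis by (simp only: s(4)) simp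
    qed (simp add: s(4))
  next
    assume m: "L 0 + 1 \<le> x" "x < U 0" "col_label n u L U x = (if even (x - L 0 - 1) then Bar n else Pos n)"
    show ?thesis
    proof (rule col_label_cases[OF c x'(3,4)])
      assume m': "L 0 + 1 \<le> x + 1" "x + 1 < U 0" "col_label n u L U (x + 1) = (if even (x + 1 - L 0 - 1) then Bar n else Pos n)"
      have "even (x + 1 - L 0 - 1) \<longleftrightarrow> odd (x - L 0 - 1)" by presburger
      then show ?thesis unfolding m(3) m'(3) by auto
    next
      fix t assume t: "U 0 \<le> x + 1" "col_label n u L U (x + 1) = Bar (n - t)"
      have "x - L 0 - 1 = (U 0 - L 0 - 1) - 1" using t(1) m by simp
      then have "odd (x - L 0 - 1)" using d by presburger
      then show ?thesis by (simp add: m(3) t(2))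
    qed (use m in auto)
  next
    fix s assume s: "s < n" "U s = x" "U (Suc s) = U s + 1" "col_label n u L U x = Bar (n - s)" "U 0 \<le> x"
    show ?thesis
    proof (rule col_label_cases[OF c x'(3,4)])
      fix t assume t: "t < n" "U t = x + 1" "U (Suc t) = U t + 1" "col_label n u L U (x + 1) = Bar (n - t)"
      have "s < t"
      proof (rule ccontr)
        assume "\<not> s < t"
        then have "U t \<le> U s" using col_up_mono[OF c, of t s] s(1) by simp
        then show False using s t by simp
      qed
      then show ?thesis using t(1) by (simp add: s(4) t(4))
    qed (use s d in auto)
  qed
qed

text \<open>A step of \<open>L\<close> is visible as the letter \<open>Pos (n - s)\<close>. Equal
  words show this letter at the same abscissa for \<open>L'\<close>; had \<open>L'\<close> moved in
  this row, it would read a different letter there.\<close>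

lemma col_low_transfer:
  assumes c: "is_col n u v L U" and c': "is_col n u v L' U'"
    and eq: "\<And>x. u \<le> x \<Longrightarrow> x < v \<Longrightarrow> col_label n u L U x = col_label n u L' U' x"
    and s: "s < n" "L (Suc s) = L' (Suc s)" "L (Suc s) = L s"
  shows "L' (Suc s) = L' s"
proof (rule ccontr)
  assume "L' (Suc s) \<noteq> L' s"
  then have e: "L' (Suc s) = L' s + 1" using is_colD(1)[OF c' s(1)] by simp
  define x where "x = low_x L (Suc s)"
  have x2: "low_x L' s = x" "low_x L s = x + 1" using s e by (simp_all add: x_def low_x_def)
  have lab: "col_label n u L U x = Pos (n - s)" using col_label_low[OF c s(1,3)] by (simp add: x_def)
  have "u \<le> x" using col_low_mono[OF c, of "Suc s" n] s is_colD(3)[OF c] by (simp add: x_def low_x_def)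
  moreover have "x + 1 \<le> L 0 + 1" using col_low_mono[OF c, of 0 s] s x2 by (simp add: low_x_def)
  ultimately have x: "u \<le> x" "x < v" using col_order[OF c] is_colD(5)[OF c] by auto
  have lab': "col_label n u L' U' x = Pos (n - s)" using eq[OF x] lab by simp
  show False
  proof (rule col_label_cases[OF c' x])
    fix t assume t: "t < n" "low_x L' (Suc t) = x" "L' (Suc t) = L' t" "col_label n u L' U' x = Pos (n - t)"
    have "t < s"
    proof (rule ccontr)
      assume "\<not> t < s"
      then have "low_x L' t \<le> low_x L' s" using col_low_mono[OF c', of s t] t(1) by simp
      then show False using t x2 by (simp add: low_x_def)
    qed
    then show False using lab' t s by simp
  next
    assume m: "L' 0 + 1 \<le> x" "col_label n u L' U' x = (if even (x - L' 0 - 1) then Bar n else Pos n)"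
    have "x \<le> L' 0 + 1" using col_low_mono[OF c', of 0 s] s x2 by (simp add: low_x_def)
    then have "x - L' 0 - 1 = 0" using m by simp
    then show False using m lab' by simp
  qed (use lab' in auto)
qed

lemma col_up_transfer:
  assumes c: "is_col n u v L U" and c': "is_col n u v L' U'"
    and eq: "\<And>x. u \<le> x \<Longrightarrow> x < v \<Longrightarrow> col_label n u L U x = col_label n u L' U' x"
    and s: "s < n" "U (Suc s) = U' (Suc s)" "U (Suc s) = U s + 1"
  shows "U' (Suc s) = U' s + 1"
proof (rule ccontr)
  assume "U' (Suc s) \<noteq> U' s + 1"
  then have e: "U' s = U s + 1" using is_colD(2)[OF c' s(1)] s by simp
  define x where "x = U s"
  have lab: "col_label n u L U x = Bar (n - s)" using col_label_up[OF c s(1,3)] by (simp add: x_def)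
  have "U 0 \<le> x" using col_up_mono[OF c, of 0 s] s by (simp add: x_def)
  moreover have "x < v" using col_up_mono[OF c, of "Suc s" n] s is_colD(4)[OF c] by (simp add: x_def)
  ultimately have x: "u \<le> x" "x < v" using col_order[OF c] is_colD(5)[OF c] by auto
  have lab': "col_label n u L' U' x = Bar (n - s)" using eq[OF x] lab by simp
  show False
  proof (rule col_label_cases[OF c' x])
    assume m: "x < U' 0" "col_label n u L' U' x = (if even (x - L' 0 - 1) then Bar n else Pos n)"
    have "U' 0 \<le> x + 1" using col_up_mono[OF c', of 0 s] s e by (simp add: x_def)
    then have "x - L' 0 - 1 = (U' 0 - L' 0 - 1) - 1" using m by simp
    then have "odd (x - L' 0 - 1)" using is_colD(6)[OF c'] by presburger
    then show False using m lab' by simp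
  next
    fix t assume t: "t < n" "U' t = x" "U' (Suc t) = U' t + 1" "col_label n u L' U' x = Bar (n - t)"
    have "t < s"
    proof (rule ccontr)
      assume "\<not> t < s"
      then have "U' s \<le> U' t" using col_up_mono[OF c', of s t] t(1) by simp
      then show False using t e by (simp add: x_def)
    qed
    then show False using lab' t s by simp
  qed (use lab' in auto)
qed

lemma col_unique:
  assumes c: "is_col n u v L U" and c': "is_col n u v L' U'"
    and eq: "\<And>x. u \<le> x \<Longrightarrow> x < v \<Longrightarrow> col_label n u L U x = col_label n u L' U' x" and "s \<le> n"
  shows "L s = L' s \<and> U s = U' s"
  using \<open>s \<le> n\<close>
proof (induction rule: inc_induct)
  case base
  then show ?case using is_colD(3,4)[OF c] is_colD(3,4)[OF c'] by simp
next
  case (step s)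
  have a: "L (Suc s) = L' (Suc s)" and b: "U (Suc s) = U' (Suc s)" using step(3) by auto
  have "L (Suc s) = L s \<longleftrightarrow> L' (Suc s) = L' s"
    using col_low_transfer[OF c c' eq step(2) a] col_low_transfer[OF c' c eq[symmetric] step(2) a[symmetric]] by blast
  then have "L s = L' s" using a is_colD(1)[OF c step(2)] is_colD(1)[OF c' step(2)] by linarith
  have "U (Suc s) = U s + 1 \<longleftrightarrow> U' (Suc s) = U' s + 1"
    using col_up_transfer[OF c c' eq step(2) b] col_up_transfer[OF c' c eq[symmetric] step(2) b[symmetric]] by blast
  then have "U s = U' s" using b is_colD(2)[OF c step(2)] is_colD(2)[OF c' step(2)] by linarith
  with \<open>L s = L' s\<close> show ?case ..
qed

text \<open>If \<open>Bar k\<close> may follow, the upper path is constant from row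
  \<open>n - k\<close> on. One more NE-step can then be inserted in that row without touching the
  earlier labels.\<close>

lemma col_extend_Bar:
  assumes c: "is_col n u v L U" and k: "1 \<le> k" "k \<le> n"
    and lst: "u < v \<Longrightarrow> \<not> letter_le n (Bar k) (col_label n u L U (v - 1))"
  shows "\<exists>L' U'. is_col n u (v + 1) L' U' \<and> (\<forall>x. u \<le> x \<longrightarrow> x < v \<longrightarrow> col_label n u L' U' x = col_label n u L U x)
    \<and> col_label n u L' U' v = Bar k"
proof -
  have le: "U s \<le> v" if "s \<le> n" for s using col_up_mono[OF c that] is_colD(4)[OF c] by simp
  have const: "U s = v" if "n - k \<le> s" "s \<le> n" for s
  proof (rule ccontr)
    assume "U s \<noteq> v"
    then have sv: "U s \<le> v - 1" using le[OF that(2)] by simp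
    have "U 0 \<le> v - 1" using col_up_mono[OF c, of 0 s] that(2) sv by simp
    then obtain t where t: "t < n" "U t = v - 1" "U (Suc t) = U t + 1" using col_up_value[OF c, of "v - 1"] by auto
    have "s \<le> t"
    proof (rule ccontr)
      assume "\<not> s \<le> t"
      then show False using col_up_mono[OF c, of "Suc t" s] t sv that(2) by simp
    qed
    moreover have "u < v" using \<open>U 0 \<le> v - 1\<close> is_colD(5)[OF c] col_order[OF c] by simp
    ultimately show False using lst col_label_up[OF c t(1,3)] t(1,2) that k by auto
  qed
  define U' where "U' s = (if s \<le> n - k then U s else v + 1)" for s
  have c': "is_col n u (v + 1) L U'"
    unfolding is_col_def
  proof (intro conjI allI impI)
    fix s assume s: "s < n"
    show "L (Suc s) = L s \<or> L (Suc s) = L s + 1" by (rule is_colD(1)[OF c s])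
    show "U' (Suc s) = U' s \<or> U' (Suc s) = U' s + 1"
      using is_colD(2)[OF c s] const[of "n - k"] k by (cases s "n - k" rule: linorder_cases) (auto simp: U'_def)
  qed (use c k in \<open>auto simp: is_col_def U'_def\<close>)
  have "col_label n u L U' x = col_label n u L U x" if x: "u \<le> x" "x < v" for x
  proof (rule col_label_cases[OF c x])
    fix s assume s: "s < n" "low_x L (Suc s) = x" "L (Suc s) = L s" "col_label n u L U x = Pos (n - s)"
    then show ?thesis using col_label_low[OF c' s(1,3)] by simp
  next
    assume m: "L 0 + 1 \<le> x" "x < U 0" "col_label n u L U x = (if even (x - L 0 - 1) then Bar n else Pos n)"
    define t where "t = nat (x - L 0 - 1)"
    have "U' 0 = U 0" by (simp add: U'_def)
    then have t: "x = L 0 + 1 + int t" "t < mid_len L U'" using m by (auto simp: t_def mid_len_def)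
    show ?thesis unfolding m(3) unfolding t(1) using col_label_mid[OF c' t(2)] by simp
  next
    fix s assume s: "s < n" "U s = x" "U (Suc s) = U s + 1" "col_label n u L U x = Bar (n - s)"
    have "s < n - k" using const[of s] s x by (rule_tac ccontr) auto
    then show ?thesis using col_label_up[OF c' s(1)] s by (auto simp: U'_def)
  qed
  moreover have "col_label n u L U' v = Bar k"
    using col_label_up[OF c', of "n - k"] const[of "n - k"] k by (simp add: U'_def)
  ultimately show ?thesis using c' by blast
qed

text \<open>Either the word so far is read on the lower path alone, which then receives one more
  NE-step, or its last letter is barred. The latter must be \<open>Bar n\<close>, the only barred
  letter that an unbarred one may follow.\<close>

lemma col_extend_Pos:
  assumes c: "is_col n u v L U" and k: "1 \<le> k" "k \<le> n"
    and lst: "u < v \<Longrightarrow> \<not> letter_le n (Pos k) (col_label n u L U (v - 1))"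
  shows "\<exists>L' U'. is_col n u (v + 1) L' U' \<and> (\<forall>x. u \<le> x \<longrightarrow> x < v \<longrightarrow> col_label n u L' U' x = col_label n u L U x)
    \<and> col_label n u L' U' v = Pos k"
proof (cases "L 0 + 1 = v")
  case True
  have b0: "U 0 = v" using True is_colD(5)[OF c] col_order[OF c] by simp
  have steps: "L (Suc s) = L s + 1" if "s \<le> n - k" "s < n" for s
  proof (rule ccontr)
    assume "L (Suc s) \<noteq> L s + 1"
    then have e: "L (Suc s) = L s" using is_colD(1)[OF c that(2)] by simp
    have u: "u \<le> low_x L (Suc s)" using col_low_mono[OF c, of "Suc s" n] that(2) is_colD(3)[OF c] by (simp add: low_x_def)
    have s0: "low_x L s \<le> v" using col_low_mono[OF c, of 0 s] that(2) True by (simp add: low_x_def)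
    have uv: "u < v" using u s0 e by (simp add: low_x_def)
    obtain t where t: "t < n" "low_x L (Suc t) = v - 1" "L (Suc t) = L t"
      using col_low_value[OF c, of "v - 1"] uv True by auto
    have "t \<le> s"
    proof (rule ccontr)
      assume "\<not> t \<le> s"
      then show False using col_low_mono[OF c, of s t] col_low_mono[OF c, of "Suc s" t] t s0 e by (simp add: low_x_def)
    qed
    then have "Suc (n - Suc t) \<ge> k" using that k by linarith
    then show False using lst[OF uv] col_label_low[OF c t(1,3)] t(1,2) by (simp add: Suc_diff_Suc)
  qed
  define L' where "L' s = (if s \<le> n - k then L s + 1 else L s)" for s
  have c': "is_col n u (v + 1) L' (\<lambda>_. v + 1)"
    unfolding is_col_def
  proof (intro conjI allI impI)
    fix s assume s: "s < n"
    show "L' (Suc s) = L' s \<or> L' (Suc s) = L' s + 1"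
      using is_colD(1)[OF c s] steps[of s] s by (cases s "n - k" rule: linorder_cases) (auto simp: L'_def)
  qed (use c k True in \<open>auto simp: is_col_def L'_def\<close>)
  have "col_label n u L' (\<lambda>_. v + 1) x = col_label n u L U x" if x: "u \<le> x" "x < v" for x
  proof (rule col_label_cases[OF c x])
    fix s assume s: "s < n" "low_x L (Suc s) = x" "L (Suc s) = L s" "col_label n u L U x = Pos (n - s)"
    have "n - k < s" using steps[of s] s by (rule_tac ccontr) auto
    then have "L' (Suc s) = L' s" "low_x L' (Suc s) = x" using s by (auto simp: L'_def low_x_def)
    then show ?thesis using col_label_low[OF c' s(1)] s(4) by simp
  qed (use x True b0 in auto)
  moreover have "col_label n u L' (\<lambda>_. v + 1) v = Pos k"
  proof -
    have s: "n - k < n" using k by simp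
    then have "L' (Suc (n - k)) = L' (n - k)" using steps[of "n - k"] by (simp add: L'_def)
    moreover have "low_x L t = v" if "t \<le> n - k" for t
      using that
    proof (induction t)
      case 0
      then show ?case using True by (simp add: low_x_def)
    next
      case (Suc t)
      then show ?case using steps[of t] s by (simp add: low_x_def)
    qed
    then have "low_x L' (Suc (n - k)) = v" using steps[of "n - k"] s by (auto simp: L'_def low_x_def)
    ultimately show ?thesis using col_label_low[OF c' s] k by simp
  qed
  ultimately show ?thesis using c' by blast
next
  case False
  then have lt: "L 0 + 1 < v" using is_colD(5)[OF c] col_order[OF c] by simp
  have uv: "u \<le> v - 1" "v - 1 < v" using lt col_order[OF c] by auto
  obtain t where t: "t < n" "U t = v - 1" "U (Suc t) = U t + 1" "col_label n u L U (v - 1) = Bar (n - t)"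
  proof (rule col_label_cases[OF c uv])
    assume m: "L 0 + 1 \<le> v - 1" "v - 1 < U 0" "col_label n u L U (v - 1) = (if even (v - 1 - L 0 - 1) then Bar n else Pos n)"
    then have "v - 1 - L 0 - 1 = (U 0 - L 0 - 1) - 1" using col_order[OF c] by simp
    then have "odd (v - 1 - L 0 - 1)" using is_colD(6)[OF c] by presburger
    then show ?thesis using lst m(3) uv k by auto
  qed (use lt in auto)
  \<comment> \<open>\<open>Bar n\<close> was read on an NE-step at height 0. Together with the new
    letter \<open>Pos n\<close> it becomes a pair of E-steps, and the upper path is moved to
    \<open>v + 1\<close>.\<close>
  have kn: "k = n" "t = 0" using lst uv t k by auto
  have b: "U 0 = v - 1" "U s = v" if "0 < s" "s \<le> n" for s
  proof -
    show "U 0 = v - 1" using t kn by simp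
    show "U s = v" using col_up_mono[OF c, of 1 s] col_up_mono[OF c, of s n] that t kn is_colD(4)[OF c] by simp
  qed
  have b0: "U 0 = v - 1" using t kn by simp
  have c': "is_col n u (v + 1) L (\<lambda>_. v + 1)"
    unfolding is_col_def using is_colD[OF c] b0 by auto
  have "col_label n u L (\<lambda>_. v + 1) x = col_label n u L U x" if x: "u \<le> x" "x < v" for x
  proof (rule col_label_cases[OF c x])
    fix s assume s: "s < n" "low_x L (Suc s) = x" "L (Suc s) = L s" "col_label n u L U x = Pos (n - s)"
    then show ?thesis using col_label_low[OF c' s(1,3)] by simp
  next
    assume m: "L 0 + 1 \<le> x" "x < U 0" "col_label n u L U x = (if even (x - L 0 - 1) then Bar n else Pos n)"
    define i where "i = nat (x - L 0 - 1)"
    have i: "x = L 0 + 1 + int i" "i < mid_len L (\<lambda>_. v + 1)" using m b0 by (auto simp: i_def mid_len_def)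
    show ?thesis unfolding m(3) unfolding i(1) using col_label_mid[OF c' i(2)] by simp
  next
    fix s assume s: "s < n" "U s = x" "U (Suc s) = U s + 1" "col_label n u L U x = Bar (n - s)"
    have "s = 0" using b(2)[of s] s x by (cases s) auto
    then have xv: "x = v - 1" using s b0 by simp
    define i where "i = nat (x - L 0 - 1)"
    have i: "x = L 0 + 1 + int i" "i < mid_len L (\<lambda>_. v + 1)" using xv lt by (auto simp: i_def mid_len_def)
    have "int i = U 0 - L 0 - 1" using i xv b0 by simp
    then have "even i" using is_colD(6)[OF c] by (metis even_of_nat)
    then show ?thesis using col_label_mid[OF c' i(2)] s(4) \<open>s = 0\<close> unfolding i(1)[symmetric] by simp
  qed
  moreover have "col_label n u L (\<lambda>_. v + 1) v = Pos k"
  proof -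
    define i where "i = nat (v - L 0 - 1)"
    have i: "v = L 0 + 1 + int i" "i < mid_len L (\<lambda>_. v + 1)" using lt by (auto simp: i_def mid_len_def)
    have "int i = U 0 - L 0 - 1 + 1" using i b0 by simp
    then have "odd i" using is_colD(6)[OF c] by presburger
    then show ?thesis using col_label_mid[OF c' i(2)] kn unfolding i(1)[symmetric] by simp
  qed
  ultimately show ?thesis using c' by blast
qed

lemma col_exists:
  assumes w: "\<And>x. u \<le> x \<Longrightarrow> x < u + int m \<Longrightarrow> w x \<in> letters n"
    and v: "\<And>x. u \<le> x \<Longrightarrow> x + 1 < u + int m \<Longrightarrow> \<not> letter_le n (w (x + 1)) (w x)"
  shows "\<exists>L U. is_col n u (u + int m) L U \<and> (\<forall>x. u \<le> x \<longrightarrow> x < u + int m \<longrightarrow> col_label n u L U x = w x)"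
  using assms
proof (induction m)
  case 0
  have "is_col n u u (\<lambda>s. u + int s - 1) (\<lambda>_. u)" by (simp add: is_col_def)
  then show ?case by (intro exI[of _ "\<lambda>s. u + int s - 1"] exI[of _ "\<lambda>_. u"]) auto
next
  case (Suc m)
  obtain L U where c: "is_col n u (u + int m) L U" "\<forall>x. u \<le> x \<longrightarrow> x < u + int m \<longrightarrow> col_label n u L U x = w x"
    using Suc.IH Suc.prems by force
  define y where "y = u + int m"
  have lst: "\<not> letter_le n (w y) (col_label n u L U (y - 1))" if "u < y"
    using Suc.prems(2)[of "y - 1"] c(2) that by (auto simp: y_def)
  have "w y \<in> letters n" using Suc.prems(1)[of y] by (simp add: y_def)
  then consider k where "1 \<le> k" "k \<le> n" "w y = Pos k" | k where "1 \<le> k" "k \<le> n" "w y = Bar k" by (auto simp: letters_def)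
  then obtain L' U' where c': "is_col n u (y + 1) L' U'" "col_label n u L' U' y = w y"
    "\<forall>x. u \<le> x \<longrightarrow> x < y \<longrightarrow> col_label n u L' U' x = col_label n u L U x"
  proof cases
    case 1
    show ?thesis using col_extend_Pos[OF c(1) 1(1,2)] lst 1(3) that unfolding y_def[symmetric] by force
  next
    case 2
    show ?thesis using col_extend_Bar[OF c(1) 2(1,2)] lst 2(3) that unfolding y_def[symmetric] by force
  qed
  have "col_label n u L' U' x = w x" if "u \<le> x" "x < y + 1" for x
    using c' c(2) that by (cases "x = y") (auto simp: y_def)
  moreover have y1: "u + int (Suc m) = y + 1" by (simp add: y_def)
  ultimately show ?case unfolding y1 using c'(1) by blast
qed

section \<open>Column lengths of a skew diagram\<close>

lemma partition_mono:
  assumes "is_partition lam" "1 \<le> i" "i \<le> k"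
  shows "lam k \<le> lam i"
  using assms(3)
proof (induction rule: dec_induct)
  case (step k)
  then show ?case using assms(1,2) unfolding is_partition_def by (metis Suc_eq_plus1 le_trans)
qed simp

lemma conj_partition_set:
  assumes p: "is_partition lam" and j: "1 \<le> j"
  shows "{i. 1 \<le> i \<and> j \<le> lam i} = {1..conj_partition lam j}"
proof -
  let ?S = "{i. 1 \<le> i \<and> j \<le> lam i}"
  have fin: "finite ?S"
    by (rule finite_subset[of _ "{i. 1 \<le> i \<and> lam i \<noteq> 0}"]) (use p j in \<open>auto simp: is_partition_def\<close>)
  show ?thesis
  proof (cases "?S = {}")
    case True
    show ?thesis unfolding conj_partition_def True by simp
  next
    case False
    define m where "m = Max ?S"
    have m: "m \<in> ?S" unfolding m_def by (rule Max_in[OF fin False])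
    have "?S = {1..m}"
    proof (intro equalityI subsetI)
      fix i assume "i \<in> ?S"
      then show "i \<in> {1..m}" using Max_ge[OF fin] by (simp add: m_def)
    next
      fix i assume "i \<in> {1..m}"
      then show "i \<in> ?S" using m partition_mono[OF p, of i m] by auto
    qed
    then show ?thesis by (simp add: conj_partition_def)
  qed
qed

lemma conj_partition_iff: "is_partition lam \<Longrightarrow> 1 \<le> j \<Longrightarrow> 1 \<le> i \<Longrightarrow> i \<le> conj_partition lam j \<longleftrightarrow> j \<le> lam i"
proof -
  assume a: "is_partition lam" "1 \<le> j" "1 \<le> i"
  have "i \<in> {i. 1 \<le> i \<and> j \<le> lam i} \<longleftrightarrow> i \<in> {1..conj_partition lam j}" by (simp only: conj_partition_set[OF a(1,2)])
  then show ?thesis using a(3) by simp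
qed

lemma conj_partition_antimono:
  assumes "is_partition lam" "1 \<le> j" "j \<le> k"
  shows "conj_partition lam k \<le> conj_partition lam j"
proof (cases "conj_partition lam k")
  case (Suc m)
  have "k \<le> lam (Suc m)" using conj_partition_iff[OF assms(1), of k "Suc m"] assms(2,3) Suc by simp
  then show ?thesis using conj_partition_iff[OF assms(1,2), of "Suc m"] assms(3) Suc by simp
qed simp

lemma conj_partition_le:
  assumes "skew_diagram lam mu" "1 \<le> j"
  shows "conj_partition mu j \<le> conj_partition lam j"
proof (cases "conj_partition mu j")
  case (Suc k)
  have p: "is_partition lam" "is_partition mu" "\<And>i. 1 \<le> i \<Longrightarrow> mu i \<le> lam i" using assms by (auto simp: skew_diagram_def)
  have "j \<le> mu (Suc k)" using conj_partition_iff[OF p(2) assms(2), of "Suc k"] Suc by simp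
  then show ?thesis using conj_partition_iff[OF p(1) assms(2), of "Suc k"] p(3)[of "Suc k"] Suc by simp
qed simp

text \<open>The abscissa of an endpoint of path number \<open>j + 1\<close>; from here on columns
  are counted from 0.\<close>

definition first_abs :: "(nat \<Rightarrow> nat) \<Rightarrow> nat \<Rightarrow> int" where
  "first_abs lam j = int (conj_partition lam (Suc j)) - int j"

lemma first_abs_strict: "is_partition lam \<Longrightarrow> i < k \<Longrightarrow> first_abs lam k < first_abs lam i"
  using conj_partition_antimono[of lam "Suc i" "Suc k"] by (simp add: first_abs_def)

lemma first_abs_le: "skew_diagram lam mu \<Longrightarrow> first_abs mu j \<le> first_abs lam j"
  using conj_partition_le[of lam mu "Suc j"] by (simp add: first_abs_def)

lemma boxes_iff:
  assumes "skew_diagram lam mu"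
  shows "(i, j) \<in> boxes lam mu \<longleftrightarrow> 1 \<le> j \<and> j \<le> lam 1 \<and> conj_partition mu j < i \<and> i \<le> conj_partition lam j"
proof -
  have p: "is_partition lam" "is_partition mu" "\<And>i. 1 \<le> i \<Longrightarrow> mu i \<le> lam i" using assms by (auto simp: skew_diagram_def)
  have "(1 \<le> i \<and> mu i + 1 \<le> j \<and> j \<le> lam i) \<longleftrightarrow> (j \<le> lam 1 \<and> conj_partition mu j < i \<and> i \<le> conj_partition lam j)" if j: "1 \<le> j"
  proof (cases "1 \<le> i")
    case True
    then show ?thesis
      using conj_partition_iff[OF p(1) j True] conj_partition_iff[OF p(2) j True] partition_mono[OF p(1), of 1 i] by auto
  qed auto
  then show ?thesis by (cases "1 \<le> j") (auto simp: boxes_def)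
qed

text \<open>Box \<open>(i, j)\<close> sits at the abscissa \<open>i - j\<close> of path number \<open>j\<close>.\<close>

lemma boxes_abs:
  assumes "skew_diagram lam mu"
  shows "(i, Suc j) \<in> boxes lam mu \<longleftrightarrow> j < lam 1 \<and> first_abs mu j \<le> int i - int (Suc j) \<and> int i - int (Suc j) < first_abs lam j"
  using boxes_iff[OF assms, of i "Suc j"] by (auto simp: first_abs_def)

section \<open>The bijection with tableaux\<close>

lemma prod_unit_steps_up:
  fixes f :: "nat \<Rightarrow> int" and G :: "int \<Rightarrow> 'r::comm_monoid_mult"
  assumes "\<And>s. s < n \<Longrightarrow> f (Suc s) = f s \<or> f (Suc s) = f s + 1" "\<And>s. s < n \<Longrightarrow> f (Suc s) = f s + 1 \<Longrightarrow> G (f s) = h s"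
  shows "(\<Prod>s<n. if f (Suc s) = f s then 1 else h s) = (\<Prod>x\<in>{f 0..<f n}. G x)"
  using assms
proof (induction n)
  case (Suc n)
  have "f 0 \<le> f n" using unit_steps_mono(1)[of n f 0 n] Suc.prems(1) by simp
  then have e: "{f 0..<f n + 1} = insert (f n) {f 0..<f n}" by auto
  show ?case
  proof (cases "f (Suc n) = f n")
    case True
    then show ?thesis using Suc by simp
  next
    case False
    then have "f (Suc n) = f n + 1" using Suc.prems(1)[of n] by simp
    then show ?thesis using Suc by (simp add: e mult.commute)
  qed
qed simp

lemma prod_unit_steps_down:
  fixes f :: "nat \<Rightarrow> int" and G :: "int \<Rightarrow> 'r::comm_monoid_mult"
  assumes "\<And>s. s < n \<Longrightarrow> f (Suc s) = f s \<or> f (Suc s) = f s - 1" "\<And>s. s < n \<Longrightarrow> f (Suc s) = f s - 1 \<Longrightarrow> G (f (Suc s)) = h s"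
  shows "(\<Prod>s<n. if f (Suc s) = f s then 1 else h s) = (\<Prod>x\<in>{f n..<f 0}. G x) \<and> f n \<le> f 0"
  using assms
proof (induction n)
  case (Suc n)
  have IH: "(\<Prod>s<n. if f (Suc s) = f s then 1 else h s) = (\<Prod>x\<in>{f n..<f 0}. G x)" "f n \<le> f 0" using Suc by auto
  have e: "{f n - 1..<f 0} = insert (f n - 1) {f n..<f 0}" using IH(2) by auto
  show ?case
  proof (cases "f (Suc n) = f n")
    case True
    then show ?thesis using IH by simp
  next
    case False
    then have "f (Suc n) = f n - 1" using Suc.prems(1)[of n] by simp
    then show ?thesis using IH Suc.prems(2)[of n] by (simp add: e mult.commute)
  qed
qed simp

lemma column_weight:
  fixes a :: complex
  assumes c: "is_col CARD('n::finite) u v L U"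
  shows "(\<Prod>x\<in>{u..<v}. zgen (col_label CARD('n) u L U x) (a - 2 * of_int x) :: 'n zring)
    = (\<Prod>s<CARD('n). if L (Suc s) = L s then zlow a (L s) s else 1) * mid_kernel (zmid a) (L 0 + 1) (U 0)
      * (\<Prod>s<CARD('n). if U (Suc s) = U s then 1 else zupp a (U s) s)"
proof -
  let ?n = "CARD('n)"
  let ?G = "\<lambda>x. zgen (col_label CARD('n) u L U x) (a - 2 * of_int x) :: 'n zring"
  note ord = col_order[OF c] is_colD(5,6)[OF c]
  have low: "(\<Prod>s<?n. if L (Suc s) = L s then zlow a (L s) s else 1) = (\<Prod>x\<in>{u..<L 0 + 1}. ?G x)"
  proof -
    have "(\<Prod>s<?n. if low_x L (Suc s) = low_x L s then 1 else zlow a (L s) s) = (\<Prod>x\<in>{low_x L ?n..<low_x L 0}. ?G x)"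
    proof (rule prod_unit_steps_down[THEN conjunct1])
      fix s assume s: "s < ?n"
      show "low_x L (Suc s) = low_x L s \<or> low_x L (Suc s) = low_x L s - 1"
        using is_colD(1)[OF c s] by (auto simp: low_x_def)
      assume "low_x L (Suc s) = low_x L s - 1"
      then have e: "L (Suc s) = L s" by (simp add: low_x_def)
      have e2: "low_x L (Suc s) = L s - int s" using e by (simp add: low_x_def)
      show "?G (low_x L (Suc s)) = zlow a (L s) s"
        unfolding col_label_low[OF c s e] zlow_def unfolding e2 by (simp add: algebra_simps)
    qed
    moreover have "(\<Prod>s<?n. if low_x L (Suc s) = low_x L s then 1 else zlow a (L s) s)
      = (\<Prod>s<?n. if L (Suc s) = L s then zlow a (L s) s else 1 :: 'n zring)"
    proof (rule prod.cong)
      fix s assume "s \<in> {..<?n}"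
      then show "(if low_x L (Suc s) = low_x L s then 1 else zlow a (L s) s) = (if L (Suc s) = L s then zlow a (L s) s else 1 :: 'n zring)"
        using is_colD(1)[OF c, of s] by (auto simp: low_x_def)
    qed simp
    ultimately show ?thesis using is_colD(3)[OF c] by (simp add: low_x_def)
  qed
  have up: "(\<Prod>s<?n. if U (Suc s) = U s then 1 else zupp a (U s) s) = (\<Prod>x\<in>{U 0..<v}. ?G x)"
    unfolding is_colD(4)[OF c, symmetric]
    by (rule prod_unit_steps_up) (use is_colD(2)[OF c] col_label_up[OF c] in \<open>auto simp: zupp_def\<close>)
  have mid: "(\<Prod>x\<in>{L 0 + 1..<U 0}. ?G x) = mid_kernel (zmid a) (L 0 + 1) (U 0)"
  proof -
    \<comment> \<open>The E-steps come in pairs labelled \<open>Bar n\<close> and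
      \<open>Pos n\<close>, and the two variables of a pair form one \<open>zmid\<close>.\<close>
    have "(\<Prod>x\<in>{L 0 + 1..<L 0 + 1 + 2 * int q}. ?G x) = (\<Prod>x\<in>{L 0 + 1..<L 0 + 1 + 2 * int q}. if even (x - (L 0 + 1)) then zmid a x else 1)"
      if "2 * q \<le> mid_len L U" for q
      using that
    proof (induction q)
      case (Suc q)
      let ?y = "L 0 + 1 + 2 * int q"
      have e: "{L 0 + 1..<L 0 + 1 + 2 * int (Suc q)} = insert (?y + 1) (insert ?y {L 0 + 1..<?y})" by auto
      have l0: "col_label ?n u L U ?y = Bar ?n" using col_label_mid[OF c, of "2 * q"] Suc.prems by simp
      have "?y + 1 = L 0 + 1 + int (Suc (2 * q))" by simp
      then have l1: "col_label ?n u L U (?y + 1) = Pos ?n" using col_label_mid[OF c, of "Suc (2 * q)"] Suc.prems by simp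
      have "?G (?y + 1) * ?G ?y = zmid a ?y" unfolding l0 l1 zmid_def zlow_def zupp_def by simp
      then show ?case unfolding e using Suc by (simp add: mult.assoc[symmetric])
    qed simp
    from this[of "nat ((U 0 - L 0 - 1) div 2)"] show ?thesis
      using ord by (simp add: mid_kernel_def mid_len_def)
  qed
  have "{u..<v} = {u..<L 0 + 1} \<union> {L 0 + 1..<U 0} \<union> {U 0..<v}" using ord by auto
  then have "(\<Prod>x\<in>{u..<v}. ?G x) = (\<Prod>x\<in>{u..<L 0 + 1}. ?G x) * (\<Prod>x\<in>{L 0 + 1..<U 0}. ?G x) * (\<Prod>x\<in>{U 0..<v}. ?G x)"
    using ord
    by (simp only:) (subst prod.union_disjoint; (subst prod.union_disjoint)?; auto)
  then show ?thesis unfolding low up mid .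
qed

lemma col_path_cong:
  assumes "\<And>s. s \<le> n \<Longrightarrow> L s = L' s" "\<And>s. s \<le> n \<Longrightarrow> U s = U' s"
  shows "col_path n u L U = col_path n u L' U'"
proof -
  have "low_steps n L = low_steps n L'" "up_steps n U = up_steps n U'"
    using assms by (auto simp: low_steps_def up_steps_def)
  then show ?thesis using assms(1)[of 0] assms(2)[of 0] by (simp add: col_path_def mid_len_def)
qed

section \<open>Tuples of columns as path tuples and as tableaux\<close>

type_synonym chains = "(nat \<Rightarrow> nat \<Rightarrow> int) \<times> (nat \<Rightarrow> nat \<Rightarrow> int)"

locale skew_paths =
  fixes n :: nat and lam mu :: "nat \<Rightarrow> nat" and W :: int
  assumes n0: "0 < n" and skew: "skew_diagram lam mu" and W3: "3 \<le> W"
    and pos: "\<And>i. 1 \<le> i \<Longrightarrow> i + 1 \<le> lam 1 \<Longrightarrow> int (conj_partition lam (i + 1)) - int (conj_partition mu i) \<le> int n"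
    and W_bound: "\<And>j. j < lam 1 \<Longrightarrow> 4 - W + int n \<le> first_abs mu j \<and> first_abs lam j + int n \<le> W - 2"
begin

abbreviation l :: nat where "l \<equiv> lam 1"
abbreviation uc :: "nat \<Rightarrow> int" where "uc \<equiv> first_abs mu"
abbreviation vc :: "nat \<Rightarrow> int" where "vc \<equiv> first_abs lam"

lemma parts: "is_partition lam" "is_partition mu"
  using skew by (auto simp: skew_diagram_def)

text \<open>The dual of a lower path starting at \<open>uc j\<close> has abscissa
  \<open>uc j + int n - 1\<close> in row \<open>n\<close>, whence the shift in the second
  argument.\<close>

sublocale families n l W "restrict vc {0..<l}" "restrict (\<lambda>j. uc j + int n - 1) {0..<l}"
proof
  show "0 < n" "3 \<le> W" by (rule n0, rule W3)
  show "dec l (restrict vc {0..<l})" using first_abs_strict[OF parts(1)] by (auto simp: dec_def)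
  show "dec l (restrict (\<lambda>j. uc j + int n - 1) {0..<l})" using first_abs_strict[OF parts(2)] by (auto simp: dec_def)
  show "restrict vc {0..<l} \<in> extensional {0..<l}" "restrict (\<lambda>j. uc j + int n - 1) {0..<l} \<in> extensional {0..<l}" by auto
  fix i assume i: "i < l"
  have "uc i \<le> vc i" by (rule first_abs_le[OF skew])
  then show "3 - W + int n \<le> restrict vc {0..<l} i \<and> restrict vc {0..<l} i \<le> W - 2"
    "3 - W + int n \<le> restrict (\<lambda>j. uc j + int n - 1) {0..<l} i \<and> restrict (\<lambda>j. uc j + int n - 1) {0..<l} i \<le> W - 2"
    using W_bound[OF i] n0 i by auto
next
  fix i assume i: "Suc i < l"
  \<comment> \<open>The positivity hypothesis with indices counted from 0; the two shifts of the
    abscissas by one cancel.\<close>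
  show "restrict vc {0..<l} (Suc i) \<le> restrict (\<lambda>j. uc j + int n - 1) {0..<l} i"
    using pos[of "Suc i"] i by (simp add: first_abs_def)
qed

text \<open>Away from height 0 the separation of neighbouring columns is the decrease of the rows in
  \<open>path_chains\<close>. The conditions added here concern the stretches at height 0.\<close>

definition YT :: "chains set" where
  "YT = {(B, A). B \<in> BC \<and> A \<in> AC \<and> (\<forall>i<l. A 0 i + 1 \<le> B 0 i \<and> even (B 0 i - A 0 i - 1))
     \<and> (\<forall>i. Suc i < l \<longrightarrow> A 0 i + 1 \<le> B 0 (Suc i) \<longrightarrow> odd (A 0 i - A 0 (Suc i)))}"

definition colA :: "chains \<Rightarrow> nat \<Rightarrow> nat \<Rightarrow> int" where
  "colA y i s = snd y s i"

definition colB :: "chains \<Rightarrow> nat \<Rightarrow> nat \<Rightarrow> int" where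
  "colB y i s = fst y s i"

lemma YT_chains:
  assumes "y \<in> YT"
  shows "fst y \<in> path_chains n l (restrict vc {0..<l}) 0" "snd y \<in> path_chains n l (restrict (\<lambda>j. uc j + int n - 1) {0..<l}) 0"
  using assms unfolding YT_def BC_def AC_def by auto

lemma YT_cond:
  assumes "y \<in> YT"
  shows "i < l \<Longrightarrow> colA y i 0 + 1 \<le> colB y i 0" "i < l \<Longrightarrow> even (colB y i 0 - colA y i 0 - 1)"
    "Suc i < l \<Longrightarrow> colA y i 0 + 1 \<le> colB y (Suc i) 0 \<Longrightarrow> odd (colA y i 0 - colA y (Suc i) 0)"
  using assms unfolding YT_def colA_def colB_def by (cases y; force)+

lemma YT_col: "y \<in> YT \<Longrightarrow> i < l \<Longrightarrow> is_col n (uc i) (vc i) (colA y i) (colB y i)"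
  unfolding is_col_def
  using chain_facts(3,4)[OF YT_chains(1)] chain_facts(3,4)[OF YT_chains(2)] YT_cond(1,2)
  by (simp add: colA_def colB_def)

lemma YT_dec:
  assumes "y \<in> YT" "s \<le> n" "i < k" "k < l"
  shows "colA y k s < colA y i s" "colB y k s < colB y i s"
  using chain_facts(1)[OF YT_chains(1)[OF assms(1)] assms(2)] chain_facts(1)[OF YT_chains(2)[OF assms(1)] assms(2)] assms(3,4)
  by (simp_all add: dec_def colA_def colB_def)

lemma YT_sep: "y \<in> YT \<Longrightarrow> Suc i < l \<Longrightarrow> col_sep n (colA y i) (colB y i) (colA y (Suc i)) (colB y (Suc i))"
  unfolding col_sep_def using YT_dec[of y _ i "Suc i"] YT_cond(3) by blast

lemma YT_make:
  assumes c: "\<And>i. i < l \<Longrightarrow> is_col n (uc i) (vc i) (L i) (U i)"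
    and s: "\<And>i. Suc i < l \<Longrightarrow> col_sep n (L i) (U i) (L (Suc i)) (U (Suc i))"
  shows "\<exists>y\<in>YT. \<forall>i<l. \<forall>s\<le>n. colA y i s = L i s \<and> colB y i s = U i s"
proof -
  define A where "A = restrict (\<lambda>s. restrict (\<lambda>i. L i s) {0..<l}) {0..n}"
  define B where "B = restrict (\<lambda>s. restrict (\<lambda>i. U i s) {0..<l}) {0..n}"
  have decI: "dec l f" if "\<And>i. Suc i < l \<Longrightarrow> f (Suc i) < f i" for f :: "nat \<Rightarrow> int"
  proof -
    have "i < k \<longrightarrow> k < l \<longrightarrow> f k < f i" for i k
    proof (induction k)
      case (Suc k)
      then show ?case using that[of k] by (cases "i = k") auto
    qed simp
    then show ?thesis by (simp add: dec_def)
  qed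
  have "A \<in> AC"
    unfolding AC_def path_chains_def
  proof (intro CollectI conjI ballI allI impI)
    show "A n = restrict (\<lambda>j. uc j + int n - 1) {0..<l}" using is_colD(3)[OF c] by (auto simp: A_def)
    fix s assume "s \<in> {0..n}"
    then show "dec l (A s)" using s by (intro decI) (auto simp: A_def col_sep_def)
  qed (use is_colD(1)[OF c] in \<open>auto simp: A_def\<close>)
  moreover have "B \<in> BC"
    unfolding BC_def path_chains_def
  proof (intro CollectI conjI ballI allI impI)
    show "B n = restrict vc {0..<l}" using is_colD(4)[OF c] by (auto simp: B_def)
    fix s assume "s \<in> {0..n}"
    then show "dec l (B s)" using s by (intro decI) (auto simp: B_def col_sep_def)
  qed (use is_colD(2)[OF c] in \<open>auto simp: B_def\<close>)
  ultimately have "(B, A) \<in> YT"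
    using is_colD(5,6)[OF c] s unfolding YT_def by (auto simp: A_def B_def col_sep_def)
  then show ?thesis by (intro bexI[of _ "(B, A)"]) (auto simp: colA_def colB_def A_def B_def)
qed

definition paths_of :: "chains \<Rightarrow> nat \<Rightarrow> path" where
  "paths_of y = (\<lambda>j\<in>{1..l}. col_path n (uc (j - 1)) (colA y (j - 1)) (colB y (j - 1)))"

definition tab_of :: "chains \<Rightarrow> nat \<times> nat \<Rightarrow> letter" where
  "tab_of y = (\<lambda>(i, j)\<in>boxes lam mu. col_label n (uc (j - 1)) (colA y (j - 1)) (colB y (j - 1)) (int i - int j))"

lemma paths_of_Suc: "j < l \<Longrightarrow> paths_of y (Suc j) = col_path n (uc j) (colA y j) (colB y j)"
  by (simp add: paths_of_def)

lemma u_pt_Suc: "u_pt n mu (Suc j) = (uc j, - int n - uc j)" and v_pt_Suc: "v_pt n lam (Suc j) = (vc j, int n - vc j)"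
  by (simp_all add: u_pt_def v_pt_def first_abs_def)

lemma paths_of_in: "y \<in> YT \<Longrightarrow> paths_of y \<in> P_HV n lam mu"
proof -
  assume y: "y \<in> YT"
  have "is_path n (paths_of y i) \<and> start (paths_of y i) = u_pt n mu i \<and> finish (paths_of y i) = v_pt n lam i" if i: "i \<in> {1..l}" for i
  proof -
    obtain j where j: "i = Suc j" "j < l" using i by (cases i) auto
    show ?thesis unfolding j(1) paths_of_Suc[OF j(2)] u_pt_Suc v_pt_Suc
      using is_path_col[OF YT_col[OF y j(2)]] start_col finish_col[OF YT_col[OF y j(2)]] by simp
  qed
  moreover have "\<not> ordinarily_intersecting (paths_of y i) (paths_of y (i + 1))" if i: "1 \<le> i" "i < l" for i
  proof -
    obtain j where j: "i = Suc j" "Suc j < l" using i by (cases i) auto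
    have jl: "j < l" using j by simp
    show ?thesis unfolding j(1) Suc_eq_plus1[symmetric] paths_of_Suc[OF j(2)] paths_of_Suc[OF jl]
      using ordinarily_intersecting_col[OF YT_col[OF y jl] YT_col[OF y j(2)]] YT_sep[OF y j(2)]
        first_abs_strict[OF parts(1), of j "Suc j"] first_abs_strict[OF parts(2), of j "Suc j"] by simp
  qed
  ultimately show ?thesis unfolding P_HV_def by (auto simp: paths_of_def PiE_iff)
qed

lemma T_v_paths_of: "y \<in> YT \<Longrightarrow> T_v n lam mu (paths_of y) = tab_of y"
proof -
  assume y: "y \<in> YT"
  have "labels n (paths_of y j) ! (i - conj_partition mu j - 1)
      = col_label n (uc (j - 1)) (colA y (j - 1)) (colB y (j - 1)) (int i - int j)" if ij: "(i, j) \<in> boxes lam mu" for i j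
  proof -
    have b: "1 \<le> j" "j \<le> l" "conj_partition mu j < i" using ij boxes_iff[OF skew] by auto
    then obtain k where k: "j = Suc k" "k < l" by (cases j) auto
    have "nat (int i - int j - uc k) = i - conj_partition mu j - 1" using b k by (simp add: first_abs_def nat_diff_distrib')
    then show ?thesis unfolding col_label_def using k by (simp add: paths_of_Suc)
  qed
  then show ?thesis unfolding T_v_def tab_of_def by (intro restrict_ext) auto
qed

lemma tab_of_box:
  assumes "j < l" "uc j \<le> x" "x < vc j"
  shows "(nat (x + int (Suc j)), Suc j) \<in> boxes lam mu"
    "tab_of y (nat (x + int (Suc j)), Suc j) = col_label n (uc j) (colA y j) (colB y j) x"
proof -
  have "0 \<le> x + int (Suc j)" using assms(2) by (simp add: first_abs_def)
  then have e: "int (nat (x + int (Suc j))) = x + int (Suc j)" by simp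
  show "(nat (x + int (Suc j)), Suc j) \<in> boxes lam mu" unfolding boxes_abs[OF skew] e using assms by simp
  then have "tab_of y (nat (x + int (Suc j)), Suc j)
      = col_label n (uc j) (colA y j) (colB y j) (int (nat (x + int (Suc j))) - int (Suc j))"
    unfolding tab_of_def by simp
  then show "tab_of y (nat (x + int (Suc j)), Suc j) = col_label n (uc j) (colA y j) (colB y j) x"
    unfolding e by simp
qed

lemma YT_eqI:
  assumes y: "y \<in> YT" "y' \<in> YT" and eq: "\<And>i s. i < l \<Longrightarrow> s \<le> n \<Longrightarrow> colA y i s = colA y' i s \<and> colB y i s = colB y' i s"
  shows "y = y'"
proof -
  have ext: "F = F'" if F: "F \<in> path_chains n l w 0" "F' \<in> path_chains n l w 0" and e: "\<And>i s. i < l \<Longrightarrow> s \<le> n \<Longrightarrow> F s i = F' s i" for F F' w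
  proof (rule extensionalityI)
    show "F \<in> extensional {0..n}" "F' \<in> extensional {0..n}" using F by (auto simp: path_chains_def)
    fix s assume "s \<in> {0..n}"
    then show "F s = F' s"
      using chain_facts(2)[OF F(1), of s] chain_facts(2)[OF F(2), of s] e by (intro extensionalityI[of _ "{0..<l}"]) auto
  qed
  have "fst y = fst y'" by (rule ext[OF YT_chains(1)[OF y(1)] YT_chains(1)[OF y(2)]]) (use eq in \<open>simp add: colB_def\<close>)
  moreover have "snd y = snd y'" by (rule ext[OF YT_chains(2)[OF y(1)] YT_chains(2)[OF y(2)]]) (use eq in \<open>simp add: colA_def\<close>)
  ultimately show ?thesis by (rule prod_eqI)
qed

lemma inj_tab_of: "inj_on tab_of YT"
proof (rule inj_onI)
  fix y y' assume y: "y \<in> YT" "y' \<in> YT" and e: "tab_of y = tab_of y'"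
  show "y = y'"
  proof (rule YT_eqI[OF y])
    fix i s assume i: "i < l" "s \<le> n"
    show "colA y i s = colA y' i s \<and> colB y i s = colB y' i s"
      by (rule col_unique[OF YT_col[OF y(1) i(1)] YT_col[OF y(2) i(1)] _ i(2)])
        (use tab_of_box[OF i(1)] e in metis)
  qed
qed

lemma paths_of_surj: "P_HV n lam mu \<subseteq> paths_of ` YT"
proof
  fix p assume p: "p \<in> P_HV n lam mu"
  have pf: "is_path n (p j)" "start (p j) = u_pt n mu j" "finish (p j) = v_pt n lam j" if "j \<in> {1..l}" for j
    using p that by (auto simp: P_HV_def PiE_iff)
  have "\<forall>i. \<exists>L U. i < l \<longrightarrow> is_col n (uc i) (vc i) L U \<and> p (Suc i) = col_path n (uc i) L U"
  proof
    fix i show "\<exists>L U. i < l \<longrightarrow> is_col n (uc i) (vc i) L U \<and> p (Suc i) = col_path n (uc i) L U"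
    proof (cases "i < l")
      case True
      then have "Suc i \<in> {1..l}" by simp
      note q = pf[OF this]
      show ?thesis using path_is_col[OF q(1) q(2)[unfolded u_pt_Suc] q(3)[unfolded v_pt_Suc]] by blast
    qed simp
  qed
  then obtain L U where ab: "\<And>i. i < l \<Longrightarrow> is_col n (uc i) (vc i) (L i) (U i)" "\<And>i. i < l \<Longrightarrow> p (Suc i) = col_path n (uc i) (L i) (U i)"
    by metis
  have "col_sep n (L i) (U i) (L (Suc i)) (U (Suc i))" if i: "Suc i < l" for i
  proof -
    have il: "i < l" using i by simp
    have "\<not> ordinarily_intersecting (p (Suc i)) (p (Suc i + 1))" using p i by (simp add: P_HV_def)
    then show ?thesis
      using ordinarily_intersecting_col[OF ab(1)[OF il] ab(1)[OF i]] ab(2)[OF il] ab(2)[OF i]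
        first_abs_strict[OF parts(1), of i "Suc i"] first_abs_strict[OF parts(2), of i "Suc i"] by simp
  qed
  then obtain y where y: "y \<in> YT" "\<forall>i<l. \<forall>s\<le>n. colA y i s = L i s \<and> colB y i s = U i s" using YT_make[of L U] ab(1) by blast
  have "p = paths_of y"
  proof (rule extensionalityI[of _ "{1..l}"])
    show "p \<in> extensional {1..l}" using p by (auto simp: P_HV_def PiE_def)
    show "paths_of y \<in> extensional {1..l}" by (simp add: paths_of_def)
    fix j assume "j \<in> {1..l}"
    then obtain i where i: "j = Suc i" "i < l" by (cases j) auto
    show "p j = paths_of y j" unfolding i(1) ab(2)[OF i(2)] paths_of_Suc[OF i(2)]
      using y(2) i(2) by (intro col_path_cong) auto
  qed
  then show "p \<in> paths_of ` YT" using y(1) by blast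
qed

text \<open>\<open>E_rule\<close> refers to an inverse of \<open>T_v\<close>, which has its intended
  value by injectivity on \<open>P_HV\<close>. This comes from the uniqueness of a column with a
  given word.\<close>

lemma the_inv_T_v: "y \<in> YT \<Longrightarrow> the_inv_into (P_HV n lam mu) (T_v n lam mu) (tab_of y) = paths_of y"
proof -
  assume y: "y \<in> YT"
  have "inj_on (T_v n lam mu) (P_HV n lam mu)"
  proof (rule inj_onI)
    fix p p' assume "p \<in> P_HV n lam mu" "p' \<in> P_HV n lam mu" and e: "T_v n lam mu p = T_v n lam mu p'"
    then obtain z z' where z: "z \<in> YT" "p = paths_of z" "z' \<in> YT" "p' = paths_of z'" using paths_of_surj by blast
    then have "tab_of z = tab_of z'" using e T_v_paths_of by simp
    then show "p = p'" using z inj_tab_of by (auto dest: inj_onD)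
  qed
  then show ?thesis using the_inv_into_f_f[OF _ paths_of_in[OF y]] T_v_paths_of[OF y] by metis
qed

lemma row_rule_iff:
  assumes i: "Suc i < l" and cols: "\<And>j. j < l \<Longrightarrow> is_col n (uc j) (vc j) (L j) (U j)"
  shows "col_sep n (L i) (U i) (L (Suc i)) (U (Suc i)) \<longleftrightarrow>
    (\<forall>x. uc i \<le> x \<and> x < vc i \<and> uc (Suc i) \<le> x - 1 \<and> x - 1 < vc (Suc i) \<longrightarrow>
      row_ok n (col_label n (uc i) (L i) (U i) x) (col_label n (uc (Suc i)) (L (Suc i)) (U (Suc i)) (x - 1)))"
proof -
  have il: "i < l" using i by simp
  show ?thesis
    using col_sep_imp_row_ok[OF cols[OF il] cols[OF i]] row_ok_imp_col_sep[OF cols[OF il] cols[OF i]]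
      first_abs_strict[OF parts(1), of i "Suc i"] first_abs_strict[OF parts(2), of i "Suc i"] by (metis lessI)
qed

lemma H_rule_iff:
  "H_rule n lam mu T \<longleftrightarrow> (\<forall>i x. Suc i < l \<longrightarrow> uc i \<le> x \<and> x < vc i \<and> uc (Suc i) \<le> x - 1 \<and> x - 1 < vc (Suc i) \<longrightarrow>
    row_ok n (T (nat (x + int (Suc i)), Suc i)) (T (nat (x + int (Suc i)), Suc (Suc i))))"
proof
  assume H: "H_rule n lam mu T"
  show "\<forall>i x. Suc i < l \<longrightarrow> uc i \<le> x \<and> x < vc i \<and> uc (Suc i) \<le> x - 1 \<and> x - 1 < vc (Suc i) \<longrightarrow>
    row_ok n (T (nat (x + int (Suc i)), Suc i)) (T (nat (x + int (Suc i)), Suc (Suc i)))"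
  proof (intro allI impI)
    fix i x assume i: "Suc i < l" and x: "uc i \<le> x \<and> x < vc i \<and> uc (Suc i) \<le> x - 1 \<and> x - 1 < vc (Suc i)"
    have e: "x - 1 + int (Suc (Suc i)) = x + int (Suc i)" by simp
    have "(nat (x + int (Suc i)), Suc i) \<in> boxes lam mu" using tab_of_box(1)[of i x] i x by simp
    moreover have "(nat (x + int (Suc i)), Suc (Suc i)) \<in> boxes lam mu"
      using tab_of_box(1)[of "Suc i" "x - 1"] i x unfolding e by simp
    ultimately show "row_ok n (T (nat (x + int (Suc i)), Suc i)) (T (nat (x + int (Suc i)), Suc (Suc i)))"
      using H unfolding H_rule_def row_ok_def Suc_eq_plus1 by blast
  qed
next
  assume R: "\<forall>i x. Suc i < l \<longrightarrow> uc i \<le> x \<and> x < vc i \<and> uc (Suc i) \<le> x - 1 \<and> x - 1 < vc (Suc i) \<longrightarrow>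
    row_ok n (T (nat (x + int (Suc i)), Suc i)) (T (nat (x + int (Suc i)), Suc (Suc i)))"
  show "H_rule n lam mu T"
    unfolding H_rule_def
  proof (intro allI impI)
    fix i j assume b: "(i, j) \<in> boxes lam mu \<and> (i, j + 1) \<in> boxes lam mu"
    then obtain k where k: "j = Suc k" using boxes_iff[OF skew, of i j] by (cases j) auto
    define x where "x = int i - int (Suc k)"
    have i: "nat (x + int (Suc k)) = i" by (simp add: x_def)
    have "Suc k < l" "uc k \<le> x" "x < vc k" "uc (Suc k) \<le> x - 1" "x - 1 < vc (Suc k)"
      using b boxes_abs[OF skew, of i k] boxes_abs[OF skew, of i "Suc k"] by (auto simp: k x_def)
    then have "row_ok n (T (i, Suc k)) (T (i, Suc (Suc k)))" using R[rule_format, of k x] unfolding i by blast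
    then show "letter_le n (T (i, j)) (T (i, j + 1)) \<or> (T (i, j), T (i, j + 1)) = (Pos n, Bar n)"
      by (simp add: row_ok_def k)
  qed
qed

text \<open>Columns are recovered from their words one at a time by \<open>col_exists\<close>, with
  the vertical rule; the horizontal rule then turns into the separation of neighbouring
  columns.\<close>

lemma tab_of_image: "tab_of ` YT = {T \<in> tableaux n lam mu. H_rule n lam mu T \<and> V_rule n lam mu T}"
proof (intro equalityI subsetI)
  fix T assume "T \<in> tab_of ` YT"
  then obtain y where y: "y \<in> YT" "T = tab_of y" by blast
  have T: "T (i, Suc j) = col_label n (uc j) (colA y j) (colB y j) (int i - int (Suc j))" if "(i, Suc j) \<in> boxes lam mu" for i j
    using that by (simp add: y(2) tab_of_def)
  have bx: "\<exists>k. j = Suc k \<and> k < l \<and> uc k \<le> int i - int (Suc k) \<and> int i - int (Suc k) < vc k" if "(i, j) \<in> boxes lam mu" for i j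
    using that boxes_iff[OF skew, of i j] boxes_abs[OF skew, of i "j - 1"] by (cases j) auto
  have "T \<in> tableaux n lam mu"
    unfolding tableaux_def
  proof (rule PiE_I)
    fix b assume b: "b \<in> boxes lam mu"
    obtain i j where ij: "b = (i, j)" by (cases b)
    obtain k where k: "j = Suc k" "k < l" "uc k \<le> int i - int (Suc k)" "int i - int (Suc k) < vc k" using bx b ij by blast
    show "T b \<in> letters n" using col_label_letters[OF YT_col[OF y(1) k(2)] k(3,4) n0] T b ij k(1) by simp
  next
    fix b assume "b \<notin> boxes lam mu"
    then show "T b = undefined" by (simp add: y(2) tab_of_def)
  qed
  moreover have "V_rule n lam mu T"
    unfolding V_rule_def
  proof (intro allI impI)
    fix i j assume b: "(i, j) \<in> boxes lam mu \<and> (i + 1, j) \<in> boxes lam mu"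
    obtain k where k: "j = Suc k" "k < l" "uc k \<le> int i - int (Suc k)" "int (i + 1) - int (Suc k) < vc k" using bx b by blast
    have e: "int (i + 1) - int (Suc k) = int i - int (Suc k) + 1" by simp
    show "\<not> letter_le n (T (i + 1, j)) (T (i, j))"
      using col_label_vertical[OF YT_col[OF y(1) k(2)] k(3)] k(4) T[of i k] T[of "i + 1" k] b unfolding k(1) e by simp
  qed
  moreover have "H_rule n lam mu T"
    unfolding H_rule_iff
  proof (intro allI impI)
    fix i x assume i: "Suc i < l" and x: "uc i \<le> x \<and> x < vc i \<and> uc (Suc i) \<le> x - 1 \<and> x - 1 < vc (Suc i)"
    have e: "x - 1 + int (Suc (Suc i)) = x + int (Suc i)" by simp
    show "row_ok n (T (nat (x + int (Suc i)), Suc i)) (T (nat (x + int (Suc i)), Suc (Suc i)))"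
      using row_rule_iff[OF i YT_col[OF y(1)]] YT_sep[OF y(1) i] x tab_of_box(2)[of i x y] tab_of_box(2)[of "Suc i" "x - 1" y] i
      unfolding e y(2) by simp
  qed
  ultimately show "T \<in> {T \<in> tableaux n lam mu. H_rule n lam mu T \<and> V_rule n lam mu T}" by simp
next
  fix T assume "T \<in> {T \<in> tableaux n lam mu. H_rule n lam mu T \<and> V_rule n lam mu T}"
  then have T: "T \<in> tableaux n lam mu" and H: "H_rule n lam mu T" and V: "V_rule n lam mu T" by auto
  define w where "w j x = T (nat (x + int (Suc j)), Suc j)" for j x
  have "\<forall>j. \<exists>L U. j < l \<longrightarrow> is_col n (uc j) (vc j) L U \<and> (\<forall>x. uc j \<le> x \<longrightarrow> x < vc j \<longrightarrow> col_label n (uc j) L U x = w j x)"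
  proof
    fix j show "\<exists>L U. j < l \<longrightarrow> is_col n (uc j) (vc j) L U \<and> (\<forall>x. uc j \<le> x \<longrightarrow> x < vc j \<longrightarrow> col_label n (uc j) L U x = w j x)"
    proof (cases "j < l")
      case True
      have v: "vc j = uc j + int (nat (vc j - uc j))" using first_abs_le[OF skew, of j] by simp
      have "\<exists>L U. is_col n (uc j) (uc j + int (nat (vc j - uc j))) L U
        \<and> (\<forall>x. uc j \<le> x \<longrightarrow> x < uc j + int (nat (vc j - uc j)) \<longrightarrow> col_label n (uc j) L U x = w j x)"
      proof (rule col_exists)
        fix x assume "uc j \<le> x" "x < uc j + int (nat (vc j - uc j))"
        then have "uc j \<le> x" "x < vc j" unfolding v[symmetric] by auto
        then have "(nat (x + int (Suc j)), Suc j) \<in> boxes lam mu" using tab_of_box(1)[OF True, of x] by simp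
        then show "w j x \<in> letters n" using T unfolding w_def tableaux_def by auto
      next
        fix x assume x: "uc j \<le> x" "x + 1 < uc j + int (nat (vc j - uc j))"
        have b: "(nat (x + int (Suc j)), Suc j) \<in> boxes lam mu" "(nat (x + 1 + int (Suc j)), Suc j) \<in> boxes lam mu"
          using tab_of_box(1)[OF True, of x] tab_of_box(1)[OF True, of "x + 1"] x unfolding v[symmetric] by auto
        have "0 \<le> x + int (Suc j)" using x(1) by (simp add: first_abs_def)
        then have "nat (x + 1 + int (Suc j)) = nat (x + int (Suc j)) + 1" by simp
        then show "\<not> letter_le n (w j (x + 1)) (w j x)" using V b unfolding V_rule_def w_def by metis
      qed
      then show ?thesis unfolding v[symmetric] by blast
    qed simp
  qed
  then obtain L U where c: "\<And>j. j < l \<Longrightarrow> is_col n (uc j) (vc j) (L j) (U j)"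
    and lab: "\<And>j x. j < l \<Longrightarrow> uc j \<le> x \<Longrightarrow> x < vc j \<Longrightarrow> col_label n (uc j) (L j) (U j) x = w j x" by metis
  have "col_sep n (L i) (U i) (L (Suc i)) (U (Suc i))" if i: "Suc i < l" for i
  proof (rule row_rule_iff[OF i, of L U, OF c, THEN iffD2], assumption, intro allI impI)
    fix x assume x: "uc i \<le> x \<and> x < vc i \<and> uc (Suc i) \<le> x - 1 \<and> x - 1 < vc (Suc i)"
    have e: "x - 1 + int (Suc (Suc i)) = x + int (Suc i)" by simp
    have "row_ok n (w i x) (w (Suc i) (x - 1))" using H[unfolded H_rule_iff] i x unfolding w_def e by blast
    then show "row_ok n (col_label n (uc i) (L i) (U i) x) (col_label n (uc (Suc i)) (L (Suc i)) (U (Suc i)) (x - 1))"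
      using lab[of i x] lab[of "Suc i" "x - 1"] i x by simp
  qed
  then obtain y where y: "y \<in> YT" "\<forall>i<l. \<forall>s\<le>n. colA y i s = L i s \<and> colB y i s = U i s" using YT_make[of L U] c by blast
  have "T = tab_of y"
  proof (rule extensionalityI[of _ "boxes lam mu"])
    show "T \<in> extensional (boxes lam mu)" using T by (auto simp: tableaux_def PiE_def)
    show "tab_of y \<in> extensional (boxes lam mu)" by (simp add: tab_of_def)
    fix b assume b: "b \<in> boxes lam mu"
    obtain i j where ij: "b = (i, j)" by (cases b)
    obtain k where k: "j = Suc k" using b ij boxes_iff[OF skew, of i j] by (cases j) auto
    define x where "x = int i - int (Suc k)"
    have i: "nat (x + int (Suc k)) = i" by (simp add: x_def)
    have x: "k < l" "uc k \<le> x" "x < vc k" using b boxes_abs[OF skew, of i k] by (auto simp: ij k x_def)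
    have "col_path n (uc k) (colA y k) (colB y k) = col_path n (uc k) (L k) (U k)"
      using y(2) x(1) by (intro col_path_cong) auto
    then have "tab_of y b = w k x" using tab_of_box(2)[OF x, of y] lab[OF x] unfolding i ij k col_label_def by simp
    then show "T b = tab_of y b" unfolding w_def i ij k by simp
  qed
  then show "T \<in> tab_of ` YT" using y(1) by blast
qed

lemma sum_Tab:
  "(\<Sum>T\<in>Tab n lam mu. f T) = (\<Sum>y\<in>{y \<in> YT. \<nexists>V. odd_II_region n l (paths_of y) V}. f (tab_of y))"
proof -
  have "Tab n lam mu = tab_of ` {y \<in> YT. \<nexists>V. odd_II_region n l (paths_of y) V}"
  proof -
    have "Tab n lam mu = {T \<in> tab_of ` YT. E_rule n lam mu T}" unfolding tab_of_image by (auto simp: Tab_def)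
    also have "\<dots> = tab_of ` {y \<in> YT. E_rule n lam mu (tab_of y)}" by auto
    also have "{y \<in> YT. E_rule n lam mu (tab_of y)} = {y \<in> YT. \<nexists>V. odd_II_region n l (paths_of y) V}"
      using the_inv_T_v by (auto simp: E_rule_def)
    finally show ?thesis .
  qed
  moreover have "inj_on tab_of {y \<in> YT. \<nexists>V. odd_II_region n l (paths_of y) V}"
    by (rule inj_on_subset[OF inj_tab_of]) auto
  ultimately show ?thesis by (simp add: sum.reindex)
qed

end

section \<open>Matched endpoints\<close>

text \<open>A natural number, so that it can serve as an index: in a decreasing family it is the
  first index whose point is not to the right of \<open>x\<close>.\<close>

definition cnt :: "nat \<Rightarrow> (nat \<Rightarrow> int) \<Rightarrow> int \<Rightarrow> nat" where
  "cnt l f x = card {i. i < l \<and> x < f i}"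

lemma cnt_iff: "dec l f \<Longrightarrow> i < l \<Longrightarrow> i < cnt l f x \<longleftrightarrow> x < f i"
  using count_above_less_iff[of l f i x] by (simp add: count_above_def cnt_def)

lemma cnt_le: "cnt l f x \<le> l"
  using card_mono[of "{..<l}" "{i. i < l \<and> x < f i}"] by (auto simp: cnt_def)

lemma cnt_mono: "x \<le> y \<Longrightarrow> cnt l f y \<le> cnt l f x"
  unfolding cnt_def by (rule card_mono) auto

lemma cntD: "dec l f \<Longrightarrow> i < cnt l f x \<Longrightarrow> x < f i"
  using cnt_iff[of l f i x] cnt_le[of l f x] by simp

lemma cnt_set: "dec l f \<Longrightarrow> {i \<in> {..<l}. x < f i} = {..<cnt l f x}"
proof (intro equalityI subsetI)
  assume d: "dec l f"
  show "i \<in> {..<cnt l f x}" if "i \<in> {i \<in> {..<l}. x < f i}" for i using that cnt_iff[OF d, of i x] by simp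
  show "i \<in> {i \<in> {..<l}. x < f i}" if "i \<in> {..<cnt l f x}" for i using that cntD[OF d, of i x] cnt_le[of l f x] by simp
qed

lemma sum_cnt: "dec l f \<Longrightarrow> (\<Sum>i<l. if x < f i then h i else 0) = (\<Sum>i<cnt l f x. h i)"
  using sum.inter_filter[of "{..<l}" h "\<lambda>i. x < f i"] cnt_set[of l f x] by simp

lemma cnt_step:
  assumes d: "dec l f"
  shows "cnt l f (x - 1) = cnt l f x \<and> (\<forall>i<l. f i \<noteq> x) \<or> cnt l f (x - 1) = Suc (cnt l f x) \<and> cnt l f x < l \<and> f (cnt l f x) = x"
proof -
  have s: "int (cnt l f (x - 1)) - int (cnt l f x) = int (card {i. i < l \<and> f i = x})"
    using count_above_step[of l f x] by (simp add: count_above_def cnt_def)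
  show ?thesis
  proof (cases "\<exists>i<l. f i = x")
    case False
    then have e: "{i. i < l \<and> f i = x} = {}" by auto
    then have "cnt l f (x - 1) = cnt l f x" using s unfolding e by simp
    then show ?thesis using False by blast
  next
    case True
    then obtain i where i: "i < l" "f i = x" by blast
    have "k = i" if "k < l" "f k = x" for k
      using d that i unfolding dec_def by (cases k i rule: linorder_cases) force+
    then have "{k. k < l \<and> f k = x} = {i}" using i by blast
    then have e: "cnt l f (x - 1) = Suc (cnt l f x)" using s by (simp only:) simp
    have "cnt l f x \<le> i" using cnt_iff[OF d i(1), of x] i(2) by simp
    moreover have "i < cnt l f (x - 1)" using cnt_iff[OF d i(1), of "x - 1"] i(2) by simp
    ultimately have "cnt l f x = i" using e by simp
    then show ?thesis using e i by simp
  qed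
qed

text \<open>\<open>f\<close> and \<open>g\<close> are the right and left ends of the stretches of
  E-steps, the latter in dual position. The second clause concerns overlapping neighbours.\<close>

definition matched :: "nat \<Rightarrow> (nat \<Rightarrow> int) \<Rightarrow> (nat \<Rightarrow> int) \<Rightarrow> bool" where
  "matched l f g \<longleftrightarrow> (\<forall>i<l. g i + 1 \<le> f i \<and> even (f i - g i - 1))
     \<and> (\<forall>i. Suc i < l \<longrightarrow> g i + 1 \<le> f (Suc i) \<longrightarrow> odd (g i - g (Suc i)))"

definition end_sum :: "nat \<Rightarrow> (nat \<Rightarrow> int) \<Rightarrow> (nat \<Rightarrow> int) \<Rightarrow> int \<Rightarrow> int" where
  "end_sum l f g x = (\<Sum>i<cnt l f x. sg (f i)) + (\<Sum>i<cnt l g x. sg (g i))"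

lemma sg_neg_iff: "sg a = - sg b \<longleftrightarrow> odd (a - b)"
  by (auto simp: sg_def)

lemma odd_of_nat_diff: "a \<le> b \<Longrightarrow> odd (int b - int a) \<longleftrightarrow> odd (b - a)"
  by (metis of_nat_diff even_of_nat)

lemma alternating_sum:
  fixes h :: "nat \<Rightarrow> int"
  assumes "\<And>i. a \<le> i \<Longrightarrow> Suc i < b \<Longrightarrow> h (Suc i) = - h i" "a \<le> b"
  shows "(\<Sum>i\<in>{a..<b}. h i) = (if even (b - a) then 0 else h (b - 1))"
    and "a < b \<Longrightarrow> h a = (if even (b - a) then - h (b - 1) else h (b - 1))"
proof -
  have "(\<Sum>i\<in>{a..<b}. h i) = (if even (b - a) then 0 else h (b - 1)) \<and> (a < b \<longrightarrow> h a = (if even (b - a) then - h (b - 1) else h (b - 1)))"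
    using assms(2,1)
  proof (induction b rule: dec_induct)
    case (step b)
    have IH: "(\<Sum>i\<in>{a..<b}. h i) = (if even (b - a) then 0 else h (b - 1))" "a < b \<Longrightarrow> h a = (if even (b - a) then - h (b - 1) else h (b - 1))"
      using step by auto
    have hb: "h b = - h (b - 1)" if "a < b" using step.prems[of "b - 1"] that by simp
    have p: "Suc b - a = Suc (b - a)" using step(1) by simp
    show ?case using step(1) IH hb unfolding p by (cases "a = b") auto
  qed simp
  then show "(\<Sum>i\<in>{a..<b}. h i) = (if even (b - a) then 0 else h (b - 1))"
    "a < b \<Longrightarrow> h a = (if even (b - a) then - h (b - 1) else h (b - 1))" by auto
qed

lemma end_sum_window:
  assumes "cnt l g x \<le> cnt l f x" "\<And>i. i < cnt l g x \<Longrightarrow> sg (f i) = - sg (g i)"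
  shows "end_sum l f g x = (\<Sum>i\<in>{cnt l g x..<cnt l f x}. sg (f i))"
proof -
  have "{..<cnt l f x} = {..<cnt l g x} \<union> {cnt l g x..<cnt l f x}" using assms(1) by auto
  then have "(\<Sum>i<cnt l f x. sg (f i)) = (\<Sum>i<cnt l g x. sg (f i)) + (\<Sum>i\<in>{cnt l g x..<cnt l f x}. sg (f i))"
    by (simp add: sum.union_disjoint ivl_disj_int)
  moreover have "(\<Sum>i<cnt l g x. sg (f i)) + (\<Sum>i<cnt l g x. sg (g i)) = 0"
    unfolding sum.distrib[symmetric] by (rule sum.neutral) (use assms(2) in auto)
  ultimately show ?thesis by (simp add: end_sum_def)
qed

context
  fixes l :: nat and f g :: "nat \<Rightarrow> int"
  assumes f: "dec l f" and g: "dec l g"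
begin

lemma matched_cnt_le:
  assumes "matched l f g"
  shows "cnt l g x \<le> cnt l f x"
proof (cases "cnt l g x")
  case (Suc k)
  then have k: "k < l" "x < g k" using cnt_le[of l g x] cntD[OF g, of k x] by auto
  then have "g k + 1 \<le> f k" using assms by (auto simp: matched_def)
  then have "k < cnt l f x" using cnt_iff[OF f k(1), of x] k(2) by simp
  then show ?thesis using Suc by simp
qed simp

lemma matched_pair: "matched l f g \<Longrightarrow> i < l \<Longrightarrow> sg (f i) = - sg (g i)"
proof -
  assume "matched l f g" "i < l"
  then have "even (f i - g i - 1)" by (simp add: matched_def)
  then have "odd (f i - g i)" by presburger
  then show ?thesis unfolding sg_neg_iff .
qed

text \<open>The indices in this range belong to stretches that reach \<open>x\<close>. Consecutive
  ones overlap, or one begins where the other ends, and in both cases their right ends have opposite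
  parities.\<close>

lemma matched_alternate:
  assumes m: "matched l f g" and i: "cnt l g x \<le> i" "Suc i < cnt l f (x - 1)"
  shows "sg (f (Suc i)) = - sg (f i)"
proof -
  have il: "Suc i < l" "i < l" using i(2) cnt_le[of l f "x - 1"] by auto
  have gi: "g i \<le> x" using cnt_iff[OF g il(2), of x] i(1) by simp
  have fi: "x \<le> f (Suc i)" using cntD[OF f i(2)] by simp
  show ?thesis
  proof (cases "g i = f (Suc i)")
    case True
    then show ?thesis using matched_pair[OF m il(2)] by simp
  next
    case False
    then have "odd (g i - g (Suc i))" using m il gi fi by (auto simp: matched_def)
    then have "sg (g i) = - sg (g (Suc i))" unfolding sg_neg_iff .
    then show ?thesis using matched_pair[OF m il(1)] matched_pair[OF m il(2)] by simp
  qed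
qed

text \<open>Stretches with both ends to the right of \<open>x\<close> cancel by
  \<open>matched_pair\<close>. The signs of those still open at \<open>x\<close> alternate, so at
  most the last one remains.\<close>

lemma matched_end_sum:
  assumes m: "matched l f g"
  shows "end_sum l f g x = (if even (cnt l f x - cnt l g x) then 0 else sg (f (cnt l f x - 1)))"
proof -
  have "end_sum l f g x = (\<Sum>i\<in>{cnt l g x..<cnt l f x}. sg (f i))"
    by (rule end_sum_window[OF matched_cnt_le[OF m]]) (use matched_pair[OF m] cnt_le[of l g x] in auto)
  also have "\<dots> = (if even (cnt l f x - cnt l g x) then 0 else sg (f (cnt l f x - 1)))"
  proof (rule alternating_sum(1)[OF _ matched_cnt_le[OF m]])
    fix i assume "cnt l g x \<le> i" "Suc i < cnt l f x"
    then show "sg (f (Suc i)) = - sg (f i)" using matched_alternate[OF m, of x i] cnt_mono[of "x - 1" x l f] by simp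
  qed
  finally show ?thesis .
qed

text \<open>The colour is the sign of the right end of the last open stretch, corrected by the
  parity of its index. As the signs alternate with the index, the corrected sign is constant while
  some stretch is open.\<close>

lemma matched_colour:
  assumes m: "matched l f g"
  defines "\<kappa> \<equiv> \<lambda>x. if cnt l g x = cnt l f x then 1 else sg (f (cnt l f x - 1)) * sg (int (cnt l f x))"
  shows "\<kappa> x \<in> {1, -1}" "odd (int (cnt l f x) - int (cnt l g x)) \<Longrightarrow> \<kappa> x = end_sum l f g x * sg (int (cnt l f x))"
    "cnt l g (x - 1) \<noteq> cnt l f (x - 1) \<Longrightarrow> cnt l g x \<noteq> cnt l f x \<Longrightarrow> \<kappa> (x - 1) = \<kappa> x"
proof -
  let ?\<phi> = "\<lambda>i. sg (f i) * sg (int (Suc i))"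
  have \<kappa>: "\<kappa> x = ?\<phi> (cnt l f x - 1)" if "cnt l g x \<noteq> cnt l f x" for x
  proof -
    have "0 < cnt l f x" using that matched_cnt_le[OF m, of x] by linarith
    then show ?thesis using that by (simp add: \<kappa>_def)
  qed
  show "\<kappa> x \<in> {1, -1}" using sg_cases[of "f (cnt l f x - 1)"] sg_cases[of "int (cnt l f x)"] by (auto simp: \<kappa>_def)
  show "\<kappa> x = end_sum l f g x * sg (int (cnt l f x))" if "odd (int (cnt l f x) - int (cnt l g x))"
  proof -
    have "odd (cnt l f x - cnt l g x)" using that odd_of_nat_diff[OF matched_cnt_le[OF m]] by blast
    then show ?thesis by (auto simp: \<kappa>_def matched_end_sum[OF m])
  qed
  show "\<kappa> (x - 1) = \<kappa> x" if ne: "cnt l g (x - 1) \<noteq> cnt l f (x - 1)" "cnt l g x \<noteq> cnt l f x"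
  proof -
    have lt: "cnt l g x < cnt l f x" "cnt l g (x - 1) < cnt l f (x - 1)" "cnt l f x \<le> cnt l f (x - 1)"
      using ne matched_cnt_le[OF m, of x] matched_cnt_le[OF m, of "x - 1"] cnt_mono[of "x - 1" x l f] by auto
    have "?\<phi> i = ?\<phi> (cnt l f x - 1)" if "cnt l f x - 1 \<le> i" "i < cnt l f (x - 1)" for i
      using that
    proof (induction rule: dec_induct)
      case (step i)
      have "cnt l g x \<le> i" using step(1) lt by linarith
      then have "sg (f (Suc i)) = - sg (f i)" using matched_alternate[OF m] step.prems by blast
      moreover have "sg (int (Suc (Suc i))) = - sg (int (Suc i))" by (auto simp: sg_def)
      ultimately show ?case using step by simp
    qed simp
    from this[of "cnt l f (x - 1) - 1"] show ?thesis unfolding \<kappa>[OF ne(1)] \<kappa>[OF ne(2)] using lt by linarith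
  qed
qed

text \<open>One step from right to left, during which a stretch may open, close or do both. The sign
  of \<open>x\<close> has to be opposite to its neighbour in the sequence: for an odd number of open
  stretches the bound on \<open>end_sum\<close> forces this, for an even number the constancy of
  \<open>\<kappa>\<close>.\<close>

lemma sweep:
  fixes \<kappa> :: "int \<Rightarrow> int"
  assumes D: "\<And>x. cnt l g x \<le> cnt l f x" and Q: "\<And>x. \<bar>end_sum l f g x\<bar> \<le> 1"
    and k1: "\<And>x. odd (int (cnt l f x) - int (cnt l g x)) \<Longrightarrow> \<kappa> x = end_sum l f g x * sg (int (cnt l f x))"
    and k2: "\<And>x. cnt l g (x - 1) \<noteq> cnt l f (x - 1) \<Longrightarrow> cnt l g x \<noteq> cnt l f x \<Longrightarrow> \<kappa> (x - 1) = \<kappa> x"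
    and I1: "\<And>i. i < cnt l g x \<Longrightarrow> sg (f i) = - sg (g i)"
    and I2: "\<And>i. cnt l g x \<le> i \<Longrightarrow> Suc i < cnt l f x \<Longrightarrow> sg (f (Suc i)) = - sg (f i)"
    and I3: "cnt l g x \<noteq> cnt l f x \<Longrightarrow> \<kappa> x = sg (f (cnt l f x - 1)) * sg (int (cnt l f x))"
  shows "(\<forall>i<cnt l g (x - 1). sg (f i) = - sg (g i))
    \<and> (\<forall>i. cnt l g (x - 1) \<le> i \<longrightarrow> Suc i < cnt l f (x - 1) \<longrightarrow> sg (f (Suc i)) = - sg (f i))
    \<and> (cnt l g (x - 1) \<noteq> cnt l f (x - 1) \<longrightarrow> \<kappa> (x - 1) = sg (f (cnt l f (x - 1) - 1)) * sg (int (cnt l f (x - 1))))"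
proof -
  define a where "a = cnt l g x"
  define b where "b = cnt l f x"
  define a' where "a' = cnt l g (x - 1)"
  define b' where "b' = cnt l f (x - 1)"
  note ab = a_def[symmetric] b_def[symmetric] a'_def[symmetric] b'_def[symmetric]
  have le: "a \<le> b" "a' \<le> b'" by (simp_all add: a_def b_def a'_def b'_def D)
  note I1' = I1[unfolded ab] and I2' = I2[unfolded ab] and I3' = I3[unfolded ab]
  have Qx: "end_sum l f g x = (if even (b - a) then 0 else sg (f (b - 1)))"
    using end_sum_window[OF D[of x] I1] alternating_sum(1)[of a b "\<lambda>i. sg (f i)", OF I2' le(1)] unfolding ab by (rule trans)
  have ha: "sg (f a) = (if even (b - a) then - sg (f (b - 1)) else sg (f (b - 1)))" if "a < b"
    using alternating_sum(2)[of a b "\<lambda>i. sg (f i)", OF I2' le(1) that] .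
  have Q': "\<bar>end_sum l f g (x - 1)\<bar> \<le> 1" by (rule Q)
  have k1': "\<kappa> (x - 1) = end_sum l f g (x - 1) * sg (int b')" if "odd (b' - a')"
    using k1[of "x - 1"] that odd_of_nat_diff[OF le(2)] unfolding ab by blast
  have k2': "a' \<noteq> b' \<Longrightarrow> a \<noteq> b \<Longrightarrow> \<kappa> (x - 1) = \<kappa> x" using k2[of x] unfolding ab .
  have e: "sg x = 1 \<or> sg x = -1" and hs: "sg (f (b - 1)) = 1 \<or> sg (f (b - 1)) = -1" and sb: "sg (int b) = 1 \<or> sg (int b) = -1"
    by (rule sg_cases)+
  have sS: "sg (int (Suc b)) = - sg (int b)" by (auto simp: sg_def)
  consider (none) "b' = b" "a' = a" "end_sum l f g (x - 1) = end_sum l f g x"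
    | (opn) "b' = Suc b" "f b = x" "a' = a" "end_sum l f g (x - 1) = end_sum l f g x + sg x"
    | (cls) "b' = b" "a' = Suc a" "g a = x" "end_sum l f g (x - 1) = end_sum l f g x + sg x"
    | (both) "b' = Suc b" "f b = x" "a' = Suc a" "g a = x" "end_sum l f g (x - 1) = end_sum l f g x + 2 * sg x"
    using cnt_step[OF f, of x] cnt_step[OF g, of x] unfolding ab end_sum_def by (elim disjE conjE) auto
  then have "(\<forall>i<a'. sg (f i) = - sg (g i)) \<and> (\<forall>i. a' \<le> i \<longrightarrow> Suc i < b' \<longrightarrow> sg (f (Suc i)) = - sg (f i))
    \<and> (a' \<noteq> b' \<longrightarrow> \<kappa> (x - 1) = sg (f (b' - 1)) * sg (int b'))"
  proof cases
    case none
    then show ?thesis using I1' I2' I3' k2' by auto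
  next
    case opn
    have cl: "sg x = - sg (f (b - 1))" if "a < b"
    proof (cases "even (b - a)")
      case True
      then have "odd (b' - a')" using opn le by (simp add: Suc_diff_le)
      then have "\<kappa> (x - 1) = sg x * sg (int (Suc b))" using k1' opn(1,4) Qx True by simp
      moreover have "\<kappa> (x - 1) = sg (f (b - 1)) * sg (int b)" using k2' I3' opn that by auto
      ultimately show ?thesis unfolding sS using sb by auto
    next
      case False
      then show ?thesis using Q' opn(4) Qx e hs by auto
    qed
    have "sg (f (Suc i)) = - sg (f i)" if "a' \<le> i" "Suc i < b'" for i
    proof (cases "Suc i = b")
      case True
      then have "i = b - 1" by simp
      then show ?thesis using cl that opn True by simp
    qed (use I2' that opn in auto)
    moreover have "\<kappa> (x - 1) = sg (f (b' - 1)) * sg (int b')" if "a' \<noteq> b'"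
    proof (cases "a = b")
      case True
      then have "odd (b' - a')" using opn by simp
      then show ?thesis using k1' opn Qx True by simp
    next
      case False
      then have "\<kappa> (x - 1) = sg (f (b - 1)) * sg (int b)" using k2' I3' that by auto
      then show ?thesis unfolding opn(1) sS using cl False le(1) opn(2) by simp
    qed
    ultimately show ?thesis using I1' opn(3) by blast
  next
    case cls
    have lt: "a < b" using le cls by simp
    have cl: "sg (f a) = - sg x"
    proof (cases "even (b - a)")
      case True
      then have "odd (b' - a')" using cls lt by simp
      then have "\<kappa> (x - 1) = sg x * sg (int b)" "a' \<noteq> b'" using k1' cls(1,4) Qx True by (auto split: if_splits)
      moreover from this have "\<kappa> (x - 1) = sg (f (b - 1)) * sg (int b)" using k2' I3' lt by auto
      ultimately show ?thesis using ha[OF lt] True sb by auto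
    next
      case False
      then show ?thesis using Q' cls(4) Qx e hs ha[OF lt] by auto
    qed
    have "sg (f i) = - sg (g i)" if "i < a'" for i
      using that cl cls I1' by (cases "i = a") auto
    moreover have "\<kappa> (x - 1) = sg (f (b' - 1)) * sg (int b')" if "a' \<noteq> b'"
      using k2' I3' that lt cls(1) by auto
    ultimately show ?thesis using I2' cls(1,2) by auto
  next
    case both
    have od: "odd (b - a)"
    proof
      assume "even (b - a)"
      then show False using Q' both(5) Qx e by auto
    qed
    then have lt: "a < b" by (cases "a < b") auto
    have cl: "sg (f a) = - sg x" "sg x = - sg (f (b - 1))" using Q' both(5) Qx e hs ha[OF lt] od by auto
    have "sg (f i) = - sg (g i)" if "i < a'" for i
      using that cl both I1' by (cases "i = a") auto
    moreover have "sg (f (Suc i)) = - sg (f i)" if "a' \<le> i" "Suc i < b'" for i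
    proof (cases "Suc i = b")
      case True
      then have "i = b - 1" by simp
      then show ?thesis using cl both True by simp
    qed (use I2' that both in auto)
    moreover have "\<kappa> (x - 1) = sg (f (b' - 1)) * sg (int b')" if "a' \<noteq> b'"
    proof -
      have "\<kappa> (x - 1) = sg (f (b - 1)) * sg (int b)" using k2' I3' that lt by auto
      then show ?thesis unfolding both(1) sS using cl(2) both(2) by simp
    qed
    ultimately show ?thesis by blast
  qed
  then show ?thesis unfolding ab .
qed

lemma matchedI:
  assumes D: "\<And>x. cnt l g x \<le> cnt l f x"
    and I1: "\<And>x i. i < cnt l g x \<Longrightarrow> sg (f i) = - sg (g i)"
    and I2: "\<And>x i. cnt l g x \<le> i \<Longrightarrow> Suc i < cnt l f x \<Longrightarrow> sg (f (Suc i)) = - sg (f i)"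
  shows "matched l f g"
proof -
  have s: "sg (f i) = - sg (g i)" if "i < l" for i using I1[of i "g i - 1"] cnt_iff[OF g that, of "g i - 1"] by simp
  have "g i + 1 \<le> f i \<and> even (f i - g i - 1)" if i: "i < l" for i
  proof -
    have "i < cnt l f (g i - 1)" using cnt_iff[OF g i, of "g i - 1"] D[of "g i - 1"] by simp
    then have "g i \<le> f i" using cntD[OF f] by fastforce
    moreover have od: "odd (f i - g i)" using s[OF i] unfolding sg_neg_iff .
    moreover have "f i \<noteq> g i"
    proof
      assume "f i = g i"
      with od show False by simp
    qed
    ultimately show ?thesis by auto
  qed
  moreover have "odd (g i - g (Suc i))" if i: "Suc i < l" "g i + 1 \<le> f (Suc i)" for i
  proof -
    have il: "i < l" using i by simp
    have "cnt l g (g i) \<le> i" using cnt_iff[OF g il, of "g i"] by simp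
    moreover have "Suc i < cnt l f (g i)" using cnt_iff[OF f i(1), of "g i"] i(2) by simp
    ultimately have "sg (f (Suc i)) = - sg (f i)" using I2 by blast
    then have "sg (g i) = - sg (g (Suc i))" using s[OF i(1)] s[OF il] by simp
    then show ?thesis unfolding sg_neg_iff .
  qed
  ultimately show ?thesis unfolding matched_def by blast
qed

end

section \<open>Matched ends in terms of depth and colour\<close>

context families
begin

lemma conf_of_cnt:
  "fst (conf_of (B, A)) (x, 0) = int (cnt l (B 0) x)" "snd (conf_of (B, A)) (x, 0) = int (cnt l (A 0) x)"
  by (simp_all add: conf_of_def height_fun_def count_above_def cnt_def)

lemma depth_row:
  "r \<le> n \<Longrightarrow> depth (conf_of (B, A)) (x, r) = int (cnt l (B r) x) - int (cnt l (A r) x)"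
  by (simp add: depth_def conf_of_def height_fun_def count_above_def cnt_def)

lemma depth_cnt: "depth (conf_of (B, A)) (x, 0) = int (cnt l (B 0) x) - int (cnt l (A 0) x)"
  by (simp add: depth_def conf_of_cnt)

lemma dec0: "B \<in> BC \<Longrightarrow> dec l (B 0)" "A \<in> AC \<Longrightarrow> dec l (A 0)"
  using chain_facts(1)[of B wB 0] chain_facts(1)[of A wA 0] by (auto simp: BC_def AC_def)

lemma Qf_end_sum:
  assumes "B \<in> BC" "A \<in> AC"
  shows "Qf (conf_of (B, A)) x = end_sum l (B 0) (A 0) x"
  unfolding Qf_conf_of[OF assms] end_sum_def
  using sum_cnt[OF dec0(1)[OF assms(1)], of x "\<lambda>i. sg (B 0 i)"] sum_cnt[OF dec0(2)[OF assms(2)], of x "\<lambda>i. sg (A 0 i)"]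
  by (simp only:)

text \<open>The colour rule is the parity condition on overlapping stretches, expressed without
  reference to the pairing of the ends. One direction is \<open>matched_colour\<close>; the other
  sweeps from the right end, where no stretch is open.\<close>

theorem matched_iff:
  assumes B: "B \<in> BC" and A: "A \<in> AC"
  shows "matched l (B 0) (A 0) \<longleftrightarrow>
    Qbd (conf_of (B, A)) \<and> (\<forall>x. 0 \<le> depth (conf_of (B, A)) (x, 0)) \<and> kapcond {0} (conf_of (B, A))"
proof
  let ?c = "conf_of (B, A)"
  note d = dec0(1)[OF B] dec0(2)[OF A]
  {
    assume m: "matched l (B 0) (A 0)"
    have "\<bar>Qf ?c x\<bar> \<le> 1" for x
      using sg_cases[of "B 0 (cnt l (B 0) x - 1)"] by (auto simp: Qf_end_sum[OF B A] matched_end_sum[OF d m])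
    moreover have "0 \<le> depth ?c (x, 0)" for x using matched_cnt_le[OF d m, of x] by (simp add: depth_cnt)
    moreover have "kapcond {0} ?c"
      unfolding kapcond_def
    proof (intro exI conjI allI impI)
      let ?\<kappa> = "\<lambda>x. if cnt l (A 0) x = cnt l (B 0) x then 1 else sg (B 0 (cnt l (B 0) x - 1)) * sg (int (cnt l (B 0) x))"
      fix x
      show "?\<kappa> x \<in> {1, -1}" by (rule matched_colour(1)[OF d m])
      show "?\<kappa> x = kap ?c x" if "odd (depth ?c (x, 0))"
        using matched_colour(2)[OF d m, of x] that by (simp add: kap_def Qf_end_sum[OF B A] conf_of_cnt depth_cnt)
      show "?\<kappa> (x - 1) = ?\<kappa> x" if "depth ?c (x - 1, 0) \<notin> {0} \<and> depth ?c (x, 0) \<notin> {0}"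
        by (rule matched_colour(3)[OF d m]) (use that in \<open>auto simp: depth_cnt\<close>)
    qed
    ultimately show "Qbd ?c \<and> (\<forall>x. 0 \<le> depth ?c (x, 0)) \<and> kapcond {0} ?c" by (simp add: Qbd_def)
  }
  assume a: "Qbd ?c \<and> (\<forall>x. 0 \<le> depth ?c (x, 0)) \<and> kapcond {0} ?c"
  then obtain \<kappa> where k: "\<forall>x. odd (depth ?c (x, 0)) \<longrightarrow> \<kappa> x = kap ?c x"
    "\<forall>x. depth ?c (x - 1, 0) \<notin> {0} \<and> depth ?c (x, 0) \<notin> {0} \<longrightarrow> \<kappa> (x - 1) = \<kappa> x"
    unfolding kapcond_def by blast
  have D: "cnt l (A 0) x \<le> cnt l (B 0) x" for x using a by (simp add: depth_cnt)
  have P: "(\<forall>i<cnt l (A 0) x. sg (B 0 i) = - sg (A 0 i))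
    \<and> (\<forall>i. cnt l (A 0) x \<le> i \<longrightarrow> Suc i < cnt l (B 0) x \<longrightarrow> sg (B 0 (Suc i)) = - sg (B 0 i))
    \<and> (cnt l (A 0) x \<noteq> cnt l (B 0) x \<longrightarrow> \<kappa> x = sg (B 0 (cnt l (B 0) x - 1)) * sg (int (cnt l (B 0) x)))" for x
  proof (induction x rule: bottom_induct)
    case (right x)
    have "B 0 i \<le> x" if "i < l" for i using BC_window[OF B that, of 0] right by simp
    then have "\<not> x < B 0 i" if "i < l" for i using that by (simp add: not_less)
    then have "{i. i < l \<and> x < B 0 i} = {}" by blast
    then have "cnt l (B 0) x = 0" by (simp add: cnt_def)
    then show ?case using D[of x] by simp
  next
    case (step x)
    show ?case
    proof (rule sweep[OF d D])
      show "\<bar>end_sum l (B 0) (A 0) x\<bar> \<le> 1" for x using a by (simp add: Qbd_def Qf_end_sum[OF B A])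
      show "\<kappa> x = end_sum l (B 0) (A 0) x * sg (int (cnt l (B 0) x))" if "odd (int (cnt l (B 0) x) - int (cnt l (A 0) x))" for x
        using k(1) that by (simp add: kap_def Qf_end_sum[OF B A] conf_of_cnt depth_cnt)
      show "\<kappa> (x - 1) = \<kappa> x" if "cnt l (A 0) (x - 1) \<noteq> cnt l (B 0) (x - 1)" "cnt l (A 0) x \<noteq> cnt l (B 0) x" for x
        using k(2) that by (simp add: depth_cnt)
    qed (use step in blast)+
  qed
  show "matched l (B 0) (A 0)"
    by (rule matchedI[OF d D]) (use P in blast)+
qed

end

section \<open>Weights of tableaux\<close>

context skew_paths
begin

lemma YT_matched: "YT = {y \<in> BC \<times> AC. matched l (fst y 0) (snd y 0)}"
  unfolding YT_def matched_def by auto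

lemma conf_of_YT: "conf_of ` YT = {c \<in> Conf. Qbd c \<and> (\<forall>x. 0 \<le> depth c (x, 0)) \<and> kapcond {0} c}"
proof -
  have "conf_of ` YT = {c \<in> conf_of ` (BC \<times> AC). Qbd c \<and> (\<forall>x. 0 \<le> depth c (x, 0)) \<and> kapcond {0} c}"
    unfolding YT_matched using matched_iff by auto
  then show ?thesis using conf_of_bij by (simp add: bij_betw_def)
qed

lemma inj_conf_of: "inj_on conf_of YT"
  by (rule inj_on_subset[of _ "BC \<times> AC"]) (use conf_of_bij in \<open>auto simp: bij_betw_def YT_def\<close>)

lemma mid_weight:
  fixes z :: "int \<Rightarrow> 'r::comm_ring_1"
  assumes y: "(B, A) \<in> YT"
  shows "(\<Prod>x\<in>{-W..W}. z x ^ nat (mid_exp (conf_of (B, A)) x)) = (\<Prod>i<l. mid_kernel z (A 0 i + 1) (B 0 i))"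
proof -
  have BA: "B \<in> BC" "A \<in> AC" using y by (auto simp: YT_def)
  have pr: "A 0 i + 1 \<le> B 0 i" "even (B 0 i - A 0 i - 1)" if "i < l" for i
    using y that by (auto simp: YT_def)
  have e: "nat (mid_exp (conf_of (B, A)) x) = (\<Sum>i<l. if A 0 i + 1 \<le> x \<and> x < B 0 i \<and> even (x - (A 0 i + 1)) then 1 else 0)" for x
  proof -
    have "mid_exp (conf_of (B, A)) x
      = (\<Sum>i<l. (if x < B 0 i \<and> even (B 0 i - x) then 1 else 0) - (if x < A 0 i + 1 - 1 \<and> even (A 0 i + 1 - x) then 1 else 0))"
      by (simp only: mid_exp_conf_of[OF BA] class_depth_def sum_subtractf)
    also have "\<dots> = (\<Sum>i<l. if A 0 i + 1 \<le> x \<and> x < B 0 i \<and> even (x - (A 0 i + 1)) then 1 else 0)"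
    proof (rule sum.cong)
      fix i assume "i \<in> {..<l}"
      then have p: "A 0 i + 1 \<le> B 0 i" "even (B 0 i - A 0 i - 1)" using pr by auto
      have q: "even (B 0 i - x) \<longleftrightarrow> even (x - (A 0 i + 1))" "even (A 0 i + 1 - x) \<longleftrightarrow> even (x - (A 0 i + 1))"
        using p(2) by presburger+
      \<comment> \<open>The class depth starts to count at \<open>A 0 i\<close>, the kernel at
        \<open>A 0 i + 1\<close>; the parity excludes the cell by which they differ.\<close>
      have "x \<noteq> A 0 i" if "even (x - (A 0 i + 1))" using that by auto
      then show "(if x < B 0 i \<and> even (B 0 i - x) then 1 else 0) - (if x < A 0 i + 1 - 1 \<and> even (A 0 i + 1 - x) then 1 else 0)
          = (if A 0 i + 1 \<le> x \<and> x < B 0 i \<and> even (x - (A 0 i + 1)) then 1 else 0 :: int)"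
        unfolding q using p(1) by (cases "even (x - (A 0 i + 1))") auto
    qed simp
    also have "\<dots> = int (\<Sum>i<l. if A 0 i + 1 \<le> x \<and> x < B 0 i \<and> even (x - (A 0 i + 1)) then 1 else 0)"
      unfolding of_nat_sum by (rule sum.cong) auto
    finally show ?thesis by (simp only: nat_int)
  qed
  have "(\<Prod>x\<in>{-W..W}. z x ^ nat (mid_exp (conf_of (B, A)) x))
    = (\<Prod>i<l. \<Prod>x\<in>{-W..W}. if A 0 i + 1 \<le> x \<and> x < B 0 i \<and> even (x - (A 0 i + 1)) then z x else 1)"
    unfolding e power_sum by (subst prod.swap) (intro prod.cong refl, auto)
  also have "\<dots> = (\<Prod>i<l. mid_kernel z (A 0 i + 1) (B 0 i))"
  proof (rule prod.cong)
    fix i assume i: "i \<in> {..<l}"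
    then have s: "{A 0 i + 1..<B 0 i} \<subseteq> {-W..W}"
      using AC_window[OF BA(2), of i 0] BC_window[OF BA(1), of i 0] by auto
    have "(\<Prod>x\<in>{-W..W}. if A 0 i + 1 \<le> x \<and> x < B 0 i \<and> even (x - (A 0 i + 1)) then z x else 1)
      = (\<Prod>x\<in>{A 0 i + 1..<B 0 i}. if even (x - (A 0 i + 1)) then z x else 1)"
      by (rule prod.mono_neutral_cong_right) (use s in auto)
    moreover have "even (B 0 i - (A 0 i + 1))" "A 0 i + 1 \<le> B 0 i" using pr[of i] i by (auto simp: algebra_simps)
    ultimately show "(\<Prod>x\<in>{-W..W}. if A 0 i + 1 \<le> x \<and> x < B 0 i \<and> even (x - (A 0 i + 1)) then z x else 1)
      = mid_kernel z (A 0 i + 1) (B 0 i)" by (simp add: mid_kernel_def)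
  qed simp
  finally show ?thesis .
qed

lemma weight_tab_of:
  fixes a :: complex
  assumes y: "(B, A) \<in> YT" and n: "n = CARD('n::finite)"
  shows "(weight lam mu a (tab_of (B, A)) :: 'n zring) = conf_wt (zlow a) (zupp a) (conf_of (B, A))"
proof -
  let ?g = "\<lambda>j x. zgen (col_label n (uc j) (colA (B, A) j) (colB (B, A) j) x) (a - 2 * of_int x) :: 'n zring"
  have BA: "B \<in> BC" "A \<in> AC" using y by (auto simp: YT_def)
  have "weight lam mu a (tab_of (B, A)) = (\<Prod>p\<in>Sigma {..<l} (\<lambda>j. {uc j..<vc j}). ?g (fst p) (snd p))"
    unfolding weight_def
  proof (rule prod.reindex_bij_witness[of _ "\<lambda>(j, x). (nat (x + int (Suc j)), Suc j)" "\<lambda>(i, j). (j - 1, int i - int j)"])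
    fix b assume b: "b \<in> boxes lam mu"
    obtain i j where ij: "b = (i, j)" by (cases b)
    obtain k where k: "j = Suc k" using b ij boxes_iff[OF skew, of i j] by (cases j) auto
    have x: "k < l" "uc k \<le> int i - int (Suc k)" "int i - int (Suc k) < vc k" using b boxes_abs[OF skew, of i k] by (auto simp: ij k)
    show "(\<lambda>(j, x). (nat (x + int (Suc j)), Suc j)) ((\<lambda>(i, j). (j - 1, int i - int j)) b) = b" by (simp add: ij k)
    show "(\<lambda>(i, j). (j - 1, int i - int j)) b \<in> Sigma {..<l} (\<lambda>j. {uc j..<vc j})" using x by (simp add: ij k)
    have "tab_of (B, A) (i, Suc k) = col_label n (uc k) (colA (B, A) k) (colB (B, A) k) (int i - int (Suc k))"
      using b by (simp add: ij k tab_of_def)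
    moreover have "a + 2 * (of_nat (Suc k) - of_nat i) = a - 2 * of_int (int i - int (Suc k))" by (simp add: algebra_simps)
    ultimately have "zgen (tab_of (B, A) (i, Suc k)) (a + 2 * (of_nat (Suc k) - of_nat i)) = ?g k (int i - int (Suc k))"
      by (simp only:)
    then show "?g (fst ((\<lambda>(i, j). (j - 1, int i - int j)) b)) (snd ((\<lambda>(i, j). (j - 1, int i - int j)) b))
      = (case b of (i, j) \<Rightarrow> zgen (tab_of (B, A) (i, j)) (a + 2 * (of_nat j - of_nat i)))"
      unfolding ij k by (simp only: split fst_conv snd_conv diff_Suc_1)
  next
    fix p assume p: "p \<in> Sigma {..<l} (\<lambda>j. {uc j..<vc j})"
    obtain j x where jx: "p = (j, x)" by (cases p)
    have x: "j < l" "uc j \<le> x" "x < vc j" using p by (auto simp: jx)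
    have "0 \<le> x + int (Suc j)" using x(2) by (simp add: first_abs_def)
    then show "(\<lambda>(i, j). (j - 1, int i - int j)) ((\<lambda>(j, x). (nat (x + int (Suc j)), Suc j)) p) = p" by (simp add: jx)
    show "(\<lambda>(j, x). (nat (x + int (Suc j)), Suc j)) p \<in> boxes lam mu" using tab_of_box(1)[OF x] by (simp add: jx)
  qed
  also have "\<dots> = (\<Prod>j<l. \<Prod>x\<in>{uc j..<vc j}. ?g j x)"
    by (subst prod.Sigma) (auto simp: case_prod_beta)
  also have "\<dots> = (\<Prod>j<l. (\<Prod>s<n. if A (Suc s) j = A s j then zlow a (A s j) s else 1) * mid_kernel (zmid a) (A 0 j + 1) (B 0 j)
      * (\<Prod>s<n. if B (Suc s) j = B s j then 1 else zupp a (B s j) s))"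
  proof (rule prod.cong)
    fix j assume "j \<in> {..<l}"
    then have "is_col n (uc j) (vc j) (colA (B, A) j) (colB (B, A) j)" using YT_col[OF y] by simp
    moreover have e: "colA (B, A) j = (\<lambda>s. A s j)" "colB (B, A) j = (\<lambda>s. B s j)" by (simp_all add: colA_def colB_def fun_eq_iff)
    ultimately have "is_col CARD('n) (uc j) (vc j) (\<lambda>s. A s j) (\<lambda>s. B s j)" unfolding n by simp
    from column_weight[where 'n = 'n, OF this, of a]
    show "(\<Prod>x\<in>{uc j..<vc j}. ?g j x) = (\<Prod>s<n. if A (Suc s) j = A s j then zlow a (A s j) s else 1) * mid_kernel (zmid a) (A 0 j + 1) (B 0 j)
      * (\<Prod>s<n. if B (Suc s) j = B s j then 1 else zupp a (B s j) s)"
      unfolding n e .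
  qed simp
  also have "\<dots> = (\<Prod>s<n. (\<Prod>j<l. if A (Suc s) j = A s j then zlow a (A s j) s else 1) * (\<Prod>j<l. if B (Suc s) j = B s j then 1 else zupp a (B s j) s))
      * (\<Prod>j<l. mid_kernel (zmid a) (A 0 j + 1) (B 0 j))"
  proof -
    have sw: "(\<Prod>j<l. \<Prod>s<n. h s j) = (\<Prod>s<n. \<Prod>j<l. h s j)" for h :: "nat \<Rightarrow> nat \<Rightarrow> 'n zring" by (rule prod.swap)
    show ?thesis unfolding prod.distrib sw by (simp only: ac_simps)
  qed
  also have "(\<Prod>s<n. (\<Prod>j<l. if A (Suc s) j = A s j then zlow a (A s j) s else 1) * (\<Prod>j<l. if B (Suc s) j = B s j then 1 else zupp a (B s j) s))
      = (\<Prod>s<n. row_wt (zlow a) (zupp a) (conf_of (B, A)) s :: 'n zring)"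
    by (rule prod.cong) (simp_all add: row_wt_conf_of[OF BA] lessThan_atLeast0 del: One_nat_def)
  also have "(\<Prod>j<l. mid_kernel (zmid a) (A 0 j + 1) (B 0 j))
      = (\<Prod>x\<in>{-W..W}. (zlow a (x + 1) 0 * zupp a x 0) ^ nat (mid_exp (conf_of (B, A)) x) :: 'n zring)"
    unfolding mid_weight[OF y, symmetric] zmid_def ..
  finally show ?thesis unfolding conf_wt_def .
qed

end

section \<open>Units and cells\<close>

text \<open>Both halves are mapped to the same strip of cells; the lower half is reflected, following the
  duality of lower and upper paths.\<close>

fun unit_of :: "half \<Rightarrow> cell \<Rightarrow> zunit" where
  "unit_of Upper (x, r) = (Upper, (x, int r - x))"
| "unit_of Lower (x, r) = (Lower, (x + 1 - int r, - x - 1))"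

lemma fst_unit_of [simp]: "fst (unit_of h u) = h"
  by (cases h; cases u) auto

lemma is_unit_of: "is_unit n (unit_of h u) \<longleftrightarrow> snd u \<le> n"
  by (cases h; cases u) (auto simp: is_unit_def ht_def)

lemma is_unit_cases:
  assumes "is_unit n U"
  obtains h u where "U = unit_of h u" "snd u \<le> n"
proof -
  obtain h x y where U: "U = (h, (x, y))" by (cases U) auto
  show ?thesis
  proof (cases h)
    case Upper
    have "U = unit_of Upper (x, nat (x + y))" "nat (x + y) \<le> n" using assms Upper by (auto simp: U is_unit_def ht_def)
    then show ?thesis using that by fastforce
  next
    case Lower
    have "U = unit_of Lower (- y - 1, nat (- (x + y)))" "nat (- (x + y)) \<le> n" using assms Lower by (auto simp: U is_unit_def ht_def)
    then show ?thesis using that by fastforce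
  qed
qed

lemma ht_unit_of: "ht (snd (unit_of h u)) = 0 \<longleftrightarrow> snd u = 0" "\<bar>ht (snd (unit_of h u))\<bar> = int n \<longleftrightarrow> snd u = n"
  by (cases h; cases u; auto simp: ht_def)+

lemma vertices_Upper:
  "(a, b) \<in> vertices n (unit_of Upper (x, r)) \<longleftrightarrow>
    ((a, b) = (x, int r - x) \<or> (a, b) = (x + 1, int r - x - 1) \<or> (a, b) = (x + 1, int r - x) \<or> (a, b) = (x, int r - x - 1))
    \<and> 0 \<le> a + b \<and> a + b \<le> int n"
  by (auto simp: vertices_def left_vertex_def right_vertex_def ht_def)

lemma vertices_Lower:
  "(a, b) \<in> vertices n (unit_of Lower (x, r)) \<longleftrightarrow>
    ((a, b) = (x + 1 - int r, - x - 1) \<or> (a, b) = (x + 2 - int r, - x - 2) \<or> (a, b) = (x + 2 - int r, - x - 1) \<or> (a, b) = (x + 1 - int r, - x - 2))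
    \<and> - int n \<le> a + b \<and> a + b \<le> 0"
  by (auto simp: vertices_def left_vertex_def right_vertex_def ht_def)

lemma vertices_Upper_iff:
  assumes "r \<le> n" "s \<le> n"
  shows "(x, int r - x) \<in> vertices n (unit_of Upper (y, s)) \<longleftrightarrow>
      (x = y \<and> r = s) \<or> (x = y + 1 \<and> r = s) \<or> (x = y + 1 \<and> r = Suc s) \<or> (x = y \<and> s = Suc r)"
    "(x + 1, int r - x - 1) \<in> vertices n (unit_of Upper (y, s)) \<longleftrightarrow>
      (y = x + 1 \<and> r = s) \<or> (x = y \<and> r = s) \<or> (x = y \<and> r = Suc s) \<or> (y = x + 1 \<and> s = Suc r)"
  unfolding vertices_Upper prod.inject using assms by presburger+

lemma vertices_Lower_iff:
  assumes "r \<le> n" "s \<le> n"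
  shows "(x + 1 - int r, - x - 1) \<in> vertices n (unit_of Lower (y, s)) \<longleftrightarrow>
      (x = y \<and> r = s) \<or> (x = y + 1 \<and> r = s) \<or> (x = y \<and> s = Suc r) \<or> (x = y + 1 \<and> r = Suc s)"
    "(x + 2 - int r, - x - 2) \<in> vertices n (unit_of Lower (y, s)) \<longleftrightarrow>
      (y = x + 1 \<and> r = s) \<or> (x = y \<and> r = s) \<or> (y = x + 1 \<and> s = Suc r) \<or> (x = y \<and> r = Suc s)"
  unfolding vertices_Lower prod.inject using assms by presburger+

text \<open>The units that meet a given one in a left or right vertex of either are those in the six
  directions of the triangulated strip. Units that only meet top against bottom are not
  adjacent.\<close>

lemma half_adjacent:
  assumes "snd u \<le> n" "snd w \<le> n"
  shows "adjacent n (unit_of h u) (unit_of h w) \<longleftrightarrow> u = w \<or> cell_adj n u w"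
proof -
  obtain x r y s where u: "u = (x, r)" "w = (y, s)" by (cases u; cases w)
  have rs: "r \<le> n" "s \<le> n" using assms by (simp_all add: u)
  have a: "cell_adj n u w \<longleftrightarrow> (s = r \<and> y = x + 1) \<or> (r = s \<and> x = y + 1) \<or> (r = Suc s \<and> y = x) \<or> (s = Suc r \<and> x = y)
      \<or> (s = Suc r \<and> y = x + 1) \<or> (r = Suc s \<and> x = y + 1)"
    using assms by (auto simp: u cell_adj_def arc_def)
  show ?thesis
  proof (cases h)
    case Upper
    have "adjacent n (unit_of h u) (unit_of h w) \<longleftrightarrow>
      ((x, int r - x) \<in> vertices n (unit_of Upper (y, s)) \<or> (x + 1, int r - x - 1) \<in> vertices n (unit_of Upper (y, s)))
      \<or> ((y, int s - y) \<in> vertices n (unit_of Upper (x, r)) \<or> (y + 1, int s - y - 1) \<in> vertices n (unit_of Upper (x, r)))"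
      unfolding adjacent_def Upper u by (simp add: left_vertex_def right_vertex_def)
    then show ?thesis unfolding vertices_Upper_iff[OF rs] vertices_Upper_iff[OF rs(2,1)] a unfolding u prod.inject by (smt (verit))
  next
    case Lower
    have "adjacent n (unit_of h u) (unit_of h w) \<longleftrightarrow>
      ((x + 1 - int r, - x - 1) \<in> vertices n (unit_of Lower (y, s)) \<or> (x + 2 - int r, - x - 2) \<in> vertices n (unit_of Lower (y, s)))
      \<or> ((y + 1 - int s, - y - 1) \<in> vertices n (unit_of Lower (x, r)) \<or> (y + 2 - int s, - y - 2) \<in> vertices n (unit_of Lower (x, r)))"
      unfolding adjacent_def Lower u by (simp add: left_vertex_def right_vertex_def algebra_simps)
    then show ?thesis unfolding vertices_Lower_iff[OF rs] vertices_Lower_iff[OF rs(2,1)] a unfolding u prod.inject by (smt (verit))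
  qed
qed

lemma comp_of_row: "v \<in> comp_of n S u \<Longrightarrow> snd u \<le> n \<Longrightarrow> snd v \<le> n"
  by (induction rule: comp_of_induct) (auto simp: cell_adj_def arc_def)

lemma cnt_eqI:
  assumes "dec l f" "k \<le> l" "k < l \<Longrightarrow> f k \<le> x" "0 < k \<Longrightarrow> x < f (k - 1)"
  shows "cnt l f x = k"
proof -
  have "cnt l f x \<le> k"
    using cnt_iff[OF assms(1), of k x] cnt_le[of l f x] assms(2,3) by (cases "k < l") auto
  moreover have "k \<le> cnt l f x"
    using cnt_iff[OF assms(1), of "k - 1" x] assms(2,4) by (cases k) auto
  ultimately show ?thesis by simp
qed

lemma prod_neg_one_card:
  assumes "finite M"
  shows "(\<Prod>i\<in>M. if P i then -1 else 1 :: int) = (if even (card {i \<in> M. P i}) then 1 else -1)"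
proof -
  have "(\<Prod>i\<in>M. if P i then -1 else 1 :: int) = (\<Prod>i\<in>{i \<in> M. P i}. -1)"
    by (rule prod.inter_filter[symmetric]) (rule assms)
  then show ?thesis by (simp add: minus_one_power_iff)
qed

section \<open>Odd regions\<close>

context skew_paths
begin

section \<open>Regions as components of cells\<close>

context
  fixes B A :: "nat \<Rightarrow> nat \<Rightarrow> int"
  notes One_nat_def [simp del]
  assumes y: "(B, A) \<in> YT"
begin

abbreviation cf :: conf where "cf \<equiv> conf_of (B, A)"
abbreviation pp :: "nat \<Rightarrow> path" where "pp \<equiv> paths_of (B, A)"
abbreviation low_cells :: "cell set" where "low_cells \<equiv> {u. depth cf u \<le> 0}"

lemma BA: "B \<in> BC" "A \<in> AC"
  using y by (auto simp: YT_def)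

lemma decs: "r \<le> n \<Longrightarrow> dec l (B r)" "r \<le> n \<Longrightarrow> dec l (A r)"
  using BA chain_facts(1) unfolding BC_def AC_def by blast+

lemma mt: "matched l (B 0) (A 0)"
  using y by (simp add: YT_matched)

lemma depth_nonneg: "0 \<le> depth cf (x, 0)"
  using matched_iff[OF BA] mt by blast

text \<open>The duals make the condition the same pair of inequalities between counts in both
  halves. So a cell of depth at most 0 is a \<open>II\<close>-unit in either half, with every index
  between the two counts.\<close>

lemma II_at_iff:
  assumes r: "r \<le> n" and i: "i \<le> l"
  shows "II_at n l pp (unit_of h (x, r)) i \<longleftrightarrow> cnt l (B r) x \<le> i \<and> i \<le> cnt l (A r) x"
proof -
  have b: "cnt l (B r) x \<le> i \<longleftrightarrow> i = l \<or> B r i \<le> x"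
    using cnt_iff[OF decs(1)[OF r], of i x] cnt_le[of l "B r" x] i by (cases "i = l") auto
  have a: "i \<le> cnt l (A r) x \<longleftrightarrow> i = 0 \<or> x < A r (i - 1)"
    using cnt_iff[OF decs(2)[OF r], of "i - 1" x] i by (cases i) auto
  have be: "beta n l pp (i + 1) (int r) = (if i = l then - \<infinity> else ereal (B r i - r / 2))"
  proof (cases "i = l")
    case False
    then have il: "i < l" using i by simp
    show ?thesis unfolding Suc_eq_plus1[symmetric]
      using pos_at_upper[OF YT_col[OF y il] r] paths_of_Suc[OF il, of "(B, A)"] False
      by (simp add: beta_def colB_def)
  qed (simp add: beta_def)
  have al: "alpha n pp i (- int r) = (if i = 0 then \<infinity> else ereal (A r (i - 1) + 1 - r / 2))"
  proof (cases i)
    case (Suc j)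
    then have jl: "j < l" using i by simp
    show ?thesis using pos_at_lower[OF YT_col[OF y jl] r] paths_of_Suc[OF jl, of "(B, A)"] Suc
      by (simp add: alpha_def colA_def)
  qed (simp add: alpha_def)
  have real_lt: "real_of_int k + 1 \<le> real_of_int m \<longleftrightarrow> k < m" for k m by linarith
  show ?thesis
  proof (cases h)
    case Upper
    have "II_at n l pp (unit_of h (x, r)) i \<longleftrightarrow> beta n l pp (i + 1) (int r) \<le> ereal (x - r / 2)
      \<and> ereal (x + 1 - r / 2) \<le> alpha n pp i (- int r) - 1"
      unfolding Upper by (simp add: ht_def hp_def left_vertex_def right_vertex_def alpha_dual_def field_simps)
    also have "\<dots> \<longleftrightarrow> (i = l \<or> B r i \<le> x) \<and> (i = 0 \<or> x < A r (i - 1))"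
      unfolding be al by (auto simp: one_ereal_def)
    finally show ?thesis unfolding a b .
  next
    case Lower
    have "II_at n l pp (unit_of h (x, r)) i \<longleftrightarrow> beta n l pp (i + 1) (int r) + 1 \<le> ereal (x + 1 - r / 2)
      \<and> ereal (x + 2 - r / 2) \<le> alpha n pp i (- int r)"
      unfolding Lower by (simp add: ht_def hp_def left_vertex_def right_vertex_def beta_dual_def field_simps)
    also have "\<dots> \<longleftrightarrow> (i = l \<or> B r i \<le> x) \<and> (i = 0 \<or> x < A r (i - 1))"
      unfolding be al by (auto simp: one_ereal_def)
    finally show ?thesis unfolding a b .
  qed
qed

lemma II_units_iff: "unit_of h u \<in> II_units n l pp \<longleftrightarrow> snd u \<le> n \<and> u \<in> low_cells"
proof (cases u)
  case (Pair x r)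
  have "(\<exists>i\<le>l. II_at n l pp (unit_of h (x, r)) i) \<longleftrightarrow> depth cf (x, r) \<le> 0" if r: "r \<le> n"
  proof
    assume "\<exists>i\<le>l. II_at n l pp (unit_of h (x, r)) i"
    then show "depth cf (x, r) \<le> 0" using II_at_iff[OF r] depth_row[OF r, of B A x] by fastforce
  next
    assume "depth cf (x, r) \<le> 0"
    then have "cnt l (B r) x \<le> cnt l (A r) x" using depth_row[OF r, of B A x] by simp
    then show "\<exists>i\<le>l. II_at n l pp (unit_of h (x, r)) i"
      using II_at_iff[OF r cnt_le[of l "B r" x]] cnt_le[of l "B r" x] by blast
  qed
  then show ?thesis unfolding Pair II_units_def by (auto simp: is_unit_of)
qed

definition edge_cell :: "cell \<Rightarrow> bool" where
  "edge_cell u \<longleftrightarrow> cnt l (B (snd u)) (fst u) = 0 \<or> cnt l (A (snd u)) (fst u) = l \<or> snd u = n"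

lemma boundary_iff:
  assumes u: "snd u \<le> n" "u \<in> low_cells"
  shows "unit_of h u \<in> boundary_II_units n l pp \<longleftrightarrow> edge_cell u"
proof -
  obtain x r where xr: "u = (x, r)" by (cases u)
  have r: "r \<le> n" using u by (simp add: xr)
  have le: "cnt l (B r) x \<le> cnt l (A r) x" using u(2) depth_row[OF r, of B A x] by (simp add: xr)
  have "(\<exists>i\<le>l. II_at n l pp (unit_of h (x, r)) i \<and> (i = 0 \<or> i = l \<or> \<bar>ht (snd (unit_of h (x, r)))\<bar> = int n))
    \<longleftrightarrow> (\<exists>i\<le>l. cnt l (B r) x \<le> i \<and> i \<le> cnt l (A r) x \<and> (i = 0 \<or> i = l \<or> r = n))"
    unfolding ht_unit_of using II_at_iff[OF r] by auto
  also have "\<dots> \<longleftrightarrow> edge_cell u"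
  proof
    assume "\<exists>i\<le>l. cnt l (B r) x \<le> i \<and> i \<le> cnt l (A r) x \<and> (i = 0 \<or> i = l \<or> r = n)"
    then show "edge_cell u" using cnt_le[of l "A r" x] unfolding edge_cell_def xr by auto
  next
    assume "edge_cell u"
    then consider "cnt l (B r) x = 0" | "cnt l (A r) x = l" | "r = n" unfolding edge_cell_def xr by auto
    then show "\<exists>i\<le>l. cnt l (B r) x \<le> i \<and> i \<le> cnt l (A r) x \<and> (i = 0 \<or> i = l \<or> r = n)"
    proof cases
      case 1 then show ?thesis by (intro exI[of _ 0]) simp
    next
      case 2 then show ?thesis using cnt_le[of l "B r" x] by (intro exI[of _ l]) simp
    next
      case 3 then show ?thesis using le cnt_le[of l "B r" x] by blast
    qed
  qed
  finally show ?thesis unfolding boundary_II_units_def xr by (simp add: is_unit_of r)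
qed

abbreviation unit_rel :: "(zunit \<times> zunit) set" where
  "unit_rel \<equiv> {(U, V). U \<in> II_units n l pp \<and> V \<in> II_units n l pp \<and> adjacent n U V}"

text \<open>Adjacency stays within a half, so each half contains its own copy of every
  component.\<close>

lemma unit_component:
  assumes u: "snd u \<le> n" "u \<in> low_cells"
  shows "unit_rel\<^sup>* `` {unit_of h u} = unit_of h ` comp_of n low_cells u"
proof (intro equalityI subsetI)
  fix U assume "U \<in> unit_rel\<^sup>* `` {unit_of h u}"
  then have "(unit_of h u, U) \<in> unit_rel\<^sup>*" by simp
  then show "U \<in> unit_of h ` comp_of n low_cells u"
  proof (induction rule: rtrancl_induct)
    case (step U V)
    then obtain w where w: "U = unit_of h w" "w \<in> comp_of n low_cells u" by blast
    have VI: "V \<in> II_units n l pp" "adjacent n U V" using step(2) by auto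
    then obtain h' v where v: "V = unit_of h' v" by (auto simp: II_units_def elim: is_unit_cases)
    have "fst U = fst V" using VI(2) by (simp add: adjacent_def)
    then have hh: "h' = h" by (simp add: w v)
    have vl: "snd v \<le> n" "v \<in> low_cells" using VI(1) unfolding v II_units_iff by auto
    have "w = v \<or> cell_adj n w v"
      using VI(2) half_adjacent[OF comp_of_row[OF w(2) u(1)] vl(1), of h] by (simp add: w v hh)
    then have "v \<in> comp_of n low_cells u" using w(2) comp_of_step[OF w(2) u(2) vl(2)] by blast
    then show ?case by (simp add: v hh)
  qed simp
next
  fix U assume "U \<in> unit_of h ` comp_of n low_cells u"
  then obtain w where w: "U = unit_of h w" "w \<in> comp_of n low_cells u" by blast
  have "(unit_of h u, unit_of h w) \<in> unit_rel\<^sup>*"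
    using w(2)
  proof (induction rule: comp_of_induct)
    case (step v w)
    have v: "snd v \<le> n" by (rule comp_of_row[OF step.hyps(1) u(1)])
    have ww: "snd w \<le> n" using step.hyps(4) by (auto simp: cell_adj_def arc_def)
    have "(unit_of h v, unit_of h w) \<in> unit_rel"
      using step.hyps(2-4) half_adjacent[OF v ww, of h] v ww by (simp add: II_units_iff)
    then show ?case using step.IH by (meson rtrancl.rtrancl_into_rtrancl)
  qed simp
  then show "U \<in> unit_rel\<^sup>* `` {unit_of h u}" by (simp add: w)
qed

text \<open>If no upper path lies to the right of a cell in its row, all cells further right have
  depth at most 0 and connect it with the outside of the window; similarly on the left with the
  lower paths. So boundary units and the border of the window single out the same
  components.\<close>

lemma bdry_iff:
  assumes x: "(x, 0) \<in> low_cells"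
  defines "C \<equiv> comp_of n low_cells (x, 0)"
  shows "bdry C \<longleftrightarrow> (\<exists>u\<in>C. edge_cell u)"
proof
  have row: "snd u \<le> n" if "u \<in> C" for u using that comp_of_row[of u n low_cells "(x, 0)"] by (simp add: C_def)
  {
    assume "bdry C"
    then obtain u where u: "u \<in> C" "snd u = n \<or> W \<le> \<bar>fst u\<bar>" by (auto simp: bdry_def)
    obtain z r where zr: "u = (z, r)" by (cases u)
    have r: "r \<le> n" using row[OF u(1)] by (simp add: zr)
    consider "r = n" | "W \<le> z" | "z \<le> - W" using u(2) zr by fastforce
    then have "edge_cell u"
    proof cases
      case 2
      have "cnt l (B r) z = 0" by (rule cnt_eqI[OF decs(1)[OF r]]) (use BC_window[OF BA(1) _ r, of 0] 2 in auto)
      then show ?thesis by (simp add: edge_cell_def zr)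
    next
      case 3
      have "cnt l (A r) z = l"
        by (rule cnt_eqI[OF decs(2)[OF r]]) (use AC_window[OF BA(2) _ r, of "l - 1"] 3 W3 in auto)
      then show ?thesis by (simp add: edge_cell_def zr)
    qed (simp add: edge_cell_def zr)
    then show "\<exists>u\<in>C. edge_cell u" using u(1) by blast
  }
  assume "\<exists>u\<in>C. edge_cell u"
  then obtain z r where zr: "(z, r) \<in> C" "edge_cell (z, r)" by auto
  have r: "r \<le> n" using row[OF zr(1)] by simp
  have step: "v \<in> C" if "w \<in> C" "v \<in> low_cells" "cell_adj n w v" for v w
    using that comp_of_step[of w n low_cells "(x, 0)" v] x unfolding C_def by blast
  consider "r = n" | "cnt l (B r) z = 0" | "cnt l (A r) z = l" using zr(2) by (auto simp: edge_cell_def)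
  then show "bdry C"
  proof cases
    case 1
    then show ?thesis using zr(1) unfolding bdry_def by force
  next
    case 2
    have "(z', r) \<in> C" if "z \<le> z'" for z'
      using that
    proof (induction z' rule: int_ge_induct)
      case base
      show ?case by (rule zr(1))
    next
      case (step k)
      have "cnt l (B r) (k + 1) = 0" using cnt_mono[of z "k + 1" l "B r"] 2 step(1) by simp
      then have "(k + 1, r) \<in> low_cells" using depth_row[OF r, of B A "k + 1"] by simp
      then show ?case using \<open>\<And>v w. w \<in> C \<Longrightarrow> v \<in> low_cells \<Longrightarrow> cell_adj n w v \<Longrightarrow> v \<in> C\<close>[OF step(2)] r
        by (auto simp: cell_adj_def arc_def)
    qed
    from this[of "max z W"] show ?thesis unfolding bdry_def by (intro bexI[of _ "(max z W, r)"]) auto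
  next
    case 3
    have "(z', r) \<in> C" if "z' \<le> z" for z'
      using that
    proof (induction z' rule: int_le_induct)
      case base
      show ?case by (rule zr(1))
    next
      case (step k)
      have "cnt l (A r) (k - 1) = l" using cnt_mono[of "k - 1" z l "A r"] cnt_le[of l "A r" "k - 1"] 3 step(1) by simp
      then have "(k - 1, r) \<in> low_cells" using depth_row[OF r, of B A "k - 1"] cnt_le[of l "B r" "k - 1"] by simp
      then show ?case using \<open>\<And>v w. w \<in> C \<Longrightarrow> v \<in> low_cells \<Longrightarrow> cell_adj n w v \<Longrightarrow> v \<in> C\<close>[OF step(2)] r
        by (auto simp: cell_adj_def arc_def)
    qed
    from this[of "min z (- W)"] show ?thesis unfolding bdry_def by (intro bexI[of _ "(min z (- W), r)"]) auto
  qed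
qed

text \<open>Index \<open>i\<close> is that of the hole between paths \<open>i\<close> and
  \<open>i + 1\<close>. As columns are counted from 0, its right end comes from the lower half of
  column \<open>i - 1\<close> and its left end from the upper half of column
  \<open>i\<close>.\<close>

definition gaps :: "cell set \<Rightarrow> nat set" where
  "gaps C = {i. 1 \<le> i \<and> i < l \<and> B 0 i < A 0 (i - 1) \<and> (B 0 i, 0) \<in> C}"

lemma gap_counts:
  assumes i: "1 \<le> i" "i < l" "B 0 i < A 0 (i - 1)"
  shows "cnt l (B 0) (A 0 (i - 1)) = i" "cnt l (A 0) (A 0 (i - 1)) = i - 1"
    "cnt l (B 0) (B 0 i - 1) = Suc i" "cnt l (A 0) (B 0 i - 1) = i"
proof -
  have m: "A 0 k + 1 \<le> B 0 k" if "k < l" for k using mt that by (simp add: matched_def)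
  have dB: "B 0 k < B 0 j" and dA: "A 0 k < A 0 j" if "j < k" "k < l" for j k
    using decs[of 0] that by (auto simp: dec_def)
  show "cnt l (B 0) (A 0 (i - 1)) = i"
    by (rule cnt_eqI[OF decs(1)]) (use i m[OF less_imp_diff_less[OF i(2), of 1]] in auto)
  show "cnt l (A 0) (A 0 (i - 1)) = i - 1"
    by (rule cnt_eqI[OF decs(2)]) (use i dA[of "i - 1 - 1" "i - 1"] in auto)
  show "cnt l (B 0) (B 0 i - 1) = Suc i"
    by (rule cnt_eqI[OF decs(1)]) (use i dB[of i "Suc i"] in auto)
  show "cnt l (A 0) (B 0 i - 1) = i"
    by (rule cnt_eqI[OF decs(2)]) (use i m[of i] in auto)
qed

lemma gap_depth:
  assumes i: "1 \<le> i" "i < l" "B 0 i < A 0 (i - 1)"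
  shows "depth cf (A 0 (i - 1), 0) = 1" "depth cf (B 0 i - 1, 0) = 1"
  using gap_counts[OF i] i(1) by (simp_all add: depth_cnt)

lemma gap_low:
  assumes i: "1 \<le> i" "i < l" and z: "B 0 i \<le> z" "z < A 0 (i - 1)"
  shows "(z, 0) \<in> low_cells"
proof -
  have "\<not> i < cnt l (B 0) z" using cnt_iff[OF decs(1)[of 0] i(2), of z] z by simp
  moreover have "i - 1 < cnt l (A 0) z" using cnt_iff[OF decs(2)[of 0], of "i - 1" z] i z by simp
  ultimately show ?thesis using depth_row[of 0 B A z] by simp
qed

context
  fixes x :: int and C :: "cell set"
  assumes x: "(x, 0) \<in> low_cells" and C: "C = comp_of n low_cells (x, 0)" and nb: "\<not> bdry C"
begin

lemma C_step: "w \<in> C \<Longrightarrow> v \<in> low_cells \<Longrightarrow> cell_adj n w v \<Longrightarrow> v \<in> C"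
  using comp_of_step[of w n low_cells "(x, 0)" v] x unfolding C by blast

lemma C_low: "C \<subseteq> low_cells"
  using comp_of_subset[OF x] unfolding C by blast

lemma C_interior: "u \<in> C \<Longrightarrow> \<not> edge_cell u"
  using bdry_iff[OF x] nb unfolding C by blast

lemma gap_connected:
  assumes i: "1 \<le> i" "i < l" and z: "B 0 i \<le> z" "z < A 0 (i - 1)"
  shows "(z, 0) \<in> C \<longleftrightarrow> (B 0 i, 0) \<in> C"
  using z
proof (induction z rule: int_ge_induct)
  case (step k)
  have "(k + 1, 0) \<in> low_cells" "(k, 0) \<in> low_cells" using gap_low[OF i] step(1,3) by auto
  then have "(k + 1, 0) \<in> C \<longleftrightarrow> (k, 0) \<in> C"
    using C_step[of "(k, 0)" "(k + 1, 0)"] C_step[of "(k + 1, 0)" "(k, 0)"] by (auto simp: cell_adj_def arc_def)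
  then show ?case using step by simp
qed simp

text \<open>The depth is 0 on the bottom of the component and rises at \<open>z\<close>, so a dual
  lower path ends there. The component is not a boundary component, which provides the upper path at
  the other end of the run.\<close>

lemma right_edges: "{z \<in> {-W..W}. (z - 1, 0) \<in> C \<and> (z, 0) \<notin> C} = (\<lambda>i. A 0 (i - 1)) ` gaps C"
proof (intro equalityI subsetI)
  fix z assume "z \<in> {z \<in> {-W..W}. (z - 1, 0) \<in> C \<and> (z, 0) \<notin> C}"
  then have z: "(z - 1, 0) \<in> C" "(z, 0) \<notin> C" by auto
  have "depth cf (z - 1, 0) \<le> 0" using C_low z(1) by auto
  then have e: "cnt l (A 0) (z - 1) = cnt l (B 0) (z - 1)" using depth_nonneg[of "z - 1"] depth_row[of 0 B A "z - 1"] by simp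
  have "(z, 0) \<notin> low_cells" using C_step[OF z(1), of "(z, 0)"] z(2) by (auto simp: cell_adj_def arc_def)
  then have lt: "cnt l (A 0) z < cnt l (B 0) z" using depth_row[of 0 B A z] by simp
  have "cnt l (B 0) z \<le> cnt l (B 0) (z - 1)" by (rule cnt_mono) simp
  then have s: "cnt l (A 0) (z - 1) = Suc (cnt l (A 0) z)" "A 0 (cnt l (A 0) z) = z"
    using cnt_step[OF decs(2)[of 0], of z] e lt by auto
  define i where "i = Suc (cnt l (A 0) z)"
  have "cnt l (A 0) (z - 1) \<noteq> l" using C_interior[OF z(1)] by (simp add: edge_cell_def)
  then have il: "i < l" using s(1) cnt_le[of l "A 0" "z - 1"] by (simp add: i_def)
  have "\<not> i < cnt l (B 0) (z - 1)" using e s by (simp add: i_def)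
  then have B: "B 0 i \<le> z - 1" using cnt_iff[OF decs(1)[of 0] il, of "z - 1"] by simp
  have a: "A 0 (i - 1) = z" using s by (simp add: i_def)
  have "(B 0 i, 0) \<in> C" using gap_connected[of i "z - 1"] il B a z(1) by (simp add: i_def)
  then have "i \<in> gaps C" using il B a by (simp add: gaps_def i_def)
  then show "z \<in> (\<lambda>i. A 0 (i - 1)) ` gaps C" using a by blast
next
  fix z assume "z \<in> (\<lambda>i. A 0 (i - 1)) ` gaps C"
  then obtain i where i: "1 \<le> i" "i < l" "B 0 i < A 0 (i - 1)" "(B 0 i, 0) \<in> C" "z = A 0 (i - 1)" by (auto simp: gaps_def)
  have "(z - 1, 0) \<in> C" using gap_connected[OF i(1,2), of "z - 1"] i by simp
  moreover have "(z, 0) \<notin> C" using gap_depth(1)[OF i(1-3)] C_low i(5) by auto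
  ultimately show "z \<in> {z \<in> {-W..W}. (z - 1, 0) \<in> C \<and> (z, 0) \<notin> C}"
    using AC_window[OF BA(2) less_imp_diff_less[OF i(2), of 1], of 0] i by auto
qed

lemma left_edges: "{z \<in> {-W..W}. (z - 1, 0) \<notin> C \<and> (z, 0) \<in> C} = (\<lambda>i. B 0 i) ` gaps C"
proof (intro equalityI subsetI)
  fix z assume "z \<in> {z \<in> {-W..W}. (z - 1, 0) \<notin> C \<and> (z, 0) \<in> C}"
  then have z: "(z - 1, 0) \<notin> C" "(z, 0) \<in> C" by auto
  have "depth cf (z, 0) \<le> 0" using C_low z(2) by auto
  then have e: "cnt l (A 0) z = cnt l (B 0) z" using depth_nonneg[of z] depth_row[of 0 B A z] by simp
  have "(z - 1, 0) \<notin> low_cells" using C_step[OF z(2), of "(z - 1, 0)"] z(1) by (auto simp: cell_adj_def arc_def)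
  then have lt: "cnt l (A 0) (z - 1) < cnt l (B 0) (z - 1)" using depth_row[of 0 B A "z - 1"] by simp
  have "cnt l (A 0) z \<le> cnt l (A 0) (z - 1)" by (rule cnt_mono) simp
  then have s: "cnt l (B 0) z < l" "B 0 (cnt l (B 0) z) = z"
    using cnt_step[OF decs(1)[of 0], of z] e lt by auto
  define i where "i = cnt l (B 0) z"
  have "cnt l (B 0) z \<noteq> 0" using C_interior[OF z(2)] by (simp add: edge_cell_def)
  then have i1: "1 \<le> i" by (simp add: i_def)
  have "z < A 0 (i - 1)" by (rule cntD[OF decs(2)[of 0]]) (use e i1 in \<open>auto simp: i_def\<close>)
  then have "i \<in> gaps C" using i1 s z(2) by (simp add: gaps_def i_def)
  then show "z \<in> (\<lambda>i. B 0 i) ` gaps C" using s(2) unfolding i_def by (metis imageI)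
next
  fix z assume "z \<in> (\<lambda>i. B 0 i) ` gaps C"
  then obtain i where i: "1 \<le> i" "i < l" "B 0 i < A 0 (i - 1)" "(B 0 i, 0) \<in> C" "z = B 0 i" by (auto simp: gaps_def)
  have "(z - 1, 0) \<notin> C" using gap_depth(2)[OF i(1-3)] C_low i(5) by auto
  then show "z \<in> {z \<in> {-W..W}. (z - 1, 0) \<notin> C \<and> (z, 0) \<in> C}"
    using BC_window[OF BA(1), of i 0] i by auto
qed

lemma finite_gaps: "finite (gaps C)"
  by (rule finite_subset[of _ "{..<l}"]) (auto simp: gaps_def)

text \<open>The colours at the two ends of a gap multiply to -1 exactly when
  \<open>A 0 (i - 1) - B 0 i\<close> is odd. The hole has length
  \<open>A 0 (i - 1) + 1 - B 0 i\<close>, so these are the even holes.\<close>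

lemma th_gaps: "th cf C = (if even (card {i \<in> gaps C. odd (A 0 (i - 1) - B 0 i)}) then 1 else -1)"
proof -
  have injA: "inj_on (\<lambda>i. A 0 (i - 1)) (gaps C)"
  proof (rule inj_onI)
    fix i j assume ij: "i \<in> gaps C" "j \<in> gaps C" "A 0 (i - 1) = A 0 (j - 1)"
    then have "i - 1 < l" "j - 1 < l" by (auto simp: gaps_def)
    then have "i - 1 = j - 1" using decs(2)[of 0] ij(3) unfolding dec_def by (metis less_irrefl linorder_neqE_nat zero_le)
    then show "i = j" using ij by (auto simp: gaps_def)
  qed
  have injB: "inj_on (\<lambda>i. B 0 i) (gaps C)"
  proof (rule inj_onI)
    fix i j assume ij: "i \<in> gaps C" "j \<in> gaps C" "B 0 i = B 0 j"
    then have "i < l" "j < l" by (auto simp: gaps_def)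
    then show "i = j" using decs(1)[of 0] ij(3) unfolding dec_def by (metis less_irrefl linorder_neqE_nat zero_le)
  qed
  have k: "kap cf (A 0 (i - 1)) * kap cf (B 0 i - 1) = (if odd (A 0 (i - 1) - B 0 i) then -1 else 1)" if i: "i \<in> gaps C" for i
  proof -
    have g: "1 \<le> i" "i < l" "B 0 i < A 0 (i - 1)" using i by (auto simp: gaps_def)
    have "kap cf (A 0 (i - 1)) = sg (B 0 (i - 1)) * sg (int i)"
      using g(1) by (simp add: kap_def Qf_end_sum[OF BA] matched_end_sum[OF decs mt] conf_of_cnt gap_counts[OF g])
    moreover have "kap cf (B 0 i - 1) = sg (B 0 i) * sg (int (Suc i))"
      using g(1) by (simp add: kap_def Qf_end_sum[OF BA] matched_end_sum[OF decs mt] conf_of_cnt gap_counts[OF g])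
    moreover have "sg (B 0 (i - 1)) = - sg (A 0 (i - 1))" by (rule matched_pair[OF decs mt]) (use g in auto)
    ultimately show ?thesis by (auto simp: sg_def)
  qed
  have "th cf C = (\<Prod>z\<in>{-W..W}. (if (z - 1, 0) \<in> C \<and> (z, 0) \<notin> C then kap cf z else 1)
      * (if (z - 1, 0) \<notin> C \<and> (z, 0) \<in> C then kap cf (z - 1) else 1))"
    unfolding th_def by (rule prod.cong) auto
  also have "\<dots> = (\<Prod>z\<in>{z \<in> {-W..W}. (z - 1, 0) \<in> C \<and> (z, 0) \<notin> C}. kap cf z)
      * (\<Prod>z\<in>{z \<in> {-W..W}. (z - 1, 0) \<notin> C \<and> (z, 0) \<in> C}. kap cf (z - 1))"
    unfolding prod.distrib by (subst (1 2) prod.inter_filter) simp_all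
  also have "\<dots> = (\<Prod>i\<in>gaps C. kap cf (A 0 (i - 1)) * kap cf (B 0 i - 1))"
    unfolding right_edges left_edges prod.distrib by (simp add: prod.reindex[OF injA] prod.reindex[OF injB])
  also have "\<dots> = (\<Prod>i\<in>gaps C. if odd (A 0 (i - 1) - B 0 i) then -1 else 1)"
    by (rule prod.cong) (use k in auto)
  also have "\<dots> = (if even (card {i \<in> gaps C. odd (A 0 (i - 1) - B 0 i)}) then 1 else -1)"
    by (rule prod_neg_one_card[OF finite_gaps])
  finally show ?thesis .
qed

lemma even_hole_iff:
  assumes i: "1 \<le> i" "i < l"
  shows "even_hole n pp i \<longleftrightarrow> B 0 i < A 0 (i - 1) \<and> odd (A 0 (i - 1) - B 0 i)"
proof -
  obtain j where j: "i = Suc j" "j < l" using i by (cases i) auto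
  have e: "pos_at (lower_path n (pp i)) 0 - pos_at (upper_path n (pp (i + 1))) 0 = real_of_int (A 0 (i - 1) + 1 - B 0 i)"
    unfolding Suc_eq_plus1[symmetric]
    using pos_at_lower[OF YT_col[OF y j(2)], of 0] pos_at_upper[OF YT_col[OF y i(2)], of 0]
      paths_of_Suc[OF j(2), of "(B, A)"] paths_of_Suc[OF i(2), of "(B, A)"]
    by (simp add: j(1) colA_def colB_def)
  have "even_hole n pp i \<longleftrightarrow> 0 < A 0 (i - 1) + 1 - B 0 i \<and> even (A 0 (i - 1) + 1 - B 0 i)"
    unfolding even_hole_def e of_int_eq_iff by blast
  also have "\<dots> \<longleftrightarrow> B 0 i < A 0 (i - 1) \<and> odd (A 0 (i - 1) - B 0 i)" by presburger
  finally show ?thesis .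
qed

text \<open>Three units of a half have the endpoint as a vertex: the last one of the gap, its
  neighbour beyond the gap, which has depth 1 and lies outside the component, and one in row 1,
  which is adjacent to the first.\<close>

lemma hole_meets_iff:
  assumes i: "1 \<le> i" "i < l" "B 0 i < A 0 (i - 1)"
  shows "hole_meets n pp i (unit_of h ` C) \<longleftrightarrow> (B 0 i, 0) \<in> C"
proof -
  obtain j where j: "i = Suc j" "j < l" using i by (cases i) auto
  have fin: "finish (lower_path n (pp i)) = (A 0 (i - 1) + 1, - A 0 (i - 1) - 1)"
    using finish_lower[OF YT_col[OF y j(2)]] paths_of_Suc[OF j(2), of "(B, A)"] by (simp add: j(1) colA_def)
  have st: "start (upper_path n (pp (i + 1))) = (B 0 i, - B 0 i)"
    unfolding Suc_eq_plus1[symmetric] using start_upper[OF YT_col[OF y i(2)]] paths_of_Suc[OF i(2), of "(B, A)"] by (simp add: colB_def)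
  have nA: "(A 0 (i - 1), 0) \<notin> C" and nB: "(B 0 i - 1, 0) \<notin> C" using gap_depth[OF i] C_low by auto
  have lowB: "(B 0 i, 0) \<in> low_cells" and lowA: "(A 0 (i - 1) - 1, 0) \<in> low_cells" using gap_low[OF i(1,2)] i(3) by auto
  have conA: "(A 0 (i - 1) - 1, 0) \<in> C \<longleftrightarrow> (B 0 i, 0) \<in> C" using gap_connected[OF i(1,2), of "A 0 (i - 1) - 1"] i(3) by simp
  show ?thesis
  proof (cases h)
    case Upper
    have "hole_meets n pp i (unit_of h ` C) \<longleftrightarrow> (\<exists>u\<in>C. (B 0 i, - B 0 i) \<in> vertices n (unit_of Upper u))"
      unfolding hole_meets_def fin st Upper by auto
    also have "\<dots> \<longleftrightarrow> (B 0 i, 0) \<in> C"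
    proof
      assume "\<exists>u\<in>C. (B 0 i, - B 0 i) \<in> vertices n (unit_of Upper u)"
      then obtain z r where z: "(z, r) \<in> C" "(B 0 i, - B 0 i) \<in> vertices n (unit_of Upper (z, r))" by auto
      then have "(z = B 0 i \<and> r = 0) \<or> (z = B 0 i - 1 \<and> r = 0) \<or> (z = B 0 i \<and> r = 1)"
        unfolding vertices_Upper by auto
      then show "(B 0 i, 0) \<in> C"
        using z(1) nB C_step[OF z(1) lowB] n0 by (auto simp: cell_adj_def arc_def)
    next
      assume "(B 0 i, 0) \<in> C"
      then show "\<exists>u\<in>C. (B 0 i, - B 0 i) \<in> vertices n (unit_of Upper u)"
        by (rule bexI[rotated]) (simp only: vertices_Upper, simp)
    qed
    finally show ?thesis .
  next
    case Lower
    have "hole_meets n pp i (unit_of h ` C) \<longleftrightarrow> (\<exists>u\<in>C. (A 0 (i - 1) + 1, - A 0 (i - 1) - 1) \<in> vertices n (unit_of Lower u))"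
      unfolding hole_meets_def fin st Lower by auto
    also have "\<dots> \<longleftrightarrow> (A 0 (i - 1) - 1, 0) \<in> C"
    proof
      assume "\<exists>u\<in>C. (A 0 (i - 1) + 1, - A 0 (i - 1) - 1) \<in> vertices n (unit_of Lower u)"
      then obtain z r where z: "(z, r) \<in> C" "(A 0 (i - 1) + 1, - A 0 (i - 1) - 1) \<in> vertices n (unit_of Lower (z, r))" by auto
      then have "(z = A 0 (i - 1) \<and> r = 0) \<or> (z = A 0 (i - 1) - 1 \<and> r = 0) \<or> (z = A 0 (i - 1) \<and> r = 1)"
        unfolding vertices_Lower by auto
      then show "(A 0 (i - 1) - 1, 0) \<in> C"
        using z(1) nA C_step[OF z(1) lowA] n0 by (auto simp: cell_adj_def arc_def)
    next
      assume "(A 0 (i - 1) - 1, 0) \<in> C"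
      then show "\<exists>u\<in>C. (A 0 (i - 1) + 1, - A 0 (i - 1) - 1) \<in> vertices n (unit_of Lower u)"
        by (rule bexI[rotated]) (simp only: vertices_Lower, simp)
    qed
    finally show ?thesis unfolding conA .
  qed
qed

lemma holes_gaps:
  "{i. 1 \<le> i \<and> i < l \<and> even_hole n pp i \<and> hole_meets n pp i (unit_of h ` C)} = {i \<in> gaps C. odd (A 0 (i - 1) - B 0 i)}"
  using even_hole_iff hole_meets_iff unfolding gaps_def by blast

end

lemma region_cases:
  assumes "V \<in> II_regions n l pp"
  obtains h x where "(x, 0) \<in> low_cells" "\<not> bdry (comp_of n low_cells (x, 0))" "V = unit_of h ` comp_of n low_cells (x, 0)"
proof -
  obtain U where U: "U \<in> II_units n l pp" "V = unit_rel\<^sup>* `` {U}"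
    using assms unfolding II_regions_def II_components_def quotient_def by auto
  then obtain h u where u: "U = unit_of h u" by (auto simp: II_units_def elim: is_unit_cases)
  have ul: "snd u \<le> n" "u \<in> low_cells" using U(1) unfolding u II_units_iff by auto
  have V: "V = unit_of h ` comp_of n low_cells u" unfolding U(2) u by (rule unit_component[OF ul])
  obtain w where w: "w \<in> comp_of n low_cells u" "snd w = 0"
    using assms unfolding II_regions_def V by (auto simp: ht_unit_of)
  obtain x where x: "w = (x, 0)" using w(2) by (cases w) auto
  have e: "comp_of n low_cells (x, 0) = comp_of n low_cells u" using comp_of_eq[OF w(1)] x by simp
  have xl: "(x, 0) \<in> low_cells" using comp_of_subset[OF ul(2)] w(1) x by blast
  have "\<not> edge_cell v" if "v \<in> comp_of n low_cells (x, 0)" for v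
  proof -
    have "snd v \<le> n" "v \<in> low_cells" using comp_of_row[OF that] comp_of_subset[OF xl] that by auto
    moreover have "unit_of h v \<notin> boundary_II_units n l pp"
      using assms that unfolding II_regions_def V e by auto
    ultimately show ?thesis using boundary_iff by blast
  qed
  then have "\<not> bdry (comp_of n low_cells (x, 0))" using bdry_iff[OF xl] by blast
  then show ?thesis using that xl V e by simp
qed

lemma region_of:
  assumes x: "(x, 0) \<in> low_cells" and nb: "\<not> bdry (comp_of n low_cells (x, 0))"
  shows "unit_of h ` comp_of n low_cells (x, 0) \<in> II_regions n l pp"
proof -
  have "unit_of h (x, 0) \<in> II_units n l pp" using x by (simp add: II_units_iff)
  then have "unit_of h ` comp_of n low_cells (x, 0) \<in> II_components n l pp"
    unfolding II_components_def using unit_component[OF _ x, of h] by (auto simp: quotient_def)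
  moreover have "ht (snd (unit_of h (x, 0))) = 0" unfolding ht_unit_of by simp
  moreover have "unit_of h v \<notin> boundary_II_units n l pp" if "v \<in> comp_of n low_cells (x, 0)" for v
  proof -
    have "snd v \<le> n" "v \<in> low_cells" using comp_of_row[OF that] comp_of_subset[OF x] that by auto
    then show ?thesis using boundary_iff bdry_iff[OF x] nb that by blast
  qed
  ultimately show ?thesis unfolding II_regions_def by auto
qed

text \<open>A region is a copy, in one of the halves, of an inner component that reaches the bottom.
  Both copies meet the same even holes, so it is the sign of the component that decides.\<close>

theorem odd_region_iff: "(\<nexists>V. odd_II_region n l pp V) \<longleftrightarrow> even_low cf"
proof -
  have "(\<exists>V. odd_II_region n l pp V) \<longleftrightarrow>
    (\<exists>x. (x, 0) \<in> low_cells \<and> \<not> bdry (comp_of n low_cells (x, 0)) \<and> th cf (comp_of n low_cells (x, 0)) \<noteq> 1)"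
  proof
    assume "\<exists>V. odd_II_region n l pp V"
    then obtain V where V: "V \<in> II_regions n l pp" "odd (card {i. 1 \<le> i \<and> i < l \<and> even_hole n pp i \<and> hole_meets n pp i V})"
      by (auto simp: odd_II_region_def)
    obtain h x where x: "(x, 0) \<in> low_cells" "\<not> bdry (comp_of n low_cells (x, 0))" "V = unit_of h ` comp_of n low_cells (x, 0)"
      using region_cases[OF V(1)] by blast
    have "th cf (comp_of n low_cells (x, 0)) \<noteq> 1"
      using th_gaps[OF x(1) refl x(2)] holes_gaps[OF x(1) refl x(2), of h] V(2) unfolding x(3) by simp
    then show "\<exists>x. (x, 0) \<in> low_cells \<and> \<not> bdry (comp_of n low_cells (x, 0)) \<and> th cf (comp_of n low_cells (x, 0)) \<noteq> 1"
      using x by blast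
  next
    assume "\<exists>x. (x, 0) \<in> low_cells \<and> \<not> bdry (comp_of n low_cells (x, 0)) \<and> th cf (comp_of n low_cells (x, 0)) \<noteq> 1"
    then obtain x where x: "(x, 0) \<in> low_cells" "\<not> bdry (comp_of n low_cells (x, 0))" "th cf (comp_of n low_cells (x, 0)) \<noteq> 1" by blast
    then have "odd_II_region n l pp (unit_of Upper ` comp_of n low_cells (x, 0))"
      unfolding odd_II_region_def holes_gaps[OF x(1) refl x(2)]
      using region_of[OF x(1,2)] th_gaps[OF x(1) refl x(2)] by (auto split: if_splits)
    then show "\<exists>V. odd_II_region n l pp V" by blast
  qed
  then show ?thesis unfolding even_low_def by auto
qed

end

end

section \<open>The determinant as a sum over tableaux\<close>

context skew_paths
begin

lemma sum_Tab_Tc: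
  fixes a :: complex
  assumes n: "n = CARD('n::finite)"
  shows "(\<Sum>T\<in>Tab n lam mu. weight lam mu a T :: 'n zring) = (\<Sum>c\<in>Tc. conf_wt (zlow a) (zupp a) c)"
proof -
  let ?Y = "{y \<in> YT. \<nexists>V. odd_II_region n l (paths_of y) V}"
  have "(\<Sum>T\<in>Tab n lam mu. weight lam mu a T :: 'n zring) = (\<Sum>y\<in>?Y. weight lam mu a (tab_of y))"
    by (rule sum_Tab)
  also have "\<dots> = (\<Sum>y\<in>?Y. conf_wt (zlow a) (zupp a) (conf_of y))"
    by (rule sum.cong) (use weight_tab_of[OF _ n] in auto)
  also have "\<dots> = (\<Sum>c\<in>conf_of ` ?Y. conf_wt (zlow a) (zupp a) c)"
  proof -
    have "inj_on conf_of ?Y" by (rule inj_on_subset[OF inj_conf_of]) blast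
    then show ?thesis by (simp only: sum.reindex comp_def)
  qed
  also have "conf_of ` ?Y = Tc"
  proof -
    have "?Y = {y \<in> YT. even_low (conf_of y)}" using odd_region_iff by auto
    then have "conf_of ` ?Y = {c \<in> conf_of ` YT. even_low c}" by auto
    then show ?thesis unfolding conf_of_YT Tc_def by auto
  qed
  finally show ?thesis .
qed

lemma jt_det_Tc:
  fixes a :: complex
  assumes n: "n = CARD('n::finite)"
  shows "(jt_det lam mu a :: 'n zring) = (\<Sum>c\<in>Tc. conf_wt (zlow a) (zupp a) c)"
proof -
  let ?wB = "restrict vc {0..<l}" and ?wA = "restrict (\<lambda>j. uc j + int n - 1) {0..<l}"
  let ?zf = "zlow a :: int \<Rightarrow> nat \<Rightarrow> 'n zring" and ?zg = "zupp a :: int \<Rightarrow> nat \<Rightarrow> 'n zring"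
  let ?CA = "\<lambda>s x i. low_coeff a s (?wA i - int n + 1) x :: 'n zring" and ?CB = "\<lambda>s x j. upp_coeff a s (?wB j) x :: 'n zring"
  have rel: "?zf x r * ?zg x r = ?zf (x + 1) (Suc r) * ?zg x (Suc r)" if "r < n" for x r
    by (rule zlow_zupp) (use that n in simp)
  have "(jt_det lam mu a :: 'n zring) = dt l (\<lambda>i j. e_coeff (vc i - uc j) (a - 2 * of_int (uc j)))"
    unfolding jt_det_def dt_def Let_def
    by (intro arg_cong[of _ _ det] cong_mat) (auto simp: first_abs_def algebra_simps)
  \<comment> \<open>After transposition rows belong to starting points and columns to end points, as
    in \<open>path_sum\<close>.\<close>
  also have "\<dots> = dt l (\<lambda>i j. e_coeff (vc j - uc i) (a - 2 * of_int (uc i)))"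
    by (rule dt_transpose)
  also have "\<dots> = dt l (\<lambda>i j. \<Sum>x\<in>{-W..W}. ?CA 0 x i
      * (\<Sum>y\<in>{-W..W}. mid_kernel (\<lambda>x. ?zf (x + 1) 0 * ?zg x 0) (x + 1) y * ?CB 0 y j))"
  proof (rule dt_cong)
    fix i j assume ij: "i < l" "j < l"
    have z: "(\<lambda>x. ?zf (x + 1) 0 * ?zg x 0) = zmid a" by (simp add: zmid_def fun_eq_iff)
    have "e_coeff (vc j - uc i) (a - 2 * of_int (uc i))
      = (\<Sum>x\<in>{-W..W}. low_coeff a 0 (uc i) x * (\<Sum>y\<in>{-W..W}. mid_kernel (zmid a) (x + 1) y * upp_coeff a 0 (vc j) y) :: 'n zring)"
      by (rule e_coeff_sum) (use W_bound[OF ij(1)] W_bound[OF ij(2)] in auto)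
    then show "e_coeff (vc j - uc i) (a - 2 * of_int (uc i)) = (\<Sum>x\<in>{-W..W}. ?CA 0 x i
      * (\<Sum>y\<in>{-W..W}. mid_kernel (\<lambda>x. ?zf (x + 1) 0 * ?zg x 0) (x + 1) y * ?CB 0 y j))"
      unfolding z using ij by simp
  qed
  also have "\<dots> = (\<Sum>c\<in>Xc. of_int (th c {u. 2 \<le> depth c u}) * conf_wt ?zf ?zg c)"
  proof (rule path_sum[where CB = ?CB and CA = ?CA])
    fix x :: int and j :: nat
    show "?CB n x j = (if x = ?wB j then 1 else 0)" unfolding n by (rule upp_coeff_top)
    have "?CA n x j = (if x = ?wA j - int n + 1 + int CARD('n) - 1 then 1 else 0)" unfolding n by (rule low_coeff_top)
    then show "?CA n x j = (if x = ?wA j then 1 else 0)" unfolding n by simp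
  next
    fix s x j assume "s < n"
    then have s: "s < CARD('n)" using n by simp
    show "?CB s x j = ?CB (Suc s) x j + ?zg x s * ?CB (Suc s) (x + 1) j" by (rule upp_coeff_step[OF s])
    show "?CA s x j = ?zf x s * ?CA (Suc s) x j + ?CA (Suc s) (x + 1) j" by (rule low_coeff_step[OF s])
  qed
  also have "\<dots> = (\<Sum>c\<in>Tc. conf_wt ?zf ?zg c)"
    by (rule sum_Xc_Tc) (rule conf_wt_tot, (assumption | rule rel)+)
  finally show ?thesis .
qed

end

theorem theorem5p6:
  fixes lam mu :: "nat \<Rightarrow> nat" and a :: complex
  assumes "skew_diagram lam mu"
    and "\<And>i. 1 \<le> i \<Longrightarrow> i + 1 \<le> lam 1 \<Longrightarrow>
      int (conj_partition lam (i + 1)) - int (conj_partition mu i) \<le> int CARD('n::finite)"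
  shows "(jt_det lam mu a :: 'n zring) = (\<Sum>T\<in>Tab CARD('n) lam mu. weight lam mu a T)"
proof -
  \<comment> \<open>Any sufficiently large window works. The interpretation adds another
    \<open>n\<close> to absorb the margins of \<open>n\<close> columns in
    \<open>W_bound\<close>.\<close>
  define W where "W = 6 + int CARD('n) + (\<Sum>j<lam 1. \<bar>first_abs mu j\<bar> + \<bar>first_abs lam j\<bar>)"
  have b: "\<bar>first_abs mu j\<bar> + \<bar>first_abs lam j\<bar> \<le> (\<Sum>j<lam 1. \<bar>first_abs mu j\<bar> + \<bar>first_abs lam j\<bar>)" if "j < lam 1" for j
    by (rule member_le_sum[of j "{..<lam 1}" "\<lambda>j. \<bar>first_abs mu j\<bar> + \<bar>first_abs lam j\<bar>"]) (use that in auto)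
  have nn: "0 \<le> (\<Sum>j<lam 1. \<bar>first_abs mu j\<bar> + \<bar>first_abs lam j\<bar>)" by (rule sum_nonneg) simp
  interpret skew_paths "CARD('n)" lam mu "W + int CARD('n)"
  proof
    show "4 - (W + int CARD('n)) + int CARD('n) \<le> first_abs mu j
        \<and> first_abs lam j + int CARD('n) \<le> (W + int CARD('n)) - 2" if "j < lam 1" for j
      using b[OF that] unfolding W_def by linarith
    show "3 \<le> W + int CARD('n)" using nn unfolding W_def by linarith
  qed (use assms in \<open>simp_all add: zero_less_card_finite\<close>)
  show ?thesis unfolding jt_det_Tc[OF refl] sum_Tab_Tc[OF refl] ..
qed

end
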